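(* Let $X$ be a compact complex manifold with $\dim_{\mathbb C}X=n$ equipped with an integrable holomorphic almost product structure $(N,F)$ and with a product Hermitian metric $\omega$. If $\omega$ is a bundle-like metric and if $\partial_N\omega_N=0$, then $$[\partial_N,\partial_F^\star]=0.$$
   Context: An integrable holomorphic almost product structure $(N,F)$ on $X$ consists of holomorphic subbundles $N,F\subset T^{1,0}X$, of ranks $r$ and $n-r$, with $T^{1,0}X=N\oplus F$, $[N,N]\subset N$, $[F,F]\subset F$. $\mathcal E^{p,q}(X)$ is the space of smooth global sections of $\Lambda^pN^\star\otimes\Lambda^qF^\star\subset\Lambda^{p+q,0}T^\star X$. By integrability, $\partial=\partial_N+\partial_F$ with $\partial_N:\mathcal E^{p,q}(X)\to\mathcal E^{p+1,q}(X)$, $\partial_F:\mathcal E^{p,q}(X)\to\mathcal E^{p,q+1}(X)$. Local product coordinates are local holomorphic coordinates $z_1,\dots,z_n$ such that $\partial/\partial z_1,\dots,\partial/\partial z_r$ frame $N$ and $\partial/\partial z_{r+1},\dots,\partial/\partial z_n$ frame $F$; put $z'=(z_1,\dots,z_r)$, $z''=(z_{r+1},\dots,z_n)$. In such coordinates $\partial_N=\sum_{l=1}^rdz_l\wedge\frac{\partial}{\partial z_l}$ and $\partial_F=\sum_{l=r+1}^ndz_l\wedge\frac{\partial}{\partial z_l}$ (derivatives acting on coefficients); the same formulae define $\partial_N,\partial_F$ on smooth forms of any bidegree, such as $\omega_N$ below. A product metric is a Hermitian metric which in every system of local product coordinates has the shape $\omega=\omega_N+\omega_F$, with $\omega_N=\sum_{j,k=1}^r\omega_{j\bar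 k}\,i\,dz_j\wedge d\bar z_k$ and $\omega_F=\sum_{j,k=r+1}^n\omega_{j\bar k}\,i\,dz_j\wedge d\bar z_k$, the coefficients being smooth functions of $(z',z'')$. It is bundle-like if in every system of local product coordinates the $\omega_{j\bar k}$ with $j,k\le r$ are functions of the variables $z'$ only and the $\omega_{j\bar k}$ with $j,k\ge r+1$ are functions of the variables $z''$ only. $\partial_F^\star$ is the formal adjoint of $\partial_F$ with respect to the $L^2$ inner product induced by $\omega$, and $[\partial_N,\partial_F^\star]=\partial_N\partial_F^\star+\partial_F^\star\partial_N$. *)

theory Defs
  imports "HOL-Analysis.Analysis"
begin

section \<open>Smooth and holomorphic maps on open sets\<close>

primrec times_differentiable_on ::
  "nat \<Rightarrow> 'a::real_normed_vector set \<Rightarrow> ('a \<Rightarrow> 'b::real_normed_vector) \<Rightarrow> bool" where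
  "times_differentiable_on 0 S f \<longleftrightarrow> continuous_on S f"
| "times_differentiable_on (Suc k) S f \<longleftrightarrow>
     (\<forall>x\<in>S. f differentiable at x) \<and>
     (\<forall>v. times_differentiable_on k S (\<lambda>x. frechet_derivative f (at x) v))"

text \<open>Only used for open sets.\<close>

definition smooth_on :: "'a::real_normed_vector set \<Rightarrow> ('a \<Rightarrow> 'b::real_normed_vector) \<Rightarrow> bool" where
  "smooth_on S f \<longleftrightarrow> (\<forall>k. times_differentiable_on k S f)"

text \<open>A holomorphic map between open subsets of complex coordinate spaces is a smooth map with
  complex linear differential (the Cauchy-Riemann equations).\<close>

definition holomorphic_map_on ::
  "(complex^'n) set \<Rightarrow> (complex^'n \<Rightarrow> complex^'m) \<Rightarrow> bool" where
  "holomorphic_map_on S f \<longleftrightarrow> smooth_on S f \<and>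
     (\<forall>z\<in>S. \<forall>a v. frechet_derivative f (at z) (a *s v) = a *s frechet_derivative f (at z) v)"

text \<open>The Wirtinger derivative \<open>\<partial>f/\<partial>z\<^sub>l = (\<partial>f/\<partial>x\<^sub>l - i \<partial>f/\<partial>y\<^sub>l)/2\<close>.\<close>

definition wirtinger :: "'n \<Rightarrow> (complex^'n::finite \<Rightarrow> complex) \<Rightarrow> complex^'n \<Rightarrow> complex" where
  "wirtinger l f z =
     (frechet_derivative f (at z) (axis l 1) - \<i> * frechet_derivative f (at z) (axis l \<i>)) / 2"

section \<open>Complex manifolds\<close>

text \<open>The manifold is the whole type \<open>'a\<close>; its dimension is \<open>CARD('n)\<close>. A chart \<open>(U, \<phi>)\<close> consists
  of an open set and a coordinate map, whose values outside \<open>U\<close> are irrelevant.\<close>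

type_synonym ('a, 'n) chart = "'a set \<times> ('a \<Rightarrow> complex^'n)"

definition cdom :: "('a, 'n) chart \<Rightarrow> 'a set" where
  "cdom c = fst c"

definition coord :: "('a, 'n) chart \<Rightarrow> 'a \<Rightarrow> complex^'n" where
  "coord c = snd c"

definition cim :: "('a, 'n) chart \<Rightarrow> (complex^'n) set" where
  "cim c = coord c ` cdom c"

definition is_chart :: "('a::topological_space, 'n::finite) chart \<Rightarrow> bool" where
  "is_chart c \<longleftrightarrow> open (cdom c) \<and> open (cim c) \<and>
     homeomorphism (cdom c) (cim c) (coord c) (inv_into (cdom c) (coord c))"

definition transition :: "('a, 'n) chart \<Rightarrow> ('a, 'n) chart \<Rightarrow> complex^'n \<Rightarrow> complex^'n" where
  "transition c d = coord d \<circ> inv_into (cdom c) (coord c)"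

text \<open>The differential at the point \<open>x\<close> of the manifold of the change of coordinates from \<open>c\<close>
  to \<open>d\<close>.\<close>

definition jac ::
  "('a, 'n::finite) chart \<Rightarrow> ('a, 'n) chart \<Rightarrow> 'a \<Rightarrow> complex^'n \<Rightarrow> complex^'n" where
  "jac c d x = frechet_derivative (transition c d) (at (coord c x))"

definition compatible :: "('a, 'n::finite) chart \<Rightarrow> ('a, 'n) chart \<Rightarrow> bool" where
  "compatible c d \<longleftrightarrow>
     holomorphic_map_on (coord c ` (cdom c \<inter> cdom d)) (transition c d) \<and>
     holomorphic_map_on (coord d ` (cdom c \<inter> cdom d)) (transition d c)"

text \<open>A complex structure is a maximal holomorphic atlas, so that the members of \<open>A\<close> are exactly
  the local holomorphic coordinate systems.\<close>

definition complex_structure :: "('a::topological_space, 'n::finite) chart set \<Rightarrow> bool" where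
  "complex_structure A \<longleftrightarrow>
     (\<forall>c\<in>A. is_chart c) \<and> (\<Union>c\<in>A. cdom c) = UNIV \<and>
     (\<forall>c\<in>A. \<forall>d\<in>A. compatible c d) \<and>
     (\<forall>c. is_chart c \<and> (\<forall>d\<in>A. compatible c d) \<longrightarrow> c \<in> A)"

section \<open>Integrable holomorphic almost product structures\<close>

text \<open>A holomorphic tangent vector at \<open>x\<close> is written, in a chart \<open>c\<close> around \<open>x\<close>, as
  \<open>\<Sum>\<^sub>j v\<^sub>j \<partial>/\<partial>z\<^sub>j\<close> with \<open>v\<close> in complex coordinate space; \<open>jac c d x\<close> is the change of
  representatives. Tensor fields on the manifold are families of local representatives, indexed by
  the charts \<open>c\<close> and the points of \<open>cim c\<close>, which match under changes of charts. Thus a subbundle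
  \<open>N\<close> of the holomorphic tangent bundle has as its fibre over \<open>x\<close>, in the chart \<open>c\<close>, the
  subspace \<open>N c (coord c x)\<close>.\<close>

type_synonym ('a, 'n) distribution = "('a, 'n) chart \<Rightarrow> complex^'n \<Rightarrow> (complex^'n) set"

definition holomorphic_subbundle ::
  "('a, 'n::finite) chart set \<Rightarrow> nat \<Rightarrow> ('a, 'n) distribution \<Rightarrow> bool" where
  "holomorphic_subbundle A r N \<longleftrightarrow>
     (\<forall>c\<in>A. \<forall>z\<in>cim c. vec.subspace (N c z) \<and> vec.dim (N c z) = r) \<and>
     (\<forall>c\<in>A. \<forall>d\<in>A. \<forall>x\<in>cdom c \<inter> cdom d. N d (coord d x) = jac c d x ` N c (coord c x)) \<and>
     (\<forall>c\<in>A. \<forall>z0\<in>cim c. \<exists>W s. open W \<and> z0 \<in> W \<and> W \<subseteq> cim c \<and>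
        (\<forall>i<r. holomorphic_map_on W (s i)) \<and>
        (\<forall>z\<in>W. N c z = vec.span ((\<lambda>i. s i z) ` {..<(r::nat)})))"

text \<open>Lie bracket of the holomorphic vector fields \<open>\<Sum>\<^sub>j \<xi>\<^sub>j \<partial>/\<partial>z\<^sub>j\<close> and
  \<open>\<Sum>\<^sub>j \<eta>\<^sub>j \<partial>/\<partial>z\<^sub>j\<close>.\<close>

definition lie_bracket ::
  "(complex^'n::finite \<Rightarrow> complex^'n) \<Rightarrow> (complex^'n \<Rightarrow> complex^'n) \<Rightarrow> complex^'n \<Rightarrow> complex^'n" where
  "lie_bracket \<xi> \<eta> z =
     frechet_derivative \<eta> (at z) (\<xi> z) - frechet_derivative \<xi> (at z) (\<eta> z)"

definition involutive ::
  "('a, 'n::finite) chart set \<Rightarrow> ('a, 'n) distribution \<Rightarrow> bool" where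
  "involutive A N \<longleftrightarrow>
     (\<forall>c\<in>A. \<forall>W \<xi> \<eta>. open W \<and> W \<subseteq> cim c \<and>
        holomorphic_map_on W \<xi> \<and> holomorphic_map_on W \<eta> \<and>
        (\<forall>z\<in>W. \<xi> z \<in> N c z \<and> \<eta> z \<in> N c z) \<longrightarrow>
        (\<forall>z\<in>W. lie_bracket \<xi> \<eta> z \<in> N c z))"

definition almost_product_structure ::
  "('a, 'n::finite) chart set \<Rightarrow> nat \<Rightarrow> ('a, 'n) distribution \<Rightarrow> ('a, 'n) distribution \<Rightarrow> bool" where
  "almost_product_structure A r N F \<longleftrightarrow>
     r \<le> CARD('n) \<and> holomorphic_subbundle A r N \<and> holomorphic_subbundle A (CARD('n) - r) F \<and>
     (\<forall>c\<in>A. \<forall>z\<in>cim c.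
        N c z \<inter> F c z = {0} \<and> {a + b |a b. a \<in> N c z \<and> b \<in> F c z} = UNIV)"

definition integrable_product_structure ::
  "('a, 'n::finite) chart set \<Rightarrow> nat \<Rightarrow> ('a, 'n) distribution \<Rightarrow> ('a, 'n) distribution \<Rightarrow> bool" where
  "integrable_product_structure A r N F \<longleftrightarrow>
     almost_product_structure A r N F \<and> involutive A N \<and> involutive A F"

text \<open>Local product coordinates. The indices of the coordinates \<open>z'\<close> along \<open>N\<close> form an arbitrary
  set \<open>R\<close> (instead of \<open>1, \<dots>, r\<close>), those of the coordinates \<open>z''\<close> along \<open>F\<close> its complement.\<close>

definition product_coords ::
  "('a, 'n::finite) chart set \<Rightarrow> ('a, 'n) distribution \<Rightarrow> ('a, 'n) distribution \<Rightarrow>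
   ('a, 'n) chart \<Rightarrow> 'n set \<Rightarrow> bool" where
  "product_coords A N F c R \<longleftrightarrow> c \<in> A \<and>
     (\<forall>z\<in>cim c. N c z = vec.span {axis l 1 |l. l \<in> R} \<and>
                 F c z = vec.span {axis l 1 |l. l \<in> - R})"

section \<open>Exterior algebra in coordinates\<close>

text \<open>A \<open>k\<close>-form at a point is a complex valued function of lists of tangent vectors which
  vanishes on lists of length other than \<open>k\<close>. The complex multilinear ones are the
  \<open>(k,0)\<close>-forms.\<close>

definition alternating_form :: "nat \<Rightarrow> ((complex^'n::finite) list \<Rightarrow> complex) \<Rightarrow> bool" where
  "alternating_form k \<alpha> \<longleftrightarrow>
     (\<forall>vs. length vs \<noteq> k \<longrightarrow> \<alpha> vs = 0) \<and>
     (\<forall>vs i a v w. length vs = k \<and> i < k \<longrightarrow>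
        \<alpha> (vs[i := a *s v + w]) = a * \<alpha> (vs[i := v]) + \<alpha> (vs[i := w])) \<and>
     (\<forall>vs i j. length vs = k \<and> i < j \<and> j < k \<and> vs ! i = vs ! j \<longrightarrow> \<alpha> vs = 0)"

text \<open>The form \<open>dz\<^sub>l \<and> \<alpha>\<close>.\<close>

definition dz_wedge ::
  "'n \<Rightarrow> ((complex^'n::finite) list \<Rightarrow> complex) \<Rightarrow> (complex^'n) list \<Rightarrow> complex" where
  "dz_wedge l \<alpha> vs =
     (\<Sum>i<length vs. (-1) ^ i * (vs ! i) $ l * \<alpha> (take i vs @ drop (Suc i) vs))"

text \<open>The conjugate coordinate form \<open>d\<bar>z\<^sub>k\<close>.\<close>

definition dzbar :: "'n \<Rightarrow> (complex^'n::finite) list \<Rightarrow> complex" where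
  "dzbar k vs = (if length vs = 1 then cnj ((vs ! 0) $ k) else 0)"

text \<open>The operator \<open>\<Sum>\<^bsub>l\<in>L\<^esub> dz\<^sub>l \<and> \<partial>/\<partial>z\<^sub>l\<close> on forms of any bidegree. As the vectors in the list
  \<open>vs\<close> are constant, the derivative acts on the coefficients of the form.\<close>

definition coord_del ::
  "'n set \<Rightarrow> (complex^'n::finite \<Rightarrow> (complex^'n) list \<Rightarrow> complex) \<Rightarrow>
   complex^'n \<Rightarrow> (complex^'n) list \<Rightarrow> complex" where
  "coord_del L f z vs = (\<Sum>l\<in>L. dz_wedge l (\<lambda>ws. wirtinger l (\<lambda>y. f y ws) z) vs)"

section \<open>Forms on the manifold\<close>

type_synonym ('a, 'n) form =
  "('a, 'n) chart \<Rightarrow> complex^'n \<Rightarrow> (complex^'n) list \<Rightarrow> complex"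

text \<open>Smooth \<open>(k,0)\<close>-forms; the convention that \<open>u c z\<close> is zero unless \<open>c\<close> is in the atlas and \<open>z\<close>
  in \<open>cim c\<close> makes two forms equal as functions iff they are the same form.\<close>

definition smooth_forms :: "('a, 'n::finite) chart set \<Rightarrow> nat \<Rightarrow> ('a, 'n) form set" where
  "smooth_forms A k = {u.
     (\<forall>c z vs. c \<notin> A \<or> z \<notin> cim c \<longrightarrow> u c z vs = 0) \<and>
     (\<forall>c\<in>A. \<forall>z\<in>cim c. alternating_form k (u c z)) \<and>
     (\<forall>c\<in>A. \<forall>vs. smooth_on (cim c) (\<lambda>z. u c z vs)) \<and>
     (\<forall>c\<in>A. \<forall>d\<in>A. \<forall>x\<in>cdom c \<inter> cdom d. \<forall>vs.
        u c (coord c x) vs = u d (coord d x) (map (jac c d x) vs))}"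

text \<open>The fibre of \<open>\<Lambda>\<^sup>pN\<^sup>* \<otimes> \<Lambda>\<^sup>qF\<^sup>*\<close> inside \<open>\<Lambda>\<^sup>p\<^sup>+\<^sup>qT\<^sup>*\<close>, where \<open>N\<^sup>*\<close> and \<open>F\<^sup>*\<close> are the annihilators of
  \<open>F\<close> and \<open>N\<close>: the forms that vanish as soon as more than \<open>p\<close> arguments lie in \<open>P\<close> (a fibre of
  \<open>N\<close>) or more than \<open>q\<close> arguments lie in \<open>Q\<close> (a fibre of \<open>F\<close>).\<close>

definition has_type ::
  "(complex^'n::finite) set \<Rightarrow> (complex^'n) set \<Rightarrow> nat \<Rightarrow> nat \<Rightarrow> ((complex^'n) list \<Rightarrow> complex) \<Rightarrow> bool" where
  "has_type P Q p q \<alpha> \<longleftrightarrow>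
     (\<forall>vs. length vs = p + q \<and>
        (p < card {i. i < p + q \<and> vs ! i \<in> P} \<or> q < card {i. i < p + q \<and> vs ! i \<in> Q}) \<longrightarrow>
        \<alpha> vs = 0)"

text \<open>The space of smooth global sections of \<open>\<Lambda>\<^sup>pN\<^sup>* \<otimes> \<Lambda>\<^sup>qF\<^sup>*\<close>.\<close>

definition forms_pq ::
  "('a, 'n::finite) chart set \<Rightarrow> ('a, 'n) distribution \<Rightarrow> ('a, 'n) distribution \<Rightarrow>
   nat \<Rightarrow> nat \<Rightarrow> ('a, 'n) form set" where
  "forms_pq A N F p q =
     {u \<in> smooth_forms A (p + q). \<forall>c\<in>A. \<forall>z\<in>cim c. has_type (N c z) (F c z) p q (u c z)}"

text \<open>The operator \<open>\<partial>\<close> on smooth \<open>(k,0)\<close>-forms.\<close>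

definition del :: "('a, 'n::finite) chart set \<Rightarrow> ('a, 'n) form \<Rightarrow> ('a, 'n) form" where
  "del A u c z vs = (if c \<in> A \<and> z \<in> cim c then coord_del UNIV (u c) z vs else 0)"

text \<open>Projection onto \<open>P\<close> along \<open>Q\<close>.\<close>

definition proj_along :: "(complex^'n) set \<Rightarrow> (complex^'n) set \<Rightarrow> complex^'n \<Rightarrow> complex^'n" where
  "proj_along P Q v = (THE a. a \<in> P \<and> v - a \<in> Q)"

text \<open>The component in \<open>\<Lambda>\<^sup>pN\<^sup>* \<otimes> \<Lambda>\<^sup>qF\<^sup>*\<close> of a \<open>(p+q)\<close>-form: split every argument along \<open>T = P \<oplus> Q\<close>,
  expand by multilinearity, and keep the terms with \<open>p\<close> arguments in \<open>P\<close> and \<open>q\<close> in \<open>Q\<close>.\<close>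

definition type_component ::
  "(complex^'n::finite) set \<Rightarrow> (complex^'n) set \<Rightarrow> nat \<Rightarrow> nat \<Rightarrow>
   ((complex^'n) list \<Rightarrow> complex) \<Rightarrow> (complex^'n) list \<Rightarrow> complex" where
  "type_component P Q p q \<alpha> vs =
     (if length vs = p + q then
        (\<Sum>S | S \<subseteq> {..<p + q} \<and> card S = p.
           \<alpha> (map (\<lambda>i. if i \<in> S then proj_along P Q (vs ! i) else proj_along Q P (vs ! i))
                [0..<p + q]))
      else 0)"

text \<open>The two components of \<open>\<partial>\<close> on sections of \<open>\<Lambda>\<^sup>pN\<^sup>* \<otimes> \<Lambda>\<^sup>qF\<^sup>*\<close>.\<close>

definition del_N ::
  "('a, 'n::finite) chart set \<Rightarrow> ('a, 'n) distribution \<Rightarrow> ('a, 'n) distribution \<Rightarrow>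
   nat \<Rightarrow> nat \<Rightarrow> ('a, 'n) form \<Rightarrow> ('a, 'n) form" where
  "del_N A N F p q u c z = type_component (N c z) (F c z) (p + 1) q (del A u c z)"

definition del_F ::
  "('a, 'n::finite) chart set \<Rightarrow> ('a, 'n) distribution \<Rightarrow> ('a, 'n) distribution \<Rightarrow>
   nat \<Rightarrow> nat \<Rightarrow> ('a, 'n) form \<Rightarrow> ('a, 'n) form" where
  "del_F A N F p q u c z = type_component (N c z) (F c z) p (q + 1) (del A u c z)"

section \<open>Hermitian metrics\<close>

text \<open>A Hermitian metric is given by its coefficient matrices: \<open>g c z $ j $ k\<close> is the coefficient
  \<open>\<omega>\<^sub>j\<^sub>k\<close> of \<open>\<omega> = \<Sum>\<^sub>j\<^sub>,\<^sub>k \<omega>\<^sub>j\<^sub>k i dz\<^sub>j \<and> d\<bar>z\<^sub>k\<close> in the chart \<open>c\<close> at \<open>z\<close>.\<close>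

type_synonym ('a, 'n) metric = "('a, 'n) chart \<Rightarrow> complex^'n \<Rightarrow> complex^'n^'n"

definition herm :: "complex^'n^'n::finite \<Rightarrow> complex^'n \<Rightarrow> complex^'n \<Rightarrow> complex" where
  "herm H v w = (\<Sum>j\<in>UNIV. \<Sum>k\<in>UNIV. H $ j $ k * v $ j * cnj (w $ k))"

definition hermitian_metric :: "('a, 'n::finite) chart set \<Rightarrow> ('a, 'n) metric \<Rightarrow> bool" where
  "hermitian_metric A g \<longleftrightarrow>
     (\<forall>c\<in>A. \<forall>j k. smooth_on (cim c) (\<lambda>z. g c z $ j $ k)) \<and>
     (\<forall>c\<in>A. \<forall>z\<in>cim c. (\<forall>j k. g c z $ k $ j = cnj (g c z $ j $ k)) \<and>
        (\<forall>v. v \<noteq> 0 \<longrightarrow> Re (herm (g c z) v v) > 0)) \<and>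
     (\<forall>c\<in>A. \<forall>d\<in>A. \<forall>x\<in>cdom c \<inter> cdom d. \<forall>v w.
        herm (g c (coord c x)) v w = herm (g d (coord d x)) (jac c d x v) (jac c d x w))"

text \<open>The form \<open>\<Sum>\<^bsub>j,k\<in>L\<^esub> \<omega>\<^sub>j\<^sub>k i dz\<^sub>j \<and> d\<bar>z\<^sub>k\<close>. In product coordinates with index set \<open>R\<close> it is \<open>\<omega>\<close>,
  \<open>\<omega>\<^sub>N\<close> and \<open>\<omega>\<^sub>F\<close> for \<open>L = UNIV\<close>, \<open>L = R\<close> and \<open>L = - R\<close>, respectively.\<close>

definition omega_part :: "'n set \<Rightarrow> complex^'n^'n::finite \<Rightarrow> (complex^'n) list \<Rightarrow> complex" where
  "omega_part L H vs = (\<Sum>j\<in>L. \<Sum>k\<in>L. H $ j $ k * \<i> * dz_wedge j (dzbar k) vs)"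

definition product_metric ::
  "('a, 'n::finite) chart set \<Rightarrow> ('a, 'n) distribution \<Rightarrow> ('a, 'n) distribution \<Rightarrow>
   ('a, 'n) metric \<Rightarrow> bool" where
  "product_metric A N F g \<longleftrightarrow> hermitian_metric A g \<and>
     (\<forall>c R. product_coords A N F c R \<longrightarrow> (\<forall>z\<in>cim c. \<forall>vs.
        omega_part UNIV (g c z) vs = omega_part R (g c z) vs + omega_part (- R) (g c z) vs))"

text \<open>The function \<open>f\<close> on the open set \<open>S\<close> depends only on the variables \<open>z\<^sub>l\<close>, \<open>l \<in> L\<close>. This is meant
  locally: the image of a coordinate system may have disconnected slices \<open>z' = const\<close>, and it
  would be unreasonable to compare values on different components of a slice. (In disconnected
  product coordinates, which can be rescaled on one component only, no metric would satisfy the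
  global reading of the bundle-like condition.)\<close>

definition function_of_vars ::
  "'n set \<Rightarrow> (complex^'n::finite) set \<Rightarrow> (complex^'n \<Rightarrow> complex) \<Rightarrow> bool" where
  "function_of_vars L S f \<longleftrightarrow>
     (\<forall>z0\<in>S. \<exists>e>0. ball z0 e \<subseteq> S \<and>
        (\<forall>z\<in>ball z0 e. \<forall>w\<in>ball z0 e. (\<forall>l\<in>L. z $ l = w $ l) \<longrightarrow> f z = f w))"

definition bundle_like ::
  "('a, 'n::finite) chart set \<Rightarrow> ('a, 'n) distribution \<Rightarrow> ('a, 'n) distribution \<Rightarrow>
   ('a, 'n) metric \<Rightarrow> bool" where
  "bundle_like A N F g \<longleftrightarrow>
     (\<forall>c R. product_coords A N F c R \<longrightarrow>
        (\<forall>j\<in>R. \<forall>k\<in>R. function_of_vars R (cim c) (\<lambda>z. g c z $ j $ k)) \<and>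
        (\<forall>j\<in>- R. \<forall>k\<in>- R. function_of_vars (- R) (cim c) (\<lambda>z. g c z $ j $ k)))"

text \<open>The condition \<open>\<partial>\<^sub>N \<omega>\<^sub>N = 0\<close>.\<close>

definition del_N_omega_N_zero ::
  "('a, 'n::finite) chart set \<Rightarrow> ('a, 'n) distribution \<Rightarrow> ('a, 'n) distribution \<Rightarrow>
   ('a, 'n) metric \<Rightarrow> bool" where
  "del_N_omega_N_zero A N F g \<longleftrightarrow>
     (\<forall>c R. product_coords A N F c R \<longrightarrow> (\<forall>z\<in>cim c. \<forall>vs.
        coord_del R (\<lambda>y. omega_part R (g c y)) z vs = 0))"

section \<open>The inner product and the formal adjoint\<close>

text \<open>The inner product of \<open>(k,0)\<close>-forms at a point, for which the \<open>e\<^sub>J\<^sup>*\<close> with \<open>J\<close> increasing are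
  orthonormal if \<open>e\<close> is an orthonormal basis of tangent vectors. The inverse matrix of \<open>H\<close> gives
  the inner product of covectors, \<open>\<langle>dz\<^sub>j, dz\<^sub>k\<rangle> = H\<^sup>-\<^sup>1 $ k $ j\<close>; the factor \<open>1/k!\<close> compensates for
  summing over all multi-indices rather than increasing ones.\<close>

definition form_inner ::
  "nat \<Rightarrow> complex^'n^'n::finite \<Rightarrow> ((complex^'n) list \<Rightarrow> complex) \<Rightarrow> ((complex^'n) list \<Rightarrow> complex) \<Rightarrow>
   complex" where
  "form_inner k H \<alpha> \<beta> =
     (\<Sum>js | length js = k. \<Sum>ks | length ks = k.
        (\<Prod>i<k. matrix_inv H $ (ks ! i) $ (js ! i)) *
        \<alpha> (map (\<lambda>j. axis j 1) js) * cnj (\<beta> (map (\<lambda>j. axis j 1) ks))) / fact k"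

text \<open>\<open>M\<close> is the measure on the manifold given by the volume form
  \<open>\<omega>\<^sup>n/n! = det (\<omega>\<^sub>j\<^sub>k) \<Prod>\<^sub>j (i dz\<^sub>j \<and> d\<bar>z\<^sub>j)\<close>, where \<open>i dz\<^sub>j \<and> d\<bar>z\<^sub>j = 2 dx\<^sub>j \<and> dy\<^sub>j\<close>.\<close>

definition volume_measure ::
  "('a::topological_space, 'n::finite) chart set \<Rightarrow> ('a, 'n) metric \<Rightarrow> 'a measure \<Rightarrow> bool" where
  "volume_measure A g M \<longleftrightarrow> sets M = sets borel \<and>
     (\<forall>c\<in>A. \<forall>B\<in>sets borel. B \<subseteq> cdom c \<longrightarrow>
        emeasure M B = (\<integral>\<^sup>+z\<in>coord c ` B. ennreal (2 ^ CARD('n) * Re (det (g c z))) \<partial>lborel))"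

text \<open>The \<open>L\<^sup>2\<close> inner product of \<open>(k,0)\<close>-forms. The integrand at \<open>x\<close> does not depend on the chart
  chosen around \<open>x\<close>.\<close>

definition chart_at :: "('a, 'n) chart set \<Rightarrow> 'a \<Rightarrow> ('a, 'n) chart" where
  "chart_at A x = (SOME c. c \<in> A \<and> x \<in> cdom c)"

definition L2_inner ::
  "('a, 'n::finite) chart set \<Rightarrow> ('a, 'n) metric \<Rightarrow> 'a measure \<Rightarrow> nat \<Rightarrow>
   ('a, 'n) form \<Rightarrow> ('a, 'n) form \<Rightarrow> complex" where
  "L2_inner A g M k u v =
     (\<integral>x. (let c = chart_at A x; z = coord c x in form_inner k (g c z) (u c z) (v c z)) \<partial>M)"

text \<open>\<open>D p q\<close>, on sections of \<open>\<Lambda>\<^sup>pN\<^sup>* \<otimes> \<Lambda>\<^sup>qF\<^sup>*\<close>, is the formal adjoint of \<open>\<partial>\<^sub>F\<close> with respect to the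
  \<open>L\<^sup>2\<close> inner product. For \<open>q = 0\<close> there is nothing that \<open>\<partial>\<^sub>F\<close> maps to the domain, and the
  adjoint is zero.\<close>

definition formal_adjoint_del_F ::
  "('a, 'n::finite) chart set \<Rightarrow> ('a, 'n) distribution \<Rightarrow> ('a, 'n) distribution \<Rightarrow>
   ('a, 'n) metric \<Rightarrow> 'a measure \<Rightarrow> (nat \<Rightarrow> nat \<Rightarrow> ('a, 'n) form \<Rightarrow> ('a, 'n) form) \<Rightarrow> bool" where
  "formal_adjoint_del_F A N F g M D \<longleftrightarrow>
     (\<forall>p. \<forall>v\<in>forms_pq A N F p 0. D p 0 v = (\<lambda>c z vs. 0)) \<and>
     (\<forall>p q. \<forall>v\<in>forms_pq A N F p (q + 1). D p (q + 1) v \<in> forms_pq A N F p q \<and>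
        (\<forall>u\<in>forms_pq A N F p q.
           L2_inner A g M (p + q + 1) (del_F A N F p q u) v =
           L2_inner A g M (p + q) u (D p (q + 1) v)))"

text \<open>The graded commutator \<open>[\<partial>\<^sub>N, D] = \<partial>\<^sub>N D + D \<partial>\<^sub>N\<close> on sections of \<open>\<Lambda>\<^sup>pN\<^sup>* \<otimes> \<Lambda>\<^sup>qF\<^sup>*\<close>, for an
  operator \<open>D\<close> of bidegree \<open>(0,-1)\<close>. If \<open>q = 0\<close>, then \<open>D p q u\<close> is zero and the
  truncated subtraction is harmless.\<close>

definition commutator_del_N ::
  "('a, 'n::finite) chart set \<Rightarrow> ('a, 'n) distribution \<Rightarrow> ('a, 'n) distribution \<Rightarrow>
   (nat \<Rightarrow> nat \<Rightarrow> ('a, 'n) form \<Rightarrow> ('a, 'n) form) \<Rightarrow> nat \<Rightarrow> nat \<Rightarrow> ('a, 'n) form \<Rightarrow> ('a, 'n) form" where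
  "commutator_del_N A N F D p q u = (\<lambda>c z vs.
     del_N A N F p (q - 1) (D p q u) c z vs + D (p + 1) q (del_N A N F p q u) c z vs)"

end

theory Submission
  imports Defs "HOL-Complex_Analysis.Complex_Analysis"
begin

text \<open>Let \<open>z'\<close> and \<open>z''\<close> be local product coordinates along \<open>N\<close> and \<open>F\<close>. For a bundle-like metric the
  coefficient matrix consists of a block along \<open>N\<close> that depends on \<open>z'\<close> only and a block along \<open>F\<close> that depends
  on \<open>z''\<close> only. Let \<open>b\<close> be the determinant of the block along \<open>F\<close>. Describe a form by its conjugated
  coefficients \<open>u\<^sup>J\<close>, with the indices along \<open>F\<close> raised by the inverse of that block. In this description each of
  the two operators involves only one group of variables:

  The adjoint of \<open>\<partial>\<^sub>F\<close> is a weighted divergence, \<open>b (Du)\<^sup>J = - \<Sum>\<^sub>l \<partial>\<^sub>l (b u\<^sup>l\<^sup>J)\<close> with \<open>l\<close> ranging over the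
  directions of \<open>F\<close>. Indeed, integration by parts yields such a formula with all indices raised and with the
  determinant of the whole metric as weight (\<open>adjoint_formula\<close>); but the block along \<open>N\<close> does not depend on \<open>z''\<close>,
  so it passes through the derivatives and drops out (\<open>adjoint_formula_F\<close>). On the other hand
  \<open>\<partial>\<^sub>N\<close> wedges with \<open>dz\<^sub>j\<close> and differentiates with respect to the conjugate of \<open>z\<^sub>j\<close>, for \<open>j\<close> in the directions of
  \<open>N\<close>; the block along \<open>F\<close> is constant for these derivatives (\<open>F_raised_del_N\<close>). Therefore both composites of the
  two operators are sums of the same mixed second derivatives of \<open>b u\<^sup>l\<^sup>J\<close>. They have opposite signs, because
  wedging with \<open>dz\<^sub>j\<close> anticommutes with removing a leading index \<open>l\<close> different from \<open>j\<close>. This is the computation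
  in \<open>commutator_in_product_coords\<close>.

  Product coordinates exist around every point by the holomorphic Frobenius theorem, applied to \<open>N\<close> and to \<open>F\<close>
  (\<open>first_integral\<close>, \<open>bundle_first_integral\<close>, \<open>product_chart_exists\<close>). It is proved by Picard iteration
  along rays. That the solutions are holomorphic in all variables rests on the fact that a continuous function which is
  holomorphic on complex lines is smooth with complex linear differential (\<open>line_holomorphic_on_has_derivative\<close>,
  \<open>line_holomorphic_on_smooth\<close>), a class of functions that is visibly closed under uniform limits.

  The forms and operators are families of local representatives. Since \<open>\<partial>\<close> commutes with holomorphic changes of
  coordinates (\<open>coord_del_pullback\<close>), the components \<open>\<partial>\<^sub>N\<close> and \<open>\<partial>\<^sub>F\<close> may be computed in product coordinates
  (\<open>del_components_in_product_coords\<close>). The formula for the adjoint is tested against forms with a single coefficient,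
  a bump function; these extend by zero to global sections because the manifold is a Hausdorff space
  (\<open>test_form_in_forms_pq\<close>).\<close>

section \<open>Calculus of smooth maps\<close>

abbreviation FD :: "('a::real_normed_vector \<Rightarrow> 'b::real_normed_vector) \<Rightarrow> 'a \<Rightarrow> 'a \<Rightarrow> 'b" where
  "FD f x \<equiv> frechet_derivative f (at x)"

lemma FD_has_derivative: "f differentiable (at x) \<Longrightarrow> (f has_derivative FD f x) (at x)"
  using frechet_derivative_works by blast

lemma FD_eqI: "(f has_derivative f') (at x) \<Longrightarrow> FD f x = f'"
  using frechet_derivative_at by metis

lemma FD_cong_open:
  assumes "open S" "x \<in> S" "\<And>y. y \<in> S \<Longrightarrow> f y = g y"
  shows "FD f x = FD g x"
proof -
  have "(f has_derivative f') (at x) \<longleftrightarrow> (g has_derivative f') (at x)" for f'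
    using has_derivative_transform_within_open[OF _ assms(1,2)] assms(3) by (metis (no_types, lifting))
  then show ?thesis unfolding frechet_derivative_def by simp
qed

lemma differentiable_cong_open:
  assumes "open S" "x \<in> S" "\<And>y. y \<in> S \<Longrightarrow> f y = g y" "f differentiable (at x)"
  shows "g differentiable (at x)"
  using assms has_derivative_transform_within_open unfolding differentiable_def by blast

lemma times_differentiable_on_cong:
  assumes "open S" "\<And>y. y \<in> S \<Longrightarrow> f y = g y" "times_differentiable_on k S f"
  shows "times_differentiable_on k S g"
  using assms(2,3)
proof (induction k arbitrary: f g)
  case 0
  then show ?case using continuous_on_cong[of S S f g] by simp
next
  case (Suc k)
  have "times_differentiable_on k S (\<lambda>x. FD g x v)" for v
  proof (rule Suc.IH)
    show "times_differentiable_on k S (\<lambda>x. FD f x v)" using Suc.prems by simp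
    show "FD f y v = FD g y v" if "y \<in> S" for y
      using FD_cong_open[OF assms(1) that] Suc.prems(1) by metis
  qed
  moreover have "g differentiable (at x)" if "x \<in> S" for x
    using Suc.prems by (intro differentiable_cong_open[OF assms(1) that, of f g]) (auto simp: that)
  ultimately show ?case by simp
qed

lemma times_differentiable_on_SucI:
  assumes "open S" "\<And>x. x \<in> S \<Longrightarrow> (f has_derivative f' x) (at x)"
    "\<And>v. times_differentiable_on k S (\<lambda>x. f' x v)"
  shows "times_differentiable_on (Suc k) S f"
proof -
  have "FD f x = f' x" if "x \<in> S" for x using FD_eqI assms(2) that by blast
  then have "times_differentiable_on k S (\<lambda>x. FD f x v)" for v
    using times_differentiable_on_cong[OF assms(1) _ assms(3)[of v], of "\<lambda>x. FD f x v"] by simp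
  then show ?thesis using assms(2) by (auto simp: differentiable_def)
qed

lemma times_differentiable_on_mono: "times_differentiable_on (Suc k) S f \<Longrightarrow> times_differentiable_on k S f"
proof (induction k arbitrary: f)
  case 0
  then show ?case
    by (auto intro!: continuous_at_imp_continuous_on differentiable_imp_continuous_within)
next
  case (Suc k)
  then show ?case by (metis times_differentiable_on.simps(2))
qed

lemma times_differentiable_on_subset:
  "times_differentiable_on k S f \<Longrightarrow> T \<subseteq> S \<Longrightarrow> times_differentiable_on k T f"
  by (induction k arbitrary: f) (auto intro: continuous_on_subset)

lemma times_differentiable_on_local:
  assumes "\<And>x. x \<in> S \<Longrightarrow> \<exists>U. open U \<and> x \<in> U \<and> times_differentiable_on k U f"
  shows "times_differentiable_on k S f"
  using assms
proof (induction k arbitrary: f)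
  case 0
  have "isCont f x" if "x \<in> S" for x
    using 0 that by (metis continuous_on_eq_continuous_at times_differentiable_on.simps(1))
  then show ?case by (simp add: continuous_at_imp_continuous_on)
next
  case (Suc k)
  have "f differentiable (at x)" if "x \<in> S" for x
    using Suc.prems[OF that] by auto
  moreover have "times_differentiable_on k S (\<lambda>x. FD f x v)" for v
    by (rule Suc.IH) (metis Suc.prems times_differentiable_on.simps(2))
  ultimately show ?case by simp
qed

lemma times_differentiable_on_const: "open S \<Longrightarrow> times_differentiable_on k S (\<lambda>x. c)"
proof (induction k arbitrary: c)
  case (Suc k)
  show ?case
    by (rule times_differentiable_on_SucI[where f'="\<lambda>x v. 0"]) (use Suc in auto)
qed auto

lemma times_differentiable_on_bounded_linear:
  assumes "bounded_linear L" "open S" "times_differentiable_on k S f"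
  shows "times_differentiable_on k S (\<lambda>x. L (f x))"
  using assms(3)
proof (induction k arbitrary: f)
  case 0
  then show ?case using bounded_linear.continuous_on[OF assms(1)] by auto
next
  case (Suc k)
  show ?case
  proof (rule times_differentiable_on_SucI[where f'="\<lambda>x v. L (FD f x v)"])
    show "((\<lambda>x. L (f x)) has_derivative (\<lambda>v. L (FD f x v))) (at x)" if "x \<in> S" for x
      using Suc.prems that
      by (intro bounded_linear.has_derivative[OF assms(1)] FD_has_derivative) auto
  qed (use Suc assms(2) in auto)
qed

lemma times_differentiable_on_add:
  assumes "open S" "times_differentiable_on k S f" "times_differentiable_on k S g"
  shows "times_differentiable_on k S (\<lambda>x. f x + g x)"
  using assms(2,3)
proof (induction k arbitrary: f g)
  case 0
  then show ?case by (auto intro: continuous_intros)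
next
  case (Suc k)
  show ?case
  proof (rule times_differentiable_on_SucI[where f'="\<lambda>x v. FD f x v + FD g x v"])
    show "((\<lambda>x. f x + g x) has_derivative (\<lambda>v. FD f x v + FD g x v)) (at x)" if "x \<in> S" for x
      using Suc.prems that by (intro has_derivative_add FD_has_derivative) auto
  qed (use Suc assms(1) in auto)
qed

lemma times_differentiable_on_bilinear:
  assumes "bounded_bilinear B" "open S" "times_differentiable_on k S f" "times_differentiable_on k S g"
  shows "times_differentiable_on k S (\<lambda>x. B (f x) (g x))"
  using assms(3,4)
proof (induction k arbitrary: f g)
  case 0
  then show ?case using bounded_bilinear.continuous_on[OF assms(1)] by auto
next
  case (Suc k)
  show ?case
  proof (rule times_differentiable_on_SucI[where f'="\<lambda>x v. B (f x) (FD g x v) + B (FD f x v) (g x)"])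
    show "((\<lambda>x. B (f x) (g x)) has_derivative (\<lambda>v. B (f x) (FD g x v) + B (FD f x v) (g x))) (at x)"
      if "x \<in> S" for x
      using Suc.prems that by (intro bounded_bilinear.FDERIV[OF assms(1)] FD_has_derivative) auto
    show "times_differentiable_on k S (\<lambda>x. B (f x) (FD g x v) + B (FD f x v) (g x))" for v
      using Suc.prems times_differentiable_on_mono[of k S f] times_differentiable_on_mono[of k S g]
      by (intro times_differentiable_on_add Suc.IH assms(2)) auto
  qed (use assms(2) in auto)
qed

lemma times_differentiable_on_sum:
  assumes "open S" "\<And>i. i \<in> I \<Longrightarrow> times_differentiable_on k S (f i)"
  shows "times_differentiable_on k S (\<lambda>x. \<Sum>i\<in>I. f i x)"
  using assms(2)
  by (induction I rule: infinite_finite_induct)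
    (auto intro: times_differentiable_on_add times_differentiable_on_const assms(1))

text \<open>By the chain rule the derivative of \<open>g \<circ> f\<close> in the direction \<open>v\<close> is a finite sum of products
  of components of \<open>FD f x v\<close> with partial derivatives of \<open>g\<close> composed with \<open>f\<close>, so the induction
  on the order of differentiability closes.\<close>

lemma times_differentiable_on_compose:
  fixes f :: "'a::real_normed_vector \<Rightarrow> 'b::euclidean_space" and g :: "'b \<Rightarrow> 'c::real_normed_vector"
  assumes "open S" "f ` S \<subseteq> T" "times_differentiable_on k S f" "times_differentiable_on k T g"
  shows "times_differentiable_on k S (\<lambda>x. g (f x))"
  using assms(3,4)
proof (induction k arbitrary: g)
  case 0
  then show ?case using continuous_on_compose2[of T g S f] assms(2) by auto
next
  case (Suc k)
  have df: "(f has_derivative FD f x) (at x)" if "x \<in> S" for x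
    using Suc.prems that by (intro FD_has_derivative) auto
  have dg: "(g has_derivative FD g (f x)) (at (f x))" if "x \<in> S" for x
    using Suc.prems that assms(2) by (intro FD_has_derivative) auto
  have exp: "FD g (f x) (FD f x v) = (\<Sum>b\<in>Basis. (FD f x v \<bullet> b) *\<^sub>R FD g (f x) b)" if "x \<in> S" for x v
  proof -
    have "linear (FD g (f x))" using dg[OF that] has_derivative_linear by blast
    then have "FD g (f x) (\<Sum>b\<in>Basis. (FD f x v \<bullet> b) *\<^sub>R b)
        = (\<Sum>b\<in>Basis. (FD f x v \<bullet> b) *\<^sub>R FD g (f x) b)"
      by (simp add: linear_sum linear_cmul)
    then show ?thesis by (simp add: euclidean_representation)
  qed
  show ?case
  proof (rule times_differentiable_on_SucI[where f'="\<lambda>x v. FD g (f x) (FD f x v)"])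
    show "((\<lambda>x. g (f x)) has_derivative (\<lambda>v. FD g (f x) (FD f x v))) (at x)" if "x \<in> S" for x
      using has_derivative_compose[OF df[OF that] dg[OF that]] by simp
    fix v
    have "times_differentiable_on k S (\<lambda>x. \<Sum>b\<in>Basis. (FD f x v \<bullet> b) *\<^sub>R FD g (f x) b)"
    proof (intro times_differentiable_on_sum assms(1)
        times_differentiable_on_bilinear[OF bounded_bilinear_scaleR])
      fix b :: 'b
      show "times_differentiable_on k S (\<lambda>x. FD f x v \<bullet> b)"
        using Suc.prems
        by (intro times_differentiable_on_bounded_linear[OF bounded_linear_inner_left]) (auto simp: assms(1))
      show "times_differentiable_on k S (\<lambda>x. FD g (f x) b)"
        using Suc.prems times_differentiable_on_mono[of k S f] by (intro Suc.IH) auto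
    qed
    then show "times_differentiable_on k S (\<lambda>x. FD g (f x) (FD f x v))"
      by (rule times_differentiable_on_cong[OF assms(1), rotated]) (simp add: exp)
  qed (rule assms(1))
qed

lemma times_differentiable_on_inverse:
  fixes f :: "'a::real_normed_vector \<Rightarrow> 'b::real_normed_field"
  assumes "open S" "\<And>x. x \<in> S \<Longrightarrow> f x \<noteq> 0" "times_differentiable_on k S f"
  shows "times_differentiable_on k S (\<lambda>x. inverse (f x))"
  using assms(3)
proof (induction k)
  case 0
  then show ?case using assms(2) by (auto intro!: continuous_intros)
next
  case (Suc k)
  have IH: "times_differentiable_on k S (\<lambda>x. inverse (f x))"
    using Suc times_differentiable_on_mono by blast
  show ?case
  proof (rule times_differentiable_on_SucI[where f'="\<lambda>x v. - (inverse (f x) * FD f x v * inverse (f x))"])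
    show "((\<lambda>x. inverse (f x)) has_derivative (\<lambda>v. - (inverse (f x) * FD f x v * inverse (f x)))) (at x)"
      if "x \<in> S" for x
      using Suc.prems that assms(2) by (intro Deriv.has_derivative_inverse FD_has_derivative) auto
    show "times_differentiable_on k S (\<lambda>x. - (inverse (f x) * FD f x v * inverse (f x)))" for v
      using Suc.prems
      by (intro times_differentiable_on_bounded_linear[OF bounded_linear_minus[OF bounded_linear_ident]]
          times_differentiable_on_bilinear[OF bounded_bilinear_mult] assms(1) IH) auto
  qed (rule assms(1))
qed

lemma smooth_on_cong: "open S \<Longrightarrow> (\<And>y. y \<in> S \<Longrightarrow> f y = g y) \<Longrightarrow> smooth_on S f \<Longrightarrow> smooth_on S g"
  unfolding smooth_on_def using times_differentiable_on_cong by blast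

lemma smooth_on_differentiable: "smooth_on S f \<Longrightarrow> x \<in> S \<Longrightarrow> f differentiable (at x)"
  unfolding smooth_on_def by (metis times_differentiable_on.simps(2))

lemma smooth_on_has_derivative: "smooth_on S f \<Longrightarrow> x \<in> S \<Longrightarrow> (f has_derivative FD f x) (at x)"
  using FD_has_derivative smooth_on_differentiable by blast

lemma smooth_on_continuous_on: "smooth_on S f \<Longrightarrow> continuous_on S f"
  unfolding smooth_on_def by (metis times_differentiable_on.simps(1))

lemma smooth_on_FD: "smooth_on S f \<Longrightarrow> smooth_on S (\<lambda>x. FD f x v)"
  unfolding smooth_on_def by (metis times_differentiable_on.simps(2))

lemma smooth_onI_derivative:
  assumes "open S" "\<And>x. x \<in> S \<Longrightarrow> (f has_derivative f' x) (at x)" "\<And>v. smooth_on S (\<lambda>x. f' x v)"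
  shows "smooth_on S f"
proof -
  have "times_differentiable_on (Suc k) S f" for k
    using assms unfolding smooth_on_def by (intro times_differentiable_on_SucI) auto
  then show ?thesis unfolding smooth_on_def using times_differentiable_on_mono by blast
qed

lemma smooth_on_subset: "smooth_on S f \<Longrightarrow> T \<subseteq> S \<Longrightarrow> smooth_on T f"
  unfolding smooth_on_def using times_differentiable_on_subset by blast

lemma smooth_on_local:
  "(\<And>x. x \<in> S \<Longrightarrow> \<exists>U. open U \<and> x \<in> U \<and> smooth_on U f) \<Longrightarrow> smooth_on S f"
  unfolding smooth_on_def by (meson times_differentiable_on_local)

lemma smooth_on_const: "open S \<Longrightarrow> smooth_on S (\<lambda>x. c)"
  unfolding smooth_on_def using times_differentiable_on_const by blast

lemma smooth_on_bounded_linear: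
  "bounded_linear L \<Longrightarrow> open S \<Longrightarrow> smooth_on S f \<Longrightarrow> smooth_on S (\<lambda>x. L (f x))"
  unfolding smooth_on_def using times_differentiable_on_bounded_linear by blast

lemma smooth_on_add: "open S \<Longrightarrow> smooth_on S f \<Longrightarrow> smooth_on S g \<Longrightarrow> smooth_on S (\<lambda>x. f x + g x)"
  unfolding smooth_on_def using times_differentiable_on_add by blast

lemma smooth_on_minus: "open S \<Longrightarrow> smooth_on S f \<Longrightarrow> smooth_on S (\<lambda>x. - f x)"
  by (rule smooth_on_bounded_linear[OF bounded_linear_minus[OF bounded_linear_ident]])

lemma smooth_on_diff: "open S \<Longrightarrow> smooth_on S f \<Longrightarrow> smooth_on S g \<Longrightarrow> smooth_on S (\<lambda>x. f x - g x)"
  using smooth_on_add[of S f "\<lambda>x. - g x"] smooth_on_minus by auto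

lemma smooth_on_bilinear:
  "bounded_bilinear B \<Longrightarrow> open S \<Longrightarrow> smooth_on S f \<Longrightarrow> smooth_on S g \<Longrightarrow> smooth_on S (\<lambda>x. B (f x) (g x))"
  unfolding smooth_on_def using times_differentiable_on_bilinear by blast

lemma smooth_on_mult:
  fixes f g :: "'a::real_normed_vector \<Rightarrow> 'b::real_normed_algebra"
  shows "open S \<Longrightarrow> smooth_on S f \<Longrightarrow> smooth_on S g \<Longrightarrow> smooth_on S (\<lambda>x. f x * g x)"
  by (rule smooth_on_bilinear[OF bounded_bilinear_mult])

lemma smooth_on_sum:
  "open S \<Longrightarrow> (\<And>i. i \<in> I \<Longrightarrow> smooth_on S (f i)) \<Longrightarrow> smooth_on S (\<lambda>x. \<Sum>i\<in>I. f i x)"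
  unfolding smooth_on_def using times_differentiable_on_sum[of S I] by blast

lemma smooth_on_prod:
  fixes f :: "'i \<Rightarrow> 'a::real_normed_vector \<Rightarrow> 'b::real_normed_field"
  assumes "open S" "\<And>i. i \<in> I \<Longrightarrow> smooth_on S (f i)"
  shows "smooth_on S (\<lambda>x. \<Prod>i\<in>I. f i x)"
  using assms(2)
  by (induction I rule: infinite_finite_induct) (auto intro: smooth_on_mult smooth_on_const assms(1))

lemma smooth_on_compose:
  fixes f :: "'a::real_normed_vector \<Rightarrow> 'b::euclidean_space"
  shows "open S \<Longrightarrow> f ` S \<subseteq> T \<Longrightarrow> smooth_on S f \<Longrightarrow> smooth_on T g \<Longrightarrow> smooth_on S (\<lambda>x. g (f x))"
  unfolding smooth_on_def using times_differentiable_on_compose by blast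

lemma smooth_on_inverse:
  fixes f :: "'a::real_normed_vector \<Rightarrow> 'b::real_normed_field"
  shows "open S \<Longrightarrow> (\<And>x. x \<in> S \<Longrightarrow> f x \<noteq> 0) \<Longrightarrow> smooth_on S f \<Longrightarrow> smooth_on S (\<lambda>x. inverse (f x))"
  unfolding smooth_on_def using times_differentiable_on_inverse by blast

lemma smooth_on_ident: "open S \<Longrightarrow> smooth_on S (\<lambda>x. x)"
  by (rule smooth_onI_derivative[where f'="\<lambda>x v. v"]) (auto intro: smooth_on_const)

lemma smooth_on_cnj: "open S \<Longrightarrow> smooth_on S f \<Longrightarrow> smooth_on S (\<lambda>x. cnj (f x))"
  by (rule smooth_on_bounded_linear[OF bounded_linear_cnj])

lemma smooth_on_nth:
  fixes f :: "'a::real_normed_vector \<Rightarrow> ('b::real_normed_vector)^'n::finite"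
  shows "open S \<Longrightarrow> smooth_on S f \<Longrightarrow> smooth_on S (\<lambda>x. f x $ i)"
  by (rule smooth_on_bounded_linear[OF bounded_linear_vec_nth])

lemma norm_axis_eq: "norm (axis i c :: 'b::real_normed_vector^'n::finite) = norm c"
  by (simp add: norm_vec_def axis_def L2_set_def if_distrib[of norm] if_distrib[of "\<lambda>x. x\<^sup>2"] cong: if_cong)

lemma bounded_linear_axis: "bounded_linear (axis i :: 'b::real_normed_vector \<Rightarrow> 'b^'n::finite)"
  by (rule bounded_linear_intro[where K=1])
    (auto simp: vec_eq_iff axis_def norm_axis_eq[unfolded axis_def])

lemma vec_eq_sum_axis: "x = (\<Sum>i\<in>UNIV. axis i (x $ i))" for x :: "('b::comm_monoid_add)^'n::finite"
  by (auto simp: vec_eq_iff axis_def sum.delta)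

lemma smooth_on_vec:
  fixes f :: "'a::real_normed_vector \<Rightarrow> ('b::real_normed_vector)^'n::finite"
  assumes "open S" "\<And>i. smooth_on S (\<lambda>x. f x $ i)"
  shows "smooth_on S f"
proof -
  have "smooth_on S (\<lambda>x. \<Sum>i\<in>UNIV. axis i (f x $ i))"
    by (intro smooth_on_sum smooth_on_bounded_linear[OF bounded_linear_axis] assms)
  then show ?thesis by (simp flip: vec_eq_sum_axis)
qed

subsection \<open>Symmetry of second derivatives\<close>

text \<open>The second difference of \<open>f\<close> over the parallelogram spanned by \<open>t v\<close> and \<open>t w\<close>, divided by
  \<open>t\<^sup>2\<close>, tends to the derivative in the direction \<open>w\<close> of the derivative in the direction \<open>v\<close>: apply
  the mean value theorem along \<open>v\<close>, then differentiability of \<open>FD f _ v\<close> at the base point. The second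
  difference is symmetric in \<open>v\<close> and \<open>w\<close>.\<close>

lemma second_difference_limit:
  fixes f :: "'a::real_normed_vector \<Rightarrow> real"
  assumes "open S" "x \<in> S" "\<And>y. y \<in> S \<Longrightarrow> f differentiable (at y)"
    "((\<lambda>y. FD f y v) has_derivative L) (at x)"
  shows "((\<lambda>t. (f (x + t *\<^sub>R v + t *\<^sub>R w) - f (x + t *\<^sub>R v) - f (x + t *\<^sub>R w) + f x) / t\<^sup>2) \<longlongrightarrow> L w) (at_right 0)"
proof (rule tendstoI)
  fix e :: real assume "e > 0"
  define K where "K = 2 * norm v + 2 * norm w + 1"
  have K: "K > 0" by (simp add: K_def add_nonneg_pos)
  define e' where "e' = e / (2 * K)"
  have e': "e' > 0" using \<open>e > 0\<close> K by (simp add: e'_def)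
  obtain d where d: "d > 0" "\<And>y. norm (y - x) < d \<Longrightarrow>
      norm (FD f y v - FD f x v - L (y - x)) \<le> e' * norm (y - x)"
    using assms(4) e' unfolding has_derivative_at_alt by blast
  obtain d2 where d2: "d2 > 0" "ball x d2 \<subseteq> S" using assms(1,2) open_contains_ball by blast
  have L: "linear L" using assms(4) has_derivative_linear by blast
  define t0 where "t0 = min d d2 / K"
  have t0: "t0 > 0" using d d2 K by (simp add: t0_def)
  have "dist ((f (x + t *\<^sub>R v + t *\<^sub>R w) - f (x + t *\<^sub>R v) - f (x + t *\<^sub>R w) + f x) / t\<^sup>2) (L w) < e"
    if t: "0 < t" "t < t0" for t
  proof -
    have tK: "t * K < min d d2" using t K unfolding t0_def by (simp add: pos_less_divide_eq)
    have near: "norm (s *\<^sub>R v + c *\<^sub>R w) \<le> t * (norm v + norm w)"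
      if "0 \<le> s" "s \<le> t" "0 \<le> c" "c \<le> t" for s c
    proof -
      have "norm (s *\<^sub>R v + c *\<^sub>R w) \<le> s * norm v + c * norm w"
        using norm_triangle_ineq[of "s *\<^sub>R v" "c *\<^sub>R w"] that by simp
      also have "\<dots> \<le> t * norm v + t * norm w"
        using that by (intro add_mono mult_right_mono) auto
      finally show ?thesis by (simp add: algebra_simps)
    qed
    have lt: "t * (norm v + norm w) < min d d2"
    proof -
      have "t * (norm v + norm w) \<le> t * K"
        using t by (intro mult_left_mono) (auto simp: K_def)
      then show ?thesis using tK by linarith
    qed
    have inS: "x + s *\<^sub>R v + c *\<^sub>R w \<in> S" if "0 \<le> s" "s \<le> t" "0 \<le> c" "c \<le> t" for s c
    proof -
      have "x - (x + s *\<^sub>R v + c *\<^sub>R w) = - (s *\<^sub>R v + c *\<^sub>R w)" by simp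
      then have "dist x (x + s *\<^sub>R v + c *\<^sub>R w) = norm (s *\<^sub>R v + c *\<^sub>R w)"
        unfolding dist_norm by (simp only: norm_minus_cancel)
      then have "x + s *\<^sub>R v + c *\<^sub>R w \<in> ball x d2" using near[OF that] lt by simp
      then show ?thesis using d2 by blast
    qed
    define g where "g s = f (x + s *\<^sub>R v + t *\<^sub>R w) - f (x + s *\<^sub>R v)" for s
    have dline: "((\<lambda>s. f (x + s *\<^sub>R v + c *\<^sub>R w)) has_real_derivative FD f (x + s *\<^sub>R v + c *\<^sub>R w) v) (at s)"
      if "0 \<le> s" "s \<le> t" "0 \<le> c" "c \<le> t" for s c
    proof -
      have 1: "((\<lambda>s. x + s *\<^sub>R v + c *\<^sub>R w) has_derivative (\<lambda>h. h *\<^sub>R v)) (at s)"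
        by (auto intro!: derivative_eq_intros)
      have 2: "(f has_derivative FD f (x + s *\<^sub>R v + c *\<^sub>R w)) (at (x + s *\<^sub>R v + c *\<^sub>R w))"
        using assms(3) inS[OF that] FD_has_derivative by blast
      have "FD f (x + s *\<^sub>R v + c *\<^sub>R w) (h *\<^sub>R v) = FD f (x + s *\<^sub>R v + c *\<^sub>R w) v * h" for h
        using has_derivative_linear[OF 2] by (simp add: linear_cmul)
      then show ?thesis
        using has_derivative_compose[OF 1 2] by (simp add: has_field_derivative_def)
    qed
    have "\<exists>z. 0 < z \<and> z < t \<and> g t - g 0 = (t - 0) * (FD f (x + z *\<^sub>R v + t *\<^sub>R w) v - FD f (x + z *\<^sub>R v) v)"
    proof (rule MVT2)
      show "0 < t" by fact
      fix s assume s: "0 \<le> s" "s \<le> t"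
      show "(g has_real_derivative FD f (x + s *\<^sub>R v + t *\<^sub>R w) v - FD f (x + s *\<^sub>R v) v) (at s)"
        unfolding g_def using dline[OF s, of t] dline[OF s, of 0] t by (auto intro!: DERIV_diff)
    qed
    then obtain z where z: "0 < z" "z < t"
      and gz: "g t - g 0 = t * (FD f (x + z *\<^sub>R v + t *\<^sub>R w) v - FD f (x + z *\<^sub>R v) v)" by auto
    have e1: "\<bar>FD f (x + z *\<^sub>R v + t *\<^sub>R w) v - FD f x v - L (z *\<^sub>R v + t *\<^sub>R w)\<bar> \<le> e' * (t * (norm v + norm w))"
    proof -
      have "norm (FD f (x + z *\<^sub>R v + t *\<^sub>R w) v - FD f x v - L (z *\<^sub>R v + t *\<^sub>R w)) \<le> e' * norm (z *\<^sub>R v + t *\<^sub>R w)"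
        using d(2)[of "x + z *\<^sub>R v + t *\<^sub>R w"] near[of z t] lt z by (simp add: algebra_simps)
      also have "\<dots> \<le> e' * (t * (norm v + norm w))" using near[of z t] z e' by (intro mult_left_mono) auto
      finally show ?thesis by simp
    qed
    have e2: "\<bar>FD f (x + z *\<^sub>R v) v - FD f x v - L (z *\<^sub>R v)\<bar> \<le> e' * (t * (norm v + norm w))"
    proof -
      have "norm (FD f (x + z *\<^sub>R v) v - FD f x v - L (z *\<^sub>R v)) \<le> e' * norm (z *\<^sub>R v)"
        using d(2)[of "x + z *\<^sub>R v"] near[of z 0] lt z t by (simp add: algebra_simps)
      also have "\<dots> \<le> e' * (t * (norm v + norm w))" using near[of z 0] z t e' by (intro mult_left_mono) auto
      finally show ?thesis by simp
    qed
    have Ladd: "L (z *\<^sub>R v + t *\<^sub>R w) = L (z *\<^sub>R v) + t * L w" using L by (simp add: linear_add linear_cmul)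
    have "\<bar>(g t - g 0) / t - t * L w\<bar> \<le> 2 * (e' * (t * (norm v + norm w)))"
      using e1 e2 gz t unfolding Ladd by simp
    also have "\<dots> = t * (e' * (2 * norm v + 2 * norm w))" by (simp add: algebra_simps)
    also have "\<dots> \<le> t * (e' * K)" using t e' by (intro mult_left_mono) (auto simp: K_def)
    also have "\<dots> = t * (e / 2)" using K by (simp add: e'_def)
    finally have "\<bar>(g t - g 0) / t - t * L w\<bar> \<le> t * (e / 2)" .
    then have "\<bar>((g t - g 0) / t - t * L w) / t\<bar> \<le> e / 2"
      using t by (simp add: abs_divide pos_divide_le_eq mult.commute)
    moreover have "((g t - g 0) / t - t * L w) / t = (g t - g 0) / t\<^sup>2 - L w"
      using t by (simp add: field_simps power2_eq_square)
    ultimately have "\<bar>(g t - g 0) / t\<^sup>2 - L w\<bar> \<le> e / 2" by simp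
    moreover have "g t - g 0 = f (x + t *\<^sub>R v + t *\<^sub>R w) - f (x + t *\<^sub>R v) - f (x + t *\<^sub>R w) + f x"
      by (simp add: g_def)
    ultimately show ?thesis using \<open>e > 0\<close> by (simp add: dist_real_def)
  qed
  then show "\<forall>\<^sub>F t in at_right 0. dist ((f (x + t *\<^sub>R v + t *\<^sub>R w) - f (x + t *\<^sub>R v) - f (x + t *\<^sub>R w) + f x) / t\<^sup>2) (L w) < e"
    using eventually_at_right_less[of 0] t0 by (auto simp: eventually_at_right intro!: exI[of _ t0])
qed

lemma FD_commute_real:
  fixes f :: "'a::real_normed_vector \<Rightarrow> real"
  assumes "open S" "x \<in> S" "smooth_on S f"
  shows "FD (\<lambda>y. FD f y v) x w = FD (\<lambda>y. FD f y w) x v"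
proof -
  have "((\<lambda>t. (f (x + t *\<^sub>R v + t *\<^sub>R w) - f (x + t *\<^sub>R v) - f (x + t *\<^sub>R w) + f x) / t\<^sup>2)
          \<longlongrightarrow> FD (\<lambda>y. FD f y v) x w) (at_right 0)" for v w
    using smooth_on_differentiable[OF assms(3)] smooth_on_has_derivative[OF smooth_on_FD[OF assms(3)]]
    by (intro second_difference_limit[OF assms(1,2)]) (use assms(2) in auto)
  from this[of v w] this[of w v] show ?thesis
    using tendsto_unique[OF trivial_limit_at_right_real] by (simp add: algebra_simps)
qed

lemma FD_bounded_linear:
  assumes "bounded_linear L" "f differentiable (at x)"
  shows "FD (\<lambda>y. L (f y)) x v = L (FD f x v)"
  using FD_eqI[OF bounded_linear.has_derivative[OF assms(1) FD_has_derivative[OF assms(2)]]] by simp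

lemma FD_commute:
  fixes f :: "'a::real_normed_vector \<Rightarrow> 'b::euclidean_space"
  assumes "open S" "x \<in> S" "smooth_on S f"
  shows "FD (\<lambda>y. FD f y v) x w = FD (\<lambda>y. FD f y w) x v"
proof (rule euclidean_eqI)
  fix b :: 'b
  have *: "FD (\<lambda>y. FD (\<lambda>y. f y \<bullet> b) y v) x w = FD (\<lambda>y. FD f y v) x w \<bullet> b" for v w
  proof -
    have "FD (\<lambda>y. FD (\<lambda>y. f y \<bullet> b) y v) x w = FD (\<lambda>y. FD f y v \<bullet> b) x w"
      by (rule fun_cong[OF FD_cong_open[OF assms(1,2)]])
        (rule FD_bounded_linear[OF bounded_linear_inner_left smooth_on_differentiable[OF assms(3)]])
    also have "\<dots> = FD (\<lambda>y. FD f y v) x w \<bullet> b"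
      using smooth_on_differentiable[OF smooth_on_FD[OF assms(3)] assms(2)]
      by (intro FD_bounded_linear[OF bounded_linear_inner_left])
    finally show ?thesis .
  qed
  show "FD (\<lambda>y. FD f y v) x w \<bullet> b = FD (\<lambda>y. FD f y w) x v \<bullet> b"
    unfolding *[symmetric]
    using FD_commute_real[OF assms(1,2) smooth_on_bounded_linear[OF bounded_linear_inner_left assms(1,3)]] .
qed

subsection \<open>Bump functions\<close>

text \<open>The functions \<open>p(1/t) exp(-1/t)\<close> for \<open>t > 0\<close>, extended by zero, with \<open>p\<close> a polynomial: this
  family is closed under differentiation, which makes all its members smooth.\<close>

definition flat_fun :: "real poly \<Rightarrow> real \<Rightarrow> real" where
  "flat_fun p t = (if t > 0 then poly p (1 / t) * exp (- (1 / t)) else 0)"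

lemma poly_exp_tendsto: "((\<lambda>x::real. poly p x * exp (- x)) \<longlongrightarrow> 0) at_top"
proof -
  have "((\<lambda>x::real. \<Sum>i\<le>degree p. coeff p i * (x ^ i / exp x)) \<longlongrightarrow> (\<Sum>i\<le>degree p. coeff p i * 0)) at_top"
    by (intro tendsto_intros tendsto_power_div_exp_0)
  moreover have "(\<Sum>i\<le>degree p. coeff p i * (x ^ i / exp x)) = poly p x * exp (- x)" for x :: real
    by (simp add: poly_altdef sum_distrib_right exp_minus divide_inverse mult.assoc)
  ultimately show ?thesis by simp
qed

lemma flat_fun_tendsto: "((\<lambda>t. flat_fun p t) \<longlongrightarrow> 0) (at_right 0)"
proof -
  have "((\<lambda>t::real. poly p (inverse t) * exp (- inverse t)) \<longlongrightarrow> 0) (at_right 0)"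
    using filterlim_compose[OF poly_exp_tendsto filterlim_inverse_at_top_right] .
  then show ?thesis
    by (rule Lim_transform_eventually)
      (auto simp: flat_fun_def inverse_eq_divide intro: eventually_at_rightI[of 0 1])
qed

text \<open>The derivative of \<open>p(1/t) exp(-1/t)\<close> is \<open>(p - p')(1/t) exp(-1/t) /
  t\<^sup>2\<close>.\<close>

definition flat_deriv :: "real poly \<Rightarrow> real poly" where
  "flat_deriv p = pCons 0 (pCons 0 (p - pderiv p))"

lemma flat_fun_deriv: "(flat_fun p has_real_derivative flat_fun (flat_deriv p) t) (at t)"
proof (cases t "0::real" rule: linorder_cases)
  case less
  have "((\<lambda>_. 0) has_real_derivative 0) (at t)" by simp
  then have "(flat_fun p has_real_derivative 0) (at t)"
    by (rule has_field_derivative_transform_within_open[where S="{..<0}"])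
      (use less in \<open>auto simp: flat_fun_def\<close>)
  then show ?thesis using less by (simp add: flat_fun_def)
next
  case greater
  have "((\<lambda>t. poly p (1 / t) * exp (- (1 / t))) has_real_derivative flat_fun (flat_deriv p) t) (at t)"
    using greater unfolding flat_fun_def flat_deriv_def
    by (auto intro!: derivative_eq_intros simp: field_simps power2_eq_square)
  then show ?thesis
    by (rule has_field_derivative_transform_within_open[where S="{0<..}"])
      (use greater in \<open>auto simp: flat_fun_def\<close>)
next
  case equal
  \<comment> \<open>At the origin the difference quotient is again a member of the family, for the
    polynomial \<open>x p\<close>.\<close>
  have "((\<lambda>h. (flat_fun p (0 + h) - flat_fun p 0) / h) \<longlongrightarrow> 0) (at (0::real))"
  proof (subst filterlim_at_split, intro conjI)
    show "((\<lambda>h. (flat_fun p (0 + h) - flat_fun p 0) / h) \<longlongrightarrow> 0) (at_left 0)"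
      by (rule Lim_transform_eventually[OF tendsto_const])
        (auto simp: flat_fun_def intro!: eventually_at_leftI[of "-1" 0])
    show "((\<lambda>h. (flat_fun p (0 + h) - flat_fun p 0) / h) \<longlongrightarrow> 0) (at_right 0)"
      by (rule Lim_transform_eventually[OF flat_fun_tendsto[of "pCons 0 p"]])
        (auto simp: flat_fun_def intro!: eventually_at_rightI[of 0 1])
  qed
  then have "(flat_fun p has_real_derivative 0) (at 0)" by (simp add: DERIV_def)
  then show ?thesis using equal by (simp add: flat_fun_def)
qed

lemma smooth_on_flat_fun: "smooth_on UNIV (flat_fun p)"
proof -
  have "times_differentiable_on k UNIV (\<lambda>t. c *\<^sub>R flat_fun p t)" for k p and c :: real
  proof (induction k arbitrary: c p)
    case 0
    have "isCont (flat_fun p) t" for t using flat_fun_deriv DERIV_isCont by blast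
    then show ?case by (auto intro!: continuous_intros continuous_at_imp_continuous_on)
  next
    case (Suc k)
    show ?case
    proof (rule times_differentiable_on_SucI[where f'="\<lambda>t v. (c * v) *\<^sub>R flat_fun (flat_deriv p) t"])
      show "((\<lambda>t. c *\<^sub>R flat_fun p t) has_derivative (\<lambda>v. (c * v) *\<^sub>R flat_fun (flat_deriv p) t)) (at t)" for t
        using flat_fun_deriv[of p t] unfolding has_field_derivative_def
        by (auto intro!: derivative_eq_intros simp: algebra_simps)
    qed (use Suc in auto)
  qed
  from this[of _ 1 p] show ?thesis by (simp add: smooth_on_def)
qed

definition bump :: "'a::euclidean_space \<Rightarrow> real \<Rightarrow> 'a \<Rightarrow> real" where
  "bump z0 e z = flat_fun 1 (e\<^sup>2 - (z - z0) \<bullet> (z - z0))"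

lemma smooth_on_bump: "smooth_on UNIV (bump z0 e)"
proof -
  have 1: "smooth_on UNIV (\<lambda>z::'a. z - z0)"
    by (rule smooth_on_diff[OF open_UNIV smooth_on_ident smooth_on_const]) auto
  have 2: "smooth_on UNIV (\<lambda>z::'a. e\<^sup>2 - (z - z0) \<bullet> (z - z0))"
    by (rule smooth_on_diff[OF open_UNIV smooth_on_const smooth_on_bilinear[OF bounded_bilinear_inner _ 1 1]]) auto
  have "smooth_on UNIV (\<lambda>z. flat_fun 1 (e\<^sup>2 - (z - z0) \<bullet> (z - z0)))"
    by (rule smooth_on_compose[OF open_UNIV _ 2 smooth_on_flat_fun]) auto
  then show ?thesis by (simp add: bump_def[abs_def])
qed

lemma bump_nonneg: "bump z0 e z \<ge> 0"
  by (simp add: bump_def flat_fun_def)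

lemma bump_pos_iff: "e > 0 \<Longrightarrow> bump z0 e z > 0 \<longleftrightarrow> dist z0 z < e"
proof -
  assume "e > 0"
  have "(z - z0) \<bullet> (z - z0) = (dist z0 z)\<^sup>2" by (simp add: dist_norm norm_minus_commute power2_norm_eq_inner)
  moreover have "(dist z0 z)\<^sup>2 < e\<^sup>2 \<longleftrightarrow> dist z0 z < e"
    using \<open>e > 0\<close> abs_le_square_iff[of e "dist z0 z"] by (simp add: linorder_not_le[symmetric])
  ultimately show ?thesis by (simp add: bump_def flat_fun_def)
qed

lemma bump_zero: "e > 0 \<Longrightarrow> dist z0 z \<ge> e \<Longrightarrow> bump z0 e z = 0"
  using bump_pos_iff[of e z0 z] bump_nonneg[of z0 e z] by linarith

section \<open>Holomorphic functions of several variables\<close>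

lemma norm_vector_scalar_mult: "norm (a *s v) = cmod a * norm v" for v :: "complex^'n::finite"
proof -
  have "norm (a *s v) = L2_set (\<lambda>i. cmod a * cmod (v $ i)) UNIV"
    by (simp add: norm_vec_def norm_mult)
  also have "\<dots> = cmod a * norm v" by (simp add: norm_vec_def L2_set_right_distrib)
  finally show ?thesis .
qed

lemma of_real_vector_scalar_mult: "complex_of_real r *s v = r *\<^sub>R v" for v :: "complex^'n::finite"
  unfolding vec_eq_iff vector_scaleR_component vector_smult_component by (simp add: scaleR_conv_of_real)

lemma bounded_linear_scalar_mult_left: "bounded_linear (\<lambda>\<zeta>. \<zeta> *s v)" for v :: "complex^'n::finite"
  by (rule bounded_linear_intro[where K="norm v"])
    (auto simp: norm_vector_scalar_mult vec_eq_iff algebra_simps)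

lemma bounded_linear_scalar_mult_right: "bounded_linear (\<lambda>v :: complex^'n::finite. a *s v)"
  by (rule bounded_linear_intro[where K="cmod a"])
    (auto simp: norm_vector_scalar_mult vec_eq_iff algebra_simps)

lemma isCont_complex_line: "isCont (\<lambda>\<zeta>. z + \<zeta> *s v) \<zeta>0" for v :: "complex^'n::finite"
  by (intro continuous_add continuous_const linear_continuous_at bounded_linear_scalar_mult_left)

lemma continuous_on_complex_line: "continuous_on T (\<lambda>\<zeta>. z + \<zeta> *s v)" for v :: "complex^'n::finite"
  using isCont_complex_line continuous_at_imp_continuous_on by blast

text \<open>Continuity together with holomorphy on complex lines passes to locally uniform limits by the theory of
  one variable, and it implies complex differentiability and smoothness. Working with this
  notion avoids integral formulae in several variables.\<close>

definition line_holomorphic_on :: "(complex^'n::finite) set \<Rightarrow> (complex^'n \<Rightarrow> complex) \<Rightarrow> bool" where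
  "line_holomorphic_on S f \<longleftrightarrow> continuous_on S f \<and>
     (\<forall>z v. (\<lambda>\<zeta>. f (z + \<zeta> *s v)) holomorphic_on {\<zeta>. z + \<zeta> *s v \<in> S})"

lemma open_complex_line_preimage:
  fixes v :: "complex^'n::finite"
  assumes "open S" shows "open {\<zeta>. z + \<zeta> *s v \<in> S}"
  using open_vimage[OF assms continuous_on_complex_line[of UNIV z v]] by (simp add: vimage_def)

lemma line_holomorphic_onI:
  assumes "open S" "continuous_on S f"
    "\<And>z v. z \<in> S \<Longrightarrow> (\<lambda>\<zeta>. f (z + \<zeta> *s v)) field_differentiable at 0"
  shows "line_holomorphic_on S f"
  unfolding line_holomorphic_on_def
proof (intro conjI assms(2) allI)
  fix z v
  show "(\<lambda>\<zeta>. f (z + \<zeta> *s v)) holomorphic_on {\<zeta>. z + \<zeta> *s v \<in> S}"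
    unfolding holomorphic_on_def
  proof
    fix \<zeta>0 assume "\<zeta>0 \<in> {\<zeta>. z + \<zeta> *s v \<in> S}"
    then have "(\<lambda>\<zeta>. f ((z + \<zeta>0 *s v) + \<zeta> *s v)) field_differentiable at 0" using assms(3) by simp
    then obtain D where "((\<lambda>\<zeta>. f ((z + \<zeta>0 *s v) + \<zeta> *s v)) has_field_derivative D) (at 0)"
      by (auto simp: field_differentiable_def)
    then have "((\<lambda>\<zeta>. f (z + \<zeta> *s v)) has_field_derivative D) (at \<zeta>0)"
      using DERIV_shift[of "\<lambda>\<zeta>. f (z + \<zeta> *s v)" D 0 \<zeta>0]
      by (simp add: algebra_simps vector_sadd_rdistrib)
    then show "(\<lambda>\<zeta>. f (z + \<zeta> *s v)) field_differentiable at \<zeta>0 within {\<zeta>. z + \<zeta> *s v \<in> S}"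
      by (auto simp: field_differentiable_def intro: has_field_derivative_at_within)
  qed
qed

lemma line_holomorphic_on_field_differentiable:
  assumes "open S" "line_holomorphic_on S f" "z \<in> S"
  shows "(\<lambda>\<zeta>. f (z + \<zeta> *s v)) field_differentiable at 0"
proof -
  have "(\<lambda>\<zeta>. f (z + \<zeta> *s v)) holomorphic_on {\<zeta>. z + \<zeta> *s v \<in> S}"
    using assms(2) unfolding line_holomorphic_on_def by blast
  then show ?thesis
    using holomorphic_on_imp_differentiable_at[OF _ open_complex_line_preimage[OF assms(1)]] assms(3) by simp
qed

lemma line_holomorphic_on_subset:
  assumes "line_holomorphic_on S f" "T \<subseteq> S"
  shows "line_holomorphic_on T f"
  unfolding line_holomorphic_on_def
proof (intro conjI allI)
  show "continuous_on T f"
    using assms continuous_on_subset unfolding line_holomorphic_on_def by blast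
  fix z v
  have "(\<lambda>\<zeta>. f (z + \<zeta> *s v)) holomorphic_on {\<zeta>. z + \<zeta> *s v \<in> S}"
    using assms(1) unfolding line_holomorphic_on_def by blast
  then show "(\<lambda>\<zeta>. f (z + \<zeta> *s v)) holomorphic_on {\<zeta>. z + \<zeta> *s v \<in> T}"
    by (rule holomorphic_on_subset) (use assms(2) in auto)
qed

lemma line_holomorphic_on_local:
  assumes "open S" "\<And>z. z \<in> S \<Longrightarrow> \<exists>U. open U \<and> z \<in> U \<and> line_holomorphic_on U f"
  shows "line_holomorphic_on S f"
proof (rule line_holomorphic_onI[OF assms(1)])
  have "isCont f x" if "x \<in> S" for x
    using assms(2)[OF that] continuous_on_eq_continuous_at unfolding line_holomorphic_on_def by blast
  then show "continuous_on S f" by (simp add: continuous_at_imp_continuous_on)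
qed (use assms(2) line_holomorphic_on_field_differentiable in blast)

lemma line_holomorphic_on_uniform_limit:
  assumes "open S" "\<And>n. line_holomorphic_on S (f n)" "uniform_limit S f g sequentially"
  shows "line_holomorphic_on S g"
proof (rule line_holomorphic_onI[OF assms(1)])
  show "continuous_on S g"
    using assms(2) by (intro uniform_limit_theorem[OF _ assms(3)])
      (auto simp: line_holomorphic_on_def)
  fix z v assume "z \<in> S"
  have "(\<lambda>\<zeta>. g (z + \<zeta> *s v)) holomorphic_on {\<zeta>. z + \<zeta> *s v \<in> S}"
  proof (rule holomorphic_uniform_sequence[OF open_complex_line_preimage[OF assms(1)]])
    show "(\<lambda>\<zeta>. f n (z + \<zeta> *s v)) holomorphic_on {\<zeta>. z + \<zeta> *s v \<in> S}" for n
      using assms(2) by (auto simp: line_holomorphic_on_def)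
    fix x assume "x \<in> {\<zeta>. z + \<zeta> *s v \<in> S}"
    then obtain d where d: "d > 0" "cball x d \<subseteq> {\<zeta>. z + \<zeta> *s v \<in> S}"
      using open_complex_line_preimage[OF assms(1)] open_contains_cball by meson
    moreover have "uniform_limit (cball x d) (\<lambda>n \<zeta>. f n (z + \<zeta> *s v)) (\<lambda>\<zeta>. g (z + \<zeta> *s v)) sequentially"
      using uniform_limit_compose'[OF assms(3), of "\<lambda>\<zeta>. z + \<zeta> *s v" "cball x d"] d by auto
    ultimately show "\<exists>d>0. cball x d \<subseteq> {\<zeta>. z + \<zeta> *s v \<in> S} \<and>
      uniform_limit (cball x d) (\<lambda>n \<zeta>. f n (z + \<zeta> *s v)) (\<lambda>\<zeta>. g (z + \<zeta> *s v)) sequentially" by blast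
  qed
  then show "(\<lambda>\<zeta>. g (z + \<zeta> *s v)) field_differentiable at 0"
    using holomorphic_on_imp_differentiable_at[OF _ open_complex_line_preimage[OF assms(1)]] \<open>z \<in> S\<close> by simp
qed

definition line_deriv :: "(complex^'n::finite \<Rightarrow> complex) \<Rightarrow> complex^'n \<Rightarrow> complex^'n \<Rightarrow> complex" where
  "line_deriv f z v = deriv (\<lambda>\<zeta>. f (z + \<zeta> *s v)) 0"

lemma line_deriv_scalar_mult:
  assumes "open S" "line_holomorphic_on S f" "z \<in> S"
  shows "line_deriv f z (a *s v) = a * line_deriv f z v"
proof -
  have "((\<lambda>\<zeta>. f (z + \<zeta> *s v)) has_field_derivative line_deriv f z v) (at (a * 0))"
    using line_holomorphic_on_field_differentiable[OF assms] DERIV_deriv_iff_field_differentiable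
    unfolding line_deriv_def by force
  moreover have "((\<lambda>\<zeta>. a * \<zeta>) has_field_derivative a) (at 0)"
    by (auto intro!: derivative_eq_intros)
  ultimately have "((\<lambda>\<zeta>. f (z + (a * \<zeta>) *s v)) has_field_derivative line_deriv f z v * a) (at 0)"
    by (rule DERIV_chain2)
  then show ?thesis unfolding line_deriv_def[of f z "a *s v"]
    by (intro DERIV_imp_deriv) (simp add: mult.commute vector_smult_assoc)
qed

lemma line_deriv_divide:
  assumes "open S" "line_holomorphic_on S f" "z \<in> S"
  shows "line_deriv f z ((1 / real m) *\<^sub>R v) = line_deriv f z v / of_nat m"
proof -
  have "(1 / real m) *\<^sub>R v = (1 / of_nat m) *s v"
    using of_real_vector_scalar_mult[of "1 / real m" v] by simp
  then show ?thesis using line_deriv_scalar_mult[OF assms, of "1 / of_nat m" v] by simp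
qed

text \<open>Cauchy's estimate for the second derivative, on the unit disc inside the disc of radius 2.\<close>

lemma taylor1_remainder_bound:
  assumes "open U" "cball 0 2 \<subseteq> U" "g holomorphic_on U" "\<And>x. x \<in> cball 0 2 \<Longrightarrow> cmod (g x) \<le> B"
    and "cmod t \<le> 1"
  shows "cmod (g t - g 0 - deriv g 0 * t) \<le> 2 * B * (cmod t)\<^sup>2"
proof -
  have "cmod ((deriv ^^ 0) g t - (\<Sum>i\<le>1. (deriv ^^ i) g 0 * (t - 0) ^ i / fact i))
      \<le> 2 * B * cmod (t - 0) ^ Suc 1 / fact 1"
  proof (rule complex_Taylor[where S="cball 0 1" and f="\<lambda>i. (deriv ^^ i) g"])
    fix i :: nat and x :: complex assume x: "x \<in> cball 0 1" and "i \<le> 1"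
    have "x \<in> U" using x assms(2) by force
    moreover have "(deriv ^^ i) g holomorphic_on U" using assms(1,3) by (rule holomorphic_higher_deriv[rotated])
    ultimately show "((deriv ^^ i) g has_field_derivative (deriv ^^ Suc i) g x) (at x within cball 0 1)"
      using holomorphic_derivI[OF _ assms(1)] by simp
  next
    fix x :: complex assume x: "x \<in> cball 0 1"
    have sub: "cball x 1 \<subseteq> cball 0 2"
    proof
      fix y assume "y \<in> cball x 1"
      then show "y \<in> cball 0 2" using x norm_triangle_ineq[of x "y - x"] by (auto simp: dist_norm norm_minus_commute)
    qed
    have "cmod ((deriv ^^ 2) g x) \<le> fact 2 * B / 1 ^ 2"
    proof (rule Cauchy_inequality)
      show "g holomorphic_on ball x 1" using sub assms(2,3) by (meson ball_subset_cball holomorphic_on_subset subset_trans)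
      show "continuous_on (cball x 1) g" using sub assms(2,3) by (meson continuous_on_subset holomorphic_on_imp_continuous_on subset_trans)
      show "cmod (g y) \<le> B" if "cmod (x - y) = 1" for y
        using that sub assms(4) by (auto simp: dist_norm subset_eq)
    qed simp
    then show "cmod ((deriv ^^ Suc 1) g x) \<le> 2 * B" by (simp add: numeral_2_eq_2)
  qed (use assms in auto)
  then show ?thesis by (simp add: power2_eq_square algebra_simps)
qed

text \<open>On the complex line through \<open>z\<close> in the direction of \<open>v\<close>, with
  \<open>v\<close> rescaled to the length \<open>d\<close>, this is the estimate in one variable.\<close>

lemma line_deriv_remainder_bound:
  assumes "open S" "line_holomorphic_on S f" "cball z0 (3 * d) \<subseteq> S" "d > 0"
    and B: "\<And>y. y \<in> cball z0 (3 * d) \<Longrightarrow> cmod (f y) \<le> B"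
    and z: "z \<in> cball z0 d" and v: "norm v \<le> d"
  shows "cmod (f (z + v) - f z - line_deriv f z v) \<le> 2 * B / d\<^sup>2 * (norm v)\<^sup>2"
proof (cases "v = 0")
  case True
  then show ?thesis by (simp add: line_deriv_def)
next
  case False
  define t where "t = complex_of_real (norm v / d)"
  define w where "w = (d / norm v) *\<^sub>R v"
  have w: "norm w = d" using False assms(4) by (simp add: w_def)
  have tw: "t *s w = v" using False assms(4) by (simp add: t_def w_def of_real_vector_scalar_mult flip: of_real_divide)
  have t: "cmod t \<le> 1" "cmod t = norm v / d" using v assms(4) by (auto simp: t_def norm_divide)
  have zS: "z \<in> S" using z assms(3,4) by (auto simp: subset_eq)
  have in3: "z + \<zeta> *s w \<in> cball z0 (3 * d)" if "\<zeta> \<in> cball 0 2" for \<zeta>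
  proof -
    have "norm (\<zeta> *s w) \<le> 2 * d" using that w assms(4) by (simp add: norm_vector_scalar_mult)
    then show ?thesis using z norm_triangle_ineq4[of "z0 - z" "\<zeta> *s w"] by (simp add: dist_norm algebra_simps)
  qed
  have "cmod (f (z + t *s w) - f (z + 0 *s w) - deriv (\<lambda>\<zeta>. f (z + \<zeta> *s w)) 0 * t) \<le> 2 * B * (cmod t)\<^sup>2"
  proof (rule taylor1_remainder_bound)
    show "open {\<zeta>. z + \<zeta> *s w \<in> S}" by (rule open_complex_line_preimage[OF assms(1)])
    show "cball 0 2 \<subseteq> {\<zeta>. z + \<zeta> *s w \<in> S}" using in3 assms(3) by blast
    show "(\<lambda>\<zeta>. f (z + \<zeta> *s w)) holomorphic_on {\<zeta>. z + \<zeta> *s w \<in> S}"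
      using assms(2) by (simp add: line_holomorphic_on_def)
    show "cmod (f (z + \<zeta> *s w)) \<le> B" if "\<zeta> \<in> cball 0 2" for \<zeta> using in3[OF that] B by blast
  qed (use t in simp)
  moreover have "line_deriv f z v = t * line_deriv f z w"
    using line_deriv_scalar_mult[OF assms(1,2) zS, of t w] tw by simp
  ultimately show ?thesis using tw t(2) by (simp add: line_deriv_def power_divide mult.commute)
qed

text \<open>The remainder bound is uniform in the base point, and dividing it by the step length makes it
  tend to zero.\<close>

lemma line_deriv_uniform_limit:
  assumes "open S" "line_holomorphic_on S f" "z0 \<in> S"
  obtains d where "d > 0" "cball z0 d \<subseteq> S"
    "\<And>n z. z \<in> ball z0 d \<Longrightarrow> norm v \<le> d * real (Suc n) \<Longrightarrow> z + (1 / real (Suc n)) *\<^sub>R v \<in> S"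
    "uniform_limit (ball z0 d) (\<lambda>n z. (f (z + (1 / real (Suc n)) *\<^sub>R v) - f z) * of_nat (Suc n))
      (\<lambda>z. line_deriv f z v) sequentially"
    "\<exists>C. \<forall>z\<in>cball z0 d. \<forall>w. norm w \<le> d \<longrightarrow> cmod (f (z + w) - f z - line_deriv f z w) \<le> C * (norm w)\<^sup>2"
proof -
  obtain e where e: "e > 0" "cball z0 e \<subseteq> S" using assms(1,3) open_contains_cball by blast
  define d where "d = e / 3"
  have d: "d > 0" "cball z0 (3 * d) \<subseteq> S" using e by (auto simp: d_def)
  have "continuous_on (cball z0 (3 * d)) f"
    using assms(2) d(2) continuous_on_subset unfolding line_holomorphic_on_def by blast
  then have "bounded (f ` cball z0 (3 * d))" using compact_continuous_image compact_imp_bounded compact_cball by blast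
  then obtain B where B: "\<And>y. y \<in> cball z0 (3 * d) \<Longrightarrow> cmod (f y) \<le> B" unfolding bounded_iff by blast
  define C where "C = 2 * B / d\<^sup>2"
  have est: "cmod (f (z + w) - f z - line_deriv f z w) \<le> C * (norm w)\<^sup>2"
    if "z \<in> cball z0 d" "norm w \<le> d" for z w
    unfolding C_def using line_deriv_remainder_bound[OF assms(1,2) d(2,1) B that] .
  have zS: "z \<in> S" if "z \<in> cball z0 d" for z using that d by (auto simp: subset_eq)
  have eq: "cmod ((f (z + (1 / real (Suc n)) *\<^sub>R v) - f z) * of_nat (Suc n) - line_deriv f z v)
      \<le> C * (norm v)\<^sup>2 / real (Suc n)" if "z \<in> cball z0 d" "norm v \<le> d * real (Suc n)" for n z
  proof -
    let ?w = "(1 / real (Suc n)) *\<^sub>R v"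
    have w: "norm ?w = norm v / real (Suc n)" by simp
    then have "norm ?w \<le> d" using that(2) by (simp add: pos_divide_le_eq)
    from est[OF that(1) this] have 1: "cmod (f (z + ?w) - f z - line_deriv f z ?w) \<le> C * (norm ?w)\<^sup>2" .
    have "line_deriv f z ?w = line_deriv f z v / of_nat (Suc n)"
      by (rule line_deriv_divide[OF assms(1,2) zS[OF that(1)]])
    then have "(f (z + ?w) - f z) * of_nat (Suc n) - line_deriv f z v
        = (f (z + ?w) - f z - line_deriv f z ?w) * of_nat (Suc n)"
      by (simp add: algebra_simps del: of_nat_Suc)
    then have "cmod ((f (z + ?w) - f z) * of_nat (Suc n) - line_deriv f z v)
        = cmod (f (z + ?w) - f z - line_deriv f z ?w) * real (Suc n)"
      by (simp only: norm_mult norm_of_nat)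
    also have "\<dots> \<le> C * (norm ?w)\<^sup>2 * real (Suc n)" using 1 by (intro mult_right_mono) auto
    also have "\<dots> = C * (norm v)\<^sup>2 / real (Suc n)" unfolding w by (simp add: power2_eq_square del: of_nat_Suc)
    finally show ?thesis .
  qed
  have "uniform_limit (ball z0 d) (\<lambda>n z. (f (z + (1 / real (Suc n)) *\<^sub>R v) - f z) * of_nat (Suc n))
      (\<lambda>z. line_deriv f z v) sequentially"
  proof (rule uniform_limitI)
    fix e :: real assume "e > 0"
    have "(\<lambda>n. C * (norm v)\<^sup>2 / real (Suc n)) \<longlonglongrightarrow> 0"
      using LIMSEQ_Suc[OF lim_const_over_n] .
    then have "\<forall>\<^sub>F n in sequentially. C * (norm v)\<^sup>2 / real (Suc n) < e"
      using \<open>e > 0\<close> order_tendstoD(2) by blast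
    moreover have "\<forall>\<^sub>F n in sequentially. norm v \<le> d * real (Suc n)"
    proof -
      obtain N where "norm v / d \<le> real N" using real_arch_simple by blast
      then have N: "norm v \<le> d * real N" using d by (simp add: pos_divide_le_eq mult.commute)
      have "norm v \<le> d * real (Suc n)" if "n \<ge> N" for n
      proof -
        have "d * real N \<le> d * real (Suc n)" using that d by (intro mult_left_mono) auto
        then show ?thesis using N by linarith
      qed
      then show ?thesis using eventually_sequentially by blast
    qed
    ultimately show "\<forall>\<^sub>F n in sequentially. \<forall>x\<in>ball z0 d.
        dist ((f (x + (1 / real (Suc n)) *\<^sub>R v) - f x) * of_nat (Suc n)) (line_deriv f x v) < e"
    proof eventually_elim
      case (elim n)
      show ?case
      proof
        fix x assume "x \<in> ball z0 d"
        then have "x \<in> cball z0 d" by simp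
        from eq[OF this elim(2)] elim(1)
        show "dist ((f (x + (1 / real (Suc n)) *\<^sub>R v) - f x) * of_nat (Suc n)) (line_deriv f x v) < e"
          unfolding dist_norm by linarith
      qed
    qed
  qed
  moreover have "z + (1 / real (Suc n)) *\<^sub>R v \<in> S"
    if "z \<in> ball z0 d" "norm v \<le> d * real (Suc n)" for n z
  proof -
    have "norm ((1 / real (Suc n)) *\<^sub>R v) \<le> d" using that(2) by (simp add: pos_divide_le_eq)
    then have "z + (1 / real (Suc n)) *\<^sub>R v \<in> cball z0 (3 * d)"
      using that(1) d(1) norm_triangle_ineq4[of "z0 - z" "(1 / real (Suc n)) *\<^sub>R v"]
      by (simp add: dist_norm algebra_simps)
    then show ?thesis using d by blast
  qed
  moreover have "cball z0 d \<subseteq> S" using zS by blast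
  ultimately show ?thesis using that d(1) est by blast
qed

text \<open>The directional derivative is a locally uniform limit of difference quotients, which inherit
  line holomorphy from \<open>f\<close>.\<close>

lemma line_holomorphic_on_line_deriv:
  assumes "open S" "line_holomorphic_on S f"
  shows "line_holomorphic_on S (\<lambda>z. line_deriv f z v)"
proof (rule line_holomorphic_on_local[OF assms(1)])
  fix z0 assume "z0 \<in> S"
  then obtain d where d: "d > 0" "cball z0 d \<subseteq> S"
    "\<And>n z. z \<in> ball z0 d \<Longrightarrow> norm v \<le> d * real (Suc n) \<Longrightarrow> z + (1 / real (Suc n)) *\<^sub>R v \<in> S"
    and ul: "uniform_limit (ball z0 d) (\<lambda>n z. (f (z + (1 / real (Suc n)) *\<^sub>R v) - f z) * of_nat (Suc n))
      (\<lambda>z. line_deriv f z v) sequentially"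
    by (rule line_deriv_uniform_limit[OF assms, where v=v]) (erule that, assumption+)
  \<comment> \<open>The first \<open>N\<close> quotients are skipped because their translates may leave
    \<open>S\<close>.\<close>
  obtain N where N: "norm v / d \<le> real N" using real_arch_simple by blast
  have vN: "norm v \<le> d * real (Suc (n + N))" for n
  proof -
    have "norm v \<le> d * real N" using N d by (simp add: pos_divide_le_eq mult.commute)
    also have "\<dots> \<le> d * real (Suc (n + N))" using d by (intro mult_left_mono) auto
    finally show ?thesis .
  qed
  let ?q = "\<lambda>n z. (f (z + (1 / real (Suc (n + N))) *\<^sub>R v) - f z) * of_nat (Suc (n + N))"
  have inS: "z + (1 / real (Suc (n + N))) *\<^sub>R v \<in> S" if "z \<in> ball z0 d" for z n
    using d(3)[OF that vN] .
  have "line_holomorphic_on (ball z0 d) (?q n)" for n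
  proof (rule line_holomorphic_onI)
    have cf: "continuous_on S f" using assms(2) by (simp add: line_holomorphic_on_def)
    have "continuous_on (ball z0 d) (\<lambda>z. f (z + (1 / real (Suc (n + N))) *\<^sub>R v))"
      by (rule continuous_on_compose2[OF cf]) (use inS in \<open>auto intro!: continuous_intros\<close>)
    moreover have "continuous_on (ball z0 d) f" using cf d(2) continuous_on_subset ball_subset_cball by blast
    ultimately show "continuous_on (ball z0 d) (?q n)" by (intro continuous_intros)
    fix z w assume z: "z \<in> ball z0 d"
    have "z \<in> S" using z d(2) by auto
    have "(\<lambda>\<zeta>. f (z + (1 / real (Suc (n + N))) *\<^sub>R v + \<zeta> *s w)) field_differentiable at 0"
      by (rule line_holomorphic_on_field_differentiable[OF assms inS[OF z]])
    moreover have "(\<lambda>\<zeta>. f (z + \<zeta> *s w)) field_differentiable at 0"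
      by (rule line_holomorphic_on_field_differentiable[OF assms \<open>z \<in> S\<close>])
    ultimately have "(\<lambda>\<zeta>. (f (z + (1 / real (Suc (n + N))) *\<^sub>R v + \<zeta> *s w) - f (z + \<zeta> *s w)) * of_nat (Suc (n + N))) field_differentiable at 0"
      by (intro field_differentiable_mult field_differentiable_diff field_differentiable_const)
    then show "(\<lambda>\<zeta>. ?q n (z + \<zeta> *s w)) field_differentiable at 0" by (simp add: algebra_simps)
  qed auto
  moreover have "uniform_limit (ball z0 d) ?q (\<lambda>z. line_deriv f z v) sequentially"
    using filterlim_compose[OF ul filterlim_add_const_nat_at_top[of N]]
    by (simp add: add.commute)
  ultimately have "line_holomorphic_on (ball z0 d) (\<lambda>z. line_deriv f z v)"
    by (rule line_holomorphic_on_uniform_limit[OF open_ball])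
  then show "\<exists>U. open U \<and> z0 \<in> U \<and> line_holomorphic_on U (\<lambda>z. line_deriv f z v)"
    using d(1) by (intro exI[of _ "ball z0 d"]) auto
qed

text \<open>Additivity of the derivative: move first by \<open>t v\<close>, then by \<open>t w\<close>, and use that the derivative in the
  direction \<open>w\<close> is continuous in the base point. Together with the quadratic bound for the remainder this
  gives differentiability.\<close>

lemma line_holomorphic_on_has_derivative:
  assumes "open S" "line_holomorphic_on S f" "z \<in> S"
  shows "(f has_derivative line_deriv f z) (at z)"
proof -
  obtain d where d: "d > 0" "cball z d \<subseteq> S"
    and "\<exists>C. \<forall>y\<in>cball z d. \<forall>w. norm w \<le> d \<longrightarrow> cmod (f (y + w) - f y - line_deriv f y w) \<le> C * (norm w)\<^sup>2"
    by (rule line_deriv_uniform_limit[OF assms, where v=0]) (erule that, assumption+)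
  then obtain C where C: "\<And>y w. y \<in> cball z d \<Longrightarrow> norm w \<le> d \<Longrightarrow>
      cmod (f (y + w) - f y - line_deriv f y w) \<le> C * (norm w)\<^sup>2"
    by blast
  have scale: "line_deriv f y (r *\<^sub>R w) = r *\<^sub>R line_deriv f y w" if "y \<in> S" for y r w
    using line_deriv_scalar_mult[OF assms(1,2) that, of "complex_of_real r" w]
    by (simp add: of_real_vector_scalar_mult scaleR_conv_of_real)
  have lim: "((\<lambda>t::real. (f (y t + t *\<^sub>R w) - f (y t)) /\<^sub>R t - line_deriv f (y t) w) \<longlongrightarrow> 0) (at_right 0)"
    if "\<forall>\<^sub>F t in at_right 0. y t \<in> cball z d" for y w
  proof (rule Lim_null_comparison)
    have "((\<lambda>t::real. t * norm w) \<longlongrightarrow> 0 * norm w) (at_right 0)" by (intro tendsto_intros)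
    then have "((\<lambda>t::real. t * norm w) \<longlongrightarrow> 0) (at_right 0)" by simp
    then have ev: "\<forall>\<^sub>F t in at_right 0. t * norm w < d" using d(1) order_tendstoD(2) by blast
    show "\<forall>\<^sub>F t in at_right 0. norm ((f (y t + t *\<^sub>R w) - f (y t)) /\<^sub>R t - line_deriv f (y t) w) \<le> C * t * (norm w)\<^sup>2"
      using that ev eventually_at_right_less[of 0]
    proof eventually_elim
      case (elim t)
      have "cmod (f (y t + t *\<^sub>R w) - f (y t) - line_deriv f (y t) (t *\<^sub>R w)) \<le> C * (norm (t *\<^sub>R w))\<^sup>2"
        using elim by (intro C) auto
      also have "\<dots> = t * (C * t * (norm w)\<^sup>2)" using elim by (simp add: power2_eq_square)
      finally have 1: "cmod (f (y t + t *\<^sub>R w) - f (y t) - t *\<^sub>R line_deriv f (y t) w) \<le> t * (C * t * (norm w)\<^sup>2)"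
        using scale elim d(2) by (auto simp: subset_eq)
      have "(f (y t + t *\<^sub>R w) - f (y t)) /\<^sub>R t - line_deriv f (y t) w
          = (f (y t + t *\<^sub>R w) - f (y t) - t *\<^sub>R line_deriv f (y t) w) /\<^sub>R t"
        using elim by (simp add: algebra_simps)
      then have "norm ((f (y t + t *\<^sub>R w) - f (y t)) /\<^sub>R t - line_deriv f (y t) w)
          = norm (f (y t + t *\<^sub>R w) - f (y t) - t *\<^sub>R line_deriv f (y t) w) / t"
        using elim by (simp add: divide_inverse mult.commute)
      also have "\<dots> \<le> t * (C * t * (norm w)\<^sup>2) / t" using 1 elim by (intro divide_right_mono) auto
      finally show ?case using elim by simp
    qed
    have "((\<lambda>t::real. C * t * (norm w)\<^sup>2) \<longlongrightarrow> C * 0 * (norm w)\<^sup>2) (at_right 0)" by (intro tendsto_intros)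
    then show "((\<lambda>t::real. C * t * (norm w)\<^sup>2) \<longlongrightarrow> 0) (at_right 0)" by simp
  qed
  have add: "line_deriv f z (v + w) = line_deriv f z v + line_deriv f z w" for v w
  proof -
    have zin: "\<forall>\<^sub>F t in at_right 0. z + t *\<^sub>R v \<in> cball z d"
    proof -
      have "((\<lambda>t::real. z + t *\<^sub>R v) \<longlongrightarrow> z + 0 *\<^sub>R v) (at_right 0)" by (intro tendsto_intros)
      then have "\<forall>\<^sub>F t in at_right 0. z + t *\<^sub>R v \<in> ball z d"
        using d(1) by (intro topological_tendstoD) auto
      then show ?thesis by eventually_elim auto
    qed
    have 1: "((\<lambda>t::real. (f (z + t *\<^sub>R (v + w)) - f z) /\<^sub>R t - line_deriv f z (v + w)) \<longlongrightarrow> 0) (at_right 0)"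
      using lim[of "\<lambda>_. z" "v + w"] d(1) by simp
    have 2: "((\<lambda>t::real. (f (z + t *\<^sub>R v) - f z) /\<^sub>R t - line_deriv f z v) \<longlongrightarrow> 0) (at_right 0)"
      using lim[of "\<lambda>_. z" v] d(1) by simp
    have 3: "((\<lambda>t::real. (f (z + t *\<^sub>R v + t *\<^sub>R w) - f (z + t *\<^sub>R v)) /\<^sub>R t - line_deriv f (z + t *\<^sub>R v) w) \<longlongrightarrow> 0) (at_right 0)"
      using lim[OF zin] .
    have 4: "((\<lambda>t::real. line_deriv f (z + t *\<^sub>R v) w) \<longlongrightarrow> line_deriv f z w) (at_right 0)"
    proof -
      have "continuous_on S (\<lambda>y. line_deriv f y w)"
        using line_holomorphic_on_line_deriv[OF assms(1,2)] by (simp add: line_holomorphic_on_def)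
      then have "isCont (\<lambda>y. line_deriv f y w) (z + 0 *\<^sub>R v)" using assms(1,3) continuous_on_eq_continuous_at by fastforce
      moreover have "((\<lambda>t::real. z + t *\<^sub>R v) \<longlongrightarrow> z + 0 *\<^sub>R v) (at_right 0)" by (intro tendsto_intros)
      ultimately have "((\<lambda>t::real. line_deriv f (z + t *\<^sub>R v) w) \<longlongrightarrow> line_deriv f (z + 0 *\<^sub>R v) w) (at_right 0)"
        by (rule isCont_tendsto_compose)
      then show ?thesis by simp
    qed
    have "((\<lambda>t::real. ((f (z + t *\<^sub>R (v + w)) - f z) /\<^sub>R t - line_deriv f z (v + w))
       - ((f (z + t *\<^sub>R v) - f z) /\<^sub>R t - line_deriv f z v)
       - ((f (z + t *\<^sub>R v + t *\<^sub>R w) - f (z + t *\<^sub>R v)) /\<^sub>R t - line_deriv f (z + t *\<^sub>R v) w)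
       - line_deriv f (z + t *\<^sub>R v) w) \<longlongrightarrow> 0 - 0 - 0 - line_deriv f z w) (at_right 0)"
      by (intro tendsto_diff 1 2 3 4)
    moreover have "((f (z + t *\<^sub>R (v + w)) - f z) /\<^sub>R t - line_deriv f z (v + w))
       - ((f (z + t *\<^sub>R v) - f z) /\<^sub>R t - line_deriv f z v)
       - ((f (z + t *\<^sub>R v + t *\<^sub>R w) - f (z + t *\<^sub>R v)) /\<^sub>R t - line_deriv f (z + t *\<^sub>R v) w)
       - line_deriv f (z + t *\<^sub>R v) w = line_deriv f z v - line_deriv f z (v + w)" for t
      by (simp add: algebra_simps)
    ultimately have "((\<lambda>t::real. line_deriv f z v - line_deriv f z (v + w)) \<longlongrightarrow> - line_deriv f z w) (at_right 0)" by simp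
    then have "line_deriv f z v - line_deriv f z (v + w) = - line_deriv f z w"
      using tendsto_unique[OF trivial_limit_at_right_real _ tendsto_const] by (metis)
    then show ?thesis by (simp add: algebra_simps)
  qed
  have "linear (line_deriv f z)" by (rule linearI) (use add scale assms(3) in auto)
  then have bl: "bounded_linear (line_deriv f z)" by (simp add: linear_conv_bounded_linear)
  show ?thesis unfolding has_derivative_at_alt
  proof (intro conjI bl allI impI)
    fix e :: real assume "e > 0"
    define \<delta> where "\<delta> = min d (e / (\<bar>C\<bar> + 1))"
    have "\<delta> > 0" using d(1) \<open>e > 0\<close> by (simp add: \<delta>_def add_nonneg_pos)
    moreover have "cmod (f y - f z - line_deriv f z (y - z)) \<le> e * norm (y - z)" if "norm (y - z) < \<delta>" for y
    proof -
      have "cmod (f (z + (y - z)) - f z - line_deriv f z (y - z)) \<le> C * (norm (y - z))\<^sup>2"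
        using that d(1) by (intro C) (auto simp: \<delta>_def)
      also have "\<dots> \<le> (\<bar>C\<bar> + 1) * (norm (y - z))\<^sup>2" by (intro mult_right_mono) auto
      also have "\<dots> = ((\<bar>C\<bar> + 1) * norm (y - z)) * norm (y - z)" by (simp add: power2_eq_square)
      also have "\<dots> \<le> e * norm (y - z)"
      proof (intro mult_right_mono norm_ge_zero)
        have "norm (y - z) \<le> e / (\<bar>C\<bar> + 1)" using that by (simp add: \<delta>_def)
        then show "(\<bar>C\<bar> + 1) * norm (y - z) \<le> e" by (simp add: pos_le_divide_eq add_nonneg_pos mult.commute)
      qed
      finally show ?thesis by simp
    qed
    ultimately show "\<exists>da>0. \<forall>y. norm (y - z) < da \<longrightarrow> cmod (f y - f z - line_deriv f z (y - z)) \<le> e * norm (y - z)"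
      by blast
  qed
qed

text \<open>Directional derivatives are line holomorphic and hence differentiable again.\<close>

lemma line_holomorphic_on_smooth:
  assumes "open S" "line_holomorphic_on S f"
  shows "smooth_on S f"
proof -
  have "times_differentiable_on k S f" if "line_holomorphic_on S f" for k f
    using that
  proof (induction k arbitrary: f)
    case 0
    then show ?case by (simp add: line_holomorphic_on_def)
  next
    case (Suc k)
    show ?case
      by (rule times_differentiable_on_SucI[OF assms(1) line_holomorphic_on_has_derivative[OF assms(1) Suc.prems]])
        (auto intro: Suc.IH line_holomorphic_on_line_deriv[OF assms(1) Suc.prems])
  qed
  then show ?thesis using assms(2) by (simp add: smooth_on_def)
qed

text \<open>The derivative under the integral sign is jointly continuous because the bound for the
  remainder is uniform in the parameter.\<close>

lemma line_holomorphic_on_integral: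
  fixes k :: "complex^'n::finite \<Rightarrow> real \<Rightarrow> complex"
  assumes "open S" "continuous_on (S \<times> {0..1}) (\<lambda>(z, s). k z s)"
    and hol: "\<And>s. s \<in> {0..1} \<Longrightarrow> line_holomorphic_on S (\<lambda>z. k z s)"
  shows "line_holomorphic_on S (\<lambda>z. integral {0..1} (k z))"
proof (rule line_holomorphic_onI[OF assms(1)])
  have "continuous_on S (\<lambda>z. integral (cbox 0 1) (k z))"
    by (rule integral_continuous_on_param) (use assms(2) in simp)
  then show "continuous_on S (\<lambda>z. integral {0..1} (k z))" by simp
  fix z v assume "z \<in> S"
  obtain e where e: "e > 0" "cball z e \<subseteq> S" using assms(1) \<open>z \<in> S\<close> open_contains_cball by blast
  define d where "d = e / 4"
  have d: "d > 0" "cball z (3 * d) \<subseteq> S" using e by (auto simp: d_def)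
  have "continuous_on (cball z (3 * d) \<times> {0..1}) (\<lambda>(z, s). k z s)"
    using assms(2) by (rule continuous_on_subset) (use d in auto)
  then have "compact ((\<lambda>(z, s). k z s) ` (cball z (3 * d) \<times> {0..1}))"
    by (intro compact_continuous_image compact_Times) auto
  then obtain B where "\<forall>y \<in> (\<lambda>(z, s). k z s) ` (cball z (3 * d) \<times> {0..1}). cmod y \<le> B"
    using compact_imp_bounded bounded_iff by metis
  then have B: "cmod (k y s) \<le> B" if "y \<in> cball z (3 * d)" "s \<in> {0..1}" for y s
    using that by force
  define D where "D y s = line_deriv (\<lambda>z. k z s) y v" for y s
  have est: "cmod (k (y + w) s - k y s - line_deriv (\<lambda>z. k z s) y w) \<le> 2 * B / d\<^sup>2 * (norm w)\<^sup>2"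
    if "y \<in> cball z d" "norm w \<le> d" "s \<in> {0..1}" for y w s
    using line_deriv_remainder_bound[OF assms(1) hol[OF that(3)] d(2,1) B that(1,2)] that(3) by simp
  obtain N where N: "norm v / d \<le> real N" using real_arch_simple by blast
  have vN: "norm ((1 / real (Suc (n + N))) *\<^sub>R v) \<le> d" for n
  proof -
    have "norm v \<le> d * real N" using N d by (simp add: pos_divide_le_eq mult.commute)
    also have "\<dots> \<le> d * real (Suc (n + N))" using d by (intro mult_left_mono) auto
    finally show ?thesis by (simp add: pos_divide_le_eq)
  qed
  have inS: "y + (1 / real (Suc (n + N))) *\<^sub>R v \<in> cball z (3 * d)" if "y \<in> cball z d" for y n
    using that vN[of n] d(1) norm_triangle_ineq4[of "z - y" "(1 / real (Suc (n + N))) *\<^sub>R v"]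
    by (simp add: dist_norm algebra_simps)
  let ?q = "\<lambda>n (y, s). (k (y + (1 / real (Suc (n + N))) *\<^sub>R v) s - k y s) * of_nat (Suc (n + N))"
  have contq: "continuous_on (cball z d \<times> {0..1}) (?q n)" for n
  proof -
    have "continuous_on (cball z d \<times> {0..1}) (\<lambda>p. (\<lambda>(z, s). k z s) (fst p + (1 / real (Suc (n + N))) *\<^sub>R v, snd p))"
      by (rule continuous_on_compose2[OF assms(2)])
        (use inS d in \<open>auto intro!: continuous_intros simp: subset_eq\<close>)
    moreover have "continuous_on (cball z d \<times> {0..1}) (\<lambda>(z, s). k z s)"
      using assms(2) by (rule continuous_on_subset) (use d in \<open>auto simp: subset_eq\<close>)
    ultimately show ?thesis by (auto simp: case_prod_beta intro!: continuous_intros)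
  qed
  have "uniform_limit (cball z d \<times> {0..1}) ?q (\<lambda>(y, s). D y s) sequentially"
  proof (rule uniform_limitI)
    fix \<epsilon> :: real assume "\<epsilon> > 0"
    have "(\<lambda>n. (2 * B / d\<^sup>2 * (norm v)\<^sup>2) / real (Suc (n + N))) \<longlonglongrightarrow> 0"
      using LIMSEQ_ignore_initial_segment[OF lim_const_over_n, of "2 * B / d\<^sup>2 * (norm v)\<^sup>2" "Suc N"] by simp
    then have "\<forall>\<^sub>F n in sequentially. (2 * B / d\<^sup>2 * (norm v)\<^sup>2) / real (Suc (n + N)) < \<epsilon>"
      using \<open>\<epsilon> > 0\<close> order_tendstoD(2) by blast
    then show "\<forall>\<^sub>F n in sequentially. \<forall>x\<in>cball z d \<times> {0..1}. dist (?q n x) ((\<lambda>(y, s). D y s) x) < \<epsilon>"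
    proof eventually_elim
      case (elim n)
      have "dist (?q n (y, s)) (D y s) < \<epsilon>" if ys: "y \<in> cball z d" "s \<in> {0..1}" for y s
      proof -
        let ?w = "(1 / real (Suc (n + N))) *\<^sub>R v"
        have yS: "y \<in> S" using ys(1) d by (auto simp: subset_eq)
        have "line_deriv (\<lambda>z. k z s) y ?w = D y s / of_nat (Suc (n + N))"
          unfolding D_def by (rule line_deriv_divide[OF assms(1) hol[OF ys(2)] yS])
        then have "(k (y + ?w) s - k y s) * of_nat (Suc (n + N)) - D y s
            = (k (y + ?w) s - k y s - line_deriv (\<lambda>z. k z s) y ?w) * of_nat (Suc (n + N))"
          by (simp add: algebra_simps del: of_nat_Suc of_nat_add)
        then have "cmod ((k (y + ?w) s - k y s) * of_nat (Suc (n + N)) - D y s)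
            = cmod (k (y + ?w) s - k y s - line_deriv (\<lambda>z. k z s) y ?w) * real (Suc (n + N))"
          by (simp only: norm_mult norm_of_nat)
        also have "\<dots> \<le> (2 * B / d\<^sup>2 * (norm ?w)\<^sup>2) * real (Suc (n + N))"
          by (intro mult_right_mono est[OF ys(1) vN ys(2)]) auto
        also have "\<dots> = (2 * B / d\<^sup>2 * (norm v)\<^sup>2) / real (Suc (n + N))"
          by (simp add: power2_eq_square del: of_nat_Suc)
        finally show ?thesis using elim by (simp add: dist_norm)
      qed
      then show ?case by auto
    qed
  qed
  then have contD: "continuous_on (cball z d \<times> {0..1}) (\<lambda>(y, s). D y s)"
    by (rule uniform_limit_theorem[rotated]) (use contq in auto)
  define r where "r = d / (norm v + 1)"
  have nv: "norm v + 1 > 0" by (simp add: add_nonneg_pos)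
  have r: "r > 0" using d nv by (simp add: r_def)
  have inball: "z + \<zeta> *s v \<in> cball z d" if "\<zeta> \<in> ball 0 r" for \<zeta> :: complex
  proof -
    have "cmod \<zeta> * norm v \<le> r * (norm v + 1)" using that r by (intro mult_mono) auto
    also have "\<dots> = d" using nv by (simp add: r_def)
    finally show ?thesis by (simp add: dist_norm norm_vector_scalar_mult)
  qed
  have "(\<lambda>\<zeta>. integral (cbox 0 1) (k (z + \<zeta> *s v))) holomorphic_on ball 0 r"
  proof (rule leibniz_rule_holomorphic[where fx="\<lambda>\<zeta> s. D (z + \<zeta> *s v) s"])
    fix \<zeta> :: complex and s :: real assume \<zeta>: "\<zeta> \<in> ball 0 r" and s: "s \<in> cbox 0 1"
    have S: "z + \<zeta> *s v \<in> S" using inball[OF \<zeta>] d by (auto simp: subset_eq)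
    have "(\<lambda>\<xi>. k ((z + \<zeta> *s v) + \<xi> *s v) s) field_differentiable at 0"
      using line_holomorphic_on_field_differentiable[OF assms(1) hol S] s by simp
    then have "((\<lambda>\<xi>. k ((z + \<zeta> *s v) + \<xi> *s v) s) has_field_derivative D (z + \<zeta> *s v) s) (at 0)"
      unfolding D_def line_deriv_def using DERIV_deriv_iff_field_differentiable by blast
    then have "((\<lambda>\<xi>. k (z + \<xi> *s v) s) has_field_derivative D (z + \<zeta> *s v) s) (at \<zeta>)"
      using DERIV_shift[of "\<lambda>\<xi>. k (z + \<xi> *s v) s" _ 0 \<zeta>]
      by (simp add: algebra_simps vector_sadd_rdistrib)
    then show "((\<lambda>\<xi>. k (z + \<xi> *s v) s) has_field_derivative D (z + \<zeta> *s v) s) (at \<zeta> within ball 0 r)"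
      by (rule has_field_derivative_at_within)
  next
    fix \<zeta> :: complex assume "\<zeta> \<in> ball 0 r"
    then have S: "z + \<zeta> *s v \<in> S" using inball[of \<zeta>] d by (auto simp: subset_eq)
    have "continuous_on {0..1} (\<lambda>s. (\<lambda>(z, s). k z s) (z + \<zeta> *s v, s))"
      by (rule continuous_on_compose2[OF assms(2)]) (use S in \<open>auto intro!: continuous_intros\<close>)
    then show "k (z + \<zeta> *s v) integrable_on cbox 0 1" by (simp add: integrable_continuous_interval)
  next
    have "continuous_on (ball 0 r \<times> cbox 0 1) (\<lambda>p. (\<lambda>(y, s). D y s) (z + fst p *s v, snd p))"
      by (rule continuous_on_compose2[OF contD])
        (use inball in \<open>auto intro!: continuous_intros continuous_on_compose2[OF continuous_on_complex_line[of UNIV]]\<close>)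
    then show "continuous_on (ball 0 r \<times> cbox 0 1) (\<lambda>(\<zeta>, s). D (z + \<zeta> *s v) s)"
      by (simp add: case_prod_beta)
  qed auto
  then show "(\<lambda>\<zeta>. integral {0..1} (k (z + \<zeta> *s v))) field_differentiable at 0"
    using holomorphic_on_imp_differentiable_at[OF _ open_ball] r by simp
qed

subsection \<open>Holomorphic maps\<close>

text \<open>Differentiability at each point suffices: on complex lines it yields holomorphic functions of one
  variable, so that smoothness is automatic.\<close>

lemma complex_differentiable_line_holomorphic:
  assumes "open S" "\<And>z. z \<in> S \<Longrightarrow> \<exists>L. (f has_derivative L) (at z) \<and> (\<forall>a v. L (a *s v) = a * L v)"
  shows "line_holomorphic_on S f"
proof (rule line_holomorphic_onI[OF assms(1)])
  show "continuous_on S f"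
  proof (intro continuous_at_imp_continuous_on ballI)
    fix z assume "z \<in> S"
    then obtain L where "(f has_derivative L) (at z)" using assms(2) by blast
    then show "isCont f z" by (rule has_derivative_continuous)
  qed
  fix z v assume "z \<in> S"
  then obtain L where L: "(f has_derivative L) (at z)" "\<And>a v. L (a *s v) = a * L v" using assms(2) by blast
  have "((\<lambda>\<zeta>. z + \<zeta> *s v) has_derivative (\<lambda>\<zeta>. \<zeta> *s v)) (at 0)"
    using bounded_linear.has_derivative[OF bounded_linear_scalar_mult_left has_derivative_ident]
    by (auto intro!: derivative_eq_intros)
  moreover have "(f has_derivative L) (at (z + 0 *s v))" using L by simp
  ultimately have "((\<lambda>\<zeta>. f (z + \<zeta> *s v)) has_derivative (\<lambda>\<zeta>. L (\<zeta> *s v))) (at 0)"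
    by (rule has_derivative_compose)
  then have "((\<lambda>\<zeta>. f (z + \<zeta> *s v)) has_field_derivative L v) (at 0)"
    unfolding has_field_derivative_def L(2) by (simp only: mult_commute_abs)
  then show "(\<lambda>\<zeta>. f (z + \<zeta> *s v)) field_differentiable at 0" by (auto simp: field_differentiable_def)
qed

lemma holomorphic_map_onI_nth:
  fixes f :: "complex^'n::finite \<Rightarrow> complex^'m::finite"
  assumes "open S" "\<And>i. line_holomorphic_on S (\<lambda>z. f z $ i)"
  shows "holomorphic_map_on S f"
proof -
  have sm: "smooth_on S f" using assms line_holomorphic_on_smooth by (blast intro: smooth_on_vec)
  have "FD f z (a *s v) = a *s FD f z v" if "z \<in> S" for z a v
  proof (rule vec_eq_iff[THEN iffD2], intro allI)
    fix i
    have "((\<lambda>z. f z $ i) has_derivative (\<lambda>v. FD f z v $ i)) (at z)"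
      using bounded_linear.has_derivative[OF bounded_linear_vec_nth smooth_on_has_derivative[OF sm that]] .
    then have "(\<lambda>v. FD f z v $ i) = line_deriv (\<lambda>z. f z $ i) z"
      using line_holomorphic_on_has_derivative[OF assms(1) assms(2) that] has_derivative_unique by blast
    then show "FD f z (a *s v) $ i = (a *s FD f z v) $ i"
      using line_deriv_scalar_mult[OF assms(1) assms(2)[of i] that, of a v] by (metis vector_smult_component)
  qed
  then show ?thesis using sm by (simp add: holomorphic_map_on_def)
qed

lemma holomorphic_map_onI:
  fixes f :: "complex^'n::finite \<Rightarrow> complex^'m::finite"
  assumes "open S" "\<And>z. z \<in> S \<Longrightarrow> \<exists>L. (f has_derivative L) (at z) \<and> (\<forall>a v. L (a *s v) = a *s L v)"
  shows "holomorphic_map_on S f"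
proof (rule holomorphic_map_onI_nth[OF assms(1)], rule complex_differentiable_line_holomorphic[OF assms(1)])
  fix i z assume "z \<in> S"
  then obtain L where L: "(f has_derivative L) (at z)" "\<forall>a v. L (a *s v) = a *s L v" using assms(2) by blast
  have "((\<lambda>z. f z $ i) has_derivative (\<lambda>v. L v $ i)) (at z)"
    using bounded_linear.has_derivative[OF bounded_linear_vec_nth L(1)] .
  then show "\<exists>L. ((\<lambda>z. f z $ i) has_derivative L) (at z) \<and> (\<forall>a v. L (a *s v) = a * L v)" using L(2) by auto
qed

lemma holomorphic_map_on_smooth: "holomorphic_map_on S f \<Longrightarrow> smooth_on S f"
  by (simp add: holomorphic_map_on_def)

lemma holomorphic_map_on_has_derivative:
  "holomorphic_map_on S f \<Longrightarrow> z \<in> S \<Longrightarrow> (f has_derivative FD f z) (at z)"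
  using holomorphic_map_on_smooth smooth_on_has_derivative by blast

lemma holomorphic_map_on_scalar_mult:
  "holomorphic_map_on S f \<Longrightarrow> z \<in> S \<Longrightarrow> FD f z (a *s v) = a *s FD f z v"
  by (simp add: holomorphic_map_on_def)

lemma holomorphic_map_on_nth:
  fixes f :: "complex^'n::finite \<Rightarrow> complex^'m::finite"
  assumes "open S" "holomorphic_map_on S f"
  shows "line_holomorphic_on S (\<lambda>z. f z $ i)"
proof (rule complex_differentiable_line_holomorphic[OF assms(1)])
  fix z assume "z \<in> S"
  then have "((\<lambda>z. f z $ i) has_derivative (\<lambda>v. FD f z v $ i)) (at z)"
    using bounded_linear.has_derivative[OF bounded_linear_vec_nth holomorphic_map_on_has_derivative[OF assms(2)]] by blast
  then show "\<exists>L. ((\<lambda>z. f z $ i) has_derivative L) (at z) \<and> (\<forall>a v. L (a *s v) = a * L v)"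
    using holomorphic_map_on_scalar_mult[OF assms(2) \<open>z \<in> S\<close>] by (intro exI[of _ "\<lambda>v. FD f z v $ i"]) auto
qed

lemma holomorphic_map_on_compose:
  fixes f :: "complex^'n::finite \<Rightarrow> complex^'m::finite" and g :: "complex^'m \<Rightarrow> complex^'k::finite"
  assumes "open S" "f ` S \<subseteq> T" "holomorphic_map_on S f" "holomorphic_map_on T g"
  shows "holomorphic_map_on S (g \<circ> f)"
proof (rule holomorphic_map_onI[OF assms(1)])
  fix z assume z: "z \<in> S"
  then have fz: "f z \<in> T" using assms(2) by blast
  have "((g \<circ> f) has_derivative (FD g (f z) \<circ> FD f z)) (at z)"
    using diff_chain_at[OF holomorphic_map_on_has_derivative[OF assms(3) z] holomorphic_map_on_has_derivative[OF assms(4) fz]] .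
  then show "\<exists>L. ((g \<circ> f) has_derivative L) (at z) \<and> (\<forall>a v. L (a *s v) = a *s L v)"
    using holomorphic_map_on_scalar_mult[OF assms(3) z] holomorphic_map_on_scalar_mult[OF assms(4) fz]
    by (intro exI[of _ "FD g (f z) \<circ> FD f z"]) (simp del: o_apply add: o_def)
qed

lemma holomorphic_map_on_subset: "holomorphic_map_on S f \<Longrightarrow> T \<subseteq> S \<Longrightarrow> holomorphic_map_on T f"
  unfolding holomorphic_map_on_def using smooth_on_subset by blast

lemma holomorphic_map_on_cong:
  fixes f :: "complex^'n::finite \<Rightarrow> complex^'m::finite"
  assumes "open S" "\<And>z. z \<in> S \<Longrightarrow> f z = g z" "holomorphic_map_on S f"
  shows "holomorphic_map_on S g"
proof (rule holomorphic_map_onI[OF assms(1)])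
  fix z assume z: "z \<in> S"
  have "(g has_derivative FD f z) (at z)"
    using has_derivative_transform_within_open[OF holomorphic_map_on_has_derivative[OF assms(3) z] assms(1) z assms(2)] by simp
  then show "\<exists>L. (g has_derivative L) (at z) \<and> (\<forall>a v. L (a *s v) = a *s L v)"
    using holomorphic_map_on_scalar_mult[OF assms(3) z] by blast
qed

subsection \<open>Composition and linear algebra of holomorphic maps\<close>

lemma line_holomorphic_on_const: "line_holomorphic_on S (\<lambda>z. c)"
  by (auto simp: line_holomorphic_on_def)

lemma line_holomorphic_on_add:
  "line_holomorphic_on S f \<Longrightarrow> line_holomorphic_on S g \<Longrightarrow> line_holomorphic_on S (\<lambda>z. f z + g z)"
  unfolding line_holomorphic_on_def by (auto intro: continuous_intros holomorphic_intros)

lemma line_holomorphic_on_mult: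
  "line_holomorphic_on S f \<Longrightarrow> line_holomorphic_on S g \<Longrightarrow> line_holomorphic_on S (\<lambda>z. f z * g z)"
  unfolding line_holomorphic_on_def by (auto intro: continuous_intros holomorphic_intros)

lemma line_holomorphic_on_inverse:
  "line_holomorphic_on S f \<Longrightarrow> (\<And>z. z \<in> S \<Longrightarrow> f z \<noteq> 0) \<Longrightarrow> line_holomorphic_on S (\<lambda>z. inverse (f z))"
  unfolding line_holomorphic_on_def by (auto intro: continuous_intros holomorphic_intros)

lemma line_holomorphic_on_sum:
  "(\<And>i. i \<in> I \<Longrightarrow> line_holomorphic_on S (f i)) \<Longrightarrow> line_holomorphic_on S (\<lambda>z. \<Sum>i\<in>I. f i z)"
  by (induction I rule: infinite_finite_induct)
    (auto intro: line_holomorphic_on_add line_holomorphic_on_const)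

lemma line_holomorphic_on_prod:
  "(\<And>i. i \<in> I \<Longrightarrow> line_holomorphic_on S (f i)) \<Longrightarrow> line_holomorphic_on S (\<lambda>z. \<Prod>i\<in>I. f i z)"
  by (induction I rule: infinite_finite_induct)
    (auto intro: line_holomorphic_on_mult line_holomorphic_on_const)

lemma line_holomorphic_on_cong:
  assumes "\<And>z. z \<in> S \<Longrightarrow> f z = g z" "line_holomorphic_on S f"
  shows "line_holomorphic_on S g"
  unfolding line_holomorphic_on_def
proof (intro conjI allI)
  show "continuous_on S g"
    using assms continuous_on_cong[of S S f g] by (simp add: line_holomorphic_on_def)
  fix z v
  have "(\<lambda>\<zeta>. f (z + \<zeta> *s v)) holomorphic_on {\<zeta>. z + \<zeta> *s v \<in> S}"
    using assms(2) by (simp add: line_holomorphic_on_def)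
  then show "(\<lambda>\<zeta>. g (z + \<zeta> *s v)) holomorphic_on {\<zeta>. z + \<zeta> *s v \<in> S}"
    by (rule holomorphic_transform) (simp add: assms(1))
qed

lemma line_holomorphic_on_compose:
  fixes g :: "complex^'m::finite \<Rightarrow> complex^'n::finite"
  assumes "open S" "open T" "holomorphic_map_on S g" "g ` S \<subseteq> T" "line_holomorphic_on T f"
  shows "line_holomorphic_on S (\<lambda>z. f (g z))"
proof (rule complex_differentiable_line_holomorphic[OF assms(1)])
  fix z assume z: "z \<in> S"
  then have gz: "g z \<in> T" using assms(4) by blast
  have "((\<lambda>z. f (g z)) has_derivative (\<lambda>v. line_deriv f (g z) (FD g z v))) (at z)"
    by (rule has_derivative_compose[OF holomorphic_map_on_has_derivative[OF assms(3) z]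
          line_holomorphic_on_has_derivative[OF assms(2,5) gz]])
  then show "\<exists>L. ((\<lambda>z. f (g z)) has_derivative L) (at z) \<and> (\<forall>a v. L (a *s v) = a * L v)"
    using line_deriv_scalar_mult[OF assms(2,5) gz] holomorphic_map_on_scalar_mult[OF assms(3) z]
    by (intro exI[of _ "\<lambda>v. line_deriv f (g z) (FD g z v)"]) simp
qed

lemma matrix_vector_mult_scaleR: "M *v (r *\<^sub>R v) = r *\<^sub>R (M *v v)" for M :: "complex^'n::finite^'m::finite"
  by (rule linear_cmul[OF matrix_vector_mul_linear])

lemma scaleR_matrix_vector: "(r *\<^sub>R M) *v v = r *\<^sub>R (M *v v)" for M :: "complex^'n::finite^'m::finite"
  by (simp add: matrix_vector_mult_def vec_eq_iff scaleR_sum_right)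

lemma bounded_bilinear_matrix_vector:
  "bounded_bilinear ((*v) :: complex^'n::finite^'m::finite \<Rightarrow> complex^'n \<Rightarrow> complex^'m)"
proof
  fix M M' :: "complex^'n^'m" and v v' :: "complex^'n" and r :: real
  show "(M + M') *v v = M *v v + M' *v v" by (rule matrix_vector_mult_add_rdistrib)
  show "M *v (v + v') = M *v v + M *v v'" by (rule matrix_vector_right_distrib)
  show "(r *\<^sub>R M) *v v = r *\<^sub>R (M *v v)" by (rule scaleR_matrix_vector)
  show "M *v (r *\<^sub>R v) = r *\<^sub>R (M *v v)" by (rule matrix_vector_mult_scaleR)
  show "\<exists>K. \<forall>(M::complex^'n^'m) v. norm (M *v v) \<le> norm M * norm v * K"
  proof (intro exI allI)
    fix M :: "complex^'n^'m" and v :: "complex^'n"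
    have entry: "cmod (M $ i $ j) \<le> norm M" for i j
      using Finite_Cartesian_Product.norm_nth_le[of "M $ i" j] Finite_Cartesian_Product.norm_nth_le[of M i] by linarith
    have "norm (M *v v) \<le> (\<Sum>i\<in>UNIV. cmod ((M *v v) $ i))"
      by (simp add: norm_vec_def L2_set_le_sum)
    also have "\<dots> \<le> (\<Sum>i\<in>(UNIV::'m set). \<Sum>j\<in>(UNIV::'n set). norm M * norm v)"
    proof (rule sum_mono)
      fix i
      have "cmod ((M *v v) $ i) \<le> (\<Sum>j\<in>UNIV. cmod (M $ i $ j * v $ j))"
        unfolding matrix_vector_mult_def by (simp add: norm_sum)
      also have "\<dots> \<le> (\<Sum>j\<in>(UNIV::'n set). norm M * norm v)"
        using entry by (intro sum_mono) (auto simp: norm_mult intro!: mult_mono Finite_Cartesian_Product.norm_nth_le)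
      finally show "cmod ((M *v v) $ i) \<le> (\<Sum>j\<in>(UNIV::'n set). norm M * norm v)" .
    qed
    also have "\<dots> = norm M * norm v * (real CARD('n) * real CARD('m))" by (simp add: mult.assoc mult.left_commute)
    finally show "norm (M *v v) \<le> norm M * norm v * (real CARD('n) * real CARD('m))" .
  qed
qed

lemma FD_matrix_vector:
  fixes A :: "'a::real_normed_vector \<Rightarrow> complex^'n::finite^'m::finite"
  assumes "A differentiable (at z)"
  shows "FD (\<lambda>y. A y *v b) z w = FD A z w *v b"
  using FD_bounded_linear[OF bounded_bilinear.bounded_linear_left[OF bounded_bilinear_matrix_vector] assms] .

lemma smooth_on_matrix_entries:
  fixes A :: "complex^'k::finite \<Rightarrow> complex^'n::finite^'m::finite"
  assumes "open V" "\<And>i j. line_holomorphic_on V (\<lambda>z. A z $ i $ j)"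
  shows "smooth_on V A"
  by (intro smooth_on_vec assms line_holomorphic_on_smooth)

text \<open>The partial derivatives are finitely many continuous functions.\<close>

lemma FD_bound_on_compact:
  fixes f :: "'a::euclidean_space \<Rightarrow> 'b::real_normed_vector"
  assumes "smooth_on V f" "compact K" "K \<subseteq> V"
  obtains B where "B \<ge> 0" "\<And>z w. z \<in> K \<Longrightarrow> norm (FD f z w) \<le> B * norm w"
proof -
  have "\<exists>B. \<forall>z\<in>K. norm (FD f z b) \<le> B" for b
  proof -
    have "continuous_on K (\<lambda>z. FD f z b)"
      using smooth_on_continuous_on[OF smooth_on_FD[OF assms(1)]] assms(3) continuous_on_subset by blast
    then have "compact ((\<lambda>z. FD f z b) ` K)" using assms(2) compact_continuous_image by blast
    then have "bounded ((\<lambda>z. FD f z b) ` K)" by (rule compact_imp_bounded)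
    then show ?thesis by (auto simp: bounded_iff)
  qed
  then obtain Bb where Bb: "\<And>b z. z \<in> K \<Longrightarrow> norm (FD f z b) \<le> Bb b" by metis
  show ?thesis
  proof
    show "0 \<le> (\<Sum>b\<in>Basis. \<bar>Bb b\<bar>)" by (intro sum_nonneg) auto
    fix z w assume z: "z \<in> K"
    have lin: "linear (FD f z)"
      using has_derivative_linear[OF smooth_on_has_derivative[OF assms(1)]] z assms(3) by blast
    have "FD f z w = FD f z (\<Sum>b\<in>Basis. (w \<bullet> b) *\<^sub>R b)" by (simp add: euclidean_representation)
    also have "\<dots> = (\<Sum>b\<in>Basis. (w \<bullet> b) *\<^sub>R FD f z b)" using lin by (simp add: linear_sum linear_cmul)
    finally have "norm (FD f z w) \<le> (\<Sum>b\<in>Basis. norm ((w \<bullet> b) *\<^sub>R FD f z b))" by (simp only: norm_sum)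
    also have "\<dots> \<le> (\<Sum>b\<in>Basis. norm w * \<bar>Bb b\<bar>)"
    proof (rule sum_mono)
      fix b :: 'a assume "b \<in> Basis"
      then show "norm ((w \<bullet> b) *\<^sub>R FD f z b) \<le> norm w * \<bar>Bb b\<bar>"
        using Basis_le_norm[of b w] Bb[OF z, of b] by (auto intro!: mult_mono)
    qed
    finally show "norm (FD f z w) \<le> (\<Sum>b\<in>Basis. \<bar>Bb b\<bar>) * norm w" by (simp add: sum_distrib_left mult.commute)
  qed
qed

text \<open>With the direction expanded in a basis this is the product rule.\<close>

lemma FD_apply_has_derivative:
  fixes f :: "'a::euclidean_space \<Rightarrow> 'b::real_normed_vector"
  assumes "smooth_on S f" "x \<in> S" "open S" "(g has_derivative g') (at x)"
  shows "((\<lambda>y. FD f y (g y)) has_derivative (\<lambda>w. FD (\<lambda>y. FD f y (g x)) x w + FD f x (g' w))) (at x)"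
proof -
  have lin: "linear (FD f y)" if "y \<in> S" for y
    using has_derivative_linear[OF smooth_on_has_derivative[OF assms(1) that]] .
  have expand: "FD f y v = (\<Sum>b\<in>Basis. (v \<bullet> b) *\<^sub>R FD f y b)" if "y \<in> S" for y v
  proof -
    have "FD f y v = FD f y (\<Sum>b\<in>Basis. (v \<bullet> b) *\<^sub>R b)" by (simp add: euclidean_representation)
    also have "\<dots> = (\<Sum>b\<in>Basis. (v \<bullet> b) *\<^sub>R FD f y b)" using lin[OF that] by (simp add: linear_sum linear_cmul)
    finally show ?thesis .
  qed
  have db: "((\<lambda>y. FD f y b) has_derivative FD (\<lambda>y. FD f y b) x) (at x)" for b
    by (rule smooth_on_has_derivative[OF smooth_on_FD[OF assms(1)] assms(2)])
  have "((\<lambda>y. \<Sum>b\<in>Basis. (g y \<bullet> b) *\<^sub>R FD f y b) has_derivative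
      (\<lambda>w. \<Sum>b\<in>Basis. (g x \<bullet> b) *\<^sub>R FD (\<lambda>y. FD f y b) x w + (g' w \<bullet> b) *\<^sub>R FD f x b)) (at x)"
    by (intro has_derivative_sum has_derivative_scaleR db bounded_linear.has_derivative[OF bounded_linear_inner_left assms(4)])
  then have 1: "((\<lambda>y. FD f y (g y)) has_derivative
      (\<lambda>w. \<Sum>b\<in>Basis. (g x \<bullet> b) *\<^sub>R FD (\<lambda>y. FD f y b) x w + (g' w \<bullet> b) *\<^sub>R FD f x b)) (at x)"
    by (rule has_derivative_transform_within_open[OF _ assms(3,2)]) (simp add: expand[symmetric])
  have "((\<lambda>y. \<Sum>b\<in>Basis. (g x \<bullet> b) *\<^sub>R FD f y b) has_derivative
      (\<lambda>w. \<Sum>b\<in>Basis. (g x \<bullet> b) *\<^sub>R FD (\<lambda>y. FD f y b) x w)) (at x)"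
    by (intro has_derivative_sum has_derivative_scaleR_right db)
  then have "((\<lambda>y. FD f y (g x)) has_derivative
      (\<lambda>w. \<Sum>b\<in>Basis. (g x \<bullet> b) *\<^sub>R FD (\<lambda>y. FD f y b) x w)) (at x)"
    by (rule has_derivative_transform_within_open[OF _ assms(3,2)]) (simp add: expand[symmetric])
  then have 2: "FD (\<lambda>y. FD f y (g x)) x w = (\<Sum>b\<in>Basis. (g x \<bullet> b) *\<^sub>R FD (\<lambda>y. FD f y b) x w)" for w
    by (rule fun_cong[OF FD_eqI])
  show ?thesis using 1 unfolding 2 expand[OF assms(2), of "g' _"] sum.distrib .
qed

text \<open>The real inverse function theorem provides the local inverse. Its derivative is the inverse
  of a complex linear map, hence complex linear.\<close>

lemma holomorphic_inverse_function:
  fixes f :: "complex^'n::finite \<Rightarrow> complex^'n"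
  assumes "open S" "x0 \<in> S" "holomorphic_map_on S f" "\<And>v. FD f x0 v = v"
  obtains U V g where "open U" "x0 \<in> U" "U \<subseteq> S" "open V" "homeomorphism U V f g"
    "holomorphic_map_on V g" "\<And>x v. x \<in> U \<Longrightarrow> FD g (f x) (FD f x v) = v"
    "\<And>x v. x \<in> U \<Longrightarrow> FD f x (FD g (f x) v) = v"
proof -
  have sm: "smooth_on S f" using assms(3) by (rule holomorphic_map_on_smooth)
  define f' where "f' x = Blinfun (FD f x)" for x
  have f': "blinfun_apply (f' x) = FD f x" if "x \<in> S" for x
    unfolding f'_def by (rule bounded_linear_Blinfun_apply)
      (use smooth_on_has_derivative[OF sm that] in \<open>auto simp: has_derivative_def\<close>)
  have cont: "continuous_on S f'"
  proof (rule continuous_on_blinfun_componentwise)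
    fix i :: "complex^'n"
    have "continuous_on S (\<lambda>x. FD f x i)" by (rule smooth_on_continuous_on[OF smooth_on_FD[OF sm]])
    then show "continuous_on S (\<lambda>x. blinfun_apply (f' x) i)" using f' by (simp cong: continuous_on_cong)
  qed
  have id: "id_blinfun o\<^sub>L f' x0 = id_blinfun"
    using f'[OF assms(2)] assms(4) by (intro blinfun_eqI) simp
  have df: "(f has_derivative blinfun_apply (f' x)) (at x)" if "x \<in> S" for x
    using smooth_on_has_derivative[OF sm that] f'[OF that] by simp
  obtain U V g g' where U: "open U" "U \<subseteq> S" "x0 \<in> U" "open V" "homeomorphism U V f g"
    and dg: "\<And>y. y \<in> V \<Longrightarrow> (g has_derivative (g' y)) (at y)"
    and g': "\<And>y. y \<in> V \<Longrightarrow> g' y = inv (blinfun_apply (f'(g y)))"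
    and bij: "\<And>y. y \<in> V \<Longrightarrow> bij (blinfun_apply (f'(g y)))"
    by (rule inverse_function_theorem[OF assms(1) df cont assms(2) id]) (assumption, erule that, assumption+)
  have gV: "g y \<in> U" "f (g y) = y" if "y \<in> V" for y
    using U(5) that by (auto simp: homeomorphism_def)
  have fU: "f x \<in> V" "g (f x) = x" if "x \<in> U" for x
    using U(5) that by (auto simp: homeomorphism_def)
  have FDg: "FD g y = inv (FD f (g y))" "bij (FD f (g y))" if "y \<in> V" for y
    using FD_eqI[OF dg[OF that]] g'[OF that] bij[OF that] f' gV(1)[OF that] U(2) by auto
  have "holomorphic_map_on V g"
  proof (rule holomorphic_map_onI[OF U(4)])
    fix y assume y: "y \<in> V"
    have "g' y (a *s v) = a *s g' y v" for a v
    proof -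
      have gy: "g y \<in> S" using gV y U(2) by blast
      have g'y: "g' y = inv (FD f (g y))" using g'[OF y] f' gV(1)[OF y] U(2) by auto
      have r: "FD f (g y) (inv (FD f (g y)) w) = w" for w
        by (rule surj_f_inv_f[OF bij_is_surj[OF FDg(2)[OF y]]])
      have "FD f (g y) (g' y (a *s v)) = FD f (g y) (a *s g' y v)"
        unfolding g'y holomorphic_map_on_scalar_mult[OF assms(3) gy] r ..
      then show ?thesis using injD[OF bij_is_inj[OF FDg(2)[OF y]]] by simp
    qed
    then show "\<exists>L. (g has_derivative L) (at y) \<and> (\<forall>a v. L (a *s v) = a *s L v)" using dg[OF y] by blast
  qed
  moreover have "FD g (f x) (FD f x v) = v" "FD f x (FD g (f x) v) = v" if "x \<in> U" for x v
    using FDg[OF fU(1)[OF that]] fU(2)[OF that] by (auto simp: bij_is_inj bij_is_surj surj_f_inv_f)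
  ultimately show ?thesis using that U by blast
qed

text \<open>At a point of the unit interval where \<open>norm h\<close> is maximal, the mean value
  inequality bounds the maximum by half of itself.\<close>

lemma homogeneous_linear_ode_zero:
  fixes h :: "real \<Rightarrow> 'a::real_normed_vector"
  assumes "\<And>s. s \<in> {0..1} \<Longrightarrow> (h has_vector_derivative h' s) (at s within {0..1})"
    "\<And>s. s \<in> {0..1} \<Longrightarrow> norm (h' s) \<le> norm (h s) / 2" "h 0 = 0" "s \<in> {0..1}"
  shows "h s = 0"
proof -
  have cont: "continuous_on {0..1} (\<lambda>s. norm (h s))"
    unfolding continuous_on_eq_continuous_within
    by (intro ballI continuous_norm has_vector_derivative_continuous[OF assms(1)])
  obtain m where m: "m \<in> {0..1}" "\<And>s. s \<in> {0..1} \<Longrightarrow> norm (h s) \<le> norm (h m)"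
    using continuous_attains_sup[OF _ _ cont] by auto
  have "norm (h m - h 0) \<le> norm (h m) / 2 * norm (m - 0)"
  proof (rule differentiable_bound[where f'="\<lambda>s t. t *\<^sub>R h' s" and S="{0..1}"])
    show "(h has_derivative (\<lambda>t. t *\<^sub>R h' s)) (at s within {0..1})" if "s \<in> {0..1}" for s
      using assms(1)[OF that] by (simp add: has_vector_derivative_def)
    show "onorm (\<lambda>t. t *\<^sub>R h' s) \<le> norm (h m) / 2" if "s \<in> {0..1}" for s
    proof (rule onorm_bound)
      fix t :: real
      have "norm (h' s) \<le> norm (h m) / 2" using assms(2)[OF that] m(2)[OF that] by linarith
      from mult_left_mono[OF this, of "\<bar>t\<bar>"]
      show "norm (t *\<^sub>R h' s) \<le> norm (h m) / 2 * norm t" by (simp add: mult.commute)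
    qed auto
  qed (use m in auto)
  also have "\<dots> \<le> norm (h m) / 2 * 1" using m(1) by (intro mult_left_mono) auto
  finally have "h m = 0" using assms(3) by simp
  then show ?thesis using m(2)[OF assms(4)] by simp
qed

section \<open>The holomorphic Frobenius theorem\<close>

text \<open>The bundle is spanned near \<open>z0\<close> by the vector fields \<open>A _ *v w\<close>, where \<open>A z\<close> is the
  parametrization of its fibre over \<open>z\<close> by the range of the fixed projection \<open>P\<close>. As \<open>P\<close> maps these fields to constant
  ones, involutivity means that they commute. Integral leaves are found by integrating along rays
  in the range of \<open>P\<close>.\<close>

locale commuting_frame =
  fixes V :: "(complex^'n::finite) set" and z0 :: "complex^'n"
    and A :: "complex^'n \<Rightarrow> complex^'n^'n" and P :: "complex^'n^'n"
  assumes open_V: "open V" and z0: "z0 \<in> V"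
    and hol: "line_holomorphic_on V (\<lambda>z. A z $ i $ j)"
    and PP: "P *v (P *v v) = P *v v"
    and PA: "z \<in> V \<Longrightarrow> P *v (A z *v v) = P *v v"
    and AP: "z \<in> V \<Longrightarrow> A z *v (P *v v) = A z *v v"
    and A_z0: "A z0 = P"
    and comm: "z \<in> V \<Longrightarrow> FD A z (A z *v a) *v b = FD A z (A z *v b) *v a"
begin

definition tube :: "real \<Rightarrow> (complex^'n) set" where
  "tube e = {x. norm (P *v x) < e \<and> norm (x - P *v x) < e}"

text \<open>The part of \<open>x\<close> in the range of \<open>P\<close> is scaled, the part in the
  kernel is kept. The ray leads from the transversal given by the kernel to \<open>x\<close>.\<close>

definition ray :: "real \<Rightarrow> complex^'n \<Rightarrow> complex^'n" where
  "ray s x = s *\<^sub>R (P *v x) + (x - P *v x)"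

lemma smooth_A: "smooth_on V A"
  by (rule smooth_on_matrix_entries[OF open_V hol])

lemma bounded_linear_P: "bounded_linear ((*v) P)"
  by (rule bounded_bilinear.bounded_linear_right[OF bounded_bilinear_matrix_vector])

lemma continuous_P: "continuous_on S g \<Longrightarrow> continuous_on S (\<lambda>x. P *v g x)"
  by (rule bounded_linear.continuous_on[OF bounded_linear_P])

lemma open_tube: "open (tube e)"
proof -
  have "open {x. norm (P *v x) < e}" "open {x. norm (x - P *v x) < e}"
    by (intro open_Collect_less continuous_intros continuous_P)+
  moreover have "tube e = {x. norm (P *v x) < e} \<inter> {x. norm (x - P *v x) < e}"
    by (auto simp: tube_def)
  ultimately show ?thesis by auto
qed

lemma P_ray: "P *v ray s x = s *\<^sub>R (P *v x)"
  by (simp add: ray_def matrix_vector_right_distrib matrix_vector_mult_scaleR matrix_vector_mult_diff_distrib PP)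

lemma ray_minus: "ray s x - P *v ray s x = x - P *v x"
  unfolding P_ray by (simp add: ray_def)

lemma ray_tube: "x \<in> tube e \<Longrightarrow> s \<in> {0..1} \<Longrightarrow> ray s x \<in> tube e"
  using mult_right_mono[of s 1 "norm (P *v x)"] by (auto simp: tube_def ray_minus[unfolded P_ray] P_ray)

lemma ray_ray: "ray s (ray t x) = ray (s * t) x"
  unfolding ray_def[of s "ray t x"] P_ray by (simp add: ray_def)

lemma ray_1: "ray 1 x = x" by (simp add: ray_def)

lemma A_ray: "z \<in> V \<Longrightarrow> A z *v ray s x = s *\<^sub>R (A z *v x)"
  by (simp add: ray_def matrix_vector_right_distrib matrix_vector_mult_scaleR
      matrix_vector_mult_diff_distrib AP)

lemma holomorphic_ray: "open S \<Longrightarrow> holomorphic_map_on S (ray s)"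
proof (rule holomorphic_map_onI)
  fix z
  have "bounded_linear (ray s)" unfolding ray_def
    by (intro bounded_linear_add bounded_linear_sub bounded_linear_ident bounded_linear_P
        bounded_linear_scaleR_right[THEN bounded_linear_compose])
  then have "(ray s has_derivative ray s) (at z)" by (rule bounded_linear_imp_has_derivative)
  moreover have "ray s (a *s v) = a *s ray s v" for a v
    by (simp add: ray_def vector_scalar_commute vec_eq_iff algebra_simps)
  ultimately show "\<exists>L. (ray s has_derivative L) (at z) \<and> (\<forall>a v. L (a *s v) = a *s L v)" by blast
qed

lemma has_vector_derivative_ray: "((\<lambda>s. ray s x) has_vector_derivative (P *v x)) (at s within T)"
  unfolding ray_def by (auto intro!: derivative_eq_intros)

text \<open>A fixed point \<open>Y\<close> satisfies \<open>d/ds Y (ray s x) = A (Y (ray s x)) x\<close>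
  and starts at \<open>z0 + x - P x\<close> for \<open>s = 0\<close>. So it maps each slice parallel to
  the range of \<open>P\<close> into the leaf through a point of the transversal.\<close>

definition leaf_integral :: "(complex^'n \<Rightarrow> complex^'n) \<Rightarrow> complex^'n \<Rightarrow> complex^'n" where
  "leaf_integral Y x = z0 + (x - P *v x) + integral {0..1} (\<lambda>s. A (Y (ray s x)) *v x)"

lemma continuous_integrand:
  assumes "continuous_on (tube e) Y" "Y ` tube e \<subseteq> V"
  shows "continuous_on (tube e \<times> {0..1}) (\<lambda>(x, s). A (Y (ray s x)) *v x)"
proof -
  have "continuous_on (tube e \<times> {0..1}) (\<lambda>p. ray (snd p) (fst p))"
    unfolding ray_def by (intro continuous_intros continuous_P)
  then have "continuous_on (tube e \<times> {0..1}) (\<lambda>p. Y (ray (snd p) (fst p)))"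
    by (rule continuous_on_compose2[OF assms(1)]) (use ray_tube in auto)
  then have "continuous_on (tube e \<times> {0..1}) (\<lambda>p. A (Y (ray (snd p) (fst p))))"
    by (rule continuous_on_compose2[OF smooth_on_continuous_on[OF smooth_A]]) (use ray_tube assms(2) in force)
  then show ?thesis
    unfolding case_prod_beta
    by (intro bounded_bilinear.continuous_on[OF bounded_bilinear_matrix_vector] continuous_intros)
qed

lemma continuous_integrand':
  assumes "continuous_on (tube e) Y" "Y ` tube e \<subseteq> V" "x \<in> tube e"
  shows "continuous_on {0..1} (\<lambda>s. A (Y (ray s x)) *v x)"
proof -
  have "continuous_on {0..1} (\<lambda>s. (\<lambda>(x, s). A (Y (ray s x)) *v x) (x, s))"
    by (rule continuous_on_compose2[OF continuous_integrand[OF assms(1,2)]])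
      (use assms(3) in \<open>auto intro!: continuous_intros\<close>)
  then show ?thesis by simp
qed

lemma leaf_integral_holomorphic:
  assumes "holomorphic_map_on (tube e) Y" "Y ` tube e \<subseteq> V"
  shows "holomorphic_map_on (tube e) (leaf_integral Y)"
proof (rule holomorphic_map_onI_nth[OF open_tube])
  fix i
  have cY: "continuous_on (tube e) Y" using assms(1) by (intro smooth_on_continuous_on holomorphic_map_on_smooth)
  let ?k = "\<lambda>x s. (A (Y (ray s x)) *v x) $ i"
  have eq: "leaf_integral Y x $ i = (z0 $ i + (x $ i - (P *v x) $ i)) + integral {0..1} (?k x)" if "x \<in> tube e" for x
  proof -
    have "(\<lambda>s. A (Y (ray s x)) *v x) integrable_on {0..1}"
      using continuous_integrand'[OF cY assms(2) that] integrable_continuous_interval by blast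
    from integral_linear[OF this bounded_linear_vec_nth[of i]] show ?thesis
      by (simp add: leaf_integral_def o_def)
  qed
  have nth: "line_holomorphic_on (tube e) (\<lambda>x. x $ j)" for j
    using holomorphic_map_on_nth[OF open_tube holomorphic_ray[OF open_tube, where s=1]] by (simp add: ray_1)
  have "line_holomorphic_on (tube e) (\<lambda>x. integral {0..1} (?k x))"
  proof (rule line_holomorphic_on_integral[OF open_tube])
    show "continuous_on (tube e \<times> {0..1}) (\<lambda>(x, s). ?k x s)"
      using bounded_linear.continuous_on[OF bounded_linear_vec_nth continuous_integrand[OF cY assms(2)], of i]
      by (simp add: case_prod_beta)
    fix s :: real assume s: "s \<in> {0..1}"
    have 1: "holomorphic_map_on (tube e) (Y \<circ> ray s)"
      by (rule holomorphic_map_on_compose[OF open_tube _ holomorphic_ray[OF open_tube] assms(1)])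
        (use ray_tube s in auto)
    have "line_holomorphic_on (tube e) (\<lambda>x. A ((Y \<circ> ray s) x) $ i $ j)" for j
      by (rule line_holomorphic_on_compose[OF open_tube open_V 1 _ hol])
        (use ray_tube s assms(2) in auto)
    then show "line_holomorphic_on (tube e) (\<lambda>x. ?k x s)"
      unfolding matrix_vector_mult_def
      by (auto intro!: line_holomorphic_on_sum line_holomorphic_on_mult nth)
  qed
  moreover have "line_holomorphic_on (tube e) (\<lambda>x. z0 $ i + (x $ i + (\<Sum>j\<in>UNIV. (- P $ i $ j) * x $ j)))"
    by (intro line_holomorphic_on_add line_holomorphic_on_const nth line_holomorphic_on_sum line_holomorphic_on_mult)
  ultimately have "line_holomorphic_on (tube e) (\<lambda>x. (z0 $ i + (x $ i + (\<Sum>j\<in>UNIV. (- P $ i $ j) * x $ j)))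
      + integral {0..1} (?k x))"
    by (rule line_holomorphic_on_add[rotated])
  then show "line_holomorphic_on (tube e) (\<lambda>x. leaf_integral Y x $ i)"
    by (rule line_holomorphic_on_cong[rotated]) (simp add: eq matrix_vector_mult_def sum_negf)
qed

primrec picard :: "nat \<Rightarrow> complex^'n \<Rightarrow> complex^'n" where
  "picard 0 = (\<lambda>x. z0 + (x - P *v x))"
| "picard (Suc k) = leaf_integral (picard k)"

lemma leaf_integral_bound:
  assumes "holomorphic_map_on (tube e) Y" "Y ` tube e \<subseteq> cball z0 d" "cball z0 d \<subseteq> V"
    and K: "\<And>z v. z \<in> cball z0 d \<Longrightarrow> norm (A z *v v) \<le> K * norm v"
    and x: "x \<in> tube e" and e: "K * e \<le> 1 / 2" "e + K * e \<le> d" "K \<ge> 0"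
  shows "leaf_integral Y x \<in> cball z0 d"
proof -
  have cY: "continuous_on (tube e) Y" using assms(1) by (intro smooth_on_continuous_on holomorphic_map_on_smooth)
  have "norm (integral {0..1} (\<lambda>s. A (Y (ray s x)) *v x)) \<le> K * e * (1 - 0)"
  proof (rule integral_bound)
    show "continuous_on {0..1} (\<lambda>s. A (Y (ray s x)) *v x)"
      by (rule continuous_integrand'[OF cY _ x]) (use assms(2,3) in blast)
    fix s :: real assume s: "s \<in> {0..1}"
    have Y: "Y (ray s x) \<in> cball z0 d" using ray_tube[OF x s] assms(2) by blast
    have "norm (A (Y (ray s x)) *v x) = norm (A (Y (ray s x)) *v (P *v x))"
      using AP Y assms(3) by (metis subsetD)
    also have "\<dots> \<le> K * norm (P *v x)" by (rule K[OF Y])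
    also have "\<dots> \<le> K * e" using x e(3) by (intro mult_left_mono) (auto simp: tube_def)
    finally show "norm (A (Y (ray s x)) *v x) \<le> K * e" .
  qed auto
  moreover have "norm (x - P *v x) < e" using x by (simp add: tube_def)
  ultimately have "norm ((x - P *v x) + integral {0..1} (\<lambda>s. A (Y (ray s x)) *v x)) \<le> d"
    using norm_triangle_ineq[of "x - P *v x" "integral {0..1} (\<lambda>s. A (Y (ray s x)) *v x)"] e(2) by simp
  moreover have "z0 - leaf_integral Y x = - ((x - P *v x) + integral {0..1} (\<lambda>s. A (Y (ray s x)) *v x))"
    by (simp add: leaf_integral_def)
  ultimately show ?thesis unfolding mem_cball dist_norm by (simp only: norm_minus_cancel)
qed

lemma leaf_integral_contraction:
  assumes "holomorphic_map_on (tube e) Y" "Y ` tube e \<subseteq> cball z0 d"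
    "continuous_on (tube e) Z" "Z ` tube e \<subseteq> cball z0 d" "cball z0 d \<subseteq> V"
    and L: "\<And>z w v. z \<in> cball z0 d \<Longrightarrow> w \<in> cball z0 d \<Longrightarrow> norm (A z *v v - A w *v v) \<le> K * norm (z - w) * norm v"
    and x: "x \<in> tube e" and e: "K * e \<le> 1 / 2" "K \<ge> 0"
    and B: "\<And>y. y \<in> tube e \<Longrightarrow> norm (Y y - Z y) \<le> B" "B \<ge> 0"
  shows "norm (leaf_integral Y x - leaf_integral Z x) \<le> B / 2"
proof -
  have cY: "continuous_on (tube e) Y" using assms(1) by (intro smooth_on_continuous_on holomorphic_map_on_smooth)
  have sub: "Y ` tube e \<subseteq> V" "Z ` tube e \<subseteq> V" using assms(2,4,5) by auto
  have int: "(\<lambda>s. A (Y (ray s x)) *v x) integrable_on {0..1}" "(\<lambda>s. A (Z (ray s x)) *v x) integrable_on {0..1}"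
    using continuous_integrand'[OF cY sub(1) x] continuous_integrand'[OF assms(3) sub(2) x] integrable_continuous_interval
    by blast+
  have "leaf_integral Y x - leaf_integral Z x
      = integral {0..1} (\<lambda>s. A (Y (ray s x)) *v x - A (Z (ray s x)) *v x)"
    using Henstock_Kurzweil_Integration.integral_diff[OF int] by (simp add: leaf_integral_def)
  also have "norm \<dots> \<le> B / 2 * (1 - 0)"
  proof (rule integral_bound)
    show "continuous_on {0..1} (\<lambda>s. A (Y (ray s x)) *v x - A (Z (ray s x)) *v x)"
      by (intro continuous_on_diff continuous_integrand'[OF cY sub(1) x] continuous_integrand'[OF assms(3) sub(2) x])
    fix s :: real assume s: "s \<in> {0..1}"
    let ?y = "Y (ray s x)" and ?z = "Z (ray s x)"
    have in1: "?y \<in> cball z0 d" "?z \<in> cball z0 d" using ray_tube[OF x s] assms(2,4) by auto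
    have "norm (A ?y *v x - A ?z *v x) = norm (A ?y *v (P *v x) - A ?z *v (P *v x))"
      using AP in1 assms(5) by (metis subsetD)
    also have "\<dots> \<le> K * norm (?y - ?z) * norm (P *v x)" by (rule L[OF in1])
    also have "\<dots> \<le> K * B * e"
      using x e(2) B(1)[OF ray_tube[OF x s]] B(2) by (intro mult_mono mult_nonneg_nonneg) (auto simp: tube_def)
    also have "\<dots> = (K * e) * B" by simp
    also have "\<dots> \<le> 1 / 2 * B" using e(1) B(2) by (intro mult_right_mono)
    finally show "norm (A ?y *v x - A ?z *v x) \<le> B / 2" by simp
  qed auto
  finally show ?thesis by simp
qed

text \<open>Picard iteration. The iterates are holomorphic in \<open>x\<close>, and so is their uniform
  limit; this includes the holomorphic dependence on the initial point.\<close>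

lemma leaf_equation_solution:
  assumes d: "cball z0 d \<subseteq> V"
    and K: "\<And>z v. z \<in> cball z0 d \<Longrightarrow> norm (A z *v v) \<le> K * norm v" "K \<ge> 0"
    and L: "\<And>z w v. z \<in> cball z0 d \<Longrightarrow> w \<in> cball z0 d \<Longrightarrow> norm (A z *v v - A w *v v) \<le> K * norm (z - w) * norm v"
    and e: "K * e \<le> 1 / 2" "e + K * e \<le> d" "e > 0"
  obtains Y where "holomorphic_map_on (tube e) Y" "Y ` tube e \<subseteq> cball z0 d"
    "\<And>x. x \<in> tube e \<Longrightarrow> Y x = leaf_integral Y x"
proof -
  have "d > 0" using e mult_nonneg_nonneg[OF K(2), of e] by linarith
  have step: "holomorphic_map_on (tube e) (picard k) \<and> picard k ` tube e \<subseteq> cball z0 d" for k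
  proof (induction k)
    case 0
    have "norm (x - P *v x) \<le> d" if "x \<in> tube e" for x
      using that e mult_nonneg_nonneg[OF K(2), of e] unfolding tube_def by auto
    then have "picard 0 ` tube e \<subseteq> cball z0 d"
      by (auto simp: dist_norm norm_minus_commute)
    moreover have "holomorphic_map_on (tube e) (picard 0)"
    proof (rule holomorphic_map_onI[OF open_tube])
      fix z
      have "((\<lambda>x. z0 + (x - P *v x)) has_derivative (\<lambda>v. v - P *v v)) (at z)"
        by (auto intro!: derivative_eq_intros bounded_linear.has_derivative[OF bounded_linear_P])
      moreover have "a *s v - P *v (a *s v) = a *s (v - P *v v)" for a v
        by (simp add: vector_scalar_commute vec_eq_iff algebra_simps)
      ultimately show "\<exists>L. (picard 0 has_derivative L) (at z) \<and> (\<forall>a v. L (a *s v) = a *s L v)"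
        by (intro exI[of _ "\<lambda>v. v - P *v v"]) simp
    qed
    ultimately show ?case by blast
  next
    case (Suc k)
    have "picard k ` tube e \<subseteq> V" using Suc d by blast
    then show ?case
      using leaf_integral_holomorphic[of e "picard k"] leaf_integral_bound[of e "picard k" d K] Suc d K e
      by auto
  qed
  have cont: "continuous_on (tube e) (picard k)" for k
    using step by (intro smooth_on_continuous_on holomorphic_map_on_smooth) blast
  have diff: "norm (picard (Suc k) x - picard k x) \<le> 2 * d * (1 / 2) ^ k" if "x \<in> tube e" for k x
    using that
  proof (induction k arbitrary: x)
    case 0
    have "picard (Suc 0) x \<in> cball z0 d" "picard 0 x \<in> cball z0 d" using step 0 by blast+
    then show ?case using norm_triangle_ineq4[of "picard (Suc 0) x - z0" "picard 0 x - z0"]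
      by (simp add: dist_norm norm_minus_commute del: picard.simps)
  next
    case (Suc k)
    have "norm (leaf_integral (picard (Suc k)) x - leaf_integral (picard k) x) \<le> (2 * d * (1 / 2) ^ k) / 2"
      using \<open>d > 0\<close> Suc
      by (intro leaf_integral_contraction[OF conjunct1[OF step] conjunct2[OF step] cont conjunct2[OF step] d L _ e(1) K(2)])
        auto
    then show ?case by simp
  qed
  define Y where "Y x = picard 0 x + (\<Sum>k. picard (Suc k) x - picard k x)" for x
  have "uniform_limit (tube e) (\<lambda>k x. \<Sum>i<k. picard (Suc i) x - picard i x) (\<lambda>x. \<Sum>k. picard (Suc k) x - picard k x) sequentially"
    by (rule Weierstrass_m_test[OF diff]) (auto intro!: summable_mult summable_geometric)
  then have "uniform_limit (tube e) (\<lambda>k x. picard 0 x + (\<Sum>i<k. picard (Suc i) x - picard i x)) Y sequentially"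
    unfolding Y_def by (intro uniform_limit_add uniform_limit_const)
  moreover have "(\<lambda>k x. picard 0 x + (\<Sum>i<k. picard (Suc i) x - picard i x)) = picard"
  proof (intro ext)
    show "picard 0 x + (\<Sum>i<k. picard (Suc i) x - picard i x) = picard k x" for k x
      using sum_lessThan_telescope[of "\<lambda>i. picard i x" k] by (simp del: picard.simps)
  qed
  ultimately have lim: "uniform_limit (tube e) picard Y sequentially" by (simp only:)
  have ptlim: "(\<lambda>k. picard k x) \<longlonglongrightarrow> Y x" if "x \<in> tube e" for x
    using tendsto_uniform_limitI[OF lim that] .
  have Yb: "Y ` tube e \<subseteq> cball z0 d"
  proof
    fix y assume "y \<in> Y ` tube e"
    then obtain x where x: "x \<in> tube e" "y = Y x" by blast
    have "Y x \<in> cball z0 d"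
    proof (rule Lim_in_closed_set[OF closed_cball _ _ ptlim[OF x(1)]])
      have "picard k x \<in> cball z0 d" for k using step x(1) by blast
      then show "\<forall>\<^sub>F k in sequentially. picard k x \<in> cball z0 d" by (intro always_eventually allI)
    qed simp
    then show "y \<in> cball z0 d" using x by simp
  qed
  have Yhol: "holomorphic_map_on (tube e) Y"
  proof (rule holomorphic_map_onI_nth[OF open_tube])
    fix i
    have "uniform_limit (tube e) (\<lambda>k x. picard k x $ i) (\<lambda>x. Y x $ i) sequentially"
      using bounded_linear.uniform_limit[OF bounded_linear_vec_nth lim] .
    then show "line_holomorphic_on (tube e) (\<lambda>x. Y x $ i)"
      by (rule line_holomorphic_on_uniform_limit[OF open_tube, rotated])
        (use step holomorphic_map_on_nth[OF open_tube] in blast)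
  qed
  have "Y x = leaf_integral Y x" if x: "x \<in> tube e" for x
  proof -
    have "(\<lambda>k. leaf_integral (picard k) x) \<longlonglongrightarrow> leaf_integral Y x"
    proof (rule LIMSEQ_I)
      fix r :: real assume "r > 0"
      have "\<forall>\<^sub>F k in sequentially. \<forall>x\<in>tube e. dist (picard k x) (Y x) < r"
        using uniform_limitD[OF lim \<open>r > 0\<close>] .
      then obtain k0 where k0: "\<And>k y. k \<ge> k0 \<Longrightarrow> y \<in> tube e \<Longrightarrow> dist (picard k y) (Y y) < r"
        by (auto simp: eventually_sequentially)
      have "norm (leaf_integral (picard k) x - leaf_integral Y x) < r" if "k \<ge> k0" for k
      proof -
        have "norm (leaf_integral (picard k) x - leaf_integral Y x) \<le> r / 2"
        proof (rule leaf_integral_contraction[OF _ _ _ Yb d L x e(1) K(2)])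
          show "continuous_on (tube e) Y" using Yhol by (intro smooth_on_continuous_on holomorphic_map_on_smooth)
          show "norm (picard k y - Y y) \<le> r" if "y \<in> tube e" for y
            using k0[OF \<open>k \<ge> k0\<close> that] by (simp add: dist_norm)
        qed (use step \<open>r > 0\<close> in auto)
        then show ?thesis using \<open>r > 0\<close> by linarith
      qed
      then show "\<exists>k0. \<forall>k\<ge>k0. norm (leaf_integral (picard k) x - leaf_integral Y x) < r" by blast
    qed
    moreover have "(\<lambda>k. leaf_integral (picard k) x) \<longlonglongrightarrow> Y x"
      using LIMSEQ_Suc[OF ptlim[OF x]] by simp
    ultimately show ?thesis using LIMSEQ_unique by blast
  qed
  then show ?thesis using that Yhol Yb by blast
qed

text \<open>Substituting in the integral along the ray through \<open>t x\<close> turns the fixed point equation into an integral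
  from \<open>0\<close> to \<open>t\<close>, which is differentiated at \<open>t = 1\<close>.\<close>

lemma leaf_euler:
  assumes "holomorphic_map_on (tube e) Y" "Y ` tube e \<subseteq> V"
    "\<And>x. x \<in> tube e \<Longrightarrow> Y x = leaf_integral Y x" "x \<in> tube e"
  shows "FD Y x (P *v x) = A (Y x) *v x"
proof -
  have cY: "continuous_on (tube e) Y" using assms(1) by (intro smooth_on_continuous_on holomorphic_map_on_smooth)
  define \<phi> where "\<phi> s = A (Y (ray s x)) *v x" for s
  have c\<phi>: "continuous_on {0..1} \<phi>" unfolding \<phi>_def by (rule continuous_integrand'[OF cY assms(2,4)])
  define F where "F t = integral {0..t} \<phi>" for t
  have dF: "(F has_vector_derivative \<phi> t) (at t within {0..1})" if "t \<in> {0..1}" for t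
    unfolding F_def by (rule integral_has_vector_derivative[OF c\<phi> that])
  have Yray: "Y (ray t x) = z0 + (x - P *v x) + F t" if t: "t \<in> {0..1}" for t
  proof -
    have "((\<lambda>s. t *\<^sub>R \<phi> (t * s)) has_integral F (t * 1) - F (t * 0)) {0..1}"
    proof (rule fundamental_theorem_of_calculus)
      fix s :: real assume s: "s \<in> {0..1}"
      have ts: "t * s \<in> {0..1}" using s t by (auto intro: mult_le_one)
      have "((\<lambda>s. t * s) has_vector_derivative t) (at s within {0..1})"
        by (auto intro!: derivative_eq_intros)
      moreover have "(F has_vector_derivative \<phi> (t * s)) (at (t * s) within (\<lambda>s. t * s) ` {0..1})"
        by (rule has_vector_derivative_within_subset[OF dF[OF ts]]) (use t in \<open>auto intro: mult_le_one\<close>)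
      ultimately have "((F \<circ> (\<lambda>s. t * s)) has_vector_derivative t *\<^sub>R \<phi> (t * s)) (at s within {0..1})"
        by (rule vector_diff_chain_within)
      then show "((\<lambda>s. F (t * s)) has_vector_derivative t *\<^sub>R \<phi> (t * s)) (at s within {0..1})"
        by (simp add: o_def)
    qed auto
    moreover have "F (t * 1) - F (t * 0) = F t" by (simp add: F_def)
    ultimately have "integral {0..1} (\<lambda>s. t *\<^sub>R \<phi> (t * s)) = F t"
      by (simp only: integral_unique)
    moreover have "A (Y (ray s (ray t x))) *v ray t x = t *\<^sub>R \<phi> (t * s)" if "s \<in> {0..1}" for s
    proof -
      have "Y (ray (s * t) x) \<in> V" using ray_tube[OF ray_tube[OF assms(4) t] that] assms(2) by (auto simp: ray_ray)
      then show ?thesis by (simp add: \<phi>_def A_ray ray_ray mult.commute)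
    qed
    ultimately show ?thesis
      using assms(3)[OF ray_tube[OF assms(4) t]] integral_cong[of "{0..1}" "\<lambda>s. A (Y (ray s (ray t x))) *v ray t x" "\<lambda>s. t *\<^sub>R \<phi> (t * s)"]
      unfolding leaf_integral_def ray_minus by simp
  qed
  have "((\<lambda>t. z0 + (x - P *v x) + F t) has_vector_derivative 0 + \<phi> 1) (at 1 within {0..1})"
    by (intro has_vector_derivative_add has_vector_derivative_const dF) simp
  then have 1: "((\<lambda>t. Y (ray t x)) has_vector_derivative \<phi> 1) (at 1 within {0..1})"
    by (intro has_vector_derivative_transform[OF _ Yray]) auto
  have "(Y has_derivative FD Y (ray 1 x)) (at (ray 1 x))"
    using holomorphic_map_on_has_derivative[OF assms(1,4)] by (simp add: ray_1)
  then have "(Y has_derivative FD Y (ray 1 x)) (at (ray 1 x) within (\<lambda>t. ray t x) ` {0..1})"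
    by (rule has_derivative_at_withinI)
  then have 2: "((Y \<circ> (\<lambda>t. ray t x)) has_vector_derivative FD Y (ray 1 x) (P *v x)) (at 1 within {0..1})"
    by (rule vector_derivative_diff_chain_within[OF has_vector_derivative_ray])
  have "\<phi> 1 = FD Y (ray 1 x) (P *v x)"
    using vector_derivative_unique_within[OF _ 1 2[unfolded o_def]] by (simp add: trivial_limit_within islimpt_Icc)
  then show ?thesis by (simp add: \<phi>_def ray_1)
qed

text \<open>The failure \<open>h\<close> of \<open>Y\<close> to be tangent to the bundle, scaled by the ray parameter, satisfies a homogeneous linear
  differential equation along each ray. The equation is the derivative in the direction \<open>w\<close> of the relation
  \<open>FD Y y (P y) = A (Y y) y\<close>; commutation of the fields exchanges the two directions in the derivative of \<open>A\<close>. As \<open>h\<close>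
  vanishes at the start of the ray, it vanishes throughout.\<close>

lemma leaf_tangent:
  assumes Y: "holomorphic_map_on (tube e) Y" and YV: "Y ` tube e \<subseteq> cball z0 d" and d: "cball z0 d \<subseteq> V"
    and fixpt: "\<And>x. x \<in> tube e \<Longrightarrow> Y x = leaf_integral Y x" and x: "x \<in> tube e"
    and K: "\<And>z w v. z \<in> cball z0 d \<Longrightarrow> norm (FD A z w *v v) \<le> K * norm w * norm v"
    and e: "K * e \<le> 1 / 2" "K \<ge> 0" and w: "P *v w = w"
  shows "FD Y x w = A (Y x) *v w"
proof -
  have sY: "smooth_on (tube e) Y" using Y by (rule holomorphic_map_on_smooth)
  have YV': "Y ` tube e \<subseteq> V" using YV d by blast
  have euler: "FD Y y (P *v y) = A (Y y) *v y" if "y \<in> tube e" for y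
    using leaf_euler[OF Y YV' fixpt that] .
  have dA: "(A has_derivative FD A (Y y)) (at (Y y))" if "y \<in> tube e" for y
    using YV' that by (intro smooth_on_has_derivative[OF smooth_A]) auto
  have dAY: "((\<lambda>y. A (Y y)) has_derivative (\<lambda>v. FD A (Y y) (FD Y y v))) (at y)" if "y \<in> tube e" for y
    by (rule has_derivative_compose[OF smooth_on_has_derivative[OF sY that] dA[OF that]])
  have linY: "linear (FD Y y)" if "y \<in> tube e" for y
    using has_derivative_linear[OF smooth_on_has_derivative[OF sY that]] .
  have linA: "linear (FD A (Y y))" if "y \<in> tube e" for y
    using has_derivative_linear[OF dA[OF that]] .
  define D2 where "D2 y v = FD (\<lambda>y. FD Y y w) y v" for y v
  have variation: "D2 y (P *v y) + FD Y y w = FD A (Y y) (FD Y y w) *v y + A (Y y) *v w" if y: "y \<in> tube e" for y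
  proof -
    have "((\<lambda>y. FD Y y (P *v y)) has_derivative (\<lambda>v. FD (\<lambda>x. FD Y x (P *v y)) y v + FD Y y (P *v v))) (at y)"
      by (rule FD_apply_has_derivative[OF sY y open_tube bounded_linear.has_derivative[OF bounded_linear_P has_derivative_ident]])
    then have "((\<lambda>y. A (Y y) *v y) has_derivative (\<lambda>v. FD (\<lambda>x. FD Y x (P *v y)) y v + FD Y y (P *v v))) (at y)"
      by (rule has_derivative_transform_within_open[OF _ open_tube y]) (rule euler)
    moreover have "((\<lambda>y. A (Y y) *v y) has_derivative (\<lambda>v. A (Y y) *v v + FD A (Y y) (FD Y y v) *v y)) (at y)"
      using bounded_bilinear.FDERIV[OF bounded_bilinear_matrix_vector dAY[OF y] has_derivative_ident] .
    ultimately have "(\<lambda>v. FD (\<lambda>x. FD Y x (P *v y)) y v + FD Y y (P *v v)) = (\<lambda>v. A (Y y) *v v + FD A (Y y) (FD Y y v) *v y)"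
      by (rule has_derivative_unique)
    then have "FD (\<lambda>x. FD Y x (P *v y)) y w + FD Y y (P *v w) = A (Y y) *v w + FD A (Y y) (FD Y y w) *v y"
      by (rule fun_cong)
    moreover have "FD (\<lambda>x. FD Y x (P *v y)) y w = D2 y (P *v y)"
      unfolding D2_def by (rule FD_commute[OF open_tube y sY])
    ultimately show ?thesis using w by (simp add: add.commute)
  qed
  have FDA_P: "FD A (Y y) u *v (P *v v) = FD A (Y y) u *v v" if "y \<in> tube e" for y u v
  proof -
    have Yy: "Y y \<in> V" using YV' that by blast
    have "FD (\<lambda>z. A z *v (P *v v)) (Y y) u = FD (\<lambda>z. A z *v v) (Y y) u"
      by (rule fun_cong[OF FD_cong_open[OF open_V Yy]]) (rule AP)
    then show ?thesis
      unfolding FD_matrix_vector[OF smooth_on_differentiable[OF smooth_A Yy]] .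
  qed
  define h where "h s = s *\<^sub>R (FD Y (ray s x) w - A (Y (ray s x)) *v w)" for s
  define h' where "h' s = FD A (Y (ray s x)) (h s) *v (P *v x)" for s
  have rx: "ray s x \<in> tube e" if "s \<in> {0..1}" for s using ray_tube[OF x that] .
  have dh: "(h has_vector_derivative h' s) (at s within {0..1})" if s: "s \<in> {0..1}" for s
  proof -
    let ?y = "ray s x"
    have y: "?y \<in> tube e" "Y ?y \<in> V" using rx[OF s] YV' by auto
    have "((\<lambda>y. FD Y y w) has_derivative D2 ?y) (at ?y)"
      unfolding D2_def by (rule smooth_on_has_derivative[OF smooth_on_FD[OF sY] y(1)])
    then have "((\<lambda>y. FD Y y w) has_derivative D2 ?y) (at ?y within (\<lambda>s. ray s x) ` {0..1})"
      by (rule has_derivative_at_withinI)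
    from vector_derivative_diff_chain_within[OF has_vector_derivative_ray this]
    have 1: "((\<lambda>s. FD Y (ray s x) w) has_vector_derivative D2 ?y (P *v x)) (at s within {0..1})" by (simp add: o_def)
    have "((\<lambda>y. A (Y y) *v w) has_derivative (\<lambda>v. FD A (Y ?y) (FD Y ?y v) *v w)) (at ?y)"
      using bounded_linear.has_derivative[OF bounded_bilinear.bounded_linear_left[OF bounded_bilinear_matrix_vector] dAY[OF y(1)]] .
    then have "((\<lambda>y. A (Y y) *v w) has_derivative (\<lambda>v. FD A (Y ?y) (FD Y ?y v) *v w)) (at ?y within (\<lambda>s. ray s x) ` {0..1})"
      by (rule has_derivative_at_withinI)
    from vector_derivative_diff_chain_within[OF has_vector_derivative_ray this]
    have 2: "((\<lambda>s. A (Y (ray s x)) *v w) has_vector_derivative FD A (Y ?y) (FD Y ?y (P *v x)) *v w) (at s within {0..1})"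
      by (simp add: o_def)
    have "(h has_vector_derivative s *\<^sub>R (D2 ?y (P *v x) - FD A (Y ?y) (FD Y ?y (P *v x)) *v w)
        + 1 *\<^sub>R (FD Y ?y w - A (Y ?y) *v w)) (at s within {0..1})"
      unfolding h_def
      by (intro has_vector_derivative_scaleR has_vector_derivative_diff 1 2 DERIV_ident[THEN has_field_derivative_at_within])
    moreover have "s *\<^sub>R (D2 ?y (P *v x) - FD A (Y ?y) (FD Y ?y (P *v x)) *v w) + 1 *\<^sub>R (FD Y ?y w - A (Y ?y) *v w) = h' s"
    proof -
      have lin2: "linear (D2 ?y)" unfolding D2_def
        by (rule has_derivative_linear[OF smooth_on_has_derivative[OF smooth_on_FD[OF sY] y(1)]])
      have a: "s *\<^sub>R D2 ?y (P *v x) = D2 ?y (P *v ?y)" using lin2 by (simp add: P_ray linear_cmul)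
      have b: "s *\<^sub>R (FD A (Y ?y) (FD Y ?y (P *v x)) *v w) = FD A (Y ?y) (A (Y ?y) *v ?y) *v w"
      proof -
        have "s *\<^sub>R (FD A (Y ?y) (FD Y ?y (P *v x)) *v w) = FD A (Y ?y) (FD Y ?y (P *v ?y)) *v w"
          using linA[OF y(1)] linY[OF y(1)] by (simp add: P_ray linear_cmul scaleR_matrix_vector)
        then show ?thesis using euler[OF y(1)] by simp
      qed
      have c: "FD A (Y ?y) (A (Y ?y) *v ?y) *v w = FD A (Y ?y) (A (Y ?y) *v w) *v ?y" by (rule comm[OF y(2)])
      have "s *\<^sub>R (D2 ?y (P *v x) - FD A (Y ?y) (FD Y ?y (P *v x)) *v w) + 1 *\<^sub>R (FD Y ?y w - A (Y ?y) *v w)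
        = FD A (Y ?y) (FD Y ?y w) *v ?y - FD A (Y ?y) (A (Y ?y) *v w) *v ?y"
        unfolding scaleR_diff_right a b c using variation[OF y(1)] by (simp add: algebra_simps)
      also have "\<dots> = FD A (Y ?y) (FD Y ?y w - A (Y ?y) *v w) *v ?y"
        by (simp add: linear_diff[OF linA[OF y(1)]] matrix_vector_mult_diff_rdistrib)
      also have "\<dots> = FD A (Y ?y) (FD Y ?y w - A (Y ?y) *v w) *v (P *v ?y)" by (simp only: FDA_P[OF y(1)])
      also have "\<dots> = h' s"
        using linA[OF y(1)] by (simp add: h'_def h_def P_ray linear_cmul scaleR_matrix_vector matrix_vector_mult_scaleR)
      finally show ?thesis .
    qed
    ultimately show ?thesis by simp
  qed
  have "norm (h' s) \<le> norm (h s) / 2" if s: "s \<in> {0..1}" for s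
  proof -
    have "norm (h' s) \<le> K * norm (h s) * norm (P *v x)"
      unfolding h'_def using YV rx[OF s] by (intro K) auto
    also have "\<dots> \<le> K * norm (h s) * e" using x e(2) by (intro mult_left_mono) (auto simp: tube_def)
    also have "\<dots> = (K * e) * norm (h s)" by simp
    also have "\<dots> \<le> 1 / 2 * norm (h s)" by (intro mult_right_mono e) auto
    finally show ?thesis by simp
  qed
  from homogeneous_linear_ode_zero[OF dh this, of 1] have "h 1 = 0" by (simp add: h_def)
  then show ?thesis by (simp add: h_def ray_1)
qed

text \<open>The inverse of the map \<open>Y\<close> flattens the bundle to the range of \<open>P\<close>; its component in the kernel of \<open>P\<close> is the
  required first integral.\<close>

theorem first_integral:
  obtains W q where "open W" "z0 \<in> W" "W \<subseteq> V" "holomorphic_map_on W q"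
    "\<And>z w. z \<in> W \<Longrightarrow> FD q z (A z *v w) = 0" "\<And>v. FD q z0 v = v - P *v v"
    "\<And>z v. z \<in> W \<Longrightarrow> P *v FD q z v = 0"
proof -
  obtain d where d: "d > 0" "cball z0 d \<subseteq> V" using open_V z0 open_contains_cball by blast
  obtain b where b: "b \<ge> 0" "\<And>M v. norm ((M::complex^'n^'n) *v v) \<le> norm M * norm v * b"
    using bounded_bilinear.nonneg_bounded[OF bounded_bilinear_matrix_vector] by metis
  have "compact (A ` cball z0 d)"
    by (intro compact_continuous_image continuous_on_subset[OF smooth_on_continuous_on[OF smooth_A] d(2)]) auto
  then have "bounded (A ` cball z0 d)" by (rule compact_imp_bounded)
  then obtain K1 where K1: "\<And>z. z \<in> cball z0 d \<Longrightarrow> norm (A z) \<le> K1" unfolding bounded_iff by blast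
  have K1': "K1 \<ge> 0" using order_trans[OF norm_ge_zero K1[of z0]] d(1) by simp
  obtain K2 where K2: "K2 \<ge> 0" "\<And>z w. z \<in> cball z0 d \<Longrightarrow> norm (FD A z w) \<le> K2 * norm w"
    by (rule FD_bound_on_compact[OF smooth_A compact_cball d(2)]) (erule that)
  define K where "K = b * K1 + b * K2"
  have K: "K \<ge> 0" "b * K1 \<le> K" "b * K2 \<le> K" using b(1) K1' K2(1) by (auto simp: K_def)
  have bA: "norm (A z *v v) \<le> K * norm v" if "z \<in> cball z0 d" for z v
  proof -
    have "norm (A z *v v) \<le> norm (A z) * norm v * b" by (rule b)
    also have "\<dots> \<le> K1 * norm v * b" using K1[OF that] b(1) by (intro mult_right_mono) auto
    also have "\<dots> = (b * K1) * norm v" by simp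
    also have "\<dots> \<le> K * norm v" using K by (intro mult_right_mono) auto
    finally show ?thesis .
  qed
  have bFD: "norm (FD A z w *v v) \<le> K * norm w * norm v" if "z \<in> cball z0 d" for z w v
  proof -
    have "norm (FD A z w *v v) \<le> norm (FD A z w) * norm v * b" by (rule b)
    also have "\<dots> \<le> (K2 * norm w) * norm v * b" using K2(2)[OF that] b(1) by (intro mult_right_mono) auto
    also have "\<dots> = (b * K2) * (norm w * norm v)" by simp
    also have "\<dots> \<le> K * (norm w * norm v)" using K by (intro mult_right_mono) auto
    finally show ?thesis by (simp add: mult.assoc)
  qed
  have bL: "norm (A z *v v - A w *v v) \<le> K * norm (z - w) * norm v" if "z \<in> cball z0 d" "w \<in> cball z0 d" for z w v
  proof -
    have "norm (A z - A w) \<le> K2 * norm (z - w)"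
    proof (rule differentiable_bound[where S="cball z0 d" and f'="FD A"])
      show "(A has_derivative FD A y) (at y within cball z0 d)" if "y \<in> cball z0 d" for y
        by (rule has_derivative_at_withinI[OF smooth_on_has_derivative[OF smooth_A subsetD[OF d(2) that]]])
      show "onorm (FD A y) \<le> K2" if "y \<in> cball z0 d" for y
        by (rule onorm_bound[OF K2(1) K2(2)[OF that]])
    qed (use that in auto)
    have "norm (A z *v v - A w *v v) = norm ((A z - A w) *v v)" by (simp add: matrix_vector_mult_diff_rdistrib)
    also have "\<dots> \<le> norm (A z - A w) * norm v * b" by (rule b)
    also have "\<dots> \<le> (K2 * norm (z - w)) * norm v * b"
      using \<open>norm (A z - A w) \<le> K2 * norm (z - w)\<close> b(1) by (intro mult_right_mono) auto
    also have "\<dots> = (b * K2) * (norm (z - w) * norm v)" by simp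
    also have "\<dots> \<le> K * (norm (z - w) * norm v)" using K by (intro mult_right_mono) auto
    finally show ?thesis by (simp add: mult.assoc)
  qed
  \<comment> \<open>The tube is so thin that the iteration contracts by the factor \<open>1/2\<close> and
    stays in the ball of radius \<open>d\<close>.\<close>
  define e where "e = min (d / 2) (min (1 / 2) (d / 2) / (K + 1))"
  have e: "e > 0" using d(1) K(1) by (simp add: e_def)
  have Ke: "K * e \<le> min (1 / 2) (d / 2)"
  proof -
    have "K * e \<le> (K + 1) * (min (1 / 2) (d / 2) / (K + 1))" using K(1) e by (intro mult_mono) (auto simp: e_def)
    then show ?thesis using K(1) by simp
  qed
  have e2: "K * e \<le> 1 / 2" "e + K * e \<le> d" using Ke by (auto simp: e_def)
  obtain Y where Y: "holomorphic_map_on (tube e) Y" "Y ` tube e \<subseteq> cball z0 d"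
    and fixp: "\<And>x. x \<in> tube e \<Longrightarrow> Y x = leaf_integral Y x"
    by (rule leaf_equation_solution[OF d(2) bA K(1) bL e2 e]) (assumption | erule that)+
  have tangent: "FD Y x (P *v w) = A (Y x) *v w" if "x \<in> tube e" for x w
  proof -
    have "Y x \<in> V" using Y(2) that d(2) by blast
    then show ?thesis using leaf_tangent[OF Y d(2) fixp that bFD e2(1) K(1) PP, of w] AP by simp
  qed
  have zero: "0 \<in> tube e" using e by (simp add: tube_def)
  \<comment> \<open>On the kernel of \<open>P\<close> the map \<open>Y\<close> is a translation, on the
    range its derivative at the origin is \<open>P\<close> by tangency. Hence its derivative at the
    origin is the identity.\<close>
  have const: "Y t = z0 + t" if "t \<in> tube e" "P *v t = 0" for t
  proof -
    have "A (Y (ray s t)) *v t = 0" if "s \<in> {0..1}" for s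
    proof -
      have "Y (ray s t) \<in> V" using ray_tube[OF \<open>t \<in> tube e\<close> that] Y(2) d(2) by blast
      then show ?thesis using AP[of "Y (ray s t)" t] \<open>P *v t = 0\<close> by simp
    qed
    then have "integral {0..1} (\<lambda>s. A (Y (ray s t)) *v t) = integral {0..1::real} (\<lambda>s. 0)"
      by (rule Henstock_Kurzweil_Integration.integral_cong)
    then show ?thesis using fixp[OF that(1)] that(2) by (simp add: leaf_integral_def)
  qed
  have Y0: "Y 0 = z0" using const[OF zero] by simp
  have dY0: "(Y has_derivative FD Y 0) (at 0)" by (rule holomorphic_map_on_has_derivative[OF Y(1) zero])
  have lin0: "linear (FD Y 0)" using has_derivative_linear[OF dY0] .
  have ker: "FD Y 0 t = t" if "P *v t = 0" for t
  proof -
    have "((\<lambda>s. s *\<^sub>R t) has_derivative (\<lambda>s. s *\<^sub>R t)) (at (0::real))" by (auto intro!: derivative_eq_intros)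
    moreover have "(Y has_derivative FD Y 0) (at ((0::real) *\<^sub>R t))" using dY0 by simp
    ultimately have 1: "((\<lambda>s::real. Y (s *\<^sub>R t)) has_derivative (\<lambda>s. FD Y 0 (s *\<^sub>R t))) (at 0)"
      by (rule has_derivative_compose)
    have 3: "open ((\<lambda>s::real. s *\<^sub>R t) -` tube e)"
      by (rule open_vimage[OF open_tube]) (auto intro!: continuous_intros)
    have 4: "0 \<in> (\<lambda>s::real. s *\<^sub>R t) -` tube e" using zero by simp
    have 5: "((\<lambda>s::real. z0 + s *\<^sub>R t) has_derivative (\<lambda>s. s *\<^sub>R t)) (at 0)"
      by (auto intro!: derivative_eq_intros)
    have 2: "((\<lambda>s::real. Y (s *\<^sub>R t)) has_derivative (\<lambda>s. s *\<^sub>R t)) (at 0)"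
      by (rule has_derivative_transform_within_open[OF 5 3 4]) (simp add: const matrix_vector_mult_scaleR that)
    from fun_cong[OF has_derivative_unique[OF 1 2], of 1] show ?thesis by simp
  qed
  have id0: "FD Y 0 v = v" for v
  proof -
    have "FD Y 0 v = FD Y 0 (P *v v) + FD Y 0 (v - P *v v)" using linear_add[OF lin0, of "P *v v" "v - P *v v"] by simp
    also have "\<dots> = P *v v + (v - P *v v)"
      using tangent[OF zero, of v] Y0 A_z0 ker[of "v - P *v v"] by (simp add: matrix_vector_mult_diff_distrib PP)
    finally show ?thesis by simp
  qed
  obtain U V' g where g: "open U" "0 \<in> U" "U \<subseteq> tube e" "open V'" "homeomorphism U V' Y g" "holomorphic_map_on V' g"
    and inv1: "\<And>x v. x \<in> U \<Longrightarrow> FD g (Y x) (FD Y x v) = v" and inv2: "\<And>x v. x \<in> U \<Longrightarrow> FD Y x (FD g (Y x) v) = v"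
    by (rule holomorphic_inverse_function[OF open_tube zero Y(1) id0]) (erule that, assumption+)
  define q where "q z = g z - P *v g z" for z
  have gy: "g z \<in> U" "Y (g z) = z" if "z \<in> V'" for z
    using g(5) that by (auto simp: homeomorphism_def)
  have z0V': "z0 \<in> V'" using g(2,5) Y0 by (force simp: homeomorphism_def)
  have gz0: "g z0 = 0" using g(2,5) Y0 by (force simp: homeomorphism_def)
  have dq: "(q has_derivative (\<lambda>v. FD g z v - P *v FD g z v)) (at z)" if "z \<in> V'" for z
    unfolding q_def
    using holomorphic_map_on_has_derivative[OF g(6) that]
    by (intro has_derivative_diff bounded_linear.has_derivative[OF bounded_linear_P])
  have FDq: "FD q z v = FD g z v - P *v FD g z v" if "z \<in> V'" for z v
    using FD_eqI[OF dq[OF that]] by simp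
  have "holomorphic_map_on V' q"
  proof (rule holomorphic_map_onI[OF g(4)])
    fix z assume z: "z \<in> V'"
    have "FD g z (a *s v) - P *v FD g z (a *s v) = a *s (FD g z v - P *v FD g z v)" for a v
      by (simp add: holomorphic_map_on_scalar_mult[OF g(6) z] vector_scalar_commute vec_eq_iff algebra_simps)
    then show "\<exists>L. (q has_derivative L) (at z) \<and> (\<forall>a v. L (a *s v) = a *s L v)" using dq[OF z] by blast
  qed
  moreover have "FD q z (A z *v w) = 0" if "z \<in> V'" for z w
  proof -
    have "FD g z (A z *v w) = P *v w"
      using inv1[OF gy(1)[OF that], of "P *v w"] tangent[of "g z" w] gy[OF that] g(3) by auto
    then show ?thesis by (simp add: FDq[OF that] PP)
  qed
  moreover have "FD q z0 v = v - P *v v" for v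
  proof -
    have "FD g z0 v = v" using inv1[OF g(2), of v] by (simp add: Y0 id0)
    then show ?thesis by (simp add: FDq[OF z0V'])
  qed
  moreover have "P *v FD q z v = 0" if "z \<in> V'" for z v
    by (simp add: FDq[OF that] matrix_vector_mult_diff_distrib PP)
  moreover have "V' \<subseteq> V"
    using gy g(3) Y(2) d(2) by (metis image_subset_iff subset_iff)
  ultimately show ?thesis using that g(4) z0V' by blast
qed

end

subsection \<open>Complementary subspaces\<close>

lemma complex_linearI:
  fixes f :: "complex^'n::finite \<Rightarrow> complex^'m::finite"
  assumes "\<And>v w. f (v + w) = f v + f w" "\<And>a v. f (a *s v) = a *s f v"
  shows "Vector_Spaces.linear (*s) (*s) f"
  by unfold_locales (auto simp: assms)

definition complementary :: "(complex^'n::finite) set \<Rightarrow> (complex^'n) set \<Rightarrow> bool" where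
  "complementary P Q \<longleftrightarrow> vec.subspace P \<and> vec.subspace Q \<and> P \<inter> Q = {0} \<and>
     {a + b |a b. a \<in> P \<and> b \<in> Q} = UNIV"

lemma complementary_commute: "complementary P Q \<Longrightarrow> complementary Q P"
proof -
  have "{a + b |a b. a \<in> P \<and> b \<in> Q} \<subseteq> {a + b |a b. a \<in> Q \<and> b \<in> P}"
    "{a + b |a b. a \<in> Q \<and> b \<in> P} \<subseteq> {a + b |a b. a \<in> P \<and> b \<in> Q}"
    by (safe; rule exI; rule exI; rule conjI[OF add.commute]; blast)+
  then show "complementary P Q \<Longrightarrow> complementary Q P" unfolding complementary_def by auto
qed

lemma proj_along_eqI:
  assumes "complementary P Q" "a \<in> P" "v - a \<in> Q"
  shows "proj_along P Q v = a"
  unfolding proj_along_def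
proof (rule the_equality)
  show "a \<in> P \<and> v - a \<in> Q" using assms by blast
  fix b assume b: "b \<in> P \<and> v - b \<in> Q"
  have PQ: "vec.subspace P" "vec.subspace Q" "P \<inter> Q = {0}" using assms(1) by (auto simp: complementary_def)
  have "b - a \<in> P" using b assms(2) PQ(1) vec.subspace_diff by blast
  moreover have "(v - a) - (v - b) \<in> Q" using b assms(3) PQ(2) vec.subspace_diff by blast
  ultimately have "b - a \<in> P \<inter> Q" by simp
  then show "b = a" using PQ(3) by simp
qed

lemma proj_along_props:
  assumes "complementary P Q"
  shows "proj_along P Q v \<in> P" "v - proj_along P Q v \<in> Q"
proof -
  have "v \<in> {a + b |a b. a \<in> P \<and> b \<in> Q}" using assms unfolding complementary_def by blast
  then obtain a b where ab: "v = a + b" "a \<in> P" "b \<in> Q" by blast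
  then have "proj_along P Q v = a" using assms by (intro proj_along_eqI) auto
  then show "proj_along P Q v \<in> P" "v - proj_along P Q v \<in> Q" using ab by auto
qed

lemma proj_along_swap:
  assumes "complementary P Q"
  shows "proj_along Q P v = v - proj_along P Q v"
  using proj_along_props[OF assms] by (intro proj_along_eqI[OF complementary_commute[OF assms]]) auto

lemma proj_along_in: "complementary P Q \<Longrightarrow> v \<in> P \<Longrightarrow> proj_along P Q v = v"
  by (rule proj_along_eqI) (auto simp: complementary_def vec.subspace_0)

lemma proj_along_zero: "complementary P Q \<Longrightarrow> v \<in> Q \<Longrightarrow> proj_along P Q v = 0"
  by (rule proj_along_eqI) (auto simp: complementary_def vec.subspace_0)

lemma proj_along_linear:
  assumes "complementary P Q"
  shows "Vector_Spaces.linear (*s) (*s) (proj_along P Q)"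
proof (rule complex_linearI)
  have PQ: "vec.subspace P" "vec.subspace Q" using assms by (auto simp: complementary_def)
  show "proj_along P Q (v + w) = proj_along P Q v + proj_along P Q w" for v w
  proof (rule proj_along_eqI[OF assms])
    show "proj_along P Q v + proj_along P Q w \<in> P"
      using PQ proj_along_props[OF assms] by (blast intro: vec.subspace_add)
    have "(v - proj_along P Q v) + (w - proj_along P Q w) \<in> Q"
      using PQ proj_along_props[OF assms] by (blast intro: vec.subspace_add)
    then show "v + w - (proj_along P Q v + proj_along P Q w) \<in> Q" by (simp add: algebra_simps)
  qed
  show "proj_along P Q (a *s v) = a *s proj_along P Q v" for a v
  proof (rule proj_along_eqI[OF assms])
    show "a *s proj_along P Q v \<in> P" using PQ proj_along_props[OF assms] by (blast intro: vec.subspace_scale)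
    have "a *s (v - proj_along P Q v) \<in> Q" using PQ proj_along_props[OF assms] by (blast intro: vec.subspace_scale)
    then show "a *s v - a *s proj_along P Q v \<in> Q" by (simp add: vec.scale_right_diff_distrib)
  qed
qed

lemma proj_along_matrix:
  assumes "complementary P Q"
  shows "matrix (proj_along P Q) *v v = proj_along P Q v"
  by (rule matrix_works[OF proj_along_linear[OF assms]])

lemma proj_along_image:
  assumes "complementary P Q" "complementary P' Q'" "Vector_Spaces.linear (*s) (*s) f"
    "f ` P \<subseteq> P'" "f ` Q \<subseteq> Q'"
  shows "proj_along P' Q' (f v) = f (proj_along P Q v)"
proof (rule proj_along_eqI[OF assms(2)])
  show "f (proj_along P Q v) \<in> P'" using proj_along_props[OF assms(1)] assms(4) by blast
  have "f v - f (proj_along P Q v) = f (v - proj_along P Q v)"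
    using vec.linear_diff[OF assms(3)] by simp
  then show "f v - f (proj_along P Q v) \<in> Q'" using proj_along_props[OF assms(1)] assms(5) by auto
qed

lemma span_image_lessThanE:
  assumes "x \<in> vec.span (f ` {..<(r::nat)})"
  obtains b where "x = (\<Sum>i<r. b i *s (f i :: complex^'n::finite))"
proof -
  let ?T = "{y. \<exists>b. y = (\<Sum>i<r. b i *s f i)}"
  have "vec.span (f ` {..<r}) \<subseteq> ?T"
  proof (rule vec.span_minimal)
    show "f ` {..<r} \<subseteq> ?T"
    proof
      fix y assume "y \<in> f ` {..<r}"
      then obtain i where i: "i < r" "y = f i" by blast
      have "y = (\<Sum>j<r. (if j = i then 1 else 0) *s f j)"
        using i by (simp add: if_distrib[of "\<lambda>c. c *s f _"] sum.delta cong: if_cong)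
      then show "y \<in> ?T" unfolding mem_Collect_eq by (rule exI[of _ "\<lambda>j. if j = i then 1 else 0"])
    qed
    show "vec.subspace ?T"
    proof (rule vec.subspaceI)
      show "0 \<in> ?T" unfolding mem_Collect_eq by (rule exI[of _ "\<lambda>_. 0"]) simp
      fix x y assume "x \<in> ?T" "y \<in> ?T"
      then obtain a b where "x = (\<Sum>i<r. a i *s f i)" "y = (\<Sum>i<r. b i *s f i)" by blast
      then have "x + y = (\<Sum>i<r. (a i + b i) *s f i)" by (simp add: sum.distrib vector_sadd_rdistrib)
      then show "x + y \<in> ?T" unfolding mem_Collect_eq by (rule exI[of _ "\<lambda>i. a i + b i"])
    next
      fix c x assume "x \<in> ?T"
      then obtain a where "x = (\<Sum>i<r. a i *s f i)" by blast
      then have "c *s x = (\<Sum>i<r. (c * a i) *s f i)" by (simp add: vec.scale_sum_right)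
      then show "c *s x \<in> ?T" unfolding mem_Collect_eq by (rule exI[of _ "\<lambda>i. c * a i"])
    qed
  qed
  then show ?thesis using assms that by blast
qed

lemma matrix_inv_mult:
  fixes M :: "complex^'n::finite^'n"
  assumes "det M \<noteq> 0"
  shows "M ** matrix_inv M = mat 1" "matrix_inv M ** M = mat 1"
proof -
  have "\<exists>M'. M ** M' = mat 1 \<and> M' ** M = mat 1"
    using assms invertible_det_nz unfolding invertible_def by blast
  from someI_ex[OF this] show "M ** matrix_inv M = mat 1" "matrix_inv M ** M = mat 1"
    unfolding matrix_inv_def by auto
qed

text \<open>Cramer's rule exhibits the entries of the inverse as rational functions of those of
  \<open>M\<close>, so that regularity of \<open>M\<close> carries over.\<close>

lemma matrix_inv_entry:
  fixes M :: "complex^'n::finite^'n"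
  assumes "det M \<noteq> 0"
  shows "matrix_inv M $ i $ j = det (\<chi> k l. if l = i then axis j 1 $ k else M $ k $ l) / det M"
proof -
  have "M *v (matrix_inv M *v axis j 1) = axis j 1"
    by (simp add: matrix_vector_mul_assoc matrix_inv_mult[OF assms])
  then have "matrix_inv M *v axis j 1 = (\<chi> k. det (\<chi> i l. if l = k then axis j 1 $ i else M $ i $ l) / det M)"
    using cramer[OF assms] by blast
  then have "(matrix_inv M *v axis j 1) $ i = det (\<chi> k l. if l = i then axis j 1 $ k else M $ k $ l) / det M"
    by simp
  moreover have "(matrix_inv M *v axis j 1) $ i = matrix_inv M $ i $ j"
    by (simp add: matrix_vector_mult_def axis_def if_distrib[of "\<lambda>c. _ * c"] sum.delta cong: if_cong)
  ultimately show ?thesis by simp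
qed

lemma line_holomorphic_on_det:
  fixes M :: "complex^'n::finite \<Rightarrow> complex^'m::finite^'m"
  assumes "\<And>i j. line_holomorphic_on S (\<lambda>z. M z $ i $ j)"
  shows "line_holomorphic_on S (\<lambda>z. det (M z))"
  unfolding det_def
  by (intro line_holomorphic_on_sum line_holomorphic_on_mult line_holomorphic_on_const line_holomorphic_on_prod assms)

lemma line_holomorphic_on_matrix_inv:
  fixes M :: "complex^'n::finite \<Rightarrow> complex^'m::finite^'m"
  assumes "\<And>i j. line_holomorphic_on S (\<lambda>z. M z $ i $ j)" "\<And>z. z \<in> S \<Longrightarrow> det (M z) \<noteq> 0"
  shows "line_holomorphic_on S (\<lambda>z. matrix_inv (M z) $ i $ j)"
proof -
  have 1: "line_holomorphic_on S (\<lambda>z. det (\<chi> k l. if l = i then axis j 1 $ k else M z $ k $ l) * inverse (det (M z)))"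
  proof (intro line_holomorphic_on_mult line_holomorphic_on_det line_holomorphic_on_inverse assms)
    show "line_holomorphic_on S (\<lambda>z. (\<chi> k l. if l = i then axis j 1 $ k else M z $ k $ l) $ k $ l)" for k l
      by (cases "l = i") (auto intro: assms line_holomorphic_on_const)
  qed
  show ?thesis
    by (rule line_holomorphic_on_cong[OF _ 1]) (simp add: matrix_inv_entry assms(2) divide_inverse)
qed

lemma line_holomorphic_on_matrix_mult:
  fixes M :: "complex^'n::finite \<Rightarrow> complex^'k::finite^'m::finite" and M' :: "complex^'n \<Rightarrow> complex^'l::finite^'k"
  assumes "\<And>i j. line_holomorphic_on S (\<lambda>z. M z $ i $ j)" "\<And>i j. line_holomorphic_on S (\<lambda>z. M' z $ i $ j)"
  shows "line_holomorphic_on S (\<lambda>z. (M z ** M' z) $ i $ j)"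
  by (simp add: matrix_matrix_mult_def) (intro line_holomorphic_on_sum line_holomorphic_on_mult assms)

subsection \<open>Charts\<close>

locale complex_manifold =
  fixes A :: "('a::t2_space, 'n::finite) chart set"
  assumes complex_structure: "complex_structure A"
begin

lemma chart: "c \<in> A \<Longrightarrow> is_chart c"
  using complex_structure by (auto simp: complex_structure_def)

lemma compat: "c \<in> A \<Longrightarrow> d \<in> A \<Longrightarrow> compatible c d"
  using complex_structure by (auto simp: complex_structure_def)

lemma chart_cover: obtains c where "c \<in> A" "x \<in> cdom c"
proof -
  have "x \<in> (\<Union>c\<in>A. cdom c)" using complex_structure by (simp add: complex_structure_def)
  then show ?thesis using that by blast
qed

lemma open_cdom: "c \<in> A \<Longrightarrow> open (cdom c)"
  using chart by (auto simp: is_chart_def)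

lemma open_cim: "c \<in> A \<Longrightarrow> open (cim c)"
  using chart by (auto simp: is_chart_def)

lemma continuous_coord: "c \<in> A \<Longrightarrow> continuous_on (cdom c) (coord c)"
  using chart by (auto simp: is_chart_def homeomorphism_def)

lemma continuous_inv_coord: "c \<in> A \<Longrightarrow> continuous_on (cim c) (inv_into (cdom c) (coord c))"
  using chart by (auto simp: is_chart_def homeomorphism_def)

lemma inv_coord: "c \<in> A \<Longrightarrow> x \<in> cdom c \<Longrightarrow> inv_into (cdom c) (coord c) (coord c x) = x"
  using chart by (auto simp: is_chart_def homeomorphism_def)

lemma coord_inv: "z \<in> cim c \<Longrightarrow> coord c (inv_into (cdom c) (coord c) z) = z"
  by (auto simp: cim_def f_inv_into_f)

lemma inv_coord_in: "z \<in> cim c \<Longrightarrow> inv_into (cdom c) (coord c) z \<in> cdom c"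
  by (auto simp: cim_def inv_into_into)

lemma coord_in: "x \<in> cdom c \<Longrightarrow> coord c x \<in> cim c"
  by (auto simp: cim_def)

lemma open_coord_image:
  assumes "c \<in> A" "open U" "U \<subseteq> cdom c"
  shows "open (coord c ` U)"
proof -
  have "coord c ` U = cim c \<inter> inv_into (cdom c) (coord c) -` U"
    using assms(3) inv_coord[OF assms(1)] coord_inv by (force simp: cim_def)
  moreover have "open (cim c \<inter> inv_into (cdom c) (coord c) -` U)"
    by (rule continuous_open_preimage[OF continuous_inv_coord[OF assms(1)] open_cim[OF assms(1)] assms(2)])
  ultimately show ?thesis by simp
qed

lemma open_overlap: "c \<in> A \<Longrightarrow> d \<in> A \<Longrightarrow> open (coord c ` (cdom c \<inter> cdom d))"
  by (intro open_coord_image open_Int open_cdom) auto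

lemma transition_coord: "c \<in> A \<Longrightarrow> x \<in> cdom c \<Longrightarrow> transition c d (coord c x) = coord d x"
  by (simp add: transition_def inv_coord)

lemma transition_holomorphic:
  "c \<in> A \<Longrightarrow> d \<in> A \<Longrightarrow> holomorphic_map_on (coord c ` (cdom c \<inter> cdom d)) (transition c d)"
  using compat by (auto simp: compatible_def)

lemma transition_has_derivative:
  assumes "c \<in> A" "d \<in> A" "x \<in> cdom c \<inter> cdom d"
  shows "(transition c d has_derivative jac c d x) (at (coord c x))"
  unfolding jac_def
  by (rule holomorphic_map_on_has_derivative[OF transition_holomorphic[OF assms(1,2)]]) (use assms(3) in blast)

lemma jac_scalar_mult:
  assumes "c \<in> A" "d \<in> A" "x \<in> cdom c \<inter> cdom d"
  shows "jac c d x (a *s v) = a *s jac c d x v"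
  unfolding jac_def
  by (rule holomorphic_map_on_scalar_mult[OF transition_holomorphic[OF assms(1,2)]]) (use assms(3) in blast)

lemma jac_linear:
  assumes "c \<in> A" "d \<in> A" "x \<in> cdom c \<inter> cdom d"
  shows "Vector_Spaces.linear (*s) (*s) (jac c d x)"
  by (rule complex_linearI)
    (use jac_scalar_mult[OF assms] linear_add[OF has_derivative_linear[OF transition_has_derivative[OF assms]]] in auto)

lemma jac_trans:
  assumes "c \<in> A" "d \<in> A" "e \<in> A" "x \<in> cdom c" "x \<in> cdom d" "x \<in> cdom e"
  shows "jac d e x (jac c d x v) = jac c e x v"
proof -
  let ?S = "coord c ` (cdom c \<inter> (cdom d \<inter> cdom e))"
  have "(transition d e has_derivative jac d e x) (at (transition c d (coord c x)))"
    using transition_has_derivative[of d e x] assms by (simp add: transition_coord)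
  then have "((\<lambda>z. transition d e (transition c d z)) has_derivative (\<lambda>v. jac d e x (jac c d x v))) (at (coord c x))"
    using has_derivative_compose[OF transition_has_derivative[of c d x]] assms by blast
  moreover have "open ?S" by (intro open_coord_image open_Int open_cdom assms) auto
  moreover have "coord c x \<in> ?S" using assms by blast
  moreover have "transition d e (transition c d z) = transition c e z" if "z \<in> ?S" for z
    using that assms by (auto simp: transition_coord)
  ultimately have "(transition c e has_derivative (\<lambda>v. jac d e x (jac c d x v))) (at (coord c x))"
    by (rule has_derivative_transform_within_open)
  then show ?thesis unfolding jac_def[of c e] by (rule fun_cong[OF FD_eqI, symmetric])
qed

lemma jac_self: "c \<in> A \<Longrightarrow> x \<in> cdom c \<Longrightarrow> jac c c x v = v"
proof -
  assume c: "c \<in> A" "x \<in> cdom c"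
  have "((\<lambda>z. z) has_derivative (\<lambda>v. v)) (at (coord c x))" by simp
  then have "(transition c c has_derivative (\<lambda>v. v)) (at (coord c x))"
    by (rule has_derivative_transform_within_open[OF _ open_cim[OF c(1)] coord_in[OF c(2)]])
      (auto simp: cim_def transition_coord c(1))
  then show "jac c c x v = v" unfolding jac_def by (rule fun_cong[OF FD_eqI])
qed

lemma jac_inverse:
  assumes "c \<in> A" "d \<in> A" "x \<in> cdom c \<inter> cdom d"
  shows "jac d c x (jac c d x v) = v"
  using jac_trans[of c d c x v] jac_self[of c x v] assms by simp

lemma subbundle_subspace:
  "holomorphic_subbundle A r N \<Longrightarrow> c \<in> A \<Longrightarrow> z \<in> cim c \<Longrightarrow> vec.subspace (N c z) \<and> vec.dim (N c z) = r"
  by (auto simp: holomorphic_subbundle_def)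

lemma subbundle_jac:
  assumes "holomorphic_subbundle A r N" "c \<in> A" "d \<in> A" "x \<in> cdom c \<inter> cdom d"
  shows "N d (coord d x) = jac c d x ` N c (coord c x)"
  using assms(1)[unfolded holomorphic_subbundle_def, THEN conjunct2, THEN conjunct1, rule_format, OF assms(2-4)] .

subsection \<open>First integrals of an involutive bundle\<close>

text \<open>A holomorphic frame of the bundle is normalized, by a matrix inversion, to be mapped by the projection
  \<open>P\<close> onto a constant frame. The bracket of two normalized fields lies in the bundle and in the kernel of \<open>P\<close>, hence
  vanishes.\<close>

lemma bundle_first_integral:
  assumes N: "holomorphic_subbundle A r N" and inv: "involutive A N" and c: "c \<in> A" and z0: "z0 \<in> cim c"
    and Q: "complementary (N c z0) Q"
  obtains W q where "open W" "z0 \<in> W" "W \<subseteq> cim c" "holomorphic_map_on W q"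
    "\<And>z v. z \<in> W \<Longrightarrow> v \<in> N c z \<Longrightarrow> FD q z v = 0"
    "\<And>v. FD q z0 v = v - proj_along (N c z0) Q v" "\<And>z v. z \<in> W \<Longrightarrow> FD q z v \<in> Q"
proof -
  obtain W0 s where W0: "open W0" "z0 \<in> W0" "W0 \<subseteq> cim c"
    and s: "\<And>i. i < r \<Longrightarrow> holomorphic_map_on W0 (s i)"
    and span: "\<And>z. z \<in> W0 \<Longrightarrow> N c z = vec.span ((\<lambda>i. s i z) ` {..<r})"
    using N[unfolded holomorphic_subbundle_def, THEN conjunct2, THEN conjunct2, rule_format, OF c z0]
    by (elim exE conjE) (erule (2) that; simp)
  define P where "P = matrix (proj_along (N c z0) Q)"
  have P: "P *v v = proj_along (N c z0) Q v" for v
    unfolding P_def by (rule proj_along_matrix[OF Q])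
  have PN: "P *v v \<in> N c z0" for v using proj_along_props[OF Q] by (simp add: P)
  have Pid: "P *v v = v" if "v \<in> N c z0" for v using proj_along_in[OF Q that] by (simp add: P)
  have PP: "P *v (P *v v) = P *v v" for v using Pid[OF PN] .
  \<comment> \<open>The coefficients that express \<open>P\<close> in the frame at \<open>z0\<close> are
    kept fixed. With the frame at \<open>z\<close> they define \<open>G z\<close>, which agrees with
    \<open>P\<close> for \<open>z = z0\<close>.\<close>
  have "\<exists>b. P *v axis j 1 = (\<Sum>k<r. b k *s s k z0)" for j
    using PN[of "axis j 1"] span[OF W0(2)] by (auto elim!: span_image_lessThanE)
  then obtain b where b: "\<And>j. P *v axis j 1 = (\<Sum>k<r. b j k *s s k z0)" by metis
  define G :: "complex^'n \<Rightarrow> complex^'n^'n" where "G z = (\<chi> i j. \<Sum>k<r. b j k * s k z $ i)" for z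
  have Gv: "G z *v v = (\<Sum>j\<in>UNIV. v $ j *s (\<Sum>k<r. b j k *s s k z))" for z v
    by (simp add: vec_eq_iff G_def matrix_vector_mult_def mult.commute)
  have GN: "G z *v v \<in> N c z" if "z \<in> W0" for z v
    unfolding Gv span[OF that]
    by (intro vec.span_sum vec.span_scale vec.span_base) auto
  have Gz0: "G z0 *v v = P *v v" for v
  proof -
    have "P *v v = P *v (\<Sum>j\<in>UNIV. v $ j *s axis j 1)" by (simp add: basis_expansion)
    also have "\<dots> = (\<Sum>j\<in>UNIV. v $ j *s (P *v axis j 1))"
      by (simp add: vec.linear_sum[OF matrix_vector_mul_linear_gen] vector_scalar_commute)
    finally show ?thesis unfolding Gv b by simp
  qed
  have Ghol: "line_holomorphic_on W0 (\<lambda>z. G z $ i $ j)" for i j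
    unfolding G_def
    by (simp, intro line_holomorphic_on_sum line_holomorphic_on_mult line_holomorphic_on_const
        holomorphic_map_on_nth[OF W0(1)] s) auto
  \<comment> \<open>\<open>E z\<close> is \<open>P G z\<close> on the range of \<open>P\<close> and the
    identity on its kernel. It is the identity for \<open>z = z0\<close>, so it is invertible nearby, and
    its inverse normalizes \<open>G\<close>.\<close>
  define E where "E z = P ** G z ** P + (mat 1 - P)" for z
  have Ev: "E z *v v = P *v (G z *v (P *v v)) + (v - P *v v)" for z v
    by (simp add: E_def matrix_vector_mult_add_rdistrib matrix_vector_mult_diff_rdistrib flip: matrix_vector_mul_assoc)
  have Ez0: "E z0 = mat 1"
    unfolding matrix_eq Ev Gz0 by (simp add: PP)
  have Ehol: "line_holomorphic_on W0 (\<lambda>z. E z $ i $ j)" for i j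
    unfolding E_def vector_add_component
    by (intro line_holomorphic_on_add line_holomorphic_on_matrix_mult Ghol line_holomorphic_on_const)
  define V where "V = {z \<in> W0. det (E z) \<noteq> 0}"
  have "continuous_on W0 (\<lambda>z. det (E z))"
    using line_holomorphic_on_det[OF Ehol] by (simp add: line_holomorphic_on_def)
  then have "open (W0 \<inter> (\<lambda>z. det (E z)) -` (- {0}))"
    by (intro continuous_open_preimage W0(1)) auto
  moreover have "V = W0 \<inter> (\<lambda>z. det (E z)) -` (- {0})" by (auto simp: V_def)
  ultimately have V: "open V" "z0 \<in> V" "V \<subseteq> W0" using W0 Ez0 by (auto simp: V_def)
  define T where "T z = G z ** P ** matrix_inv (E z) ** P" for z
  have Tv: "T z *v v = G z *v (P *v (matrix_inv (E z) *v (P *v v)))" for z v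
    by (simp add: T_def flip: matrix_vector_mul_assoc)
  have Ei: "E z *v (matrix_inv (E z) *v v) = v" "matrix_inv (E z) *v (E z *v v) = v" if "z \<in> V" for z v
    using that matrix_inv_mult[of "E z"] by (auto simp: matrix_vector_mul_assoc V_def)
  have EP: "P *v (E z *v v) = E z *v (P *v v)" for z v
    unfolding Ev by (simp add: matrix_vector_right_distrib matrix_vector_mult_diff_distrib PP)
  have EiP: "matrix_inv (E z) *v (P *v v) = P *v (matrix_inv (E z) *v v)" if "z \<in> V" for z v
  proof -
    have "P *v v = E z *v (P *v (matrix_inv (E z) *v v))" using Ei(1)[OF that] by (simp flip: EP)
    then show ?thesis using Ei(2)[OF that] by metis
  qed
  have PT: "P *v (T z *v v) = P *v v" if "z \<in> V" for z v
  proof -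
    have "P *v (T z *v v) = E z *v (P *v (matrix_inv (E z) *v (P *v v)))"
      unfolding Tv Ev by (simp add: PP)
    also have "\<dots> = P *v v" using Ei(1)[OF that] EP PP by metis
    finally show ?thesis .
  qed
  have TP: "T z *v (P *v v) = T z *v v" for z v unfolding Tv PP ..
  have TN: "T z *v v \<in> N c z" if "z \<in> V" for z v unfolding Tv using GN that V(3) by blast
  \<comment> \<open>\<open>T z\<close> maps the fibre over \<open>z0\<close> injectively into the fibre
    over \<open>z\<close>, hence onto it for dimension reasons.\<close>
  have Tid: "T z *v v = v" if z: "z \<in> V" and v: "v \<in> N c z" for z v
  proof -
    let ?S = "N c z0"
    have zc: "z \<in> cim c" using z V W0 by blast
    have subS: "vec.subspace ?S" "vec.dim ?S = r" using subbundle_subspace[OF N c z0] by auto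
    have lin: "Vector_Spaces.linear (*s) (*s) ((*v) (T z))" by simp
    have inj: "inj_on ((*v) (T z)) ?S"
      by (rule inj_on_inverseI[where g="(*v) P"]) (simp add: PT[OF z] Pid)
    have "vec.dim ((*v) (T z) ` ?S) = vec.dim ?S"
      by (rule vec.dim_image_eq[OF lin]) (use inj subS(1) in \<open>simp add: vec.span_eq_iff[THEN iffD2]\<close>)
    moreover have "vec.subspace ((*v) (T z) ` ?S)"
      by (rule vec.linear_subspace_image[OF lin subS(1)])
    moreover have "(*v) (T z) ` ?S \<subseteq> N c z" using TN[OF z] by blast
    ultimately have "(*v) (T z) ` ?S = N c z"
      using vec.subspace_dim_equal[of "(*v) (T z) ` ?S" "N c z"] subbundle_subspace[OF N c zc] subS(2) by auto
    then obtain w where w: "w \<in> ?S" "v = T z *v w" using v by blast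
    have "T z *v v = T z *v (P *v v)" by (simp only: TP)
    also have "\<dots> = v" using PT[OF z, of w] Pid[OF w(1)] w(2) by simp
    finally show ?thesis .
  qed
  have Thol: "line_holomorphic_on V (\<lambda>z. T z $ i $ j)" for i j
    unfolding T_def
    by (intro line_holomorphic_on_matrix_mult line_holomorphic_on_const line_holomorphic_on_matrix_inv
        line_holomorphic_on_subset[OF Ghol V(3)] line_holomorphic_on_subset[OF Ehol V(3)]) (simp add: V_def)
  have sT: "smooth_on V T" by (rule smooth_on_matrix_entries[OF V(1) Thol])
  have comm: "FD T z (T z *v u) *v w = FD T z (T z *v w) *v u" if z: "z \<in> V" for z u w
  proof -
    have hol: "holomorphic_map_on V (\<lambda>z. T z *v v)" for v
      by (rule holomorphic_map_onI_nth[OF V(1)])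
        (simp add: matrix_vector_mult_def, intro line_holomorphic_on_sum line_holomorphic_on_mult
          line_holomorphic_on_const Thol)
    have dT: "T differentiable (at z)" by (rule smooth_on_differentiable[OF sT z])
    let ?B = "lie_bracket (\<lambda>z. T z *v u) (\<lambda>z. T z *v w) z"
    have B: "?B = FD T z (T z *v u) *v w - FD T z (T z *v w) *v u"
      unfolding lie_bracket_def FD_matrix_vector[OF dT] ..
    have sub: "open V \<and> V \<subseteq> cim c" using V W0 by blast
    have mem: "\<forall>z\<in>V. T z *v u \<in> N c z \<and> T z *v w \<in> N c z" using TN by blast
    have "\<forall>z\<in>V. lie_bracket (\<lambda>z. T z *v u) (\<lambda>z. T z *v w) z \<in> N c z"
      using inv[unfolded involutive_def, rule_format, OF c, of V "\<lambda>z. T z *v u" "\<lambda>z. T z *v w"] hol sub mem by blast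
    then have BN: "?B \<in> N c z" using z by blast
    have P0: "P *v (FD T z x *v v) = 0" for x v
    proof -
      have d: "(\<lambda>y. T y *v v) differentiable (at z)" by (rule smooth_on_differentiable[OF holomorphic_map_on_smooth[OF hol] z])
      have "P *v (FD T z x *v v) = FD (\<lambda>y. P *v (T y *v v)) z x"
        unfolding FD_bounded_linear[OF bounded_bilinear.bounded_linear_right[OF bounded_bilinear_matrix_vector] d]
          FD_matrix_vector[OF dT] ..
      also have "\<dots> = FD (\<lambda>y. P *v v) z x"
        by (rule fun_cong[OF FD_cong_open[OF V(1) z PT]])
      finally show ?thesis by simp
    qed
    have "?B = T z *v ?B" using Tid[OF z BN] by simp
    also have "\<dots> = T z *v (P *v ?B)" by (simp only: TP)
    also have "P *v ?B = 0" unfolding B matrix_vector_mult_diff_distrib P0 by simp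
    finally show ?thesis unfolding B by simp
  qed
  have "T z0 = P"
  proof -
    have i: "matrix_inv (E z0) *v v = v" for v using Ei(2)[OF V(2), of v] unfolding Ez0 by simp
    show ?thesis unfolding matrix_eq Tv i Gz0 PP by simp
  qed
  then interpret commuting_frame V z0 T P
    by unfold_locales (use V Thol PP PT TP comm in auto)
  obtain W q where W: "open W" "z0 \<in> W" "W \<subseteq> V" "holomorphic_map_on W q"
    and q1: "\<And>z w. z \<in> W \<Longrightarrow> FD q z (T z *v w) = 0" and q2: "\<And>v. FD q z0 v = v - P *v v"
    and q3: "\<And>z v. z \<in> W \<Longrightarrow> P *v FD q z v = 0"
    by (rule first_integral) (erule that, assumption+)
  show ?thesis
  proof (rule that[OF W(1,2) _ W(4)])
    show "W \<subseteq> cim c" using W V W0 by blast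
    show "FD q z v = 0" if "z \<in> W" "v \<in> N c z" for z v
      using q1[OF that(1), of v] Tid[of z v] that W(3) by auto
    show "FD q z0 v = v - proj_along (N c z0) Q v" for v using q2 P by simp
    show "FD q z v \<in> Q" if "z \<in> W" for z v
      using proj_along_props(2)[OF Q, of "FD q z v"] q3[OF that, of v] by (simp add: P)
  qed
qed

end

subsection \<open>Coordinate subspaces\<close>

definition axes :: "'n set \<Rightarrow> (complex^'n::finite) set" where
  "axes R = vec.span {axis l 1 |l. l \<in> R}"

lemma mem_axes_iff: "v \<in> axes R \<longleftrightarrow> (\<forall>l. l \<notin> R \<longrightarrow> v $ l = 0)" for v :: "complex^'n::finite"
proof
  have "axes R \<subseteq> {v :: complex^'n. \<forall>l. l \<notin> R \<longrightarrow> v $ l = 0}" unfolding axes_def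
  proof (rule vec.span_minimal)
    show "vec.subspace {v :: complex^'n. \<forall>l. l \<notin> R \<longrightarrow> v $ l = 0}" by (rule vec.subspaceI) auto
  qed (auto simp: axis_def)
  then show "v \<in> axes R \<Longrightarrow> \<forall>l. l \<notin> R \<longrightarrow> v $ l = 0" by blast
  assume v: "\<forall>l. l \<notin> R \<longrightarrow> v $ l = 0"
  have "(\<Sum>l\<in>UNIV. v $ l *s axis l 1) \<in> axes R"
    unfolding axes_def
  proof (rule vec.span_sum)
    fix l
    show "v $ l *s axis l 1 \<in> vec.span {axis l 1 |l. l \<in> R}"
    proof (cases "l \<in> R")
      case True
      then show ?thesis by (intro vec.span_scale vec.span_base) auto
    next
      case False
      then show ?thesis using v by (simp add: vec.span_zero)
    qed
  qed
  then show "v \<in> axes R" by (simp add: basis_expansion)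
qed

lemma axis_in_axes: "axis l 1 \<in> axes R \<longleftrightarrow> l \<in> R"
  by (auto simp: mem_axes_iff axis_def)

lemma complementary_axes: "complementary (axes R) (axes (- R) :: (complex^'n::finite) set)"
  unfolding complementary_def
proof (intro conjI)
  show "vec.subspace (axes R)" "vec.subspace (axes (- R))" by (simp_all add: axes_def)
  show "axes R \<inter> axes (- R) = {0 :: complex^'n}"
    by (auto simp: mem_axes_iff vec_eq_iff) (metis (full_types))
  have "\<exists>a b. v = a + b \<and> a \<in> axes R \<and> b \<in> axes (- R)" for v :: "complex^'n"
    by (intro exI[of _ "\<chi> l. if l \<in> R then v $ l else 0"] exI[of _ "\<chi> l. if l \<in> R then 0 else v $ l"])
      (auto simp: mem_axes_iff vec_eq_iff)
  then show "{a + b |a b. a \<in> axes R \<and> b \<in> axes (- R)} = (UNIV :: (complex^'n) set)" by blast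
qed

text \<open>Identifies subspaces from inclusions alone, without comparing dimensions: the component of a vector of
  \<open>P'\<close> in \<open>Q\<close> lies in both \<open>P'\<close> and \<open>Q'\<close>.\<close>

lemma complementary_subset_eq:
  assumes "complementary P Q" "complementary P' Q'" "P \<subseteq> P'" "Q \<subseteq> Q'"
  shows "P = P'"
proof
  show "P' \<subseteq> P"
  proof
    fix v assume v: "v \<in> P'"
    have 1: "proj_along P Q v \<in> P" "v - proj_along P Q v \<in> Q" by (rule proj_along_props[OF assms(1)])+
    have "v - proj_along P Q v \<in> P'" using v 1 assms(2,3) by (auto simp: complementary_def intro: vec.subspace_diff)
    then have "v - proj_along P Q v \<in> P' \<inter> Q'" using 1 assms(4) by blast
    then have "v - proj_along P Q v = 0" using assms(2) unfolding complementary_def by blast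
    then show "v \<in> P" using 1(1) by simp
  qed
qed fact

text \<open>Isomorphisms of \<open>P\<close> and \<open>Q\<close> onto coordinate subspaces of the same
  dimensions are joined along the two projections. Any index set \<open>R\<close> with \<open>r\<close>
  elements will do.\<close>

lemma straightening_isomorphism:
  fixes P Q :: "(complex^'n::finite) set"
  assumes "complementary P Q" "vec.dim P = r" "vec.dim Q = CARD('n) - r" "r \<le> CARD('n)"
  obtains T T' :: "complex^'n^'n" and R :: "'n set" where "T ** T' = mat 1" "T' ** T = mat 1"
    "(*v) T ` P \<subseteq> axes R" "(*v) T ` Q \<subseteq> axes (- R)"
proof -
  obtain R :: "'n set" where R: "card R = r" using obtain_subset_with_card_n[OF assms(4)] by blast
  have cR: "card (- R) = CARD('n) - r" using R by (simp add: Compl_eq_Diff_UNIV card_Diff_subset)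
  have sub: "vec.subspace P" "vec.subspace Q" using assms(1) by (auto simp: complementary_def)
  have iso: "\<exists>f. Vector_Spaces.linear (*s) (*s) f \<and> f ` S = axes L \<and> inj_on f S"
    if S: "vec.subspace S" "vec.dim S = card L" for S :: "(complex^'n) set" and L :: "'n set"
  proof -
    let ?C = "{axis l 1 |l. l \<in> L} :: (complex^'n) set"
    have C: "?C = (\<lambda>l. axis l 1) ` L" by blast
    have indC: "vec.independent ?C"
      by (rule vec.independent_mono[OF independent_cart_basis]) (auto simp: cart_basis_def)
    have cardC: "card ?C = card L" unfolding C by (rule card_image) (auto simp: inj_on_def axis_eq_axis)
    have dimC: "vec.dim (axes L :: (complex^'n) set) = card L"
      unfolding axes_def vec.dim_span_eq_card_independent[OF indC] by (rule cardC)
    obtain B where B: "B \<subseteq> S" "vec.independent B" "S \<subseteq> vec.span B" "card B = vec.dim S"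
      by (rule vec.basis_exists)
    have "vec.subspace (axes L :: (complex^'n) set)" by (simp add: axes_def)
    moreover have "?C \<subseteq> axes L" unfolding axes_def by (rule vec.span_superset)
    moreover have "axes L \<subseteq> vec.span ?C" unfolding axes_def by simp
    ultimately obtain f where "Vector_Spaces.linear (*s) (*s) f" "f ` S = axes L" "inj_on f S"
      using vec.basis_to_basis_subspace_isomorphism[OF S(1), of "axes L" B ?C] B indC cardC dimC S(2) by auto
    then show ?thesis by blast
  qed
  obtain f where f: "Vector_Spaces.linear (*s) (*s) f" "f ` P = axes R" "inj_on f P"
    using iso[OF sub(1), of R] assms(2) R by auto
  obtain g where g: "Vector_Spaces.linear (*s) (*s) g" "g ` Q = axes (- R)" "inj_on g Q"
    using iso[OF sub(2), of "- R"] assms(3) cR by auto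
  define t where "t v = f (proj_along P Q v) + g (proj_along Q P v)" for v
  have lp: "Vector_Spaces.linear (*s) (*s) (proj_along P Q)" "Vector_Spaces.linear (*s) (*s) (proj_along Q P)"
    using proj_along_linear assms(1) complementary_commute by blast+
  have lt: "Vector_Spaces.linear (*s) (*s) t"
    by (rule complex_linearI)
      (simp_all add: t_def vec.linear_add[OF f(1)] vec.linear_add[OF g(1)] vec.linear_add[OF lp(1)] vec.linear_add[OF lp(2)]
        vec.linear_scale[OF f(1)] vec.linear_scale[OF g(1)] vec.linear_scale[OF lp(1)] vec.linear_scale[OF lp(2)]
        vec.scale_right_distrib)
  have pP: "proj_along P Q v \<in> P" "proj_along Q P v \<in> Q" for v
    using proj_along_props assms(1) complementary_commute by blast+
  have ker: "v = 0" if "t v = 0" for v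
  proof -
    have "f (proj_along P Q v) = - g (proj_along Q P v)" using that by (simp add: t_def eq_neg_iff_add_eq_0)
    moreover have "f (proj_along P Q v) \<in> axes R" "g (proj_along Q P v) \<in> axes (- R)" using f(2) g(2) pP by blast+
    ultimately have "f (proj_along P Q v) \<in> axes R \<inter> axes (- R)"
      by (auto simp: axes_def intro: vec.span_neg)
    then have z: "f (proj_along P Q v) = 0" using complementary_axes[of R] by (auto simp: complementary_def)
    then have z': "g (proj_along Q P v) = 0" using that by (simp add: t_def)
    have "proj_along P Q v = 0"
      using inj_onD[OF f(3), of "proj_along P Q v" 0] z pP vec.linear_0[OF f(1)] vec.subspace_0[OF sub(1)] by simp
    moreover have "proj_along Q P v = 0"
      using inj_onD[OF g(3), of "proj_along Q P v" 0] z' pP vec.linear_0[OF g(1)] vec.subspace_0[OF sub(2)] by simp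
    ultimately show ?thesis using proj_along_swap[OF assms(1), of v] by simp
  qed
  define T where "T = matrix t"
  have T: "T *v v = t v" for v unfolding T_def by (rule matrix_works[OF lt])
  have "det T \<noteq> 0"
  proof -
    have "\<forall>x. T *v x = 0 \<longrightarrow> x = 0" using ker T by simp
    then obtain B where "B ** T = mat 1" using matrix_left_invertible_ker[of T] by blast
    then show ?thesis using invertible_det_nz matrix_left_right_inverse unfolding invertible_def by metis
  qed
  note inv = matrix_inv_mult[OF this]
  have "t v \<in> axes R" if "v \<in> P" for v
    using f(2) that unfolding t_def proj_along_in[OF assms(1) that] proj_along_zero[OF complementary_commute[OF assms(1)] that]
    by (auto simp: vec.linear_0[OF g(1)])
  moreover have "t v \<in> axes (- R)" if "v \<in> Q" for v
    using g(2) that unfolding t_def proj_along_in[OF complementary_commute[OF assms(1)] that] proj_along_zero[OF assms(1) that]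
    by (auto simp: vec.linear_0[OF f(1)])
  ultimately have "(*v) T ` P \<subseteq> axes R" "(*v) T ` Q \<subseteq> axes (- R)" by (auto simp: T)
  then show ?thesis by (rule that[OF inv])
qed

lemma matrix_has_derivative: "((*v) T has_derivative (*v) T) (at z)" for T :: "complex^'n::finite^'m::finite"
  by (rule bounded_linear_imp_has_derivative[OF bounded_bilinear.bounded_linear_right[OF bounded_bilinear_matrix_vector]])

lemma holomorphic_map_on_matrix: "open S \<Longrightarrow> holomorphic_map_on S ((*v) T)" for T :: "complex^'n::finite^'m::finite"
  by (rule holomorphic_map_onI) (use matrix_has_derivative vector_scalar_commute in metis)+

lemma holomorphic_map_on_add:
  fixes f g :: "complex^'n::finite \<Rightarrow> complex^'m::finite"
  assumes "open S" "holomorphic_map_on S f" "holomorphic_map_on S g"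
  shows "holomorphic_map_on S (\<lambda>z. f z + g z)"
  by (rule holomorphic_map_onI_nth[OF assms(1)])
    (simp add: line_holomorphic_on_add holomorphic_map_on_nth[OF assms(1)] assms)

text \<open>Let \<open>q1\<close> and \<open>q2\<close> be first integrals of \<open>N\<close> and
  \<open>F\<close> with values in the fibres of \<open>F\<close> and \<open>N\<close> at
  \<open>x\<close>. Their sum \<open>\<Phi>\<close> has the identity as derivative at \<open>x\<close>,
  so it is a local coordinate system. It maps \<open>N\<close> into the fixed fibre of \<open>N\<close>,
  as \<open>N\<close> is annihilated by the differential of \<open>q1\<close>, and likewise
  \<open>F\<close>. A linear isomorphism moves the two fixed fibres to coordinate subspaces. The new
  chart belongs to the atlas because the atlas is maximal.\<close>

lemma (in complex_manifold) product_chart_exists: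
  assumes int: "integrable_product_structure A r N F"
  obtains d R where "product_coords A N F d R" "x \<in> cdom d"
proof -
  have NF: "r \<le> CARD('n)" "holomorphic_subbundle A r N" "holomorphic_subbundle A (CARD('n) - r) F" "involutive A N" "involutive A F"
    and direct: "\<And>c z. c \<in> A \<Longrightarrow> z \<in> cim c \<Longrightarrow> N c z \<inter> F c z = {0} \<and> {a + b |a b. a \<in> N c z \<and> b \<in> F c z} = UNIV"
    using int unfolding integrable_product_structure_def almost_product_structure_def by auto
  have comp: "complementary (N c z) (F c z)" if "c \<in> A" "z \<in> cim c" for c z
    using direct[OF that] subbundle_subspace[OF NF(2) that] subbundle_subspace[OF NF(3) that]
    by (simp add: complementary_def)
  obtain c where c: "c \<in> A" "x \<in> cdom c" by (rule chart_cover)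
  define z0 where "z0 = coord c x"
  have z0: "z0 \<in> cim c" using c by (simp add: z0_def coord_in)
  note comp0 = comp[OF c(1) z0]
  obtain W1 q1 where W1: "open W1" "z0 \<in> W1" "W1 \<subseteq> cim c" "holomorphic_map_on W1 q1"
    and q1: "\<And>z v. z \<in> W1 \<Longrightarrow> v \<in> N c z \<Longrightarrow> FD q1 z v = 0"
    "\<And>v. FD q1 z0 v = v - proj_along (N c z0) (F c z0) v" "\<And>z v. z \<in> W1 \<Longrightarrow> FD q1 z v \<in> F c z0"
    by (rule bundle_first_integral[OF NF(2,4) c(1) z0 comp0]) (erule that, assumption+)
  obtain W2 q2 where W2: "open W2" "z0 \<in> W2" "W2 \<subseteq> cim c" "holomorphic_map_on W2 q2"
    and q2: "\<And>z v. z \<in> W2 \<Longrightarrow> v \<in> F c z \<Longrightarrow> FD q2 z v = 0"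
    "\<And>v. FD q2 z0 v = v - proj_along (F c z0) (N c z0) v" "\<And>z v. z \<in> W2 \<Longrightarrow> FD q2 z v \<in> N c z0"
    by (rule bundle_first_integral[OF NF(3,5) c(1) z0 complementary_commute[OF comp0]]) (erule that, assumption+)
  define W where "W = W1 \<inter> W2"
  have W: "open W" "z0 \<in> W" "W \<subseteq> cim c" using W1 W2 by (auto simp: W_def)
  define \<Phi> where "\<Phi> z = q1 z + q2 z" for z
  have hol\<Phi>: "holomorphic_map_on W \<Phi>"
    unfolding \<Phi>_def using W1(4) W2(4)
    by (intro holomorphic_map_on_add W(1)) (auto simp: W_def intro: holomorphic_map_on_subset)
  have FD\<Phi>: "FD \<Phi> z v = FD q1 z v + FD q2 z v" if "z \<in> W" for z v
  proof -
    have "(q1 has_derivative FD q1 z) (at z)" "(q2 has_derivative FD q2 z) (at z)"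
      using that W1(4) W2(4) by (auto simp: W_def intro: holomorphic_map_on_has_derivative)
    then have "((\<lambda>z. q1 z + q2 z) has_derivative (\<lambda>v. FD q1 z v + FD q2 z v)) (at z)"
      by (rule has_derivative_add)
    then show ?thesis unfolding \<Phi>_def[abs_def] by (rule fun_cong[OF FD_eqI])
  qed
  have id: "FD \<Phi> z0 v = v" for v
    unfolding FD\<Phi>[OF W(2)] q1(2) q2(2) proj_along_swap[OF comp0] by simp
  obtain U V g where U: "open U" "z0 \<in> U" "U \<subseteq> W" "open V" "homeomorphism U V \<Phi> g" "holomorphic_map_on V g"
    by (rule holomorphic_inverse_function[OF W(1,2) hol\<Phi> id]) (erule that, assumption+)
  obtain T T' :: "complex^'n^'n" and R :: "'n set" where T: "T ** T' = mat 1" "T' ** T = mat 1"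
    and TR: "(*v) T ` N c z0 \<subseteq> axes R" "(*v) T ` F c z0 \<subseteq> axes (- R)"
    by (rule straightening_isomorphism[OF comp0 conjunct2[OF subbundle_subspace[OF NF(2) c(1) z0]]
          conjunct2[OF subbundle_subspace[OF NF(3) c(1) z0]] NF(1)]) (erule that, assumption+)
  have TT: "T *v (T' *v v) = v" "T' *v (T *v v) = v" for v
    by (simp_all add: matrix_vector_mul_assoc T)
  have cT: "continuous_on S ((*v) M)" for S and M :: "complex^'n^'n"
    by (rule bounded_linear.continuous_on[OF bounded_bilinear.bounded_linear_right[OF bounded_bilinear_matrix_vector] continuous_on_id])
  let ?ic = "inv_into (cdom c) (coord c)"
  have Uc: "U \<subseteq> cim c" using U(3) W(3) by blast
  define dd where "dd = cdom c \<inter> coord c -` U"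
  have dd: "open dd" "dd \<subseteq> cdom c" "x \<in> dd"
    using continuous_open_preimage[OF continuous_coord[OF c(1)] open_cdom[OF c(1)] U(1)] U(2) c(2)
    by (auto simp: dd_def z0_def)
  have ddU: "coord c ` dd = U"
    using Uc by (force simp: dd_def cim_def)
  define d :: "('a, 'n) chart" where "d = (dd, \<lambda>y. T *v \<Phi> (coord c y))"
  have d: "cdom d = dd" "coord d y = T *v \<Phi> (coord c y)" for y by (simp_all add: d_def cdom_def coord_def)
  have cimd: "cim d = (*v) T ` V"
  proof -
    have "cim d = (*v) T ` \<Phi> ` coord c ` dd" unfolding cim_def d(1) by (auto simp: d(2))
    then show ?thesis unfolding ddU using U(5) by (simp add: homeomorphism_def)
  qed
  have h1: "homeomorphism dd U (coord c) ?ic"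
    by (rule homeomorphism_of_subsets[OF _ dd(2) _ ddU]) (use chart[OF c(1)] Uc in \<open>auto simp: is_chart_def\<close>)
  have h2: "homeomorphism V ((*v) T ` V) ((*v) T) ((*v) T')"
    unfolding homeomorphism_def by (auto simp: TT cT image_image)
  have "homeomorphism dd ((*v) T ` V) ((*v) T \<circ> (\<Phi> \<circ> coord c)) ((?ic \<circ> g) \<circ> (*v) T')"
    by (rule homeomorphism_compose[OF homeomorphism_compose[OF h1 U(5)] h2])
  then have hd: "homeomorphism dd (cim d) (coord d) ((?ic \<circ> g) \<circ> (*v) T')"
    by (rule homeomorphism_cong) (auto simp: cimd d(2))
  have injd: "inj_on (coord d) dd"
    by (rule inj_on_inverseI[of _ "(?ic \<circ> g) \<circ> (*v) T'"]) (use hd in \<open>auto simp: homeomorphism_def\<close>)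
  have invd: "inv_into dd (coord d) z = ?ic (g (T' *v z))" if "z \<in> cim d" for z
  proof -
    have 1: "?ic (g (T' *v z)) \<in> dd" "coord d (?ic (g (T' *v z))) = z"
      using hd that by (auto simp: homeomorphism_def)
    show ?thesis using inv_into_f_f[OF injd 1(1)] 1(2) by simp
  qed
  have chd: "is_chart d"
    unfolding is_chart_def d(1)
  proof (intro conjI dd(1))
    have "(*v) T ` V = (*v) T' -` V"
    proof
      show "(*v) T ` V \<subseteq> (*v) T' -` V" by (auto simp: TT)
      show "(*v) T' -` V \<subseteq> (*v) T ` V"
        by (rule subsetI, rule image_eqI[where x="T' *v _"]) (auto simp: TT)
    qed
    then show "open (cim d)" unfolding cimd using open_vimage[OF U(4) cT] by simp
    show "homeomorphism dd (cim d) (coord d) (inv_into dd (coord d))"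
      by (rule homeomorphism_cong[OF hd]) (auto simp: invd)
  qed
  have sub_eq: "coord d y \<in> (*v) T ` V" if "y \<in> dd" for y using that cimd by (auto simp: cim_def d(1))
  have T'V: "T' *v coord d y \<in> V" if "y \<in> dd" for y using sub_eq[OF that] by (auto simp: TT)
  have gd: "g (T' *v coord d y) = coord c y" if "y \<in> dd" for y
  proof -
    have "coord c y \<in> U" using that ddU by blast
    then show ?thesis using U(5) by (simp add: d(2) TT homeomorphism_def)
  qed
  have compat1: "compatible d e" "compatible e d" if e: "e \<in> A" for e
  proof -
    have ce: "open (coord e ` (cdom e \<inter> dd))" "open (coord c ` (dd \<inter> cdom e))"
      by (intro open_coord_image open_Int open_cdom dd(1) e c(1); use dd(2) in blast)+
    have od: "open (coord d ` (dd \<inter> cdom e))"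
    proof -
      have "coord d ` (dd \<inter> cdom e) = (*v) T' -` (V \<inter> g -` (coord c ` (dd \<inter> cdom e)))" (is "?L = ?R")
      proof
        show "?L \<subseteq> ?R"
        proof
          fix z assume "z \<in> ?L"
          then obtain y where y: "y \<in> dd" "y \<in> cdom e" "z = coord d y" by blast
          then have "T' *v z \<in> V" using sub_eq[OF y(1)] by (auto simp: TT)
          then show "z \<in> ?R" using gd[OF y(1)] y by auto
        qed
        show "?R \<subseteq> ?L"
        proof
          fix z assume "z \<in> ?R"
          then obtain y where y: "T' *v z \<in> V" "y \<in> dd" "y \<in> cdom e" "g (T' *v z) = coord c y" by auto
          then have "T' *v z = \<Phi> (coord c y)" using U(5) by (metis homeomorphism_apply2)
          then have "z = coord d y" unfolding d(2) by (metis TT(1))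
          then show "z \<in> ?L" using y by blast
        qed
      qed
      moreover have "open (V \<inter> g -` (coord c ` (dd \<inter> cdom e)))"
        using U(5) ce(2) by (intro continuous_open_preimage U(4)) (auto simp: homeomorphism_def)
      ultimately show ?thesis using open_vimage[OF _ cT] by metis
    qed
    have "holomorphic_map_on (coord d ` (dd \<inter> cdom e)) (transition c e \<circ> (g \<circ> (*v) T'))"
    proof (rule holomorphic_map_on_compose[OF od _ _ transition_holomorphic[OF c(1) e]])
      show "holomorphic_map_on (coord d ` (dd \<inter> cdom e)) (g \<circ> (*v) T')"
        by (rule holomorphic_map_on_compose[OF od _ holomorphic_map_on_matrix[OF od] U(6)])
          (use T'V in auto)
      show "(g \<circ> (*v) T') ` coord d ` (dd \<inter> cdom e) \<subseteq> coord c ` (cdom c \<inter> cdom e)"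
        using gd dd(2) by auto
    qed
    then have d1: "holomorphic_map_on (coord d ` (dd \<inter> cdom e)) (transition d e)"
    proof (rule holomorphic_map_on_cong[OF od, rotated])
      fix z assume "z \<in> coord d ` (dd \<inter> cdom e)"
      then obtain y where y: "y \<in> dd" "y \<in> cdom e" "z = coord d y" by blast
      then show "(transition c e \<circ> (g \<circ> (*v) T')) z = transition d e z"
        using gd[OF y(1)] dd(2) inv_into_f_f[OF injd y(1)]
        by (simp add: transition_coord[OF c(1)] subset_iff) (simp add: transition_def d(1))
    qed
    have "holomorphic_map_on (coord e ` (cdom e \<inter> dd)) (((*v) T \<circ> \<Phi>) \<circ> transition e c)"
    proof (rule holomorphic_map_on_compose[OF ce(1)])
      show "holomorphic_map_on (coord e ` (cdom e \<inter> dd)) (transition e c)"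
        by (rule holomorphic_map_on_subset[OF transition_holomorphic[OF e c(1)]]) (use dd(2) in blast)
      show "holomorphic_map_on U ((*v) T \<circ> \<Phi>)"
        by (rule holomorphic_map_on_compose[OF U(1) _ holomorphic_map_on_subset[OF hol\<Phi> U(3)] holomorphic_map_on_matrix[OF open_UNIV]]) auto
      show "transition e c ` coord e ` (cdom e \<inter> dd) \<subseteq> U"
        using ddU by (auto simp: transition_coord[OF e])
    qed
    then have d2: "holomorphic_map_on (coord e ` (cdom e \<inter> dd)) (transition e d)"
    proof (rule holomorphic_map_on_cong[OF ce(1), rotated])
      fix z assume "z \<in> coord e ` (cdom e \<inter> dd)"
      then obtain y where y: "y \<in> dd" "y \<in> cdom e" "z = coord e y" by blast
      then show "(((*v) T \<circ> \<Phi>) \<circ> transition e c) z = transition e d z"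
        by (simp add: transition_coord[OF e] d(2))
    qed
    show "compatible d e" "compatible e d"
      using d1 d2 by (simp_all add: compatible_def d(1) Int_commute)
  qed
  have dA: "d \<in> A" using complex_structure chd compat1 unfolding complex_structure_def by blast
  have jac: "jac c d y v = T *v FD \<Phi> (coord c y) v" if y: "y \<in> dd" for y v
  proof -
    have cy: "coord c y \<in> U" using y ddU by blast
    have "(\<Phi> has_derivative FD \<Phi> (coord c y)) (at (coord c y))"
      using cy U(3) by (intro holomorphic_map_on_has_derivative[OF hol\<Phi>]) auto
    then have "((\<lambda>z. T *v \<Phi> z) has_derivative (\<lambda>v. T *v FD \<Phi> (coord c y) v)) (at (coord c y))"
      by (rule has_derivative_compose[OF _ matrix_has_derivative])
    then have "(transition c d has_derivative (\<lambda>v. T *v FD \<Phi> (coord c y) v)) (at (coord c y))"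
      by (rule has_derivative_transform_within_open[OF _ U(1) cy])
        (use ddU dd(2) in \<open>auto simp: transition_coord[OF c(1)] d(2) subset_iff\<close>)
    then show ?thesis unfolding jac_def by (rule fun_cong[OF FD_eqI])
  qed
  have "N d z = axes R \<and> F d z = axes (- R)" if z: "z \<in> cim d" for z
  proof -
    obtain y where y: "y \<in> dd" "z = coord d y" using z by (auto simp: cim_def d(1))
    have yc: "y \<in> cdom c \<inter> cdom d" using y dd(2) by (auto simp: d(1))
    have cy: "coord c y \<in> W" using y ddU U(3) by blast
    have cy': "coord c y \<in> W1" "coord c y \<in> W2" using cy by (auto simp: W_def)
    have sN: "N d z \<subseteq> axes R"
    proof
      fix u assume "u \<in> N d z"
      then obtain v where v: "v \<in> N c (coord c y)" "u = jac c d y v"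
        using subbundle_jac[OF NF(2) c(1) dA yc] y(2) by auto
      have "FD \<Phi> (coord c y) v \<in> N c z0" using FD\<Phi>[OF cy] q1(1)[OF cy'(1) v(1)] q2(3)[OF cy'(2)] by simp
      then show "u \<in> axes R" using TR(1) v(2) jac[OF y(1)] by auto
    qed
    have sF: "F d z \<subseteq> axes (- R)"
    proof
      fix u assume "u \<in> F d z"
      then obtain v where v: "v \<in> F c (coord c y)" "u = jac c d y v"
        using subbundle_jac[OF NF(3) c(1) dA yc] y(2) by auto
      have "FD \<Phi> (coord c y) v \<in> F c z0" using FD\<Phi>[OF cy] q2(1)[OF cy'(2) v(1)] q1(3)[OF cy'(1)] by simp
      then show "u \<in> axes (- R)" using TR(2) v(2) jac[OF y(1)] by auto
    qed
    have cz: "complementary (N d z) (F d z)" by (rule comp[OF dA z])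
    show ?thesis
      using complementary_subset_eq[OF cz complementary_axes sN sF]
        complementary_subset_eq[OF complementary_commute[OF cz] complementary_commute[OF complementary_axes] sF sN] by blast
  qed
  then have "product_coords A N F d R" using dA by (auto simp: product_coords_def axes_def)
  then show ?thesis using that dd(3) d(1) by blast
qed

section \<open>Exterior algebra on lists\<close>

abbreviation drop_at :: "nat \<Rightarrow> 'b list \<Rightarrow> 'b list" where
  "drop_at i xs \<equiv> take i xs @ drop (Suc i) xs"

definition antisymmetric :: "nat \<Rightarrow> ('b list \<Rightarrow> complex) \<Rightarrow> bool" where
  "antisymmetric k Y \<longleftrightarrow> (\<forall>xs a b ys. length xs + length ys + 2 = k \<longrightarrow> Y (xs @ a # b # ys) = - Y (xs @ b # a # ys))"

lemma antisymmetric_move: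
  assumes "antisymmetric k Y" "length xs + length ys + length zs + 1 = k"
  shows "Y (xs @ a # ys @ zs) = (-1) ^ length ys * Y (xs @ ys @ a # zs)"
  using assms(2)
proof (induction ys arbitrary: xs)
  case (Cons b ys)
  have "Y (xs @ a # b # (ys @ zs)) = - Y (xs @ b # a # (ys @ zs))"
    using assms(1)[unfolded antisymmetric_def, rule_format, of xs "ys @ zs" a b] Cons.prems by simp
  also have "Y (xs @ b # a # (ys @ zs)) = (-1) ^ length ys * Y ((xs @ [b]) @ ys @ a # zs)"
    using Cons.IH[of "xs @ [b]"] Cons.prems by simp
  finally show ?case by simp
qed simp

lemma antisymmetric_move_front:
  assumes "antisymmetric (Suc k) Y" "length js = k" "i \<le> k"
  shows "Y (take i js @ l # drop i js) = (-1) ^ i * Y (l # js)"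
proof -
  have "Y (l # take i js @ drop i js) = (-1) ^ i * Y (take i js @ l # drop i js)"
    using antisymmetric_move[OF assms(1), of "[]" "take i js" "drop i js" l] assms(2,3) by simp
  then have "(-1) ^ i * Y (l # js) = ((-1) ^ i * (-1) ^ i) * Y (take i js @ l # drop i js)"
    by (simp add: mult.assoc)
  then show ?thesis by (simp flip: power_add)
qed

lemma antisymmetric_Cons:
  fixes Y :: "'b list \<Rightarrow> complex"
  assumes "antisymmetric (Suc k) Y"
  shows "antisymmetric k (\<lambda>js. Y (j # js))"
  unfolding antisymmetric_def
proof (intro allI impI)
  fix xs ys :: "'b list" and a b assume "length xs + length ys + 2 = k"
  then show "Y (j # xs @ a # b # ys) = - Y (j # xs @ b # a # ys)"
    using assms[unfolded antisymmetric_def, rule_format, of "j # xs" ys a b] by simp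
qed

abbreviation lists_of :: "nat \<Rightarrow> 'n list set" where
  "lists_of k \<equiv> {js. length js = k}"

lemma finite_lists_of [simp]: "finite (lists_of k :: 'n::finite list set)"
  using finite_lists_length_eq[of "UNIV :: 'n set" k] by simp

lemma sum_lists_of_insert:
  fixes f :: "'n::finite list \<Rightarrow> complex"
  assumes "i \<le> k"
  shows "(\<Sum>js\<in>lists_of (Suc k). f js) = (\<Sum>j\<in>UNIV. \<Sum>js\<in>lists_of k. f (take i js @ j # drop i js))"
proof -
  have "(\<Sum>p\<in>UNIV \<times> lists_of k. f (take i (snd p) @ fst p # drop i (snd p))) = (\<Sum>js\<in>lists_of (Suc k). f js)"
  proof (rule sum.reindex_bij_witness[where i="\<lambda>js. (js ! i, drop_at i js)" and j="\<lambda>p. take i (snd p) @ fst p # drop i (snd p)"])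
    fix js :: "'n list" assume js: "js \<in> lists_of (Suc k)"
    then show "take i (snd (js ! i, drop_at i js)) @ fst (js ! i, drop_at i js) # drop i (snd (js ! i, drop_at i js)) = js"
      using assms id_take_nth_drop[of i js] by (simp add: min_def)
    show "(js ! i, drop_at i js) \<in> UNIV \<times> lists_of k" using js assms by (simp add: min_def)
  next
    fix p :: "'n \<times> 'n list" assume p: "p \<in> UNIV \<times> lists_of k"
    then show "((take i (snd p) @ fst p # drop i (snd p)) ! i, drop_at i (take i (snd p) @ fst p # drop i (snd p))) = p"
      using assms by (auto simp: nth_append min_def)
    show "take i (snd p) @ fst p # drop i (snd p) \<in> lists_of (Suc k)" using p by auto
  qed auto
  then show ?thesis by (simp add: sum.cartesian_product case_prod_beta)
qed

lemma sum_lists_of_Suc: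
  fixes f :: "'n::finite list \<Rightarrow> complex"
  shows "(\<Sum>js\<in>lists_of (Suc k). f js) = (\<Sum>j\<in>UNIV. \<Sum>js\<in>lists_of k. f (j # js))"
  using sum_lists_of_insert[of 0 k f] by simp

subsection \<open>Raising indices\<close>

text \<open>The action of a matrix on all indices of a coefficient family: \<open>M\<close> may be an inverse metric or a
  Jacobian matrix.\<close>

primrec raise :: "complex^'n::finite^'n \<Rightarrow> ('n list \<Rightarrow> complex) \<Rightarrow> 'n list \<Rightarrow> complex" where
  "raise M Y [] = Y []"
| "raise M Y (j # js) = (\<Sum>k\<in>UNIV. M $ k $ j * raise M (\<lambda>ks. Y (k # ks)) js)"

lemma raise_eq_sum:
  "raise M Y js = (\<Sum>ks\<in>lists_of (length js). (\<Prod>i<length js. M $ (ks ! i) $ (js ! i)) * Y ks)"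
proof (induction js arbitrary: Y)
  case (Cons j js)
  have "raise M Y (j # js) = (\<Sum>k\<in>UNIV. M $ k $ j * (\<Sum>ks\<in>lists_of (length js). (\<Prod>i<length js. M $ (ks ! i) $ (js ! i)) * Y (k # ks)))"
    by (simp add: Cons.IH)
  also have "\<dots> = (\<Sum>k\<in>UNIV. \<Sum>ks\<in>lists_of (length js). (\<Prod>i<Suc (length js). M $ ((k # ks) ! i) $ ((j # js) ! i)) * Y (k # ks))"
    unfolding prod.lessThan_Suc_shift by (simp add: sum_distrib_left mult.assoc)
  also have "\<dots> = (\<Sum>ks\<in>lists_of (Suc (length js)). (\<Prod>i<Suc (length js). M $ (ks ! i) $ ((j # js) ! i)) * Y ks)"
    by (rule sum_lists_of_Suc[symmetric])
  finally show ?case by simp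
qed simp

lemma raise_sum: "raise M (\<lambda>ks. \<Sum>l\<in>L. Y l ks) js = (\<Sum>l\<in>L. raise M (Y l) js)"
proof (induction js arbitrary: Y)
  case (Cons j js)
  show ?case unfolding raise.simps Cons.IH sum_distrib_left by (rule sum.swap)
qed simp

lemma raise_scale: "raise M (\<lambda>ks. c * Y ks) js = c * raise M Y js"
  by (induction js arbitrary: Y) (simp_all add: sum_distrib_left mult.left_commute)

lemma raise_zero: "raise M (\<lambda>ks. 0) js = 0"
  using raise_scale[of M 0 "\<lambda>_. 0" js] by simp

lemma raise_cong: "(\<And>ks. length ks = length js \<Longrightarrow> Y ks = Z ks) \<Longrightarrow> raise M Y js = raise M Z js"
  unfolding raise_eq_sum by simp

lemma raise_raise: "raise S (raise T Y) js = raise (T ** S) Y js"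
proof (induction js arbitrary: Y)
  case (Cons j js)
  have "raise S (raise T Y) (j # js)
      = (\<Sum>k\<in>UNIV. S $ k $ j * raise S (\<lambda>ks. \<Sum>l\<in>UNIV. T $ l $ k * raise T (\<lambda>ls. Y (l # ls)) ks) js)"
    by simp
  also have "\<dots> = (\<Sum>k\<in>UNIV. S $ k $ j * (\<Sum>l\<in>UNIV. T $ l $ k * raise (T ** S) (\<lambda>ls. Y (l # ls)) js))"
    by (simp add: raise_sum raise_scale Cons.IH)
  also have "\<dots> = (\<Sum>l\<in>UNIV. \<Sum>k\<in>UNIV. T $ l $ k * S $ k $ j * raise (T ** S) (\<lambda>ls. Y (l # ls)) js)"
    unfolding sum_distrib_left by (subst sum.swap) (simp add: ac_simps)
  also have "\<dots> = raise (T ** S) Y (j # js)"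
    by (simp add: matrix_matrix_mult_def sum_distrib_right)
  finally show ?case .
qed simp

lemma raise_id: "raise (mat 1) Y js = Y js"
proof (induction js arbitrary: Y)
  case (Cons j js)
  have "raise (mat 1) Y (j # js) = (\<Sum>k\<in>UNIV. if k = j then Y (k # js) else 0)"
    unfolding raise.simps Cons.IH by (intro sum.cong refl) (simp add: mat_def)
  then show ?case by simp
qed simp

lemma raise_pairing:
  "(\<Sum>js\<in>lists_of k. raise M X js * Z js) = (\<Sum>js\<in>lists_of k. X js * raise (transpose M) Z js)"
proof -
  have "(\<Sum>js\<in>lists_of k. raise M X js * Z js)
      = (\<Sum>js\<in>lists_of k. \<Sum>ks\<in>lists_of k. (\<Prod>i<k. M $ (ks ! i) $ (js ! i)) * X ks * Z js)"
    by (intro sum.cong) (auto simp: raise_eq_sum sum_distrib_right)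
  also have "\<dots> = (\<Sum>ks\<in>lists_of k. \<Sum>js\<in>lists_of k. (\<Prod>i<k. M $ (ks ! i) $ (js ! i)) * X ks * Z js)"
    by (rule sum.swap)
  also have "\<dots> = (\<Sum>js\<in>lists_of k. X js * raise (transpose M) Z js)"
    by (intro sum.cong) (auto simp: raise_eq_sum transpose_def sum_distrib_left ac_simps)
  finally show ?thesis .
qed

lemma raise_antisymmetric:
  assumes "antisymmetric k Y" shows "antisymmetric k (raise M Y)"
  unfolding antisymmetric_def
proof (intro allI impI)
  fix xs ys :: "'a list" and a b :: 'a assume "length xs + length ys + 2 = k"
  with assms show "raise M Y (xs @ a # b # ys) = - raise M Y (xs @ b # a # ys)"
  proof (induction xs arbitrary: k Y)
    case Nil
    have Y: "Y (l # m # ks) = - Y (m # l # ks)" if "length ks = length ys" for l m ks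
      using Nil(1)[unfolded antisymmetric_def, rule_format, of "[]" ks l m] Nil(2) that by simp
    have "raise M Y (a # b # ys) = (\<Sum>l\<in>UNIV. \<Sum>m\<in>UNIV. M $ l $ a * (M $ m $ b * raise M (\<lambda>ks. Y (l # m # ks)) ys))"
      by (simp add: sum_distrib_left)
    also have "\<dots> = (\<Sum>l\<in>UNIV. \<Sum>m\<in>UNIV. - (M $ m $ b * (M $ l $ a * raise M (\<lambda>ks. Y (m # l # ks)) ys)))"
    proof (intro sum.cong refl)
      fix l m
      have "raise M (\<lambda>ks. Y (l # m # ks)) ys = raise M (\<lambda>ks. (-1) * Y (m # l # ks)) ys"
        by (rule raise_cong, subst Y) auto
      then show "M $ l $ a * (M $ m $ b * raise M (\<lambda>ks. Y (l # m # ks)) ys)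
          = - (M $ m $ b * (M $ l $ a * raise M (\<lambda>ks. Y (m # l # ks)) ys))"
        unfolding raise_scale by simp
    qed
    also have "\<dots> = - (\<Sum>m\<in>UNIV. \<Sum>l\<in>UNIV. M $ m $ b * (M $ l $ a * raise M (\<lambda>ks. Y (m # l # ks)) ys))"
      by (subst sum.swap) (simp add: sum_negf)
    also have "\<dots> = - raise M Y (b # a # ys)" by (simp add: sum_distrib_left)
    finally show ?case by simp
  next
    case (Cons x xs)
    obtain k' where k: "k = Suc k'" using Cons.prems by (cases k) auto
    have "raise M (\<lambda>ks. Y (j # ks)) (xs @ a # b # ys) = - raise M (\<lambda>ks. Y (j # ks)) (xs @ b # a # ys)" for j
      using Cons.IH[OF antisymmetric_Cons[OF Cons.prems(1)[unfolded k]], of j] Cons.prems(2) k by simp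
    then show ?case by (simp add: sum_negf)
  qed
qed

subsection \<open>Alternating forms\<close>

lemma alternating_form_length: "alternating_form k \<alpha> \<Longrightarrow> length vs \<noteq> k \<Longrightarrow> \<alpha> vs = 0"
  by (auto simp: alternating_form_def)

lemma alternating_form_lin:
  "alternating_form k \<alpha> \<Longrightarrow> length vs = k \<Longrightarrow> i < k \<Longrightarrow>
    \<alpha> (vs[i := a *s v + w]) = a * \<alpha> (vs[i := v]) + \<alpha> (vs[i := w])"
  by (auto simp: alternating_form_def)

lemma alternating_form_eq:
  "alternating_form k \<alpha> \<Longrightarrow> length vs = k \<Longrightarrow> i < j \<Longrightarrow> j < k \<Longrightarrow> vs ! i = vs ! j \<Longrightarrow> \<alpha> vs = 0"
  unfolding alternating_form_def by blast

lemma alternating_form_slot_zero: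
  assumes "alternating_form k \<alpha>" "length vs = k" "i < k"
  shows "\<alpha> (vs[i := 0]) = 0"
  using alternating_form_lin[OF assms, of 1 0 0] by simp

lemma alternating_form_slot_add:
  assumes "alternating_form k \<alpha>" "length vs = k" "i < k"
  shows "\<alpha> (vs[i := v + w]) = \<alpha> (vs[i := v]) + \<alpha> (vs[i := w])"
  using alternating_form_lin[OF assms, of 1 v w] by simp

lemma alternating_form_slot_scale:
  assumes "alternating_form k \<alpha>" "length vs = k" "i < k"
  shows "\<alpha> (vs[i := a *s v]) = a * \<alpha> (vs[i := v])"
  using alternating_form_lin[OF assms, of a v 0] alternating_form_slot_zero[OF assms] by simp

lemma alternating_form_slot_sum:
  assumes "alternating_form k \<alpha>" "length vs = k" "i < k"
  shows "\<alpha> (vs[i := (\<Sum>j\<in>J. f j)]) = (\<Sum>j\<in>J. \<alpha> (vs[i := f j]))"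
  by (induction J rule: infinite_finite_induct)
    (simp_all add: alternating_form_slot_zero[OF assms] alternating_form_slot_add[OF assms])

lemma alternating_form_antisymmetric:
  assumes "alternating_form k \<alpha>" shows "antisymmetric k \<alpha>"
  unfolding antisymmetric_def
proof (intro allI impI)
  fix xs ys :: "(complex^'a) list" and a b :: "complex^'a" assume len: "length xs + length ys + 2 = k"
  let ?i = "length xs"
  have upd: "(xs @ u # w # ys)[?i := u'] = xs @ u' # w # ys" "(xs @ u # w # ys)[Suc ?i := u'] = xs @ u # u' # ys"
    for u w u' by (simp_all add: list_update_append)
  have add1: "\<alpha> (xs @ (u + u') # w # ys) = \<alpha> (xs @ u # w # ys) + \<alpha> (xs @ u' # w # ys)" for u u' w
    using alternating_form_slot_add[OF assms, of "xs @ u # w # ys" ?i u u'] len by (simp add: upd)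
  have add2: "\<alpha> (xs @ w # (u + u') # ys) = \<alpha> (xs @ w # u # ys) + \<alpha> (xs @ w # u' # ys)" for u u' w
    using alternating_form_slot_add[OF assms, of "xs @ w # u # ys" "Suc ?i" u u'] len by (simp add: upd)
  have z: "\<alpha> (xs @ u # u # ys) = 0" for u
    by (rule alternating_form_eq[OF assms, of _ ?i "Suc ?i"]) (use len in \<open>auto simp: nth_append\<close>)
  have "0 = \<alpha> (xs @ (a + b) # (a + b) # ys)" by (simp add: z)
  also have "\<dots> = \<alpha> (xs @ a # b # ys) + \<alpha> (xs @ b # a # ys)" unfolding add1 unfolding add2 unfolding z by simp
  finally have "0 = \<alpha> (xs @ a # b # ys) + \<alpha> (xs @ b # a # ys)" .
  from this[symmetric] show "\<alpha> (xs @ a # b # ys) = - \<alpha> (xs @ b # a # ys)" by (simp only: eq_neg_iff_add_eq_0)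
qed

lemma alternating_form_zero: "alternating_form k (\<lambda>vs. 0)"
  by (auto simp: alternating_form_def)

lemma alternating_form_add: "alternating_form k \<alpha> \<Longrightarrow> alternating_form k \<beta> \<Longrightarrow> alternating_form k (\<lambda>vs. \<alpha> vs + \<beta> vs)"
  by (auto simp: alternating_form_def algebra_simps)

lemma alternating_form_scale: "alternating_form k \<alpha> \<Longrightarrow> alternating_form k (\<lambda>vs. c * \<alpha> vs)"
  by (auto simp: alternating_form_def algebra_simps)

lemma alternating_form_sum:
  "(\<And>i. i \<in> I \<Longrightarrow> alternating_form k (f i)) \<Longrightarrow> alternating_form k (\<lambda>vs. \<Sum>i\<in>I. f i vs)"
  by (induction I rule: infinite_finite_induct) (auto intro: alternating_form_zero alternating_form_add)

lemma alternating_form_map: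
  assumes "alternating_form k \<alpha>" "Vector_Spaces.linear (*s) (*s) L"
  shows "alternating_form k (\<lambda>vs. \<alpha> (map L vs))"
  unfolding alternating_form_def
proof (intro conjI allI impI)
  fix vs :: "(complex^'b) list" and i j
  show "\<alpha> (map L vs) = 0" if "length vs \<noteq> k" using alternating_form_length[OF assms(1)] that by simp
  show "\<alpha> (map L (vs[i := a *s v + w])) = a * \<alpha> (map L (vs[i := v])) + \<alpha> (map L (vs[i := w]))"
    if "length vs = k \<and> i < k" for a v w
    using alternating_form_lin[OF assms(1), of "map L vs" i a "L v" "L w"] that
    by (simp add: map_update vec.linear_add[OF assms(2)] vec.linear_scale[OF assms(2)])
  show "\<alpha> (map L vs) = 0" if "length vs = k \<and> i < j \<and> j < k \<and> vs ! i = vs ! j"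
    using alternating_form_eq[OF assms(1), of "map L vs" i j] that by simp
qed

abbreviation axis_list :: "'n list \<Rightarrow> (complex^'n::finite) list" where
  "axis_list js \<equiv> map (\<lambda>j. axis j 1) js"

text \<open>The arguments are expanded one after the other, by induction on the number \<open>m\<close>
  of those already expanded.\<close>

lemma alternating_form_expand:
  assumes \<alpha>: "alternating_form k \<alpha>" and vs: "length vs = k"
  shows "\<alpha> vs = (\<Sum>js\<in>lists_of k. (\<Prod>i<k. (vs ! i) $ (js ! i)) * \<alpha> (axis_list js))"
proof -
  have "\<alpha> vs = (\<Sum>js\<in>lists_of m. (\<Prod>i<m. (vs ! i) $ (js ! i)) * \<alpha> (axis_list js @ drop m vs))" if "m \<le> k" for m
    using that
  proof (induction m)
    case (Suc m)
    have slot: "\<alpha> (axis_list js @ drop m vs) = (\<Sum>j\<in>UNIV. (vs ! m) $ j * \<alpha> (axis_list (js @ [j]) @ drop (Suc m) vs))"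
      if js: "length js = m" for js
    proof -
      have m: "m < length vs" using Suc.prems vs by simp
      let ?w = "axis_list js @ drop m vs"
      have len: "length ?w = k" "m < k" using js vs Suc.prems by auto
      have upd: "?w[m := x] = axis_list js @ x # drop (Suc m) vs" for x
        using js m by (simp add: list_update_append Cons_nth_drop_Suc[symmetric])
      have "\<alpha> ?w = \<alpha> (?w[m := (\<Sum>j\<in>UNIV. (vs ! m) $ j *s axis j 1)])"
        unfolding upd basis_expansion using Cons_nth_drop_Suc[OF m] by simp
      also have "\<dots> = (\<Sum>j\<in>UNIV. (vs ! m) $ j * \<alpha> (?w[m := axis j 1]))"
        unfolding alternating_form_slot_sum[OF \<alpha> len] alternating_form_slot_scale[OF \<alpha> len] ..
      finally show ?thesis unfolding upd by simp
    qed
    have "\<alpha> vs = (\<Sum>js\<in>lists_of m. \<Sum>j\<in>UNIV. (\<Prod>i<m. (vs ! i) $ (js ! i)) * ((vs ! m) $ j * \<alpha> (axis_list (js @ [j]) @ drop (Suc m) vs)))"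
      using Suc.IH Suc.prems by (simp add: slot sum_distrib_left)
    also have "\<dots> = (\<Sum>j\<in>UNIV. \<Sum>js\<in>lists_of m. (\<Prod>i<Suc m. (vs ! i) $ ((take m js @ j # drop m js) ! i)) *
        \<alpha> (axis_list (take m js @ j # drop m js) @ drop (Suc m) vs))"
      by (subst sum.swap) (intro sum.cong refl, simp add: nth_append)
    also have "\<dots> = (\<Sum>js\<in>lists_of (Suc m). (\<Prod>i<Suc m. (vs ! i) $ (js ! i)) * \<alpha> (axis_list js @ drop (Suc m) vs))"
      by (rule sum_lists_of_insert[symmetric]) simp
    finally show ?case .
  qed simp
  from this[of k] show ?thesis using vs by (simp cong: sum.cong)
qed

lemma alternating_form_ext:
  assumes "alternating_form k \<alpha>" "alternating_form k \<beta>" "\<And>js. length js = k \<Longrightarrow> \<alpha> (axis_list js) = \<beta> (axis_list js)"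
  shows "\<alpha> = \<beta>"
proof
  fix vs show "\<alpha> vs = \<beta> vs"
  proof (cases "length vs = k")
    case True
    then show ?thesis unfolding alternating_form_expand[OF assms(1) True] alternating_form_expand[OF assms(2) True]
      using assms(3) by simp
  qed (simp add: alternating_form_length[OF assms(1)] alternating_form_length[OF assms(2)])
qed

lemma raise_map_linear:
  assumes "alternating_form k \<alpha>" "Vector_Spaces.linear (*s) (*s) L" "length js = k"
  shows "\<alpha> (map L (axis_list js)) = raise (matrix L) (\<lambda>ks. \<alpha> (axis_list ks)) js"
proof -
  have "\<alpha> (map L (axis_list js)) = (\<Sum>ks\<in>lists_of k. (\<Prod>i<k. (map L (axis_list js) ! i) $ (ks ! i)) * \<alpha> (axis_list ks))"
    by (rule alternating_form_expand[OF assms(1)]) (simp add: assms(3))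
  also have "\<dots> = raise (matrix L) (\<lambda>ks. \<alpha> (axis_list ks)) js"
    using assms(3) by (simp add: raise_eq_sum matrix_def)
  finally show ?thesis .
qed

lemma drop_at_update: "i < length vs \<Longrightarrow> m < length vs \<Longrightarrow> i \<noteq> m \<Longrightarrow>
    drop_at i (vs[m := x]) = (drop_at i vs)[(if m < i then m else m - 1) := x]"
  by (rule nth_equalityI) (auto simp: nth_append nth_list_update min_def split: if_splits)

lemma nth_drop_at: "i < length vs \<Longrightarrow> m < length vs - 1 \<Longrightarrow> drop_at i vs ! m = (if m < i then vs ! m else vs ! Suc m)"
  by (auto simp: nth_append min_def)

lemma length_drop_at: "i < length vs \<Longrightarrow> length (drop_at i vs) = length vs - 1"
  by (auto simp: min_def)

text \<open>In the sum defining \<open>dz_wedge l \<alpha> vs\<close> with two equal arguments, only the terms omitting one of them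
  survive; they differ by moving a vector past the arguments in between, and cancel.\<close>

lemma dz_wedge_alternating:
  assumes \<alpha>: "alternating_form k \<alpha>"
  shows "alternating_form (Suc k) (dz_wedge l \<alpha>)"
  unfolding alternating_form_def
proof (intro conjI allI impI)
  fix vs :: "(complex^'a) list"
  assume "length vs \<noteq> Suc k"
  then show "dz_wedge l \<alpha> vs = 0"
    unfolding dz_wedge_def by (intro sum.neutral) (auto intro!: alternating_form_length[OF \<alpha>])
next
  fix vs :: "(complex^'a) list" and m a v w
  assume h: "length vs = Suc k \<and> m < Suc k"
  let ?t = "\<lambda>x i. (-1) ^ i * (vs[m := x] ! i) $ l * \<alpha> (drop_at i (vs[m := x]))"
  have "?t (a *s v + w) i = a * ?t v i + ?t w i" if i: "i < Suc k" for i
  proof (cases "i = m")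
    case True
    then show ?thesis using h by (simp add: algebra_simps)
  next
    case False
    let ?m = "if m < i then m else m - 1"
    have "\<alpha> ((drop_at i vs)[?m := a *s v + w]) = a * \<alpha> ((drop_at i vs)[?m := v]) + \<alpha> ((drop_at i vs)[?m := w])"
      by (rule alternating_form_lin[OF \<alpha>]) (use h i False in \<open>auto simp: length_drop_at\<close>)
    moreover have "drop_at i (vs[m := x]) = (drop_at i vs)[?m := x]" for x
      by (rule drop_at_update) (use h i False in auto)
    ultimately show ?thesis using False by (simp add: algebra_simps)
  qed
  then show "dz_wedge l \<alpha> (vs[m := a *s v + w]) = a * dz_wedge l \<alpha> (vs[m := v]) + dz_wedge l \<alpha> (vs[m := w])"
  proof -
    assume *: "\<And>i. i < Suc k \<Longrightarrow> ?t (a *s v + w) i = a * ?t v i + ?t w i"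
    have "(\<Sum>i<Suc k. ?t (a *s v + w) i) = (\<Sum>i<Suc k. a * ?t v i + ?t w i)"
      by (rule sum.cong[OF refl], rule *) simp
    also have "\<dots> = a * (\<Sum>i<Suc k. ?t v i) + (\<Sum>i<Suc k. ?t w i)"
      by (simp only: sum.distrib sum_distrib_left)
    finally show ?thesis using h unfolding dz_wedge_def length_list_update by (simp only:)
  qed
next
  fix vs :: "(complex^'a) list" and p q
  assume h: "length vs = Suc k \<and> p < q \<and> q < Suc k \<and> vs ! p = vs ! q"
  let ?t = "\<lambda>i. (-1) ^ i * (vs ! i) $ l * \<alpha> (drop_at i vs)"
  have zero: "?t i = 0" if "i < Suc k" "i \<noteq> p" "i \<noteq> q" for i
  proof -
    have "\<alpha> (drop_at i vs) = 0"
      by (rule alternating_form_eq[OF \<alpha>, of _ "if p < i then p else p - 1" "if q < i then q else q - 1"])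
        (use h that in \<open>auto simp: length_drop_at nth_drop_at simp del: One_nat_def\<close>)
    then show ?thesis by simp
  qed
  define xs ys zs where "xs = take p vs" and "ys = take (q - p - 1) (drop (Suc p) vs)" and "zs = drop (Suc q) vs"
  have len: "length xs = p" "length ys = q - p - 1" "length zs = k - q" using h by (auto simp: xs_def ys_def zs_def)
  have dq: "drop (Suc p) vs = ys @ vs ! q # zs"
  proof -
    have "q - p - 1 < length (drop (Suc p) vs)" using h by (simp, linarith)
    from id_take_nth_drop[OF this] show ?thesis using h by (simp add: ys_def zs_def)
  qed
  have vs: "vs = xs @ vs ! p # ys @ vs ! q # zs"
    using h id_take_nth_drop[of p vs] dq by (simp add: xs_def)
  have dp: "drop_at p vs = xs @ ys @ vs ! q # zs" unfolding dq by (simp add: xs_def)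
  have "drop_at q vs = xs @ vs ! p # ys @ zs"
  proof -
    have "drop_at q (xs @ vs ! p # ys @ vs ! q # zs) = xs @ vs ! p # ys @ zs"
    proof -
      have q: "q = Suc (length xs + length ys)" using len h by simp
      show ?thesis unfolding q by (simp add: Suc_diff_le)
    qed
    then show ?thesis using vs by simp
  qed
  moreover have "\<alpha> (xs @ vs ! q # ys @ zs) = (-1) ^ (q - p - 1) * \<alpha> (xs @ ys @ vs ! q # zs)"
    using antisymmetric_move[OF alternating_form_antisymmetric[OF \<alpha>], of xs ys zs] len h by simp
  ultimately have "?t p + ?t q = ((-1) ^ p + (-1) ^ q * (-1) ^ (q - p - 1)) * ((vs ! q) $ l * \<alpha> (drop_at p vs))"
    using h dp by (simp add: algebra_simps)
  moreover have "(-1 :: complex) ^ p + (-1) ^ q * (-1) ^ (q - p - 1) = 0"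
  proof -
    have q: "q = Suc (p + length ys)" "q - p - 1 = length ys" using len h by auto
    have "(-1 :: complex) ^ length ys * (-1) ^ length ys = 1" by (simp flip: power_mult_distrib)
    then show ?thesis unfolding q(2) by (subst q(1)) (simp add: power_add mult.assoc)
  qed
  ultimately have pq: "?t p + ?t q = 0" by simp
  have "dz_wedge l \<alpha> vs = (\<Sum>i\<in>{p, q}. ?t i)"
    unfolding dz_wedge_def using h zero by (intro sum.mono_neutral_right) auto
  then show "dz_wedge l \<alpha> vs = 0" using h pq by simp
qed

lemma dz_wedge_axis_list:
  "dz_wedge l \<alpha> (axis_list js) = (\<Sum>i<length js. if js ! i = l then (-1) ^ i * \<alpha> (axis_list (drop_at i js)) else 0)"
  unfolding dz_wedge_def by (auto intro!: sum.cong simp: take_map drop_map axis_def)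

text \<open>The \<open>i\<close>-th term of the wedge product inserts \<open>l\<close> at the position \<open>i\<close>. Moving it to the front produces the
  same sign as the term carries, so all \<open>k + 1\<close> terms contribute the same amount.\<close>

lemma dz_wedge_pairing:
  fixes Y :: "'n::finite list \<Rightarrow> complex"
  assumes Y: "antisymmetric (Suc k) Y"
  shows "(\<Sum>js\<in>lists_of (Suc k). dz_wedge l \<beta> (axis_list js) * Y js)
    = of_nat (Suc k) * (\<Sum>js\<in>lists_of k. \<beta> (axis_list js) * Y (l # js))"
proof -
  have "(\<Sum>js\<in>lists_of (Suc k). dz_wedge l \<beta> (axis_list js) * Y js)
      = (\<Sum>js\<in>lists_of (Suc k). \<Sum>i<Suc k. (if js ! i = l then (-1) ^ i * \<beta> (axis_list (drop_at i js)) else 0) * Y js)"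
    by (intro sum.cong refl) (simp add: dz_wedge_axis_list sum_distrib_right del: sum.lessThan_Suc)
  also have "\<dots> = (\<Sum>i<Suc k. \<Sum>js\<in>lists_of (Suc k). (if js ! i = l then (-1) ^ i * \<beta> (axis_list (drop_at i js)) else 0) * Y js)"
    by (rule sum.swap)
  also have "\<dots> = (\<Sum>i<Suc k. \<Sum>js\<in>lists_of k. \<beta> (axis_list js) * Y (l # js))"
  proof (rule sum.cong[OF refl])
    fix i assume "i \<in> {..<Suc k}"
    then have i: "i \<le> k" by simp
    have "(\<Sum>js\<in>lists_of (Suc k). (if js ! i = l then (-1) ^ i * \<beta> (axis_list (drop_at i js)) else 0) * Y js)
      = (\<Sum>j\<in>UNIV. \<Sum>js\<in>lists_of k. if j = l then (-1) ^ i * \<beta> (axis_list js) * Y (take i js @ j # drop i js) else 0)"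
      unfolding sum_lists_of_insert[OF i]
    proof (intro sum.cong refl)
      fix j and js :: "'n list" assume "js \<in> lists_of k"
      then have 1: "(take i js @ j # drop i js) ! i = j" and 2: "drop_at i (take i js @ j # drop i js) = js"
        using i by (auto simp: nth_append)
      show "(if (take i js @ j # drop i js) ! i = l
            then (-1) ^ i * \<beta> (axis_list (drop_at i (take i js @ j # drop i js))) else 0) * Y (take i js @ j # drop i js)
          = (if j = l then (-1) ^ i * \<beta> (axis_list js) * Y (take i js @ j # drop i js) else 0)"
        unfolding 1 2 by simp
    qed
    also have "\<dots> = (\<Sum>js\<in>lists_of k. (-1) ^ i * \<beta> (axis_list js) * Y (take i js @ l # drop i js))"
      by (subst sum.swap) simp
    also have "\<dots> = (\<Sum>js\<in>lists_of k. \<beta> (axis_list js) * Y (l # js))"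
    proof (rule sum.cong[OF refl])
      fix js :: "'n list" assume "js \<in> lists_of k"
      then have "Y (take i js @ l # drop i js) = (-1) ^ i * Y (l # js)"
        using antisymmetric_move_front[OF Y _ i] by simp
      then show "(-1) ^ i * \<beta> (axis_list js) * Y (take i js @ l # drop i js) = \<beta> (axis_list js) * Y (l # js)"
        by (simp flip: power_add mult.assoc)
    qed
    finally show "(\<Sum>js\<in>lists_of (Suc k). (if js ! i = l then (-1) ^ i * \<beta> (axis_list (drop_at i js)) else 0) * Y js)
      = (\<Sum>js\<in>lists_of k. \<beta> (axis_list js) * Y (l # js))" .
  qed
  finally show ?thesis by simp
qed

text \<open>The form \<open>dz\<^sub>j \<and> dz\<^sub>j' \<and> \<dots>\<close> for a list \<open>j, j',
  \<dots>\<close> of indices.\<close>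

primrec elementary_form :: "'n list \<Rightarrow> (complex^'n::finite) list \<Rightarrow> complex" where
  "elementary_form [] = (\<lambda>vs. if vs = [] then 1 else 0)"
| "elementary_form (j # js) = dz_wedge j (elementary_form js)"

lemma elementary_form_alternating: "alternating_form (length js) (elementary_form js)"
proof (induction js)
  case Nil
  show ?case by (auto simp: alternating_form_def)
next
  case (Cons j js)
  then show ?case using dz_wedge_alternating by simp
qed

text \<open>Pairing with an elementary form extracts one coefficient; iterate the duality of wedging and
  insertion.\<close>

lemma elementary_form_pairing:
  "antisymmetric (length J) Y \<Longrightarrow>
    (\<Sum>js\<in>lists_of (length J). elementary_form J (axis_list js) * Y js) = fact (length J) * Y J"
proof (induction J arbitrary: Y)
  case (Cons j J)
  have "(\<Sum>js\<in>lists_of (Suc (length J)). dz_wedge j (elementary_form J) (axis_list js) * Y js)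
      = of_nat (Suc (length J)) * (fact (length J) * Y (j # J))"
    using dz_wedge_pairing[of "length J" Y j "elementary_form J"] Cons.prems
      Cons.IH[OF antisymmetric_Cons[of "length J" Y j]] by simp
  then show ?case by (simp add: mult.assoc)
qed simp

subsection \<open>Types of forms\<close>

text \<open>With respect to coordinate subspaces the type of a form is read off from its coefficients.\<close>

definition index_type :: "'n set \<Rightarrow> nat \<Rightarrow> nat \<Rightarrow> ('n list \<Rightarrow> complex) \<Rightarrow> bool" where
  "index_type R p q Y \<longleftrightarrow> (\<forall>js. length js = p + q \<and> length (filter (\<lambda>j. j \<in> R) js) \<noteq> p \<longrightarrow> Y js = 0)"

lemma has_type_iff_filter:
  "has_type P Q p q \<alpha> \<longleftrightarrow> (\<forall>vs. length vs = p + q \<and>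
     (p < length (filter (\<lambda>v. v \<in> P) vs) \<or> q < length (filter (\<lambda>v. v \<in> Q) vs)) \<longrightarrow> \<alpha> vs = 0)"
  unfolding has_type_def length_filter_conv_card by (simp cong: conj_cong)

lemma length_filter_mono_nth:
  assumes "length xs = length ys" "\<And>i. i < length xs \<Longrightarrow> P (xs ! i) \<Longrightarrow> Q (ys ! i)"
  shows "length (filter P xs) \<le> length (filter Q ys)"
  unfolding length_filter_conv_card using assms by (intro card_mono) auto

lemma length_filter_Compl: "length (filter (\<lambda>j. j \<in> - R) js) = length js - length (filter (\<lambda>j. j \<in> R) js)"
  using sum_length_filter_compl[of "\<lambda>j. j \<in> R" js] by simp

text \<open>A list of axis vectors with the wrong number of indices in \<open>R\<close> has too many
  vectors in one of the two subspaces. Conversely, if a list has too many vectors in one of them, then so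
  has every list of axis vectors that occurs in its expansion.\<close>

lemma has_type_axes_iff:
  fixes \<alpha> :: "(complex^'n::finite) list \<Rightarrow> complex"
  assumes \<alpha>: "alternating_form (p + q) \<alpha>"
  shows "has_type (axes R) (axes (- R)) p q \<alpha> \<longleftrightarrow> index_type R p q (\<lambda>js. \<alpha> (axis_list js))"
proof
  assume t: "has_type (axes R) (axes (- R)) p q \<alpha>"
  show "index_type R p q (\<lambda>js. \<alpha> (axis_list js))"
    unfolding index_type_def
  proof (intro allI impI)
    fix js :: "'n list" assume js: "length js = p + q \<and> length (filter (\<lambda>j. j \<in> R) js) \<noteq> p"
    have f: "length (filter (\<lambda>v. v \<in> axes L) (axis_list js :: (complex^'n) list)) = length (filter (\<lambda>j. j \<in> L) js)" for L
      by (simp add: filter_map o_def axis_in_axes)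
    have "p < length (filter (\<lambda>j. j \<in> R) js) \<or> q < length (filter (\<lambda>j. j \<in> - R) js)"
      using js length_filter_Compl[of R js] length_filter_le[of "\<lambda>j. j \<in> R" js] by linarith
    then have "length (axis_list js :: (complex^'n) list) = p + q \<and>
        (p < length (filter (\<lambda>v. v \<in> axes R) (axis_list js :: (complex^'n) list)) \<or>
         q < length (filter (\<lambda>v. v \<in> axes (- R)) (axis_list js :: (complex^'n) list)))"
      unfolding f using js by simp
    then show "\<alpha> (axis_list js) = 0" by (rule t[unfolded has_type_iff_filter, rule_format])
  qed
next
  assume t: "index_type R p q (\<lambda>js. \<alpha> (axis_list js))"
  show "has_type (axes R) (axes (- R)) p q \<alpha>"
    unfolding has_type_iff_filter
  proof (intro allI impI)
    fix vs :: "(complex^'n) list"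
    assume vs: "length vs = p + q \<and> (p < length (filter (\<lambda>v. v \<in> axes R) vs) \<or> q < length (filter (\<lambda>v. v \<in> axes (- R)) vs))"
    have "(\<Prod>i<p + q. (vs ! i) $ (js ! i)) * \<alpha> (axis_list js) = 0" if js: "length js = p + q" for js
    proof (rule ccontr)
      assume nz: "(\<Prod>i<p + q. (vs ! i) $ (js ! i)) * \<alpha> (axis_list js) \<noteq> 0"
      then have "\<forall>i<p + q. (vs ! i) $ (js ! i) \<noteq> 0" by simp
      then have "length (filter (\<lambda>v. v \<in> axes L) vs) \<le> length (filter (\<lambda>j. j \<in> L) js)" for L
        using vs js by (intro length_filter_mono_nth) (auto simp: mem_axes_iff)
      then have "p < length (filter (\<lambda>j. j \<in> R) js) \<or> q < length (filter (\<lambda>j. j \<in> - R) js)"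
        using vs by (meson order_less_le_trans)
      then have "length (filter (\<lambda>j. j \<in> R) js) \<noteq> p" using js length_filter_Compl[of R js] by linarith
      then have "\<alpha> (axis_list js) = 0" using t js by (simp add: index_type_def)
      then show False using nz by simp
    qed
    then have "(\<Sum>js\<in>lists_of (p + q). (\<Prod>i<p + q. (vs ! i) $ (js ! i)) * \<alpha> (axis_list js)) = 0"
      by (intro sum.neutral) blast
    then show "\<alpha> vs = 0" using alternating_form_expand[OF \<alpha>, of vs] vs by simp
  qed
qed

lemma has_type_image:
  assumes "has_type P' Q' p q \<alpha>" "L ` P \<subseteq> P'" "L ` Q \<subseteq> Q'"
  shows "has_type P Q p q (\<lambda>vs. \<alpha> (map L vs))"
  unfolding has_type_iff_filter
proof (intro allI impI)
  fix vs assume vs: "length vs = p + q \<and> (p < length (filter (\<lambda>v. v \<in> P) vs) \<or> q < length (filter (\<lambda>v. v \<in> Q) vs))"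
  have "length (filter (\<lambda>v. v \<in> P) vs) \<le> length (filter (\<lambda>v. v \<in> P') (map L vs))"
    "length (filter (\<lambda>v. v \<in> Q) vs) \<le> length (filter (\<lambda>v. v \<in> Q') (map L vs))"
    using assms(2,3) by (intro length_filter_mono_nth; auto)+
  then show "\<alpha> (map L vs) = 0"
    using assms(1)[unfolded has_type_iff_filter, rule_format, of "map L vs"] vs by auto
qed

lemma alternating_form_split:
  assumes \<alpha>: "alternating_form k \<alpha>" and vs: "length vs = k" "\<And>i. i < k \<Longrightarrow> vs ! i = f i + g i"
  shows "\<alpha> vs = (\<Sum>S\<in>Pow {..<k}. \<alpha> (map (\<lambda>i. if i \<in> S then f i else g i) [0..<k]))"
proof -
  let ?w = "\<lambda>m S. map (\<lambda>i. if i < m then if i \<in> S then f i else g i else vs ! i) [0..<k]"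
  have main: "\<alpha> vs = (\<Sum>S\<in>Pow {..<m}. \<alpha> (?w m S))" if "m \<le> k" for m
    using that
  proof (induction m)
    case 0
    have "map (\<lambda>i. vs ! i) [0..<k] = vs" using vs(1) by (auto intro: nth_equalityI)
    then show ?case by simp
  next
    case (Suc m)
    have slot: "\<alpha> (?w m S) = \<alpha> (?w (Suc m) S) + \<alpha> (?w (Suc m) (insert m S))" if S: "S \<in> Pow {..<m}" for S
    proof -
      have m: "m \<notin> S" "m < k" using S Suc.prems by auto
      have len: "length (?w m S) = k" by simp
      have "?w m S = (?w m S)[m := f m + g m]" "?w (Suc m) S = (?w m S)[m := g m]"
        "?w (Suc m) (insert m S) = (?w m S)[m := f m]"
        using m vs(2) by (auto intro!: nth_equalityI simp: nth_list_update less_Suc_eq)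
      then show ?thesis using alternating_form_slot_add[OF \<alpha> len m(2), of "f m" "g m"] by (simp add: add.commute)
    qed
    have inj: "inj_on (insert m) (Pow {..<m})" by (auto simp: inj_on_def)
    have disj: "Pow {..<m} \<inter> insert m ` Pow {..<m} = {}" by auto
    have "(\<Sum>S\<in>Pow {..<Suc m}. \<alpha> (?w (Suc m) S))
        = (\<Sum>S\<in>Pow {..<m}. \<alpha> (?w (Suc m) S)) + (\<Sum>S\<in>Pow {..<m}. \<alpha> (?w (Suc m) (insert m S)))"
      unfolding lessThan_Suc Pow_insert
      by (subst sum.union_disjoint) (auto simp: disj sum.reindex[OF inj])
    then show ?case using Suc.IH Suc.prems slot by (simp add: sum.distrib)
  qed
  have eq: "?w k S = map (\<lambda>i. if i \<in> S then f i else g i) [0..<k]" for S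
    by (rule map_cong) auto
  show ?thesis using main[of k] unfolding eq by simp
qed

lemma type_component_term_zero:
  assumes "complementary P Q" "has_type P Q p' q' \<alpha>" "p' + q' = p + q" "p' \<noteq> card S" "S \<subseteq> {..<p + q}"
    "length vs = p + q"
  shows "\<alpha> (map (\<lambda>i. if i \<in> S then proj_along P Q (vs ! i) else proj_along Q P (vs ! i)) [0..<p + q]) = 0"
proof -
  let ?w = "map (\<lambda>i. if i \<in> S then proj_along P Q (vs ! i) else proj_along Q P (vs ! i)) [0..<p + q]"
  have mem: "proj_along P Q v \<in> P" "proj_along Q P v \<in> Q" for v
    using proj_along_props assms(1) complementary_commute by blast+
  have "S \<subseteq> {i. i < p + q \<and> ?w ! i \<in> P}" "{..<p + q} - S \<subseteq> {i. i < p + q \<and> ?w ! i \<in> Q}"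
    using assms(5) mem by auto
  then have "card S \<le> card {i. i < p + q \<and> ?w ! i \<in> P}" "card ({..<p + q} - S) \<le> card {i. i < p + q \<and> ?w ! i \<in> Q}"
    by (intro card_mono; simp)+
  moreover have "card ({..<p + q} - S) = p + q - card S"
    using assms(5) by (simp add: card_Diff_subset finite_subset[OF assms(5)])
  moreover have "card S \<le> p + q" using card_mono[OF _ assms(5)] by simp
  ultimately have "p' < card {i. i < p + q \<and> ?w ! i \<in> P} \<or> q' < card {i. i < p + q \<and> ?w ! i \<in> Q}"
    using assms(3,4) by linarith
  then show ?thesis using assms(2)[unfolded has_type_def, rule_format, of ?w] assms(3) by simp
qed

text \<open>Of the terms obtained by splitting each argument only those with \<open>p\<close> arguments
  in \<open>P\<close> survive.\<close>

lemma type_component_same: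
  assumes "complementary P Q" "alternating_form (p + q) \<alpha>" "has_type P Q p q \<alpha>"
  shows "type_component P Q p q \<alpha> = \<alpha>"
proof
  fix vs show "type_component P Q p q \<alpha> vs = \<alpha> vs"
  proof (cases "length vs = p + q")
    case True
    let ?t = "\<lambda>S. \<alpha> (map (\<lambda>i. if i \<in> S then proj_along P Q (vs ! i) else proj_along Q P (vs ! i)) [0..<p + q])"
    have "\<alpha> vs = (\<Sum>S\<in>Pow {..<p + q}. ?t S)"
      by (rule alternating_form_split[OF assms(2) True]) (simp add: proj_along_swap[OF assms(1)])
    also have "\<dots> = (\<Sum>S | S \<subseteq> {..<p + q} \<and> card S = p. ?t S)"
    proof (rule sum.mono_neutral_right)
      show "\<forall>S\<in>Pow {..<p + q} - {S. S \<subseteq> {..<p + q} \<and> card S = p}. ?t S = 0"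
      proof
        fix S assume "S \<in> Pow {..<p + q} - {S. S \<subseteq> {..<p + q} \<and> card S = p}"
        then show "?t S = 0" by (intro type_component_term_zero[OF assms(1,3) refl _ _ True]) auto
      qed
    qed auto
    finally show ?thesis using True by (simp add: type_component_def)
  qed (simp add: type_component_def alternating_form_length[OF assms(2)])
qed

lemma type_component_other:
  assumes "complementary P Q" "has_type P Q p' q' \<alpha>" "p' + q' = p + q" "p' \<noteq> p"
  shows "type_component P Q p q \<alpha> = (\<lambda>vs. 0)"
proof
  fix vs show "type_component P Q p q \<alpha> vs = 0"
    unfolding type_component_def
    using type_component_term_zero[OF assms(1-3)] assms(4) by (auto intro!: sum.neutral)
qed

lemma type_component_add:
  "type_component P Q p q (\<lambda>vs. \<alpha> vs + \<beta> vs) vs = type_component P Q p q \<alpha> vs + type_component P Q p q \<beta> vs"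
  by (simp add: type_component_def sum.distrib)

lemma type_component_map:
  assumes "complementary P Q" "complementary P' Q'" "Vector_Spaces.linear (*s) (*s) L" "L ` P \<subseteq> P'" "L ` Q \<subseteq> Q'"
  shows "type_component P Q p q (\<lambda>vs. \<alpha> (map L vs)) vs = type_component P' Q' p q \<alpha> (map L vs)"
proof (cases "length vs = p + q")
  case True
  have "L (proj_along P Q v) = proj_along P' Q' (L v)" "L (proj_along Q P v) = proj_along Q' P' (L v)" for v
    using proj_along_image[OF assms] proj_along_image[OF assms(1,2)[THEN complementary_commute] assms(3,5,4)] by auto
  then show ?thesis using True unfolding type_component_def
    by (auto intro!: sum.cong arg_cong[of _ _ \<alpha>])
qed (simp add: type_component_def)

lemma type_component_zero: "type_component P Q p q (\<lambda>vs. 0) = (\<lambda>vs. 0)"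
  by (rule ext) (simp add: type_component_def)

lemma length_filter_drop_at:
  assumes "i < length js"
  shows "length (filter P js) = length (filter P (drop_at i js)) + (if P (js ! i) then 1 else 0)"
  by (subst id_take_nth_drop[OF assms]) simp

lemma dz_wedge_index_type:
  fixes \<alpha> :: "(complex^'n::finite) list \<Rightarrow> complex"
  assumes "index_type R p q (\<lambda>js. \<alpha> (axis_list js))"
  shows "l \<in> R \<Longrightarrow> index_type R (Suc p) q (\<lambda>js. dz_wedge l \<alpha> (axis_list js))"
    "l \<notin> R \<Longrightarrow> index_type R p (Suc q) (\<lambda>js. dz_wedge l \<alpha> (axis_list js))"
proof -
  have "dz_wedge l \<alpha> (axis_list js) = 0"
    if len: "length js = Suc (p + q)" and n: "length (filter (\<lambda>j. j \<in> R) js) \<noteq> (if l \<in> R then Suc p else p)" for js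
    unfolding dz_wedge_axis_list
  proof (rule sum.neutral, rule ballI)
    fix i assume "i \<in> {..<length js}"
    then have i: "i < length js" by simp
    show "(if js ! i = l then (-1) ^ i * \<alpha> (axis_list (drop_at i js)) else 0) = 0"
    proof (cases "js ! i = l")
      case True
      then have 1: "length (filter (\<lambda>j. j \<in> R) (drop_at i js)) \<noteq> p"
        using n length_filter_drop_at[OF i, of "\<lambda>j. j \<in> R"] by (auto split: if_splits)
      have "length (drop_at i js) = p + q" using len length_drop_at[OF i] by simp
      then have "\<alpha> (axis_list (drop_at i js)) = 0"
        using assms[unfolded index_type_def, rule_format, OF conjI[OF _ 1]] by blast
      then show ?thesis by simp
    qed simp
  qed
  then show "l \<in> R \<Longrightarrow> index_type R (Suc p) q (\<lambda>js. dz_wedge l \<alpha> (axis_list js))"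
    "l \<notin> R \<Longrightarrow> index_type R p (Suc q) (\<lambda>js. dz_wedge l \<alpha> (axis_list js))"
    by (auto simp: index_type_def)
qed

lemma index_type_sum:
  "(\<And>l. l \<in> L \<Longrightarrow> index_type R p q (Y l)) \<Longrightarrow> index_type R p q (\<lambda>js. \<Sum>l\<in>L. Y l js)"
  by (auto simp: index_type_def intro: sum.neutral)

lemma elementary_form_index_type:
  fixes J :: "'n::finite list"
  assumes "length J = p + q" "length (filter (\<lambda>j. j \<in> R) J) = p"
  shows "index_type R p q (\<lambda>js. elementary_form J (axis_list js))"
  using assms
proof (induction J arbitrary: p q)
  case Nil
  then show ?case by (auto simp: index_type_def)
next
  case (Cons j J)
  show ?case
  proof (cases "j \<in> R")
    case True
    then obtain p' where p: "p = Suc p'" using Cons.prems by (cases p) auto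
    show ?thesis unfolding p using dz_wedge_index_type(1)[OF Cons.IH[of p' q] True] Cons.prems p True by simp
  next
    case False
    then have "q \<noteq> 0" using Cons.prems length_filter_le[of "\<lambda>j. j \<in> R" J] by (intro notI) simp
    then obtain q' where q: "q = Suc q'" by (cases q) auto
    show ?thesis unfolding q using dz_wedge_index_type(2)[OF Cons.IH[of p q'] False] Cons.prems q False by simp
  qed
qed

section \<open>Wirtinger calculus\<close>

lemma axis_ii: "axis l \<i> = \<i> *s axis l 1"
  by (auto simp: vec_eq_iff axis_def)

lemma wirtinger_cong_open:
  assumes "open S" "z \<in> S" "\<And>y. y \<in> S \<Longrightarrow> f y = g y"
  shows "wirtinger l f z = wirtinger l g z"
  unfolding wirtinger_def using FD_cong_open[OF assms] by simp

lemma wirtinger_const: "wirtinger l (\<lambda>y. c) z = 0"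
  by (simp add: wirtinger_def)

lemma wirtinger_add:
  assumes "f differentiable (at z)" "g differentiable (at z)"
  shows "wirtinger l (\<lambda>y. f y + g y) z = wirtinger l f z + wirtinger l g z"
proof -
  have "FD (\<lambda>y. f y + g y) z = (\<lambda>v. FD f z v + FD g z v)"
    by (rule FD_eqI[OF has_derivative_add[OF FD_has_derivative[OF assms(1)] FD_has_derivative[OF assms(2)]]])
  then show ?thesis by (simp add: wirtinger_def field_simps)
qed

lemma wirtinger_mult:
  assumes "f differentiable (at z)" "g differentiable (at z)"
  shows "wirtinger l (\<lambda>y. f y * g y) z = f z * wirtinger l g z + wirtinger l f z * g z"
proof -
  have "FD (\<lambda>y. f y * g y) z = (\<lambda>v. f z * FD g z v + FD f z v * g z)"
    by (rule FD_eqI[OF has_derivative_mult[OF FD_has_derivative[OF assms(1)] FD_has_derivative[OF assms(2)]]])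
  then show ?thesis by (simp add: wirtinger_def field_simps)
qed

lemma wirtinger_scale:
  assumes "f differentiable (at z)"
  shows "wirtinger l (\<lambda>y. c * f y) z = c * wirtinger l f z"
  using wirtinger_mult[of "\<lambda>y. c" z f l] assms by (simp add: wirtinger_const)

lemma wirtinger_sum:
  assumes "\<And>i. i \<in> I \<Longrightarrow> f i differentiable (at z)"
  shows "wirtinger l (\<lambda>y. \<Sum>i\<in>I. f i y) z = (\<Sum>i\<in>I. wirtinger l (f i) z)"
  using assms
proof (induction I rule: infinite_finite_induct)
  case (insert i I)
  then have "wirtinger l (\<lambda>y. f i y + (\<Sum>i\<in>I. f i y)) z = wirtinger l (f i) z + wirtinger l (\<lambda>y. \<Sum>i\<in>I. f i y) z"
    by (intro wirtinger_add differentiable_sum) auto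
  then show ?case using insert by simp
qed (simp_all add: wirtinger_const)

lemma smooth_on_wirtinger:
  "open S \<Longrightarrow> smooth_on S f \<Longrightarrow> smooth_on S (wirtinger l f)"
  unfolding wirtinger_def[abs_def] divide_inverse
  by (intro smooth_on_mult smooth_on_diff smooth_on_const smooth_on_FD)

text \<open>The derivative with respect to the conjugate of the coordinate, defined by conjugation so
  that its rules follow from those for \<open>\<partial>f/\<partial>z\<^sub>l\<close>.\<close>

definition wirtinger_bar :: "'n \<Rightarrow> (complex^'n::finite \<Rightarrow> complex) \<Rightarrow> complex^'n \<Rightarrow> complex" where
  "wirtinger_bar l f z = cnj (wirtinger l (\<lambda>y. cnj (f y)) z)"

lemma wirtinger_bar_eq:
  assumes "f differentiable (at z)"
  shows "wirtinger_bar l f z = (FD f z (axis l 1) + \<i> * FD f z (axis l \<i>)) / 2"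
  unfolding wirtinger_bar_def wirtinger_def FD_bounded_linear[OF bounded_linear_cnj assms] by simp

lemma smooth_on_wirtinger_bar:
  "open S \<Longrightarrow> smooth_on S f \<Longrightarrow> smooth_on S (wirtinger_bar l f)"
  unfolding wirtinger_bar_def[abs_def] by (intro smooth_on_cnj smooth_on_wirtinger)

lemma differentiable_cnj: "f differentiable (at z) \<Longrightarrow> (\<lambda>y. cnj (f y)) differentiable (at z)"
  using bounded_linear.has_derivative[OF bounded_linear_cnj] unfolding differentiable_def by blast

lemma wirtinger_bar_cong_open:
  assumes "open S" "z \<in> S" "\<And>y. y \<in> S \<Longrightarrow> f y = g y"
  shows "wirtinger_bar l f z = wirtinger_bar l g z"
proof -
  have "wirtinger l (\<lambda>y. cnj (f y)) z = wirtinger l (\<lambda>y. cnj (g y)) z"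
    by (rule wirtinger_cong_open[OF assms(1,2)]) (simp add: assms(3))
  then show ?thesis by (simp add: wirtinger_bar_def)
qed

lemma wirtinger_bar_mult:
  assumes "f differentiable (at z)" "g differentiable (at z)"
  shows "wirtinger_bar l (\<lambda>y. f y * g y) z = f z * wirtinger_bar l g z + wirtinger_bar l f z * g z"
  using wirtinger_mult[OF assms[THEN differentiable_cnj]] by (simp add: wirtinger_bar_def)

lemma wirtinger_bar_sum:
  assumes "\<And>i. i \<in> I \<Longrightarrow> f i differentiable (at z)"
  shows "wirtinger_bar l (\<lambda>y. \<Sum>i\<in>I. f i y) z = (\<Sum>i\<in>I. wirtinger_bar l (f i) z)"
  using wirtinger_sum[of I "\<lambda>i y. cnj (f i y)" z l] assms by (simp add: wirtinger_bar_def differentiable_cnj)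

lemma wirtinger_commute:
  fixes f :: "complex^'n::finite \<Rightarrow> complex"
  assumes S: "open S" "z \<in> S" and f: "smooth_on S f"
  shows "wirtinger l (wirtinger_bar j f) z = wirtinger_bar j (wirtinger l f) z"
proof -
  have d: "(\<lambda>y. FD f y v) differentiable (at y)" if "y \<in> S" for y v
    by (rule smooth_on_differentiable[OF smooth_on_FD[OF f] that])
  have half: "(\<lambda>y. (FD f y v + c * FD f y w) / 2) differentiable (at z)"
    "FD (\<lambda>y. (FD f y v + c * FD f y w) / 2) z u = (FD (\<lambda>y. FD f y v) z u + c * FD (\<lambda>y. FD f y w) z u) / 2" for v c w u
  proof -
    have h: "((\<lambda>y. (FD f y v + c * FD f y w) / 2) has_derivative
        (\<lambda>u. (FD (\<lambda>y. FD f y v) z u + c * FD (\<lambda>y. FD f y w) z u) / 2)) (at z)"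
      using FD_has_derivative[OF d[OF S(2)]] by (auto intro!: derivative_eq_intros)
    then show "(\<lambda>y. (FD f y v + c * FD f y w) / 2) differentiable (at z)" by (auto simp: differentiable_def)
    show "FD (\<lambda>y. (FD f y v + c * FD f y w) / 2) z u = (FD (\<lambda>y. FD f y v) z u + c * FD (\<lambda>y. FD f y w) z u) / 2"
      using FD_eqI[OF h] by simp
  qed
  have "wirtinger l (wirtinger_bar j f) z = wirtinger l (\<lambda>y. (FD f y (axis j 1) + \<i> * FD f y (axis j \<i>)) / 2) z"
    by (rule wirtinger_cong_open[OF S]) (rule wirtinger_bar_eq[OF smooth_on_differentiable[OF f]])
  also have "\<dots> = ((FD (\<lambda>y. FD f y (axis j 1)) z (axis l 1) + \<i> * FD (\<lambda>y. FD f y (axis j \<i>)) z (axis l 1)) / 2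
      - \<i> * ((FD (\<lambda>y. FD f y (axis j 1)) z (axis l \<i>) + \<i> * FD (\<lambda>y. FD f y (axis j \<i>)) z (axis l \<i>)) / 2)) / 2"
    unfolding wirtinger_def half(2) ..
  also have "\<dots> = ((FD (\<lambda>y. FD f y (axis l 1)) z (axis j 1) + (- \<i>) * FD (\<lambda>y. FD f y (axis l \<i>)) z (axis j 1)) / 2
      + \<i> * ((FD (\<lambda>y. FD f y (axis l 1)) z (axis j \<i>) + (- \<i>) * FD (\<lambda>y. FD f y (axis l \<i>)) z (axis j \<i>)) / 2)) / 2"
    unfolding FD_commute[OF S f, of "axis l 1" "axis j _"] FD_commute[OF S f, of "axis l \<i>" "axis j _"]
    by (simp add: field_simps)
  also have "\<dots> = wirtinger_bar j (\<lambda>y. (FD f y (axis l 1) + (- \<i>) * FD f y (axis l \<i>)) / 2) z"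
    unfolding wirtinger_bar_eq[OF half(1)] half(2) ..
  also have "(\<lambda>y. (FD f y (axis l 1) + (- \<i>) * FD f y (axis l \<i>)) / 2) = wirtinger l f"
    by (rule ext) (simp add: wirtinger_def)
  finally show ?thesis .
qed

text \<open>The complex linear part of the differential, which expresses \<open>\<partial>\<close>
  without reference to coordinates.\<close>

definition del_dir :: "(complex^'n::finite \<Rightarrow> complex) \<Rightarrow> complex^'n \<Rightarrow> complex^'n \<Rightarrow> complex" where
  "del_dir f z v = (FD f z v - \<i> * FD f z (\<i> *s v)) / 2"

lemma del_dir_eq_sum:
  assumes "f differentiable (at z)"
  shows "del_dir f z v = (\<Sum>l\<in>UNIV. v $ l * wirtinger l f z)"
proof -
  have lin: "linear (FD f z)" by (rule linear_frechet_derivative[OF assms])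
  have split: "FD f z (a *s w) = of_real (Re a) * FD f z w + of_real (Im a) * FD f z (\<i> *s w)" for a w
  proof -
    have "a *s w = Re a *\<^sub>R w + Im a *\<^sub>R (\<i> *s w)"
      unfolding of_real_vector_scalar_mult[symmetric] vector_smult_assoc vector_sadd_rdistrib[symmetric]
      by (simp add: complex_eq[symmetric] mult.commute)
    then have "FD f z (a *s w) = Re a *\<^sub>R FD f z w + Im a *\<^sub>R FD f z (\<i> *s w)"
      by (simp only: linear_add[OF lin] linear_cmul[OF lin])
    then show ?thesis by (simp only: scaleR_conv_of_real)
  qed
  have scale: "del_dir f z (a *s w) = a * del_dir f z w" for a w
    unfolding del_dir_def vector_smult_assoc split[of a] split[of "\<i> * a"]
    by (simp add: complex_eq_iff algebra_simps)
  have add: "del_dir f z (v + w) = del_dir f z v + del_dir f z w" for v w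
    using lin by (simp add: del_dir_def linear_add vector_add_ldistrib add_divide_distrib diff_divide_distrib algebra_simps)
  have zero: "del_dir f z 0 = 0" using scale[of 0 0] by simp
  have sum: "del_dir f z (\<Sum>l\<in>L. g l) = (\<Sum>l\<in>L. del_dir f z (g l))" for L and g :: "'a \<Rightarrow> complex^'a"
    by (induction L rule: infinite_finite_induct) (simp_all add: zero add)
  have "del_dir f z v = del_dir f z (\<Sum>l\<in>UNIV. v $ l *s axis l 1)" by (simp add: basis_expansion)
  also have "\<dots> = (\<Sum>l\<in>UNIV. v $ l * del_dir f z (axis l 1))" by (simp add: sum scale)
  finally show ?thesis by (simp add: del_dir_def wirtinger_def axis_ii)
qed

subsection \<open>The operators \<open>\<partial>\<close>, \<open>\<partial>\<^sub>N\<close>, \<open>\<partial>\<^sub>F\<close> in coordinates\<close>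

lemma wirtinger_alternating:
  fixes f :: "complex^'n::finite \<Rightarrow> (complex^'n) list \<Rightarrow> complex"
  assumes S: "open S" "z \<in> S" and alt: "\<And>y. y \<in> S \<Longrightarrow> alternating_form k (f y)"
    and sm: "\<And>ws. smooth_on S (\<lambda>y. f y ws)"
  shows "alternating_form k (\<lambda>ws. wirtinger l (\<lambda>y. f y ws) z)"
  unfolding alternating_form_def
proof (intro conjI allI impI)
  have d: "(\<lambda>y. f y ws) differentiable (at z)" for ws by (rule smooth_on_differentiable[OF sm S(2)])
  fix vs :: "(complex^'n) list" and i j
  show "wirtinger l (\<lambda>y. f y vs) z = 0" if "length vs \<noteq> k"
  proof -
    have "wirtinger l (\<lambda>y. f y vs) z = wirtinger l (\<lambda>y. 0) z"
      by (rule wirtinger_cong_open[OF S]) (rule alternating_form_length[OF alt that])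
    then show ?thesis by (simp add: wirtinger_const)
  qed
  show "wirtinger l (\<lambda>y. f y (vs[i := a *s v + w])) z
      = a * wirtinger l (\<lambda>y. f y (vs[i := v])) z + wirtinger l (\<lambda>y. f y (vs[i := w])) z"
    if "length vs = k \<and> i < k" for a v w
  proof -
    have "wirtinger l (\<lambda>y. f y (vs[i := a *s v + w])) z = wirtinger l (\<lambda>y. a * f y (vs[i := v]) + f y (vs[i := w])) z"
      using that by (intro wirtinger_cong_open[OF S] alternating_form_lin[OF alt]) auto
    also have "\<dots> = wirtinger l (\<lambda>y. a * f y (vs[i := v])) z + wirtinger l (\<lambda>y. f y (vs[i := w])) z"
      by (rule wirtinger_add) (auto intro: d)
    finally show ?thesis by (simp add: wirtinger_scale[OF d])
  qed
  show "wirtinger l (\<lambda>y. f y vs) z = 0" if "length vs = k \<and> i < j \<and> j < k \<and> vs ! i = vs ! j"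
  proof -
    have "wirtinger l (\<lambda>y. f y vs) z = wirtinger l (\<lambda>y. 0) z"
      using that by (intro wirtinger_cong_open[OF S] alternating_form_eq[OF alt, of _ vs i j]) auto
    then show ?thesis by (simp add: wirtinger_const)
  qed
qed

lemma coord_del_alternating:
  fixes f :: "complex^'n::finite \<Rightarrow> (complex^'n) list \<Rightarrow> complex"
  assumes "open S" "z \<in> S" "\<And>y. y \<in> S \<Longrightarrow> alternating_form k (f y)" "\<And>ws. smooth_on S (\<lambda>y. f y ws)"
  shows "alternating_form (Suc k) (coord_del L f z)"
proof -
  have "alternating_form (Suc k) (\<lambda>vs. \<Sum>l\<in>L. dz_wedge l (\<lambda>ws. wirtinger l (\<lambda>y. f y ws) z) vs)"
    by (intro alternating_form_sum dz_wedge_alternating wirtinger_alternating[OF assms])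
  then show ?thesis by (simp add: coord_del_def[abs_def])
qed

lemma smooth_on_coord_del:
  fixes f :: "complex^'n::finite \<Rightarrow> (complex^'n) list \<Rightarrow> complex"
  assumes "open S" "\<And>ws. smooth_on S (\<lambda>y. f y ws)"
  shows "smooth_on S (\<lambda>z. coord_del L f z vs)"
  unfolding coord_del_def dz_wedge_def
  by (intro smooth_on_sum smooth_on_mult smooth_on_const smooth_on_wirtinger assms)

lemma wirtinger_index_type:
  assumes S: "open S" "z \<in> S" and t: "\<And>y. y \<in> S \<Longrightarrow> index_type R p q (f y)"
  shows "index_type R p q (\<lambda>js. wirtinger l (\<lambda>y. f y js) z)"
  unfolding index_type_def
proof (intro allI impI)
  fix js :: "'b list" assume js: "length js = p + q \<and> length (filter (\<lambda>j. j \<in> R) js) \<noteq> p"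
  have "wirtinger l (\<lambda>y. f y js) z = wirtinger l (\<lambda>y. 0) z"
    by (rule wirtinger_cong_open[OF S]) (use t js in \<open>auto simp: index_type_def\<close>)
  then show "wirtinger l (\<lambda>y. f y js) z = 0" by (simp add: wirtinger_const)
qed

lemma coord_del_index_type:
  fixes f :: "complex^'n::finite \<Rightarrow> (complex^'n) list \<Rightarrow> complex"
  assumes "open S" "z \<in> S" "\<And>y. y \<in> S \<Longrightarrow> index_type R p q (\<lambda>js. f y (axis_list js))"
  shows "index_type R (Suc p) q (\<lambda>js. coord_del R f z (axis_list js))"
    "index_type R p (Suc q) (\<lambda>js. coord_del (- R) f z (axis_list js))"
proof -
  have w: "index_type R p q (\<lambda>js. wirtinger l (\<lambda>y. f y (axis_list js)) z)" for l
    by (rule wirtinger_index_type[OF assms])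
  show "index_type R (Suc p) q (\<lambda>js. coord_del R f z (axis_list js))"
    unfolding coord_del_def by (intro index_type_sum dz_wedge_index_type(1) w)
  show "index_type R p (Suc q) (\<lambda>js. coord_del (- R) f z (axis_list js))"
    unfolding coord_del_def by (intro index_type_sum dz_wedge_index_type(2) w) auto
qed

lemma coord_del_UNIV: "coord_del UNIV f z vs = coord_del R f z vs + coord_del (- R) f z vs"
  for f :: "complex^'n::finite \<Rightarrow> (complex^'n) list \<Rightarrow> complex"
proof -
  have "coord_del (R \<union> - R) f z vs = coord_del R f z vs + coord_del (- R) f z vs"
    unfolding coord_del_def by (rule sum.union_disjoint) auto
  then show ?thesis by (simp add: Un_commute)
qed

lemma coord_del_UNIV_eq:
  assumes "\<And>ws. (\<lambda>y. f y ws) differentiable (at z)"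
  shows "coord_del UNIV f z vs = (\<Sum>i<length vs. (-1) ^ i * del_dir (\<lambda>y. f y (drop_at i vs)) z (vs ! i))"
  unfolding coord_del_def dz_wedge_def del_dir_eq_sum[OF assms] sum_distrib_left
  by (subst sum.swap) (simp add: mult.assoc)

text \<open>The terms with second derivatives of a change of coordinates: \<open>b i j\<close> is symmetric, and the
  terms \<open>(i, j)\<close> and \<open>(j, i)\<close> cancel.\<close>

lemma symmetric_insertions_cancel:
  fixes vs :: "(complex^'n::finite) list"
  assumes \<alpha>: "alternating_form k \<alpha>" and vs: "length vs = Suc k" and b: "\<And>i j. b i j = b j i"
  shows "(\<Sum>i<Suc k. (-1) ^ i * (\<Sum>m<k. \<alpha> ((drop_at i vs)[m := b i (if m < i then m else Suc m)]))) = 0"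
proof -
  define t where "t i j = (-1) ^ i * \<alpha> (drop_at i (vs[j := b i j]))" for i j
  have reindex: "(\<Sum>m<k. \<alpha> ((drop_at i vs)[m := b i (if m < i then m else Suc m)])) * (-1) ^ i
      = (\<Sum>j\<in>{..<Suc k} - {i}. t i j)" if i: "i < Suc k" for i
  proof -
    have "(\<Sum>j\<in>{..<Suc k} - {i}. t i j)
        = (\<Sum>m<k. (-1) ^ i * \<alpha> ((drop_at i vs)[m := b i (if m < i then m else Suc m)]))"
    proof (rule sum.reindex_bij_witness[where j="\<lambda>j. if j < i then j else j - 1" and i="\<lambda>m. if m < i then m else Suc m"])
      fix j assume j: "j \<in> {..<Suc k} - {i}"
      have "drop_at i (vs[j := b i j]) = (drop_at i vs)[(if j < i then j else j - 1) := b i j]"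
        by (rule drop_at_update) (use j i vs in auto)
      then show "(-1) ^ i * \<alpha> ((drop_at i vs)[(if j < i then j else j - 1) :=
          b i (if (if j < i then j else j - 1) < i then (if j < i then j else j - 1) else Suc (if j < i then j else j - 1))]) = t i j"
        using j by (auto simp: t_def)
    qed (use i in auto)
    then show ?thesis by (simp add: sum_distrib_left mult.commute)
  qed
  have anti: "t i j = - t j i" if ij: "i < j" "j < Suc k" for i j
  proof -
    define xs ys zs where "xs = take i vs" and "ys = take (j - i - 1) (drop (Suc i) vs)" and "zs = drop (Suc j) vs"
    have len: "length xs = i" "length ys = j - i - 1" "length zs = k - j" using ij vs by (auto simp: xs_def ys_def zs_def)
    have j: "j = Suc (length xs + length ys)" using len ij by simp
    have "j - i - 1 < length (drop (Suc i) vs)" using ij vs by simp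
    from id_take_nth_drop[OF this] have dq: "drop (Suc i) vs = ys @ vs ! j # zs" using ij vs by (simp add: ys_def zs_def)
    have e: "vs = xs @ vs ! i # ys @ vs ! j # zs"
      using ij vs id_take_nth_drop[of i vs] dq by (simp add: xs_def)
    have 1: "drop_at i (vs[j := c]) = xs @ ys @ c # zs" for c
    proof -
      have "drop_at i ((xs @ vs ! i # ys @ vs ! j # zs)[j := c]) = xs @ ys @ c # zs"
        unfolding j using len(1) by (simp add: list_update_append)
      then show ?thesis using e by simp
    qed
    have 2: "drop_at j (vs[i := c]) = xs @ c # ys @ zs" for c
    proof -
      have "drop_at j ((xs @ vs ! i # ys @ vs ! j # zs)[i := c]) = xs @ c # ys @ zs"
        unfolding j using len(1) by (simp add: list_update_append Suc_diff_le)
      then show ?thesis using e by simp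
    qed
    have m: "\<alpha> (xs @ c # ys @ zs) = (-1) ^ length ys * \<alpha> (xs @ ys @ c # zs)" for c
      by (rule antisymmetric_move[OF alternating_form_antisymmetric[OF \<alpha>]]) (use len ij in auto)
    have jj: "j = Suc (i + length ys)" using j len(1) by simp
    have sq: "(-1 :: complex) ^ length ys * (-1) ^ length ys = 1" by (simp flip: power_mult_distrib)
    have "t j i = (-1) ^ j * ((-1) ^ length ys * \<alpha> (xs @ ys @ b i j # zs))" unfolding t_def 2 m b[of j i] ..
    also have "\<dots> = - ((-1) ^ i * (((-1) ^ length ys * (-1) ^ length ys) * \<alpha> (xs @ ys @ b i j # zs)))"
      by (subst jj) (simp add: power_add mult.assoc)
    also have "\<dots> = - t i j" unfolding sq t_def 1 by simp
    finally show ?thesis by simp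
  qed
  have anti': "t i j = - t j i" if "i \<noteq> j" "i < Suc k" "j < Suc k" for i j
    using anti[of i j] anti[of j i] that by (cases "i < j") auto
  let ?P = "SIGMA i:{..<Suc k}. {..<Suc k} - {i}"
  have "(\<Sum>p\<in>?P. t (fst p) (snd p)) = (\<Sum>p\<in>?P. t (snd p) (fst p))"
    by (rule sum.reindex_bij_witness[where i=prod.swap and j=prod.swap]) auto
  also have "\<dots> = (\<Sum>p\<in>?P. - t (fst p) (snd p))"
  proof (rule sum.cong[OF refl])
    fix p assume "p \<in> ?P"
    then show "t (snd p) (fst p) = - t (fst p) (snd p)" by (intro anti') auto
  qed
  also have "\<dots> = - (\<Sum>p\<in>?P. t (fst p) (snd p))" by (rule sum_negf)
  finally have "(\<Sum>p\<in>?P. t (fst p) (snd p)) = 0" by simp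
  moreover have "(\<Sum>p\<in>?P. t (fst p) (snd p)) = (\<Sum>i<Suc k. \<Sum>j\<in>{..<Suc k} - {i}. t i j)"
    by (subst sum.Sigma) (auto simp: case_prod_beta)
  moreover have "\<dots> = (\<Sum>i<Suc k. (-1) ^ i * (\<Sum>m<k. \<alpha> ((drop_at i vs)[m := b i (if m < i then m else Suc m)])))"
    by (rule sum.cong[OF refl]) (simp only: reindex[symmetric] lessThan_iff mult.commute)
  ultimately show ?thesis by simp
qed

text \<open>Expanded in coefficients this is the product rule: the first term differentiates the
  coefficients of \<open>U\<close>, and the others differentiate one of the arguments \<open>FD \<tau> y
  w\<close> each.\<close>

lemma pullback_has_derivative:
  fixes \<tau> :: "complex^'n::finite \<Rightarrow> complex^'n" and U :: "complex^'n \<Rightarrow> (complex^'n) list \<Rightarrow> complex"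
  assumes S: "open S" "z \<in> S" and \<tau>: "smooth_on S \<tau>" and T: "open T" "\<tau> ` S \<subseteq> T"
    and alt: "\<And>y. y \<in> T \<Longrightarrow> alternating_form k (U y)" and sm: "\<And>ws. smooth_on T (\<lambda>y. U y ws)"
    and ws: "length ws = k"
  shows "((\<lambda>y. U (\<tau> y) (map (FD \<tau> y) ws)) has_derivative
    (\<lambda>v. FD (\<lambda>y. U y (map (FD \<tau> z) ws)) (\<tau> z) (FD \<tau> z v)
       + (\<Sum>m<k. U (\<tau> z) ((map (FD \<tau> z) ws)[m := FD (\<lambda>y. FD \<tau> y (ws ! m)) z v])))) (at z)"
proof -
  let ?c = "\<lambda>y js. \<Prod>m<k. (FD \<tau> y (ws ! m)) $ (js ! m)"
  let ?B = "\<lambda>m v. FD (\<lambda>y. FD \<tau> y (ws ! m)) z v"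
  have \<tau>z: "\<tau> z \<in> T" using S T by blast
  have expand: "U (\<tau> y) (map (FD \<tau> y) ws) = (\<Sum>js\<in>lists_of k. ?c y js * U (\<tau> y) (axis_list js))" if "y \<in> S" for y
    using alternating_form_expand[OF alt[of "\<tau> y"], of "map (FD \<tau> y) ws"] that T(2) ws by (simp add: image_subset_iff)
  have dc: "((\<lambda>y. ?c y js) has_derivative (\<lambda>v. \<Sum>m<k. (?B m v) $ (js ! m) * (\<Prod>j\<in>{..<k} - {m}. (FD \<tau> z (ws ! j)) $ (js ! j)))) (at z)" for js
    by (intro has_derivative_prod bounded_linear.has_derivative[OF bounded_linear_vec_nth]
        smooth_on_has_derivative[OF smooth_on_FD[OF \<tau>] S(2)])
  have dU: "((\<lambda>y. U (\<tau> y) vs) has_derivative (\<lambda>v. FD (\<lambda>y. U y vs) (\<tau> z) (FD \<tau> z v))) (at z)" for vs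
    by (rule has_derivative_compose[OF smooth_on_has_derivative[OF \<tau> S(2)] smooth_on_has_derivative[OF sm \<tau>z]])
  let ?D = "\<lambda>v. \<Sum>js\<in>lists_of k. ?c z js * FD (\<lambda>y. U y (axis_list js)) (\<tau> z) (FD \<tau> z v)
      + (\<Sum>m<k. (?B m v) $ (js ! m) * (\<Prod>j\<in>{..<k} - {m}. (FD \<tau> z (ws ! j)) $ (js ! j))) * U (\<tau> z) (axis_list js)"
  have "((\<lambda>y. \<Sum>js\<in>lists_of k. ?c y js * U (\<tau> y) (axis_list js)) has_derivative ?D) (at z)"
    by (intro has_derivative_sum has_derivative_mult dc dU)
  then have 1: "((\<lambda>y. U (\<tau> y) (map (FD \<tau> y) ws)) has_derivative ?D) (at z)"
    by (rule has_derivative_transform_within_open[OF _ S]) (simp only: expand)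
  have "?D v = FD (\<lambda>y. U y (map (FD \<tau> z) ws)) (\<tau> z) (FD \<tau> z v)
       + (\<Sum>m<k. U (\<tau> z) ((map (FD \<tau> z) ws)[m := ?B m v]))" for v
  proof -
    have a: "(\<Sum>js\<in>lists_of k. ?c z js * FD (\<lambda>y. U y (axis_list js)) (\<tau> z) x) = FD (\<lambda>y. U y (map (FD \<tau> z) ws)) (\<tau> z) x" for x
    proof -
      have "((\<lambda>y. \<Sum>js\<in>lists_of k. ?c z js * U y (axis_list js)) has_derivative
          (\<lambda>x. \<Sum>js\<in>lists_of k. ?c z js * FD (\<lambda>y. U y (axis_list js)) (\<tau> z) x)) (at (\<tau> z))"
        by (intro has_derivative_sum has_derivative_mult_right smooth_on_has_derivative[OF sm \<tau>z])
      then have "((\<lambda>y. U y (map (FD \<tau> z) ws)) has_derivative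
          (\<lambda>x. \<Sum>js\<in>lists_of k. ?c z js * FD (\<lambda>y. U y (axis_list js)) (\<tau> z) x)) (at (\<tau> z))"
        by (rule has_derivative_transform_within_open[OF _ T(1) \<tau>z])
          (use alternating_form_expand[OF alt, of _ "map (FD \<tau> z) ws"] ws in simp)
      from FD_eqI[OF this] show ?thesis by simp
    qed
    have b: "(\<Sum>js\<in>lists_of k. ((?B m v) $ (js ! m) * (\<Prod>j\<in>{..<k} - {m}. (FD \<tau> z (ws ! j)) $ (js ! j))) * U (\<tau> z) (axis_list js))
        = U (\<tau> z) ((map (FD \<tau> z) ws)[m := ?B m v])" if m: "m < k" for m
    proof -
      let ?w = "(map (FD \<tau> z) ws)[m := ?B m v]"
      have "(\<Prod>i<k. (?w ! i) $ (js ! i)) = (?B m v) $ (js ! m) * (\<Prod>j\<in>{..<k} - {m}. (FD \<tau> z (ws ! j)) $ (js ! j))" for js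
        using m ws by (subst prod.remove[of _ m]) (auto intro!: prod.cong)
      then show ?thesis using alternating_form_expand[OF alt[OF \<tau>z], of ?w] ws by simp
    qed
    have "?D v = (\<Sum>js\<in>lists_of k. ?c z js * FD (\<lambda>y. U y (axis_list js)) (\<tau> z) (FD \<tau> z v))
        + (\<Sum>m<k. \<Sum>js\<in>lists_of k. ((?B m v) $ (js ! m) * (\<Prod>j\<in>{..<k} - {m}. (FD \<tau> z (ws ! j)) $ (js ! j))) * U (\<tau> z) (axis_list js))"
      unfolding sum.distrib sum_distrib_right by (subst (2) sum.swap) simp
    also have "\<dots> = FD (\<lambda>y. U y (map (FD \<tau> z) ws)) (\<tau> z) (FD \<tau> z v) + (\<Sum>m<k. U (\<tau> z) ((map (FD \<tau> z) ws)[m := ?B m v]))"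
      unfolding a by (intro arg_cong2[of _ _ _ _ "(+)"] refl sum.cong b) auto
    finally show ?thesis .
  qed
  with 1 show ?thesis by simp
qed

text \<open>Besides the expected terms, differentiating a pullback produces terms with second derivatives of \<open>\<tau>\<close>. As \<open>\<tau>\<close> is
  holomorphic, these are complex linear in the direction of differentiation and so occur in full in the complex
  linear part; as second derivatives are symmetric, they cancel by alternation.\<close>

lemma coord_del_pullback:
  fixes \<tau> :: "complex^'n::finite \<Rightarrow> complex^'n" and U :: "complex^'n \<Rightarrow> (complex^'n) list \<Rightarrow> complex"
  assumes S: "open S" "z \<in> S" and \<tau>: "holomorphic_map_on S \<tau>" and T: "open T" "\<tau> ` S \<subseteq> T"
    and alt: "\<And>y. y \<in> T \<Longrightarrow> alternating_form k (U y)" and sm: "\<And>ws. smooth_on T (\<lambda>y. U y ws)"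
    and V: "\<And>y vs. y \<in> S \<Longrightarrow> V y vs = U (\<tau> y) (map (FD \<tau> y) vs)"
    and altV: "\<And>y. y \<in> S \<Longrightarrow> alternating_form k (V y)" and smV: "\<And>ws. smooth_on S (\<lambda>y. V y ws)"
  shows "coord_del UNIV V z vs = coord_del UNIV U (\<tau> z) (map (FD \<tau> z) vs)"
proof (cases "length vs = Suc k")
  case False
  then show ?thesis
    using alternating_form_length[OF coord_del_alternating[OF S altV smV]] S T
      alternating_form_length[OF coord_del_alternating[OF T(1) _ alt sm, of "\<tau> z"]] by (simp add: image_subset_iff)
next
  case True
  have \<tau>z: "\<tau> z \<in> T" using S T by blast
  have s\<tau>: "smooth_on S \<tau>" by (rule holomorphic_map_on_smooth[OF \<tau>])
  let ?J = "FD \<tau> z"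
  define B where "B v w = FD (\<lambda>y. FD \<tau> y w) z v" for v w
  have Bsym: "B v w = B w v" for v w unfolding B_def by (rule FD_commute[OF S s\<tau>])
  have Bscale: "B (a *s v) w = a *s B v w" for a v w
  proof -
    have "B (a *s v) w = B w (a *s v)" by (rule Bsym)
    also have "\<dots> = FD (\<lambda>y. a *s FD \<tau> y v) z w" unfolding B_def
      by (rule fun_cong[OF FD_cong_open[OF S]]) (rule holomorphic_map_on_scalar_mult[OF \<tau>])
    also have "\<dots> = a *s B w v" unfolding B_def
      by (rule FD_bounded_linear[OF bounded_linear_scalar_mult_right smooth_on_differentiable[OF smooth_on_FD[OF s\<tau>] S(2)]])
    finally show ?thesis by (simp add: Bsym[of w v])
  qed
  have main: "del_dir (\<lambda>y. V y ws) z v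
      = del_dir (\<lambda>y. U y (map ?J ws)) (\<tau> z) (?J v) + (\<Sum>m<k. U (\<tau> z) ((map ?J ws)[m := B v (ws ! m)]))"
    if ws: "length ws = k" for ws v
  proof -
    have "((\<lambda>y. V y ws) has_derivative (\<lambda>v. FD (\<lambda>y. U y (map ?J ws)) (\<tau> z) (?J v)
       + (\<Sum>m<k. U (\<tau> z) ((map ?J ws)[m := B v (ws ! m)])))) (at z)"
      unfolding B_def
      by (rule has_derivative_transform_within_open[OF pullback_has_derivative[OF S s\<tau> T alt sm ws] S]) (simp_all add: V)
    from FD_eqI[OF this]
    have FDV: "FD (\<lambda>y. V y ws) z v = FD (\<lambda>y. U y (map ?J ws)) (\<tau> z) (?J v)
       + (\<Sum>m<k. U (\<tau> z) ((map ?J ws)[m := B v (ws ! m)]))" for v by simp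
    have "(\<Sum>m<k. U (\<tau> z) ((map ?J ws)[m := B (\<i> *s v) (ws ! m)])) = (\<Sum>m<k. \<i> * U (\<tau> z) ((map ?J ws)[m := B v (ws ! m)]))"
      unfolding Bscale using ws by (intro sum.cong refl alternating_form_slot_scale[OF alt[OF \<tau>z]]) auto
    then have "(\<Sum>m<k. U (\<tau> z) ((map ?J ws)[m := B (\<i> *s v) (ws ! m)])) = \<i> * (\<Sum>m<k. U (\<tau> z) ((map ?J ws)[m := B v (ws ! m)]))"
      by (simp add: sum_distrib_left)
    then show ?thesis
      unfolding del_dir_def FDV holomorphic_map_on_scalar_mult[OF \<tau> S(2)]
      by (simp add: complex_eq_iff field_simps)
  qed
  have len: "length (drop_at i vs) = k" if "i < Suc k" for i using True that by (simp add: length_drop_at)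
  have mapd: "map ?J (drop_at i vs) = drop_at i (map ?J vs)" for i by (simp add: take_map drop_map)
  let ?b = "\<lambda>i j. B (vs ! i) (vs ! j)"
  have cancel: "(\<Sum>i<Suc k. (-1) ^ i * (\<Sum>m<k. U (\<tau> z) ((drop_at i (map ?J vs))[m := ?b i (if m < i then m else Suc m)]))) = 0"
    by (rule symmetric_insertions_cancel[OF alt[OF \<tau>z]]) (use True Bsym in auto)
  have "coord_del UNIV V z vs = (\<Sum>i<Suc k. (-1) ^ i * del_dir (\<lambda>y. V y (drop_at i vs)) z (vs ! i))"
    using coord_del_UNIV_eq[OF smooth_on_differentiable[OF smV S(2)]] True by simp
  also have "\<dots> = (\<Sum>i<Suc k. (-1) ^ i * del_dir (\<lambda>y. U y (drop_at i (map ?J vs))) (\<tau> z) (?J (vs ! i))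
      + (-1) ^ i * (\<Sum>m<k. U (\<tau> z) ((drop_at i (map ?J vs))[m := ?b i (if m < i then m else Suc m)])))"
  proof (rule sum.cong[OF refl])
    fix i assume "i \<in> {..<Suc k}"
    then have i: "i < Suc k" by simp
    have "(drop_at i vs) ! m = vs ! (if m < i then m else Suc m)" if "m < k" for m
      using nth_drop_at[of i vs m] i that True by auto
    then have "(\<Sum>m<k. U (\<tau> z) ((map ?J (drop_at i vs))[m := B (vs ! i) (drop_at i vs ! m)]))
        = (\<Sum>m<k. U (\<tau> z) ((map ?J (drop_at i vs))[m := ?b i (if m < i then m else Suc m)]))"
      by (intro sum.cong refl) (simp only: lessThan_iff)
    then show "(-1) ^ i * del_dir (\<lambda>y. V y (drop_at i vs)) z (vs ! i)
        = (-1) ^ i * del_dir (\<lambda>y. U y (drop_at i (map ?J vs))) (\<tau> z) (?J (vs ! i))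
        + (-1) ^ i * (\<Sum>m<k. U (\<tau> z) ((drop_at i (map ?J vs))[m := ?b i (if m < i then m else Suc m)]))"
      unfolding main[OF len[OF i]] mapd by (simp only: distrib_left)
  qed
  also have "\<dots> = (\<Sum>i<Suc k. (-1) ^ i * del_dir (\<lambda>y. U y (drop_at i (map ?J vs))) (\<tau> z) (?J (vs ! i)))"
    unfolding sum.distrib cancel by simp
  also have "\<dots> = (\<Sum>i<length (map ?J vs). (-1) ^ i * del_dir (\<lambda>y. U y (drop_at i (map ?J vs))) (\<tau> z) (map ?J vs ! i))"
    using True by (intro sum.cong) auto
  also have "\<dots> = coord_del UNIV U (\<tau> z) (map ?J vs)"
    by (rule coord_del_UNIV_eq[OF smooth_on_differentiable[OF sm \<tau>z], symmetric])
  finally show ?thesis .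
qed

section \<open>Forms on the manifold\<close>

context complex_manifold
begin

lemma smooth_formsD:
  assumes "u \<in> smooth_forms A k"
  shows "c \<notin> A \<or> z \<notin> cim c \<Longrightarrow> u c z vs = 0"
    "c \<in> A \<Longrightarrow> z \<in> cim c \<Longrightarrow> alternating_form k (u c z)"
    "c \<in> A \<Longrightarrow> smooth_on (cim c) (\<lambda>z. u c z vs)"
    "c \<in> A \<Longrightarrow> d \<in> A \<Longrightarrow> x \<in> cdom c \<inter> cdom d \<Longrightarrow> u c (coord c x) vs = u d (coord d x) (map (jac c d x) vs)"
  using assms unfolding smooth_forms_def by blast+

text \<open>Changes of charts are holomorphic with linear Jacobians, so alternation and smoothness near a point pass from
  one chart to all others.\<close>

lemma smooth_formsI:
  assumes zero: "\<And>c z vs. c \<notin> A \<or> z \<notin> cim c \<Longrightarrow> w c z vs = 0"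
    and compat: "\<And>c d x vs. c \<in> A \<Longrightarrow> d \<in> A \<Longrightarrow> x \<in> cdom c \<inter> cdom d \<Longrightarrow>
      w c (coord c x) vs = w d (coord d x) (map (jac c d x) vs)"
    and loc: "\<And>x. \<exists>d U. d \<in> A \<and> open U \<and> x \<in> U \<and> U \<subseteq> cdom d \<and>
      (\<forall>y\<in>U. alternating_form k (w d (coord d y))) \<and> (\<forall>vs. smooth_on (coord d ` U) (\<lambda>z. w d z vs))"
  shows "w \<in> smooth_forms A k"
  unfolding smooth_forms_def mem_Collect_eq
proof (intro conjI ballI allI impI)
  show "w c z vs = 0" if "c \<notin> A \<or> z \<notin> cim c" for c z vs using zero[OF that] .
  show "w c (coord c x) vs = w d (coord d x) (map (jac c d x) vs)"
    if "c \<in> A" "d \<in> A" "x \<in> cdom c \<inter> cdom d" for c d x vs using compat[OF that] .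
  fix c assume c: "c \<in> A"
  show alt: "alternating_form k (w c z)" if "z \<in> cim c" for z
  proof -
    from that obtain x where x: "x \<in> cdom c" "z = coord c x" by (auto simp: cim_def)
    obtain d U where d: "d \<in> A" "x \<in> U" "U \<subseteq> cdom d" "\<forall>y\<in>U. alternating_form k (w d (coord d y))"
      using loc[of x] by blast
    have xcd: "x \<in> cdom c \<inter> cdom d" using x d by blast
    have "alternating_form k (\<lambda>vs. w d (coord d x) (map (jac c d x) vs))"
      by (rule alternating_form_map[OF _ jac_linear[OF c d(1) xcd]]) (use d in blast)
    moreover have "w c z = (\<lambda>vs. w d (coord d x) (map (jac c d x) vs))"
      using compat[OF c d(1) xcd] x by auto
    ultimately show ?thesis by simp
  qed
  fix vs
  show "smooth_on (cim c) (\<lambda>z. w c z vs)"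
  proof (cases "length vs = k")
    case False
    have "smooth_on (cim c) (\<lambda>z. 0 :: complex)" by (rule smooth_on_const[OF open_cim[OF c]])
    then show ?thesis
      by (rule smooth_on_cong[OF open_cim[OF c], rotated]) (simp add: alternating_form_length[OF alt False])
  next
    case True
    show ?thesis
    proof (rule smooth_on_local)
      fix z assume "z \<in> cim c"
      then obtain x where x: "x \<in> cdom c" "z = coord c x" by (auto simp: cim_def)
      obtain d U where d: "d \<in> A" "open U" "x \<in> U" "U \<subseteq> cdom d" "\<forall>y\<in>U. alternating_form k (w d (coord d y))"
        "\<forall>vs. smooth_on (coord d ` U) (\<lambda>z. w d z vs)"
        using loc[of x] by blast
      let ?S = "coord c ` (cdom c \<inter> U)"
      have S: "open ?S" by (intro open_coord_image c open_Int open_cdom d) auto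
      have h\<tau>: "holomorphic_map_on ?S (transition c d)"
        by (rule holomorphic_map_on_subset[OF transition_holomorphic[OF c d(1)]]) (use d(4) in blast)
      have im: "transition c d ` ?S \<subseteq> coord d ` U" by (auto simp: transition_coord[OF c])
      have s\<tau>: "smooth_on ?S (transition c d)" by (rule holomorphic_map_on_smooth[OF h\<tau>])
      have "smooth_on ?S (\<lambda>y. \<Sum>js\<in>lists_of k. (\<Prod>m<k. (FD (transition c d) y (vs ! m)) $ (js ! m)) * w d (transition c d y) (axis_list js))"
        using d(6)
        by (intro smooth_on_sum smooth_on_mult smooth_on_prod smooth_on_nth smooth_on_FD S s\<tau>
            smooth_on_compose[OF S im s\<tau>]) auto
      then have "smooth_on ?S (\<lambda>y. w c y vs)"
      proof (rule smooth_on_cong[OF S, rotated])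
        fix y assume "y \<in> ?S"
        then obtain x' where x': "x' \<in> cdom c" "x' \<in> U" "y = coord c x'" by blast
        have "x' \<in> cdom c \<inter> cdom d" using x' d(4) by blast
        then have "w c y vs = w d (coord d x') (map (jac c d x') vs)" using compat[OF c d(1)] x' by simp
        also have "\<dots> = (\<Sum>js\<in>lists_of k. (\<Prod>i<k. (map (jac c d x') vs ! i) $ (js ! i)) * w d (coord d x') (axis_list js))"
          by (rule alternating_form_expand) (use d(5) x' True in auto)
        finally show "(\<Sum>js\<in>lists_of k. (\<Prod>m<k. (FD (transition c d) y (vs ! m)) $ (js ! m)) * w d (transition c d y) (axis_list js)) = w c y vs"
          using x' True by (simp add: jac_def transition_coord[OF c])
      qed
      then show "\<exists>U. open U \<and> z \<in> U \<and> smooth_on U (\<lambda>z. w c z vs)" using S x d(3) by blast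
    qed
  qed
qed

lemma del_compat:
  assumes u: "u \<in> smooth_forms A k" and c: "c \<in> A" "d \<in> A" "x \<in> cdom c \<inter> cdom d"
  shows "del A u c (coord c x) vs = del A u d (coord d x) (map (jac c d x) vs)"
proof -
  let ?S = "coord c ` (cdom c \<inter> cdom d)"
  have sub: "?S \<subseteq> cim c" by (auto simp: cim_def)
  have "coord_del UNIV (u c) (coord c x) vs
      = coord_del UNIV (u d) (transition c d (coord c x)) (map (FD (transition c d) (coord c x)) vs)"
  proof (rule coord_del_pullback[OF open_overlap[OF c(1,2)] _ transition_holomorphic[OF c(1,2)] open_cim[OF c(2)]])
    show "transition c d ` ?S \<subseteq> cim d" by (auto simp: transition_coord[OF c(1)] coord_in)
    show "u c y vs = u d (transition c d y) (map (FD (transition c d) y) vs)" if "y \<in> ?S" for y vs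
    proof -
      from that obtain x' where x': "x' \<in> cdom c \<inter> cdom d" "y = coord c x'" by blast
      then show ?thesis using smooth_formsD(4)[OF u c(1,2) x'(1)] by (simp add: jac_def transition_coord[OF c(1)])
    qed
    show "alternating_form k (u c y)" if "y \<in> ?S" for y using smooth_formsD(2)[OF u c(1)] that sub by blast
    show "smooth_on ?S (\<lambda>y. u c y ws)" for ws by (rule smooth_on_subset[OF smooth_formsD(3)[OF u c(1)] sub])
  qed (use c smooth_formsD[OF u] in auto)
  then show ?thesis using c by (simp add: del_def coord_in jac_def transition_coord)
qed

end

locale product_manifold = complex_manifold A
  for A :: "('a::t2_space, 'n::finite) chart set" +
  fixes N F :: "('a, 'n) distribution" and r :: nat
  assumes integrable: "integrable_product_structure A r N F"
begin

lemma subbundles: "holomorphic_subbundle A r N" "holomorphic_subbundle A (CARD('n) - r) F"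
  using integrable unfolding integrable_product_structure_def almost_product_structure_def by auto

lemma complementary_fibres: "c \<in> A \<Longrightarrow> z \<in> cim c \<Longrightarrow> complementary (N c z) (F c z)"
  using integrable subbundle_subspace[OF subbundles(1)] subbundle_subspace[OF subbundles(2)]
  unfolding integrable_product_structure_def almost_product_structure_def complementary_def by auto

lemma product_chart_cover: obtains d R where "product_coords A N F d R" "x \<in> cdom d"
  by (rule product_chart_exists[OF integrable]) (erule that)

lemma product_coords_in: "product_coords A N F d R \<Longrightarrow> d \<in> A"
  by (simp add: product_coords_def)

lemma product_coords_axes: "product_coords A N F d R \<Longrightarrow> z \<in> cim d \<Longrightarrow> N d z = axes R \<and> F d z = axes (- R)"
  by (simp add: product_coords_def axes_def)

lemma forms_pq_smooth: "u \<in> forms_pq A N F p q \<Longrightarrow> u \<in> smooth_forms A (p + q)"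
  by (simp add: forms_pq_def)

lemma forms_pq_type: "u \<in> forms_pq A N F p q \<Longrightarrow> c \<in> A \<Longrightarrow> z \<in> cim c \<Longrightarrow> has_type (N c z) (F c z) p q (u c z)"
  by (simp add: forms_pq_def)

lemma forms_pq_index_type:
  assumes "u \<in> forms_pq A N F p q" "product_coords A N F d R" "z \<in> cim d"
  shows "index_type R p q (\<lambda>js. u d z (axis_list js))"
  using forms_pq_type[OF assms(1) product_coords_in[OF assms(2)] assms(3)] product_coords_axes[OF assms(2,3)]
    has_type_axes_iff[OF smooth_formsD(2)[OF forms_pq_smooth[OF assms(1)] product_coords_in[OF assms(2)] assms(3)]]
  by simp

text \<open>In product coordinates \<open>\<partial>\<close> is the sum of the two operators on the
  right, which raise one of the two degrees each; so they are the components of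
  \<open>\<partial>\<close>.\<close>

lemma del_components_in_product_coords:
  assumes u: "u \<in> forms_pq A N F p q" and d: "product_coords A N F d R" and z: "z \<in> cim d"
  shows "del_N A N F p q u d z = coord_del R (u d) z" "del_F A N F p q u d z = coord_del (- R) (u d) z"
proof -
  have dA: "d \<in> A" by (rule product_coords_in[OF d])
  note us = smooth_formsD[OF forms_pq_smooth[OF u]]
  have alt: "alternating_form (Suc (p + q)) (coord_del L (u d) z)" for L
    using coord_del_alternating[OF open_cim[OF dA] z us(2)[OF dA] us(3)[OF dA]] .
  have alt': "alternating_form (Suc p + q) (coord_del L (u d) z)" "alternating_form (p + Suc q) (coord_del L (u d) z)" for L
    using alt[of L] by simp_all
  have tN: "has_type (axes R) (axes (- R)) (Suc p) q (coord_del R (u d) z)"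
    unfolding has_type_axes_iff[OF alt'(1)]
    by (rule coord_del_index_type(1)[OF open_cim[OF dA] z]) (rule forms_pq_index_type[OF u d])
  have tF: "has_type (axes R) (axes (- R)) p (Suc q) (coord_del (- R) (u d) z)"
    unfolding has_type_axes_iff[OF alt'(2)]
    by (rule coord_del_index_type(2)[OF open_cim[OF dA] z]) (rule forms_pq_index_type[OF u d])
  have del: "del A u d z = (\<lambda>vs. coord_del R (u d) z vs + coord_del (- R) (u d) z vs)"
    using dA z by (intro ext) (simp add: del_def coord_del_UNIV[of _ _ _ R])
  have "type_component (axes R) (axes (- R)) (Suc p) q (coord_del R (u d) z) = coord_del R (u d) z"
    by (rule type_component_same[OF complementary_axes alt'(1) tN])
  moreover have "type_component (axes R) (axes (- R)) (Suc p) q (coord_del (- R) (u d) z) = (\<lambda>vs. 0)"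
    by (rule type_component_other[OF complementary_axes tF]) auto
  moreover have "type_component (axes R) (axes (- R)) p (Suc q) (coord_del (- R) (u d) z) = coord_del (- R) (u d) z"
    by (rule type_component_same[OF complementary_axes alt'(2) tF])
  moreover have "type_component (axes R) (axes (- R)) p (Suc q) (coord_del R (u d) z) = (\<lambda>vs. 0)"
    by (rule type_component_other[OF complementary_axes tN]) auto
  ultimately show "del_N A N F p q u d z = coord_del R (u d) z" "del_F A N F p q u d z = coord_del (- R) (u d) z"
    unfolding del_N_def del_F_def del using product_coords_axes[OF d z]
    by (auto simp: type_component_add)
qed

lemma del_components_compat:
  assumes u: "u \<in> forms_pq A N F p q" and c: "c \<in> A" "d \<in> A" "x \<in> cdom c \<inter> cdom d"
  shows "del_N A N F p q u c (coord c x) vs = del_N A N F p q u d (coord d x) (map (jac c d x) vs)"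
    "del_F A N F p q u c (coord c x) vs = del_F A N F p q u d (coord d x) (map (jac c d x) vs)"
proof -
  have e: "del A u c (coord c x) = (\<lambda>vs. del A u d (coord d x) (map (jac c d x) vs))"
    using del_compat[OF forms_pq_smooth[OF u] c] by blast
  have comp: "complementary (N c (coord c x)) (F c (coord c x))" "complementary (N d (coord d x)) (F d (coord d x))"
    using c by (auto intro!: complementary_fibres coord_in)
  have im: "jac c d x ` N c (coord c x) \<subseteq> N d (coord d x)" "jac c d x ` F c (coord c x) \<subseteq> F d (coord d x)"
    using subbundle_jac[OF subbundles(1) c] subbundle_jac[OF subbundles(2) c] by simp_all
  show "del_N A N F p q u c (coord c x) vs = del_N A N F p q u d (coord d x) (map (jac c d x) vs)"
    unfolding del_N_def e by (rule type_component_map[OF comp jac_linear[OF c] im])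
  show "del_F A N F p q u c (coord c x) vs = del_F A N F p q u d (coord d x) (map (jac c d x) vs)"
    unfolding del_F_def e by (rule type_component_map[OF comp jac_linear[OF c] im])
qed

lemma del_N_in_forms_pq:
  assumes u: "u \<in> forms_pq A N F p q"
  shows "del_N A N F p q u \<in> forms_pq A N F (Suc p) q"
proof -
  note us = smooth_formsD[OF forms_pq_smooth[OF u]]
  have alt: "alternating_form (Suc p + q) (del_N A N F p q u d z)"
    and ty: "has_type (N d z) (F d z) (Suc p) q (del_N A N F p q u d z)"
    if d: "product_coords A N F d R" and z: "z \<in> cim d" for d R z
  proof -
    have dA: "d \<in> A" by (rule product_coords_in[OF d])
    show 1: "alternating_form (Suc p + q) (del_N A N F p q u d z)"
      unfolding del_components_in_product_coords[OF u d z]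
      using coord_del_alternating[OF open_cim[OF dA] z us(2)[OF dA] us(3)[OF dA]] by simp
    have "index_type R (Suc p) q (\<lambda>js. del_N A N F p q u d z (axis_list js))"
      unfolding del_components_in_product_coords[OF u d z]
      by (rule coord_del_index_type(1)[OF open_cim[OF dA] z]) (rule forms_pq_index_type[OF u d])
    then show "has_type (N d z) (F d z) (Suc p) q (del_N A N F p q u d z)"
      using has_type_axes_iff[OF 1] product_coords_axes[OF d z] by simp
  qed
  have "del_N A N F p q u \<in> smooth_forms A (Suc p + q)"
  proof (rule smooth_formsI)
    fix c z vs assume "c \<notin> A \<or> z \<notin> cim c"
    then have "del A u c z = (\<lambda>vs. 0)" by (auto simp: del_def)
    then show "del_N A N F p q u c z vs = 0" by (simp add: del_N_def type_component_zero)
  next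
    fix x
    obtain d R where d: "product_coords A N F d R" "x \<in> cdom d" by (rule product_chart_cover)
    have dA: "d \<in> A" by (rule product_coords_in[OF d(1)])
    have "smooth_on (cim d) (\<lambda>z. del_N A N F p q u d z vs)" for vs
      by (rule smooth_on_cong[OF open_cim[OF dA] _ smooth_on_coord_del[where L=R and vs=vs, OF open_cim[OF dA] us(3)[OF dA]]])
        (simp add: del_components_in_product_coords[OF u d(1)])
    then show "\<exists>d U. d \<in> A \<and> open U \<and> x \<in> U \<and> U \<subseteq> cdom d \<and>
      (\<forall>y\<in>U. alternating_form (Suc p + q) (del_N A N F p q u d (coord d y))) \<and>
      (\<forall>vs. smooth_on (coord d ` U) (\<lambda>z. del_N A N F p q u d z vs))"
      using dA d alt[OF d(1) coord_in] open_cdom[OF dA]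
      by (intro exI[of _ d] exI[of _ "cdom d"]) (auto simp: cim_def)
  qed (rule del_components_compat(1)[OF u])
  moreover have "has_type (N c z) (F c z) (Suc p) q (del_N A N F p q u c z)" if c: "c \<in> A" "z \<in> cim c" for c z
  proof -
    obtain x where x: "x \<in> cdom c" "z = coord c x" using c by (auto simp: cim_def)
    obtain d R where d: "product_coords A N F d R" "x \<in> cdom d" by (rule product_chart_cover)
    have dA: "d \<in> A" by (rule product_coords_in[OF d(1)])
    have xcd: "x \<in> cdom c \<inter> cdom d" using x d by blast
    have e: "del_N A N F p q u c z = (\<lambda>vs. del_N A N F p q u d (coord d x) (map (jac c d x) vs))"
      using del_components_compat(1)[OF u c(1) dA xcd] x by blast
    have im: "jac c d x ` N c z \<subseteq> N d (coord d x)" "jac c d x ` F c z \<subseteq> F d (coord d x)"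
      using subbundle_jac[OF subbundles(1) c(1) dA xcd] subbundle_jac[OF subbundles(2) c(1) dA xcd] x by simp_all
    show ?thesis unfolding e by (rule has_type_image[OF ty[OF d(1) coord_in[OF d(2)]] im])
  qed
  ultimately show ?thesis by (simp add: forms_pq_def)
qed

end

section \<open>Integration against test functions\<close>

lemma integrable_compact_support:
  fixes f :: "'a::euclidean_space \<Rightarrow> 'b::{banach, second_countable_topology}"
  assumes "continuous_on UNIV f" "compact K" "\<And>z. z \<notin> K \<Longrightarrow> f z = 0"
  shows "integrable lborel f"
proof -
  have "integrable lborel (\<lambda>z. indicator K z *\<^sub>R f z)"
    by (rule borel_integrable_compact[OF assms(2) continuous_on_subset[OF assms(1)]]) auto
  moreover have "(\<lambda>z. indicator K z *\<^sub>R f z) = f" by (auto simp: indicator_def assms(3))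
  ultimately show ?thesis by simp
qed

lemma smooth_on_extend_zero:
  assumes "open V" "closed K" "K \<subseteq> V" "smooth_on V f" "\<And>z. z \<in> V - K \<Longrightarrow> f z = 0"
  shows "smooth_on UNIV (\<lambda>z. if z \<in> V then f z else 0)"
proof (rule smooth_on_local)
  fix z :: 'a
  show "\<exists>U. open U \<and> z \<in> U \<and> smooth_on U (\<lambda>z. if z \<in> V then f z else 0)"
  proof (cases "z \<in> V")
    case True
    have "smooth_on V (\<lambda>z. if z \<in> V then f z else 0)"
      by (rule smooth_on_cong[OF assms(1) _ assms(4)]) simp
    then show ?thesis using True assms(1) by blast
  next
    case False
    have o: "open (- K)" using assms(2) by auto
    have "smooth_on (- K) (\<lambda>z. if z \<in> V then f z else 0)"
      by (rule smooth_on_cong[OF o _ smooth_on_const[OF o, where c=0]]) (use assms(5) in auto)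
    then show ?thesis using False assms(3) o by blast
  qed
qed

text \<open>Difference quotients of \<open>h\<close> have integral zero by translation invariance, and converge
  boundedly to the derivative.\<close>

lemma integral_FD_zero:
  fixes h :: "'a::euclidean_space \<Rightarrow> complex"
  assumes h: "smooth_on UNIV h" and K: "compact K" and supp: "\<And>z. z \<notin> K \<Longrightarrow> h z = 0"
  shows "(\<integral>z. FD h z v \<partial>lborel) = 0" "integrable lborel (\<lambda>z. FD h z v)"
proof -
  have ch: "continuous_on UNIV h" by (rule smooth_on_continuous_on[OF h])
  have cF: "continuous_on UNIV (\<lambda>z. FD h z v)" by (rule smooth_on_continuous_on[OF smooth_on_FD[OF h]])
  have dh: "(h has_derivative FD h z) (at z)" for z by (rule smooth_on_has_derivative[OF h]) simp
  have F0: "FD h z w = 0" if "z \<notin> K" for z w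
  proof -
    have "FD h z = FD (\<lambda>_. 0) z"
      by (rule FD_cong_open[of "- K"]) (use that K supp in \<open>auto simp: compact_imp_closed open_Compl\<close>)
    then show ?thesis by simp
  qed
  show "integrable lborel (\<lambda>z. FD h z v)" by (rule integrable_compact_support[OF cF K]) (rule F0)
  obtain B where B: "B \<ge> 0" "\<And>z w. z \<in> K \<Longrightarrow> norm (FD h z w) \<le> B * norm w"
    by (rule FD_bound_on_compact[OF h K subset_UNIV]) (erule that)
  have B': "norm (FD h z w) \<le> B * norm w" for z w
    using B F0[of z w] by (cases "z \<in> K") auto
  have lip: "norm (h x - h y) \<le> B * norm (x - y)" for x y
    by (rule differentiable_bound[OF convex_UNIV dh onorm_bound[OF B(1) B']]) (rule UNIV_I)+
  have "\<exists>r. \<forall>x\<in>K. norm x \<le> r" using compact_imp_bounded[OF K] by (simp add: bounded_iff)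
  then obtain r where r: "K \<subseteq> cball 0 r" by (auto simp: subset_iff)
  let ?s = "\<lambda>n z. (h ((1 / real (Suc n)) *\<^sub>R v + z) - h z) * of_nat (Suc n)"
  let ?K = "cball (0::'a) (r + norm v)"
  have small: "norm ((1 / real (Suc n)) *\<^sub>R v) \<le> norm v" for n
    using mult_right_mono[of "1 / real (Suc n)" 1 "norm v"] by (simp add: divide_simps)
  have outside: "h (c + z) = 0" if "z \<notin> ?K" "norm c \<le> norm v" for c z
  proof (rule supp)
    have "norm z \<le> norm (c + z) + norm c" using norm_triangle_ineq4[of "c + z" c] by simp
    then have "norm (c + z) > r" using that by simp
    then show "c + z \<notin> K" using r by auto
  qed
  have int_shift: "(\<integral>z. h (c + z) \<partial>lborel) = (\<integral>z. h z \<partial>lborel)" for c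
  proof -
    have "(\<integral>z. h z \<partial>(distr lborel borel ((+) c))) = (\<integral>z. h (c + z) \<partial>lborel)"
      by (rule integral_distr) (auto intro: borel_measurable_continuous_onI[OF ch])
    then show ?thesis by (simp add: lborel_distr_plus)
  qed
  have integrable_shift: "integrable lborel (\<lambda>z. h (c + z))" if "norm c \<le> norm v" for c
    by (rule integrable_compact_support[of _ ?K])
      (auto intro!: continuous_on_compose2[OF ch] continuous_intros outside[OF _ that])
  have ints: "(\<integral>z. ?s n z \<partial>lborel) = 0" for n
  proof -
    have "integrable lborel (\<lambda>z. h z)" using integrable_shift[of 0] by simp
    then have "(\<integral>z. h ((1 / real (Suc n)) *\<^sub>R v + z) - h z \<partial>lborel) = 0"
      using Bochner_Integration.integral_diff[OF integrable_shift[OF small[of n]]] int_shift by simp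
    then show ?thesis by (simp only: integral_mult_left_zero mult_zero_left)
  qed
  have "(\<lambda>n. \<integral>z. ?s n z \<partial>lborel) \<longlonglongrightarrow> (\<integral>z. FD h z v \<partial>lborel)"
  proof (rule integral_dominated_convergence[where w="\<lambda>z. indicator ?K z *\<^sub>R (B * norm v)"])
    show "(\<lambda>z. FD h z v) \<in> borel_measurable lborel"
      using borel_measurable_continuous_onI[OF cF] by simp
    show "?s n \<in> borel_measurable lborel" for n
    proof -
      have "?s n \<in> borel_measurable borel"
        by (intro borel_measurable_continuous_onI continuous_intros continuous_on_compose2[OF ch]) auto
      then show ?thesis by simp
    qed
    show "integrable lborel (\<lambda>z. indicator ?K z *\<^sub>R (B * norm v))"
      by (rule borel_integrable_compact) auto
    show "AE z in lborel. (\<lambda>n. ?s n z) \<longlonglongrightarrow> FD h z v"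
    proof (rule AE_I2)
      fix z
      show "(\<lambda>n. ?s n z) \<longlonglongrightarrow> FD h z v"
      proof (cases "v = 0")
        case True
        then show ?thesis using linear_0[OF has_derivative_linear[OF dh]] by simp
      next
        case False
        let ?h = "\<lambda>n. (1 / real (Suc n)) *\<^sub>R v"
        have "?h \<longlonglongrightarrow> 0 *\<^sub>R v" by (intro tendsto_scaleR tendsto_const LIMSEQ_Suc[OF lim_1_over_n])
        then have "filterlim ?h (at 0) sequentially" using False by (simp add: filterlim_at)
        moreover have "((\<lambda>u. norm (h (z + u) - h z - FD h z u) / norm u) \<longlongrightarrow> 0) (at 0)"
          using dh[of z] unfolding has_derivative_at by blast
        ultimately have "(\<lambda>n. norm (h (z + ?h n) - h z - FD h z (?h n)) / norm (?h n)) \<longlonglongrightarrow> 0"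
          by (rule filterlim_compose[rotated])
        then have "(\<lambda>n. norm (h (z + ?h n) - h z - FD h z (?h n)) / norm (?h n) * norm v) \<longlonglongrightarrow> 0 * norm v"
          by (rule tendsto_mult) (rule tendsto_const)
        moreover have "norm (h (z + ?h n) - h z - FD h z (?h n)) / norm (?h n) * norm v = norm (?s n z - FD h z v)" for n
        proof -
          have e: "FD h z (?h n) = FD h z v / of_nat (Suc n)"
            using linear_cmul[OF has_derivative_linear[OF dh[of z]], of "1 / real (Suc n)" v]
            by (simp add: scaleR_conv_of_real)
          have "?s n z - FD h z v = (h (z + ?h n) - h z - FD h z (?h n)) * of_nat (Suc n)"
            unfolding e by (simp add: field_simps add.commute del: of_nat_Suc)
          then have "norm (?s n z - FD h z v) = norm (h (z + ?h n) - h z - FD h z (?h n)) * real (Suc n)"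
            by (simp only: norm_mult norm_of_nat)
          then show ?thesis using False by (simp del: of_nat_Suc)
        qed
        ultimately have "(\<lambda>n. norm (?s n z - FD h z v)) \<longlonglongrightarrow> 0" by simp
        then show ?thesis using LIM_zero_cancel tendsto_norm_zero_iff by blast
      qed
    qed
    show "AE z in lborel. norm (?s n z) \<le> indicator ?K z *\<^sub>R (B * norm v)" for n
    proof (rule AE_I2)
      fix z
      show "norm (?s n z) \<le> indicator ?K z *\<^sub>R (B * norm v)"
      proof (cases "z \<in> ?K")
        case True
        have "norm (?s n z) = norm (h ((1 / real (Suc n)) *\<^sub>R v + z) - h z) * real (Suc n)"
          by (simp only: norm_mult norm_of_nat)
        also have "\<dots> \<le> (B * norm (((1 / real (Suc n)) *\<^sub>R v + z) - z)) * real (Suc n)"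
          by (intro mult_right_mono lip) auto
        also have "\<dots> = B * norm v" by (simp del: of_nat_Suc)
        finally show ?thesis using True by simp
      next
        case False
        then have "h ((1 / real (Suc n)) *\<^sub>R v + z) = 0" "h (0 + z) = 0"
          by (intro outside[OF False]; use small in simp)+
        then show ?thesis using False by simp
      qed
    qed
  qed
  then show "(\<integral>z. FD h z v \<partial>lborel) = 0" unfolding ints using LIMSEQ_unique[OF tendsto_const] by metis
qed

lemma integral_wirtinger_zero:
  fixes h :: "complex^'n::finite \<Rightarrow> complex"
  assumes "smooth_on UNIV h" "compact K" "\<And>z. z \<notin> K \<Longrightarrow> h z = 0"
  shows "(\<integral>z. wirtinger l h z \<partial>lborel) = 0"
  unfolding wirtinger_def using integral_FD_zero[OF assms]
  by (simp add: Bochner_Integration.integral_diff)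

text \<open>If \<open>G z0 \<noteq> 0\<close>, then the real part of \<open>cnj (G z0) * G z\<close> is
  positive on a small ball, and so is its integral against a bump function.\<close>

lemma bump_integrals_zero_imp_zero:
  fixes G :: "complex^'n::finite \<Rightarrow> complex"
  assumes V: "open V" and G: "continuous_on V G" and z0: "z0 \<in> V"
    and int: "\<And>e. e > 0 \<Longrightarrow> cball z0 e \<subseteq> V \<Longrightarrow> (\<integral>z. indicator V z *\<^sub>R (bump z0 e z *\<^sub>R G z) \<partial>lborel) = 0"
  shows "G z0 = 0"
proof (rule ccontr)
  assume nz: "G z0 \<noteq> 0"
  let ?g = "\<lambda>z. Re (cnj (G z0) * G z)"
  have cg: "continuous_on V ?g" using G by (intro continuous_intros)
  have "?g z0 = (cmod (G z0))\<^sup>2" unfolding cmod_power2 by (simp add: power2_eq_square)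
  then have "?g z0 > 0" using nz by simp
  moreover have "open (V \<inter> ?g -` {0<..})" by (rule continuous_open_preimage[OF cg V]) auto
  ultimately obtain e where e: "e > 0" "cball z0 e \<subseteq> V \<inter> ?g -` {0<..}"
    using z0 open_contains_cball by (metis (no_types, lifting) IntI greaterThan_iff vimage_eq)
  have eV: "cball z0 e \<subseteq> V" using e by blast
  have b0: "bump z0 e z = 0" if "z \<notin> cball z0 e" for z by (rule bump_zero[OF e(1)]) (use that in auto)
  let ?f = "\<lambda>z. indicator V z *\<^sub>R (bump z0 e z *\<^sub>R G z)"
  have cf: "continuous_on (cball z0 e) (\<lambda>z. bump z0 e z *\<^sub>R G z)"
    by (intro continuous_intros continuous_on_subset[OF G eV] continuous_on_subset[OF smooth_on_continuous_on[OF smooth_on_bump]]) auto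
  have "integrable lborel (\<lambda>z. indicator (cball z0 e) z *\<^sub>R (bump z0 e z *\<^sub>R G z))"
    by (rule borel_integrable_compact[OF compact_cball cf])
  moreover have "(\<lambda>z. indicator (cball z0 e) z *\<^sub>R (bump z0 e z *\<^sub>R G z)) = ?f"
  proof
    fix z
    show "indicator (cball z0 e) z *\<^sub>R (bump z0 e z *\<^sub>R G z) = ?f z"
      using b0[of z] eV by (cases "z \<in> cball z0 e") (auto simp: subset_iff)
  qed
  ultimately have intf: "integrable lborel ?f" by simp
  let ?k = "\<lambda>z. Re (cnj (G z0) * ?f z)"
  have intk: "integrable lborel ?k" by (intro integrable_Re integrable_mult_right intf)
  have "(\<integral>z. ?k z \<partial>lborel) = Re (\<integral>z. cnj (G z0) * ?f z \<partial>lborel)"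
    by (rule integral_Re[OF integrable_mult_right[OF intf]])
  also have "\<dots> = Re (cnj (G z0) * (\<integral>z. ?f z \<partial>lborel))"
    by (simp only: integral_mult_right_zero)
  also have "\<dots> = 0" unfolding int[OF e(1) eV] by simp
  finally have z: "(\<integral>z. ?k z \<partial>lborel) = 0" .
  have kz: "?k z = (if z \<in> V then bump z0 e z * ?g z else 0)" for z
    by (simp add: indicator_def mult.left_commute)
  have nonneg: "?k z \<ge> 0" for z
    unfolding kz using e(2) b0[of z] bump_nonneg[of z0 e z] by (cases "z \<in> cball z0 e") auto
  have "AE z in lborel. ?k z = 0"
    using integral_nonneg_eq_0_iff_AE[OF intk] nonneg z by simp
  then have "AE z in lebesgue. ?k z = 0" by (rule AE_completion)
  then have "{z. ?k z \<noteq> 0} \<in> null_sets lebesgue" by (simp add: AE_iff_null_sets completion.AE_iff_null_sets)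
  then have "negligible {z. ?k z \<noteq> 0}" by (simp add: negligible_iff_null_sets)
  moreover have "ball z0 e \<subseteq> {z. ?k z \<noteq> 0}"
  proof
    fix z assume "z \<in> ball z0 e"
    then have zc: "z \<in> cball z0 e" and "bump z0 e z > 0" using bump_pos_iff[OF e(1), of z0 z] by auto
    moreover have "?g z > 0" "z \<in> V" using subsetD[OF e(2) zc] by blast+
    ultimately show "z \<in> {z. ?k z \<noteq> 0}" unfolding kz mem_Collect_eq by auto
  qed
  ultimately have "negligible (ball z0 e)" using negligible_subset by blast
  then show False using open_not_negligible[of "ball z0 e"] e(1) by simp
qed

section \<open>Hermitian matrices and the inner product of forms\<close>

lemma smooth_on_det:
  fixes M :: "complex^'n::finite \<Rightarrow> complex^'m::finite^'m"
  assumes "open S" "\<And>i j. smooth_on S (\<lambda>z. M z $ i $ j)"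
  shows "smooth_on S (\<lambda>z. det (M z))"
  unfolding det_def by (intro smooth_on_sum smooth_on_mult smooth_on_const smooth_on_prod assms)

lemma smooth_on_matrix_inv:
  fixes M :: "complex^'n::finite \<Rightarrow> complex^'m::finite^'m"
  assumes "open S" "\<And>i j. smooth_on S (\<lambda>z. M z $ i $ j)" "\<And>z. z \<in> S \<Longrightarrow> det (M z) \<noteq> 0"
  shows "smooth_on S (\<lambda>z. matrix_inv (M z) $ i $ j)"
proof -
  have 1: "smooth_on S (\<lambda>z. det (\<chi> k l. if l = i then axis j 1 $ k else M z $ k $ l) * inverse (det (M z)))"
  proof (intro smooth_on_mult smooth_on_det smooth_on_inverse assms)
    show "smooth_on S (\<lambda>z. (\<chi> k l. if l = i then axis j 1 $ k else M z $ k $ l) $ k $ l)" for k l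
      by (cases "l = i") (auto intro: assms smooth_on_const)
  qed
  show ?thesis
    by (rule smooth_on_cong[OF assms(1) _ 1]) (simp add: matrix_inv_entry assms(3) divide_inverse)
qed

lemma matrix_inv_unique:
  fixes M :: "complex^'n::finite^'n"
  assumes "M' ** M = mat 1" shows "matrix_inv M = M'" "det M \<noteq> 0"
proof -
  show "det M \<noteq> 0" using assms by (metis det_I det_mul mult_zero_right zero_neq_one)
  from matrix_inv_mult(1)[OF this] have "M' = M' ** (M ** matrix_inv M)" by simp
  then show "matrix_inv M = M'" using assms by (simp add: matrix_mul_assoc)
qed

lemma herm_eq: "herm H v w = (\<Sum>k\<in>UNIV. (transpose H *v v) $ k * cnj (w $ k))"
  unfolding herm_def matrix_vector_mult_def transpose_def
  by (subst sum.swap) (simp add: sum_distrib_right)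

lemma positive_definite_det_nonzero:
  fixes H :: "complex^'n::finite^'n"
  assumes "\<And>v. v \<noteq> 0 \<Longrightarrow> Re (herm H v v) > 0"
  shows "det H \<noteq> 0"
proof -
  have "v = 0" if "transpose H *v v = 0" for v
  proof (rule ccontr)
    assume "v \<noteq> 0"
    moreover have "herm H v v = 0" unfolding herm_eq that by simp
    ultimately show False using assms[of v] by simp
  qed
  then obtain B where "B ** transpose H = mat 1" using matrix_left_invertible_ker[of "transpose H"] by blast
  then show ?thesis using matrix_inv_unique(2)[of B "transpose H"] by (simp add: det_transpose)
qed

lemma det_cnj: "det (\<chi> i j. cnj (H $ i $ j)) = cnj (det H)" for H :: "complex^'n::finite^'n"
  unfolding det_def by simp

lemma hermitian_det_real:
  fixes H :: "complex^'n::finite^'n"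
  assumes "\<And>j k. H $ k $ j = cnj (H $ j $ k)"
  shows "det H = of_real (Re (det H))"
proof -
  have "(\<chi> i j. cnj (H $ i $ j)) = transpose H"
    unfolding transpose_def vec_eq_iff by (intro allI) (simp, rule assms[symmetric])
  then have "cnj (det H) = det H" using det_cnj[of H] by (simp add: det_transpose)
  then show ?thesis by (simp add: complex_eq_iff)
qed

text \<open>Along the segment from the identity to \<open>H\<close> the determinant is real and does not vanish.\<close>

lemma positive_definite_det_pos:
  fixes H :: "complex^'n::finite^'n"
  assumes herm: "\<And>j k. H $ k $ j = cnj (H $ j $ k)" and pos: "\<And>v. v \<noteq> 0 \<Longrightarrow> Re (herm H v v) > 0"
  shows "Re (det H) > 0"
proof (rule ccontr)
  assume neg: "\<not> Re (det H) > 0"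
  define C where "C t = (\<chi> i j. of_real (1 - t) * mat 1 $ i $ j + of_real t * H $ i $ j)" for t :: real
  have C: "C 0 = mat 1" "C 1 = H" by (auto simp: C_def vec_eq_iff)
  have "continuous_on {0..1} (\<lambda>t. Re (det (C t)))"
    unfolding det_def C_def by (simp, intro continuous_intros)
  then obtain t where t: "0 \<le> t" "t \<le> 1" "Re (det (C t)) = 0"
    using IVT2'[of "\<lambda>t. Re (det (C t))" 1 0 0] neg C by auto
  have hC: "C t $ k $ j = cnj (C t $ j $ k)" for j k
    using herm[of k j] by (auto simp: C_def mat_def)
  have "Re (herm (C t) v v) > 0" if "v \<noteq> 0" for v
  proof -
    have e: "herm (C t) v v = of_real (1 - t) * (\<Sum>k\<in>UNIV. v $ k * cnj (v $ k)) + of_real t * herm H v v"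
    proof -
      have "herm (C t) v v = (\<Sum>j\<in>UNIV. \<Sum>k\<in>UNIV. of_real (1 - t) * (if j = k then v $ j * cnj (v $ k) else 0))
          + (\<Sum>j\<in>UNIV. \<Sum>k\<in>UNIV. of_real t * (H $ j $ k * v $ j * cnj (v $ k)))"
        unfolding herm_def sum.distrib[symmetric] by (intro sum.cong refl) (simp add: C_def mat_def algebra_simps)
      then show ?thesis
        by (simp add: herm_def sum_distrib_left if_distrib[of "\<lambda>c. _ * c"] cong: if_cong)
    qed
    have s: "Re (\<Sum>k\<in>UNIV. v $ k * cnj (v $ k)) = (\<Sum>k\<in>UNIV. (cmod (v $ k))\<^sup>2)"
      by (simp add: complex_norm_square[symmetric] flip: of_real_sum of_real_power)
    have "(\<Sum>k\<in>UNIV. (cmod (v $ k))\<^sup>2) > 0"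
    proof -
      from that obtain k where "v $ k \<noteq> 0" by (auto simp: vec_eq_iff)
      then have "0 < (cmod (v $ k))\<^sup>2" by simp
      also have "\<dots> \<le> (\<Sum>k\<in>UNIV. (cmod (v $ k))\<^sup>2)" by (rule member_le_sum) auto
      finally show ?thesis .
    qed
    moreover have "Re (herm H v v) > 0" using pos that by blast
    ultimately have "(1 - t) * (\<Sum>k\<in>UNIV. (cmod (v $ k))\<^sup>2) + t * Re (herm H v v) > 0"
      using t by (cases "t = 0") (auto intro: add_nonneg_pos)
    then show ?thesis unfolding e using s by simp
  qed
  then have "det (C t) \<noteq> 0" by (rule positive_definite_det_nonzero)
  then show False using hermitian_det_real[of "C t", OF hC] t(3) by simp
qed

text \<open>With the indices of the second argument raised, the inner product becomes a plain pairing of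
  coefficients.\<close>

lemma form_inner_eq:
  "form_inner k H \<alpha> \<beta> =
    (\<Sum>js\<in>lists_of k. \<alpha> (axis_list js) * raise (matrix_inv H) (\<lambda>ks. cnj (\<beta> (axis_list ks))) js) / fact k"
  unfolding form_inner_def
  by (intro arg_cong2[of _ _ _ _ "(/)"] refl sum.cong) (auto simp: raise_eq_sum sum_distrib_left ac_simps)

lemma cnj_raise: "cnj (raise M Y js) = raise (\<chi> i j. cnj (M $ i $ j)) (\<lambda>ks. cnj (Y ks)) js"
  by (simp add: raise_eq_sum)

text \<open>The inverse metric transforms by the Jacobian matrices which the coefficients absorb.\<close>

lemma form_inner_map:
  fixes L :: "complex^'n::finite \<Rightarrow> complex^'n"
  assumes L: "Vector_Spaces.linear (*s) (*s) L" and inv: "\<And>v. L' (L v) = v"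
    and herm: "\<And>v w. herm H v w = herm H' (L v) (L w)" and det: "det H \<noteq> 0"
    and \<alpha>: "alternating_form k \<alpha>" and \<beta>: "alternating_form k \<beta>"
  shows "form_inner k H (\<lambda>vs. \<alpha> (map L vs)) (\<lambda>vs. \<beta> (map L vs)) = form_inner k H' \<alpha> \<beta>"
proof -
  define J where "J = matrix L"
  define Jc where "Jc = (\<chi> i j. cnj (J $ i $ j))"
  have Jv: "J *v v = L v" for v unfolding J_def by (rule matrix_works[OF L])
  have "v = 0" if "J *v v = 0" for v
    using that inv[of v] inv[of 0] vec.linear_0[OF L] by (simp add: Jv)
  then obtain J' where J': "J' ** J = mat 1" using matrix_left_invertible_ker[of J] by blast
  have H: "H = transpose J ** H' ** Jc"
  proof (rule vec_eq_iff[THEN iffD2, rule_format], rule vec_eq_iff[THEN iffD2, rule_format])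
    fix j k
    have "H $ j $ k = herm H (axis j 1) (axis k 1)"
      by (simp add: herm_def axis_def if_distrib[of "\<lambda>c. _ * c"] if_distrib[of cnj] cong: if_cong)
    also have "\<dots> = (\<Sum>a\<in>UNIV. \<Sum>b\<in>UNIV. H' $ a $ b * J $ a $ j * cnj (J $ b $ k))"
      unfolding herm by (simp add: herm_def J_def matrix_def)
    also have "\<dots> = (transpose J ** H' ** Jc) $ j $ k"
      unfolding matrix_matrix_mult_def transpose_def Jc_def
      by (simp add: sum_distrib_left sum_distrib_right) (subst sum.swap, simp add: ac_simps)
    finally show "H $ j $ k = (transpose J ** H' ** Jc) $ j $ k" .
  qed
  define Jc' where "Jc' = (\<chi> i j. cnj (J' $ i $ j))"
  have JcJ: "Jc' ** Jc = mat 1"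
  proof -
    have "(Jc' ** Jc) $ i $ j = cnj ((J' ** J) $ i $ j)" for i j
      by (simp add: Jc'_def Jc_def matrix_matrix_mult_def)
    then show ?thesis unfolding J' by (auto simp: vec_eq_iff mat_def)
  qed
  then have JJc: "Jc ** Jc' = mat 1" using matrix_left_right_inverse by blast
  have "(Jc ** matrix_inv H ** transpose J) ** H' = Jc ** matrix_inv H ** (transpose J ** H' ** Jc) ** Jc'"
    by (simp add: matrix_mul_assoc[symmetric] JJc)
  also have "\<dots> = Jc ** (matrix_inv H ** H) ** Jc'" unfolding H[symmetric] by (simp add: matrix_mul_assoc)
  also have "\<dots> = mat 1" by (simp add: matrix_inv_mult(2)[OF det] JJc)
  finally have inv': "matrix_inv H' = Jc ** matrix_inv H ** transpose J" by (rule matrix_inv_unique(1))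
  have c: "\<gamma> (map L (axis_list js)) = raise J (\<lambda>ks. \<gamma> (axis_list ks)) js"
    if "alternating_form k \<gamma>" "js \<in> lists_of k" for \<gamma> js
    unfolding J_def by (rule raise_map_linear[OF that(1) L]) (use that(2) in simp)
  have "(\<Sum>js\<in>lists_of k. \<alpha> (map L (axis_list js)) * raise (matrix_inv H) (\<lambda>ks. cnj (\<beta> (map L (axis_list ks)))) js)
      = (\<Sum>js\<in>lists_of k. raise J (\<lambda>ks. \<alpha> (axis_list ks)) js * raise (matrix_inv H) (raise Jc (\<lambda>ks. cnj (\<beta> (axis_list ks)))) js)"
  proof (rule sum.cong[OF refl])
    fix js :: "'n list" assume js: "js \<in> lists_of k"
    have "raise (matrix_inv H) (\<lambda>ks. cnj (\<beta> (map L (axis_list ks)))) js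
        = raise (matrix_inv H) (raise Jc (\<lambda>ks. cnj (\<beta> (axis_list ks)))) js"
      by (rule raise_cong) (use js in \<open>simp add: c[OF \<beta>, simplified map_map[symmetric]] cnj_raise Jc_def del: map_map\<close>)
    then show "\<alpha> (map L (axis_list js)) * raise (matrix_inv H) (\<lambda>ks. cnj (\<beta> (map L (axis_list ks)))) js
      = raise J (\<lambda>ks. \<alpha> (axis_list ks)) js * raise (matrix_inv H) (raise Jc (\<lambda>ks. cnj (\<beta> (axis_list ks)))) js"
      by (simp only: c[OF \<alpha> js])
  qed
  also have "\<dots> = (\<Sum>js\<in>lists_of k. \<alpha> (axis_list js) *
      raise (transpose J) (raise (matrix_inv H) (raise Jc (\<lambda>ks. cnj (\<beta> (axis_list ks))))) js)"
    by (rule raise_pairing)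
  also have "\<dots> = (\<Sum>js\<in>lists_of k. \<alpha> (axis_list js) * raise (matrix_inv H') (\<lambda>ks. cnj (\<beta> (axis_list ks))) js)"
  proof -
    have "raise (matrix_inv H) (raise Jc Y) = raise (Jc ** matrix_inv H) Y" for Y by (rule ext) (rule raise_raise)
    then show ?thesis unfolding inv' by (simp add: raise_raise)
  qed
  finally show ?thesis unfolding form_inner_eq by simp
qed

lemma form_inner_zero: "form_inner k H (\<lambda>vs. 0) \<beta> = 0"
  by (simp add: form_inner_eq)

section \<open>The formal adjoint in product coordinates\<close>

lemma smooth_on_raise:
  fixes P :: "complex^'n::finite \<Rightarrow> complex^'m::finite^'m" and Y :: "complex^'n \<Rightarrow> 'm list \<Rightarrow> complex"
  assumes "open S" "\<And>i j. smooth_on S (\<lambda>z. P z $ i $ j)" "\<And>ks. smooth_on S (\<lambda>z. Y z ks)"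
  shows "smooth_on S (\<lambda>z. raise (P z) (Y z) js)"
  unfolding raise_eq_sum by (intro smooth_on_sum smooth_on_mult smooth_on_prod assms)

lemma antisymmetric_components:
  fixes \<alpha> :: "(complex^'n::finite) list \<Rightarrow> complex"
  assumes "alternating_form k \<alpha>"
  shows "antisymmetric k (\<lambda>ks. cnj (\<alpha> (axis_list ks)))"
  unfolding antisymmetric_def
proof (intro allI impI)
  fix xs ys :: "'n list" and a b assume "length xs + length ys + 2 = k"
  then show "cnj (\<alpha> (axis_list (xs @ a # b # ys))) = - cnj (\<alpha> (axis_list (xs @ b # a # ys)))"
    using alternating_form_antisymmetric[OF assms, unfolded antisymmetric_def, rule_format,
        of "axis_list xs" "axis_list ys" "axis a 1" "axis b 1"] by simp
qed

text \<open>A nonvanishing product of entries of \<open>M\<close> pairs each index with one on the same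
  side of \<open>R\<close>, so raising indices preserves their number in \<open>R\<close>.\<close>

lemma raise_index_type:
  fixes M :: "complex^'n::finite^'n"
  assumes M: "\<And>j k. (j \<in> R \<longleftrightarrow> k \<notin> R) \<Longrightarrow> M $ j $ k = 0" and Y: "index_type R p q Y"
  shows "index_type R p q (raise M Y)"
  unfolding index_type_def
proof (intro allI impI)
  fix js :: "'n list" assume js: "length js = p + q \<and> length (filter (\<lambda>j. j \<in> R) js) \<noteq> p"
  have "(\<Prod>i<length js. M $ (ks ! i) $ (js ! i)) * Y ks = 0" if ks: "length ks = length js" for ks
  proof (cases "\<forall>i<length js. (ks ! i \<in> R) = (js ! i \<in> R)")
    case True
    then have "length (filter (\<lambda>j. j \<in> R) ks) = length (filter (\<lambda>j. j \<in> R) js)"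
      unfolding length_filter_conv_card using ks by (intro arg_cong[of _ _ card]) auto
    then have "Y ks = 0" using Y js ks by (auto simp: index_type_def)
    then show ?thesis by simp
  next
    case False
    then obtain i where "i < length js" "(ks ! i \<in> R) \<noteq> (js ! i \<in> R)" by blast
    then have "(\<Prod>i<length js. M $ (ks ! i) $ (js ! i)) = 0" using M by (intro prod_zero bexI[of _ i]) auto
    then show ?thesis by simp
  qed
  then show "raise M Y js = 0" unfolding raise_eq_sum by (intro sum.neutral) auto
qed

locale hermitian_product_manifold = product_manifold A N F r
  for A :: "('a::t2_space, 'n::finite) chart set" and N F :: "('a, 'n) distribution" and r :: nat +
  fixes g :: "('a, 'n) metric" and M :: "'a measure"
  assumes metric: "product_metric A N F g" and volume: "volume_measure A g M"
begin

lemma hermitian: "hermitian_metric A g"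
  using metric by (simp only: product_metric_def)

lemma metric_smooth: "c \<in> A \<Longrightarrow> smooth_on (cim c) (\<lambda>z. g c z $ j $ k)"
  using hermitian unfolding hermitian_metric_def by blast

lemma metric_hermitian: "c \<in> A \<Longrightarrow> z \<in> cim c \<Longrightarrow> g c z $ k $ j = cnj (g c z $ j $ k)"
  using hermitian unfolding hermitian_metric_def by blast

lemma metric_pos: "c \<in> A \<Longrightarrow> z \<in> cim c \<Longrightarrow> v \<noteq> 0 \<Longrightarrow> Re (herm (g c z) v v) > 0"
  using hermitian unfolding hermitian_metric_def by blast

lemma metric_jac: "c \<in> A \<Longrightarrow> d \<in> A \<Longrightarrow> x \<in> cdom c \<inter> cdom d \<Longrightarrow>
    herm (g c (coord c x)) v w = herm (g d (coord d x)) (jac c d x v) (jac c d x w)"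
  using hermitian unfolding hermitian_metric_def by blast

lemma metric_det: "c \<in> A \<Longrightarrow> z \<in> cim c \<Longrightarrow> det (g c z) \<noteq> 0"
  by (rule positive_definite_det_nonzero[OF metric_pos])

lemma metric_det_real:
  assumes "c \<in> A" "z \<in> cim c"
  shows "det (g c z) = of_real (Re (det (g c z)))"
  by (rule hermitian_det_real[OF metric_hermitian[OF assms]])

lemma metric_det_pos: "c \<in> A \<Longrightarrow> z \<in> cim c \<Longrightarrow> Re (det (g c z)) > 0"
  by (rule positive_definite_det_pos[OF metric_hermitian metric_pos])

text \<open>The density of the volume measure with respect to the Lebesgue measure in the chart, as a
  complex number so that it can be differentiated along with complex coefficients.\<close>

definition weight :: "('a, 'n) chart \<Rightarrow> complex^'n \<Rightarrow> complex" where
  "weight c z = 2 ^ CARD('n) * det (g c z)"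

lemma weight_real: "c \<in> A \<Longrightarrow> z \<in> cim c \<Longrightarrow> weight c z = of_real (2 ^ CARD('n) * Re (det (g c z)))"
  using metric_det_real[of c z] by (simp add: weight_def)

lemma smooth_on_weight: "c \<in> A \<Longrightarrow> smooth_on (cim c) (weight c)"
  unfolding weight_def[abs_def]
  by (intro smooth_on_mult smooth_on_const smooth_on_det open_cim metric_smooth)

lemma chart_integral:
  fixes f :: "complex^'n \<Rightarrow> complex"
  assumes c: "c \<in> A" and f: "continuous_on (cim c) f"
  shows "(\<integral>x. (if x \<in> cdom c then f (coord c x) else 0) \<partial>M)
    = (\<integral>z. indicator (cim c) z *\<^sub>R (weight c z * f z) \<partial>lborel)"
proof -
  let ?w = "\<lambda>z. 2 ^ CARD('n) * Re (det (g c z))"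
  let ?\<psi> = "inv_into (cdom c) (coord c)"
  let ?L = "restrict_space lborel (cim c)"
  let ?M = "restrict_space M (cdom c)"
  have sM: "sets M = sets borel"
    and vol: "\<And>B. B \<in> sets borel \<Longrightarrow> B \<subseteq> cdom c \<Longrightarrow> emeasure M B = (\<integral>\<^sup>+z\<in>coord c ` B. ennreal (?w z) \<partial>lborel)"
    using volume c by (auto simp: volume_measure_def)
  have spM: "space M = UNIV" using sets_eq_imp_space_eq[OF sM] by simp
  have oc: "cdom c \<in> sets borel" "cim c \<in> sets borel" using open_cdom[OF c] open_cim[OF c] by auto
  have smM: "sets ?M = sets (restrict_space borel (cdom c))" by (rule sets_restrict_space_cong[OF sM])
  have smL: "sets ?L = sets (restrict_space borel (cim c))" by (rule sets_restrict_space_cong) simp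
  have cw: "continuous_on (cim c) ?w"
    unfolding det_def
    by (intro continuous_intros smooth_on_continuous_on[OF metric_smooth[OF c]])
  have w: "?w \<in> borel_measurable ?L"
    unfolding measurable_cong_sets[OF smL refl] by (rule borel_measurable_continuous_on_restrict[OF cw])
  have \<psi>: "?\<psi> \<in> measurable ?L ?M"
  proof -
    have 1: "?\<psi> \<in> borel_measurable ?L"
      unfolding measurable_cong_sets[OF smL refl]
      by (rule borel_measurable_continuous_on_restrict[OF continuous_inv_coord[OF c]])
    have "?\<psi> \<in> measurable ?L (restrict_space borel (cdom c))"
      by (rule measurable_restrict_space2[OF _ 1]) (auto simp: space_restrict_space inv_coord_in)
    then show ?thesis unfolding measurable_cong_sets[OF refl smM] .
  qed
  have fm: "(\<lambda>x. f (coord c x)) \<in> borel_measurable ?M"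
    unfolding measurable_cong_sets[OF smM refl]
    by (rule borel_measurable_continuous_on_restrict)
      (auto intro!: continuous_on_compose2[OF f continuous_coord[OF c]] simp: coord_in)
  have eq: "?M = distr (density ?L (\<lambda>z. ennreal (?w z))) ?M ?\<psi>"
  proof (rule measure_eqI)
    fix B assume "B \<in> sets ?M"
    then have B: "B \<subseteq> cdom c" "B \<in> sets borel" using oc by (auto simp: sets_restrict_space_iff sM spM)
    have BM: "B \<in> sets M" using B sM by simp
    have pre: "?\<psi> -` B \<inter> cim c = coord c ` B"
    proof (intro set_eqI iffI)
      show "z \<in> coord c ` B" if "z \<in> ?\<psi> -` B \<inter> cim c" for z
        using that by (intro image_eqI[of _ _ "?\<psi> z"]) (auto simp: coord_inv)
      show "z \<in> ?\<psi> -` B \<inter> cim c" if "z \<in> coord c ` B" for z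
        using that B inv_coord[OF c] by (auto simp: coord_in subset_iff)
    qed
    have BsM: "B \<in> sets ?M" using B oc by (simp add: sets_restrict_space_iff sM spM)
    have "emeasure (distr (density ?L (\<lambda>z. ennreal (?w z))) ?M ?\<psi>) B
        = emeasure (density ?L (\<lambda>z. ennreal (?w z))) (?\<psi> -` B \<inter> cim c)"
      using emeasure_distr[of ?\<psi> "density ?L (\<lambda>z. ennreal (?w z))" ?M B] \<psi> BsM
      by (simp add: space_restrict_space)
    also have "\<dots> = (\<integral>\<^sup>+z. ennreal (?w z) * indicator (?\<psi> -` B \<inter> cim c) z \<partial>?L)"
    proof (rule emeasure_density)
      show "(\<lambda>z. ennreal (?w z)) \<in> borel_measurable ?L" using w by simp
      show "?\<psi> -` B \<inter> cim c \<in> sets ?L" using measurable_sets[OF \<psi> BsM] by (simp add: space_restrict_space)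
    qed
    also have "\<dots> = (\<integral>\<^sup>+z. ennreal (?w z) * indicator (?\<psi> -` B \<inter> cim c) z * indicator (cim c) z \<partial>lborel)"
      by (rule nn_integral_restrict_space) (use oc in simp)
    also have "\<dots> = (\<integral>\<^sup>+z\<in>coord c ` B. ennreal (?w z) \<partial>lborel)"
      unfolding pre using B(1) by (intro nn_integral_cong) (auto simp: indicator_def cim_def)
    finally show "emeasure ?M B = emeasure (distr (density ?L (\<lambda>z. ennreal (?w z))) ?M ?\<psi>) B"
      using vol[OF B(2,1)] emeasure_restrict_space[of "cdom c" M B] oc B(1) by (simp add: sM spM)
  qed simp
  have "(\<integral>x. (if x \<in> cdom c then f (coord c x) else 0) \<partial>M) = (\<integral>x. indicator (cdom c) x *\<^sub>R f (coord c x) \<partial>M)"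
    by (intro Bochner_Integration.integral_cong) (auto simp: indicator_def)
  also have "\<dots> = (\<integral>x. f (coord c x) \<partial>?M)"
    by (rule integral_restrict_space[symmetric]) (use oc in \<open>simp add: sM spM\<close>)
  also have "\<dots> = (\<integral>x. f (coord c x) \<partial>(distr (density ?L (\<lambda>z. ennreal (?w z))) ?M ?\<psi>))"
    using eq by simp
  also have "\<dots> = (\<integral>z. f (coord c (?\<psi> z)) \<partial>(density ?L (\<lambda>z. ennreal (?w z))))"
    by (rule integral_distr) (use \<psi> fm in simp_all)
  also have "\<dots> = (\<integral>z. ?w z *\<^sub>R f (coord c (?\<psi> z)) \<partial>?L)"
  proof (rule integral_density)
    show "(\<lambda>z. f (coord c (?\<psi> z))) \<in> borel_measurable ?L" using measurable_compose[OF \<psi> fm] .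
    show "AE z in ?L. 0 \<le> ?w z"
      using metric_det_pos[OF c] by (intro AE_I2) (auto simp: space_restrict_space less_imp_le)
  qed (rule w)
  also have "\<dots> = (\<integral>z. indicator (cim c) z *\<^sub>R (?w z *\<^sub>R f (coord c (?\<psi> z))) \<partial>lborel)"
    by (rule integral_restrict_space) (use oc in simp)
  also have "\<dots> = (\<integral>z. indicator (cim c) z *\<^sub>R (weight c z * f z) \<partial>lborel)"
    by (intro Bochner_Integration.integral_cong)
      (auto simp: indicator_def coord_inv weight_real[OF c] scaleR_conv_of_real)
  finally show ?thesis .
qed

text \<open>By the transformation rules the integrand does not depend on the chart, and it vanishes where
  \<open>u\<close> does.\<close>

lemma L2_inner_in_chart:
  assumes c: "c \<in> A"
    and alt: "\<And>z. z \<in> cim c \<Longrightarrow> alternating_form k (u c z)" "\<And>z. z \<in> cim c \<Longrightarrow> alternating_form k (v c z)"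
    and compat: "\<And>d x vs. d \<in> A \<Longrightarrow> x \<in> cdom d \<inter> cdom c \<Longrightarrow> u d (coord d x) vs = u c (coord c x) (map (jac d c x) vs)"
      "\<And>d x vs. d \<in> A \<Longrightarrow> x \<in> cdom d \<inter> cdom c \<Longrightarrow> v d (coord d x) vs = v c (coord c x) (map (jac d c x) vs)"
    and supp: "\<And>d x. d \<in> A \<Longrightarrow> x \<in> cdom d - cdom c \<Longrightarrow> u d (coord d x) = (\<lambda>vs. 0)"
    and cont: "continuous_on (cim c) (\<lambda>z. form_inner k (g c z) (u c z) (v c z))"
  shows "L2_inner A g M k u v = (\<integral>z. indicator (cim c) z *\<^sub>R (weight c z * form_inner k (g c z) (u c z) (v c z)) \<partial>lborel)"
proof -
  have "(let d = chart_at A x; z = coord d x in form_inner k (g d z) (u d z) (v d z))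
      = (if x \<in> cdom c then form_inner k (g c (coord c x)) (u c (coord c x)) (v c (coord c x)) else 0)" for x
  proof -
    define d where "d = chart_at A x"
    have "\<exists>d. d \<in> A \<and> x \<in> cdom d" by (rule chart_cover[of x]) blast
    from someI_ex[OF this] have d: "d \<in> A" "x \<in> cdom d" unfolding d_def chart_at_def by auto
    have "form_inner k (g d (coord d x)) (u d (coord d x)) (v d (coord d x))
      = (if x \<in> cdom c then form_inner k (g c (coord c x)) (u c (coord c x)) (v c (coord c x)) else 0)"
    proof (cases "x \<in> cdom c")
      case False
      then show ?thesis using supp[OF d(1), of x] d(2) by (simp add: form_inner_zero)
    next
      case True
      have x: "x \<in> cdom d \<inter> cdom c" using True d by blast
      have e: "u d (coord d x) = (\<lambda>vs. u c (coord c x) (map (jac d c x) vs))"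
        "v d (coord d x) = (\<lambda>vs. v c (coord c x) (map (jac d c x) vs))"
        using compat[OF d(1) x] by blast+
      have "form_inner k (g d (coord d x)) (u d (coord d x)) (v d (coord d x))
          = form_inner k (g c (coord c x)) (u c (coord c x)) (v c (coord c x))"
        unfolding e
      proof (rule form_inner_map[OF jac_linear[OF d(1) c x]])
        show "jac c d x (jac d c x v) = v" for v by (rule jac_inverse[OF d(1) c x])
        show "herm (g d (coord d x)) v w = herm (g c (coord c x)) (jac d c x v) (jac d c x w)" for v w
          by (rule metric_jac[OF d(1) c x])
        show "det (g d (coord d x)) \<noteq> 0" by (rule metric_det[OF d(1) coord_in[OF d(2)]])
      qed (use alt coord_in[OF True] in auto)
      then show ?thesis using True by simp
    qed
    then show ?thesis unfolding Let_def d_def .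
  qed
  then show ?thesis unfolding L2_inner_def using chart_integral[OF c cont] by simp
qed

text \<open>A bump function times an elementary form in the chart \<open>c0\<close>, transported to all
  other charts and extended by zero.\<close>

definition test_form :: "('a, 'n) chart \<Rightarrow> complex^'n \<Rightarrow> real \<Rightarrow> 'n list \<Rightarrow> ('a, 'n) form" where
  "test_form c0 z0 e J c z vs =
     (let x = inv_into (cdom c) (coord c) z in
      if c \<in> A \<and> z \<in> cim c \<and> x \<in> cdom c0
      then of_real (bump z0 e (coord c0 x)) * elementary_form J (map (jac c c0 x) vs) else 0)"

lemma test_form_coord:
  assumes "c \<in> A" "x \<in> cdom c"
  shows "test_form c0 z0 e J c (coord c x) vs =
    (if x \<in> cdom c0 then of_real (bump z0 e (coord c0 x)) * elementary_form J (map (jac c c0 x) vs) else 0)"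
  using assms by (simp add: test_form_def inv_coord coord_in)

lemma test_form_in_chart:
  assumes "c0 \<in> A" "z \<in> cim c0"
  shows "test_form c0 z0 e J c0 z vs = of_real (bump z0 e z) * elementary_form J vs"
proof -
  obtain x where x: "x \<in> cdom c0" "z = coord c0 x" using assms(2) by (auto simp: cim_def)
  have "map (jac c0 c0 x) vs = vs" by (rule map_idI) (rule jac_self[OF assms(1) x(1)])
  then show ?thesis using test_form_coord[OF assms(1) x(1)] x by simp
qed

text \<open>As the manifold is a Hausdorff space, the compact support of a test form is closed, so that a
  test form vanishes near every point outside its chart.\<close>

lemma test_form_vanishes_near:
  assumes c0: "c0 \<in> A" "e > 0" "cball z0 e \<subseteq> cim c0" and c: "c \<in> A" "x \<in> cdom c" "x \<notin> cdom c0"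
  shows "\<exists>U. open U \<and> x \<in> U \<and> U \<subseteq> cdom c \<and> (\<forall>y\<in>U. test_form c0 z0 e J c (coord c y) = (\<lambda>vs. 0))"
proof -
  let ?K = "inv_into (cdom c0) (coord c0) ` cball z0 e"
  have "compact ?K"
    by (rule compact_continuous_image[OF continuous_on_subset[OF continuous_inv_coord[OF c0(1)] c0(3)]]) simp
  then have cl: "closed ?K" by (rule compact_imp_closed)
  have sub: "?K \<subseteq> cdom c0" using c0(3) inv_coord_in by blast
  have "test_form c0 z0 e J c (coord c y) = (\<lambda>vs. 0)" if y: "y \<in> cdom c - ?K" for y
  proof
    fix vs
    have "bump z0 e (coord c0 y) = 0" if "y \<in> cdom c0"
    proof (rule bump_zero[OF c0(2)], rule ccontr)
      assume "\<not> e \<le> dist z0 (coord c0 y)"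
      then have "coord c0 y \<in> cball z0 e" by simp
      then have "inv_into (cdom c0) (coord c0) (coord c0 y) \<in> ?K" by blast
      then show False using y inv_coord[OF c0(1) that] by simp
    qed
    then show "test_form c0 z0 e J c (coord c y) vs = 0" using test_form_coord[OF c(1), of y] y by simp
  qed
  moreover have "open (cdom c - ?K)" using open_cdom[OF c(1)] cl by (rule open_Diff)
  moreover have "x \<in> cdom c - ?K" using c sub by blast
  ultimately show ?thesis by blast
qed

lemma test_form_in_forms_pq:
  assumes c0: "product_coords A N F c0 R" "e > 0" "cball z0 e \<subseteq> cim c0"
    and J: "length J = p + q" "length (filter (\<lambda>j. j \<in> R) J) = p"
  shows "test_form c0 z0 e J \<in> forms_pq A N F p q"
proof -
  let ?\<phi> = "test_form c0 z0 e J"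
  have cA: "c0 \<in> A" by (rule product_coords_in[OF c0(1)])
  have altJ: "alternating_form (p + q) (elementary_form J :: (complex^'n) list \<Rightarrow> complex)"
    using elementary_form_alternating[of J] J(1) by simp
  have "?\<phi> \<in> smooth_forms A (p + q)"
  proof (rule smooth_formsI)
    show "?\<phi> c z vs = 0" if "c \<notin> A \<or> z \<notin> cim c" for c z vs using that by (auto simp: test_form_def)
    fix c d x vs assume cd: "c \<in> A" "d \<in> A" "x \<in> cdom c \<inter> cdom d"
    show "?\<phi> c (coord c x) vs = ?\<phi> d (coord d x) (map (jac c d x) vs)"
    proof (cases "x \<in> cdom c0")
      case True
      have "map (jac d c0 x) (map (jac c d x) vs) = map (jac c c0 x) vs"
        using jac_trans[OF cd(1,2) cA] cd(3) True by simp
      then show ?thesis using cd by (simp add: test_form_coord del: map_map)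
    qed (use cd in \<open>simp add: test_form_coord\<close>)
  next
    fix x
    show "\<exists>d U. d \<in> A \<and> open U \<and> x \<in> U \<and> U \<subseteq> cdom d \<and>
      (\<forall>y\<in>U. alternating_form (p + q) (?\<phi> d (coord d y))) \<and> (\<forall>vs. smooth_on (coord d ` U) (\<lambda>z. ?\<phi> d z vs))"
    proof (cases "x \<in> cdom c0")
      case True
      have "smooth_on (cim c0) (\<lambda>z. ?\<phi> c0 z vs)" for vs
      proof (rule smooth_on_cong[OF open_cim[OF cA]])
        show "of_real (bump z0 e z) * elementary_form J vs = ?\<phi> c0 z vs" if "z \<in> cim c0" for z
          using test_form_in_chart[OF cA that] by simp
        show "smooth_on (cim c0) (\<lambda>z. of_real (bump z0 e z) * elementary_form J vs)"
          by (intro smooth_on_mult smooth_on_const smooth_on_bounded_linear[OF bounded_linear_of_real] open_cim[OF cA]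
              smooth_on_subset[OF smooth_on_bump]) auto
      qed
      moreover have "alternating_form (p + q) (?\<phi> c0 (coord c0 y))" if "y \<in> cdom c0" for y
      proof -
        have "?\<phi> c0 (coord c0 y) = (\<lambda>vs. of_real (bump z0 e (coord c0 y)) * elementary_form J vs)"
          using test_form_in_chart[OF cA coord_in[OF that]] by blast
        then show ?thesis using alternating_form_scale[OF altJ] by simp
      qed
      ultimately show ?thesis using True cA open_cdom[OF cA]
        by (intro exI[of _ c0] exI[of _ "cdom c0"]) (auto simp: cim_def)
    next
      case False
      obtain d where d: "d \<in> A" "x \<in> cdom d" by (rule chart_cover)
      obtain U where U: "open U" "x \<in> U" "U \<subseteq> cdom d" "\<forall>y\<in>U. ?\<phi> d (coord d y) = (\<lambda>vs. 0)"
        using test_form_vanishes_near[OF cA c0(2,3) d False] by blast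
      have o: "open (coord d ` U)" by (rule open_coord_image[OF d(1) U(1,3)])
      have "smooth_on (coord d ` U) (\<lambda>z. ?\<phi> d z vs)" for vs
        by (rule smooth_on_cong[OF o _ smooth_on_const[OF o, where c=0]]) (use U(4) in auto)
      then show ?thesis using d U alternating_form_zero
        by (intro exI[of _ d] exI[of _ U]) auto
    qed
  qed
  moreover have "has_type (N c z) (F c z) p q (?\<phi> c z)" if c: "c \<in> A" "z \<in> cim c" for c z
  proof -
    obtain x where x: "x \<in> cdom c" "z = coord c x" using c by (auto simp: cim_def)
    show ?thesis
    proof (cases "x \<in> cdom c0")
      case True
      have xc: "x \<in> cdom c \<inter> cdom c0" using x True by blast
      have "has_type (axes R) (axes (- R)) p q (elementary_form J :: (complex^'n) list \<Rightarrow> complex)"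
        using has_type_axes_iff[OF altJ] elementary_form_index_type[OF J] by blast
      then have "has_type (N c0 (coord c0 x)) (F c0 (coord c0 x)) p q (elementary_form J)"
        using product_coords_axes[OF c0(1) coord_in[OF True]] by simp
      then have "has_type (N c z) (F c z) p q (\<lambda>vs. elementary_form J (map (jac c c0 x) vs))"
        by (rule has_type_image)
          (use subbundle_jac[OF subbundles(1) c(1) cA xc] subbundle_jac[OF subbundles(2) c(1) cA xc] x in auto)
      then show ?thesis unfolding has_type_def x(2) test_form_coord[OF c(1) x(1)] by simp
    next
      case False
      then show ?thesis unfolding has_type_def x(2) test_form_coord[OF c(1) x(1)] by simp
    qed
  qed
  ultimately show ?thesis by (simp add: forms_pq_def)
qed

text \<open>The conjugated coefficients of \<open>u\<close> with all indices raised by the metric. They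
  pair with the coefficients of another form in the \<open>L\<^sup>2\<close> inner product.\<close>

definition raised :: "('a, 'n) form \<Rightarrow> ('a, 'n) chart \<Rightarrow> 'n list \<Rightarrow> complex^'n \<Rightarrow> complex" where
  "raised u c js z = raise (matrix_inv (g c z)) (\<lambda>ks. cnj (u c z (axis_list ks))) js"

lemma smooth_on_raised:
  assumes "u \<in> smooth_forms A k" "c \<in> A"
  shows "smooth_on (cim c) (raised u c js)"
  unfolding raised_def[abs_def]
  by (intro smooth_on_raise smooth_on_matrix_inv smooth_on_cnj open_cim metric_smooth metric_det
      smooth_formsD(3)[OF assms(1)] assms(2))

lemma antisymmetric_raised:
  assumes "u \<in> smooth_forms A k" "c \<in> A" "z \<in> cim c"
  shows "antisymmetric k (\<lambda>js. raised u c js z)"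
  unfolding raised_def
  by (rule raise_antisymmetric[OF antisymmetric_components[OF smooth_formsD(2)[OF assms]], unfolded eta_contract_eq])

text \<open>Evaluating the product shape of the metric on axis vectors, the second of them multiplied by a constant
  \<open>c\<close>, gives a linear relation between two entries for each \<open>c\<close>; those for \<open>c = 1\<close> and \<open>c = \<i>\<close> together
  force the entries to vanish.\<close>

lemma metric_block:
  assumes d: "product_coords A N F d R" and z: "z \<in> cim d" and jk: "j \<in> R \<longleftrightarrow> k \<notin> R"
  shows "g d z $ j $ k = 0"
proof -
  have dA: "d \<in> A" by (rule product_coords_in[OF d])
  have ne: "j \<noteq> k" using jk by auto
  let ?H = "g d z"
  have om: "omega_part L ?H [axis j 1, axis k c]
      = (if j \<in> L \<and> k \<in> L then \<i> * (?H $ j $ k * cnj c - ?H $ k $ j * c) else 0)" for L c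
  proof -
    have w: "dz_wedge a (dzbar b) [axis j 1, axis k c] = (if a = j \<and> b = k then cnj c else 0) - (if a = k \<and> b = j then c else 0)" for a b
      using ne by (auto simp: dz_wedge_def dzbar_def axis_def lessThan_Suc)
    have "omega_part L ?H [axis j 1, axis k c]
        = (\<Sum>a\<in>L. \<Sum>b\<in>L. (if a = j then (if b = k then \<i> * ?H $ j $ k * cnj c else 0) else 0)
             - (if a = k then (if b = j then \<i> * ?H $ k $ j * c else 0) else 0))"
      unfolding omega_part_def w using ne by (intro sum.cong refl) (auto simp: algebra_simps)
    also have "\<dots> = (if j \<in> L \<and> k \<in> L then \<i> * ?H $ j $ k * cnj c else 0) - (if k \<in> L \<and> j \<in> L then \<i> * ?H $ k $ j * c else 0)"
    proof -
      have s: "(\<Sum>a\<in>L. \<Sum>b\<in>L. if a = i then (if b = i' then C else 0) else 0) = (if i \<in> L \<and> i' \<in> L then C else (0::complex))" for i i' C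
      proof -
        have "(\<Sum>a\<in>L. \<Sum>b\<in>L. if a = i then (if b = i' then C else 0) else 0) = (\<Sum>a\<in>L. if a = i then (\<Sum>b\<in>L. if b = i' then C else 0) else 0)"
          by (intro sum.cong refl) auto
        then show ?thesis by simp
      qed
      show ?thesis unfolding sum_subtractf s ..
    qed
    finally show ?thesis using ne by (auto simp: algebra_simps)
  qed
  have pm: "omega_part UNIV ?H vs = omega_part R ?H vs + omega_part (- R) ?H vs" for vs
    using metric d z unfolding product_metric_def by blast
  have "\<i> * (?H $ j $ k * cnj c - ?H $ k $ j * c) = 0" for c
    using pm[of "[axis j 1, axis k c]"] jk unfolding om by auto
  from this[of 1] this[of \<i>] show ?thesis by (simp add: complex_eq_iff)
qed

text \<open>Integration by parts against test forms, each of which extracts one coefficient near \<open>z0\<close>. Raising the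
  indices beforehand keeps the metric out of the pairing, so that only its determinant is differentiated.\<close>

lemma adjoint_formula:
  assumes c: "product_coords A N F c R" and z0: "z0 \<in> cim c"
    and v: "v \<in> forms_pq A N F p (q + 1)" and w: "w \<in> forms_pq A N F p q"
    and adj: "\<And>u. u \<in> forms_pq A N F p q \<Longrightarrow>
      L2_inner A g M (p + q + 1) (del_F A N F p q u) v = L2_inner A g M (p + q) u w"
    and J: "length J = p + q" "length (filter (\<lambda>j. j \<in> R) J) = p"
  shows "weight c z0 * raised w c J z0 + (\<Sum>l\<in>- R. wirtinger l (\<lambda>z. weight c z * raised v c (l # J) z) z0) = 0"
proof -
  let ?k = "p + q"
  have cA: "c \<in> A" by (rule product_coords_in[OF c])
  note V = open_cim[OF cA]
  have v': "v \<in> smooth_forms A (Suc ?k)" using forms_pq_smooth[OF v] by simp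
  have w': "w \<in> smooth_forms A ?k" by (rule forms_pq_smooth[OF w])
  let ?Y = "\<lambda>l z. weight c z * raised v c (l # J) z"
  have sY: "smooth_on (cim c) (?Y l)" for l
    by (intro smooth_on_mult V smooth_on_weight[OF cA] smooth_on_raised[OF v' cA])
  have sw: "smooth_on (cim c) (\<lambda>z. weight c z * raised w c J z)"
    by (intro smooth_on_mult V smooth_on_weight[OF cA] smooth_on_raised[OF w' cA])
  let ?G = "\<lambda>z. weight c z * raised w c J z + (\<Sum>l\<in>- R. wirtinger l (?Y l) z)"
  have sG: "smooth_on (cim c) ?G"
    by (intro smooth_on_add V sw smooth_on_sum smooth_on_wirtinger sY)
  show ?thesis
  proof (rule bump_integrals_zero_imp_zero[OF V smooth_on_continuous_on[OF sG] z0])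
    fix e :: real assume e: "e > 0" "cball z0 e \<subseteq> cim c"
    let ?\<phi> = "test_form c z0 e J"
    let ?b = "\<lambda>z. of_real (bump z0 e z) :: complex"
    have sb: "smooth_on UNIV ?b" by (rule smooth_on_bounded_linear[OF bounded_linear_of_real open_UNIV smooth_on_bump])
    have sbV: "smooth_on (cim c) ?b" by (rule smooth_on_subset[OF sb]) simp
    have \<phi>: "?\<phi> \<in> forms_pq A N F p q" by (rule test_form_in_forms_pq[OF c e J])
    have \<phi>': "?\<phi> \<in> smooth_forms A ?k" by (rule forms_pq_smooth[OF \<phi>])
    have \<phi>c: "?\<phi> c z = (\<lambda>vs. ?b z * elementary_form J vs)" if "z \<in> cim c" for z
      using test_form_in_chart[OF cA that] by blast
    have inner1: "form_inner ?k (g c z) (?\<phi> c z) (w c z) = ?b z * raised w c J z" if z: "z \<in> cim c" for z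
    proof -
      have "form_inner ?k (g c z) (?\<phi> c z) (w c z)
          = ?b z * (\<Sum>js\<in>lists_of ?k. elementary_form J (axis_list js) * raised w c js z) / fact ?k"
        unfolding form_inner_eq \<phi>c[OF z] raised_def by (simp add: sum_distrib_left mult.assoc)
      also have "(\<Sum>js\<in>lists_of ?k. elementary_form J (axis_list js) * raised w c js z) = fact ?k * raised w c J z"
        using elementary_form_pairing[of J "\<lambda>js. raised w c js z"] antisymmetric_raised[OF w' cA z] J(1) by simp
      finally show ?thesis by simp
    qed
    have L1: "L2_inner A g M ?k ?\<phi> w = (\<integral>z. indicator (cim c) z *\<^sub>R (weight c z * (?b z * raised w c J z)) \<partial>lborel)"
    proof -
      have "continuous_on (cim c) (\<lambda>z. ?b z * raised w c J z)"
        by (intro smooth_on_continuous_on smooth_on_mult V sbV smooth_on_raised[OF w' cA])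
      then have "continuous_on (cim c) (\<lambda>z. form_inner ?k (g c z) (?\<phi> c z) (w c z))"
        using inner1 by (simp cong: continuous_on_cong)
      then have "L2_inner A g M ?k ?\<phi> w = (\<integral>z. indicator (cim c) z *\<^sub>R (weight c z * form_inner ?k (g c z) (?\<phi> c z) (w c z)) \<partial>lborel)"
      proof (rule L2_inner_in_chart[OF cA, rotated -1])
        show "?\<phi> d (coord d x) = (\<lambda>vs. 0)" if "d \<in> A" "x \<in> cdom d - cdom c" for d x
          using that test_form_coord[of d x c] by (intro ext) simp
      qed (rule smooth_formsD(2)[OF \<phi>' cA] smooth_formsD(2)[OF w' cA] smooth_formsD(4)[OF \<phi>' _ cA] smooth_formsD(4)[OF w' _ cA]; assumption)+
      also have "\<dots> = (\<integral>z. indicator (cim c) z *\<^sub>R (weight c z * (?b z * raised w c J z)) \<partial>lborel)"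
        by (intro Bochner_Integration.integral_cong refl) (auto simp: indicator_def inner1)
      finally show ?thesis .
    qed
    have delF: "del_F A N F p q ?\<phi> c z vs = (\<Sum>l\<in>- R. wirtinger l ?b z * dz_wedge l (elementary_form J) vs)" if z: "z \<in> cim c" for z vs
    proof -
      have wl: "wirtinger l (\<lambda>y. ?\<phi> c y ws) z = wirtinger l ?b z * elementary_form J ws" for l ws
      proof -
        have "wirtinger l (\<lambda>y. ?\<phi> c y ws) z = wirtinger l (\<lambda>y. elementary_form J ws * ?b y) z"
          by (rule wirtinger_cong_open[OF V z]) (simp add: \<phi>c)
        then show ?thesis
          using wirtinger_scale[OF smooth_on_differentiable[OF sbV z], of l "elementary_form J ws"] by simp
      qed
      show ?thesis
        unfolding del_components_in_product_coords(2)[OF \<phi> c z] coord_del_def wl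
        by (simp add: dz_wedge_def sum_distrib_left mult.left_commute)
    qed
    have altF: "alternating_form (Suc ?k) (del_F A N F p q ?\<phi> c z)" if z: "z \<in> cim c" for z
      unfolding del_components_in_product_coords(2)[OF \<phi> c z]
      by (rule coord_del_alternating[OF V z]) (use smooth_formsD[OF \<phi>'] cA in blast)+
    have inner2: "form_inner (Suc ?k) (g c z) (del_F A N F p q ?\<phi> c z) (v c z)
        = (\<Sum>l\<in>- R. wirtinger l ?b z * raised v c (l # J) z)" if z: "z \<in> cim c" for z
    proof -
      have asv: "antisymmetric (Suc ?k) (\<lambda>js. raised v c js z)" by (rule antisymmetric_raised[OF v' cA z])
      have "(\<Sum>js\<in>lists_of (Suc ?k). del_F A N F p q ?\<phi> c z (axis_list js) * raised v c js z)
          = (\<Sum>js\<in>lists_of (Suc ?k). \<Sum>l\<in>- R. wirtinger l ?b z * (dz_wedge l (elementary_form J) (axis_list js) * raised v c js z))"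
        unfolding delF[OF z] sum_distrib_right mult.assoc ..
      also have "\<dots> = (\<Sum>l\<in>- R. wirtinger l ?b z * (\<Sum>js\<in>lists_of (Suc ?k). dz_wedge l (elementary_form J) (axis_list js) * raised v c js z))"
        unfolding sum_distrib_left by (rule sum.swap)
      also have "\<dots> = (\<Sum>l\<in>- R. wirtinger l ?b z * (of_nat (Suc ?k) * (fact ?k * raised v c (l # J) z)))"
        using elementary_form_pairing[of J, unfolded J(1), OF antisymmetric_Cons[OF asv]]
        unfolding dz_wedge_pairing[OF asv] by simp
      finally have s: "(\<Sum>js\<in>lists_of (Suc ?k). del_F A N F p q ?\<phi> c z (axis_list js) * raised v c js z)
        = fact (Suc ?k) * (\<Sum>l\<in>- R. wirtinger l ?b z * raised v c (l # J) z)"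
        by (simp add: sum_distrib_left mult.left_commute mult.assoc)
      have "form_inner (Suc ?k) (g c z) (del_F A N F p q ?\<phi> c z) (v c z)
        = (\<Sum>js\<in>lists_of (Suc ?k). del_F A N F p q ?\<phi> c z (axis_list js) * raised v c js z) / fact (Suc ?k)"
        unfolding form_inner_eq raised_def ..
      moreover have "fact (Suc ?k) \<noteq> (0::complex)" by (rule fact_nonzero)
      ultimately show ?thesis unfolding s by (simp del: fact_Suc)
    qed
    have L2: "L2_inner A g M (Suc ?k) (del_F A N F p q ?\<phi>) v
        = (\<integral>z. indicator (cim c) z *\<^sub>R (weight c z * (\<Sum>l\<in>- R. wirtinger l ?b z * raised v c (l # J) z)) \<partial>lborel)"
    proof -
      have "continuous_on (cim c) (\<lambda>z. \<Sum>l\<in>- R. wirtinger l ?b z * raised v c (l # J) z)"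
        by (intro smooth_on_continuous_on smooth_on_sum smooth_on_mult V smooth_on_wirtinger sbV smooth_on_raised[OF v' cA])
      then have "continuous_on (cim c) (\<lambda>z. form_inner (Suc ?k) (g c z) (del_F A N F p q ?\<phi> c z) (v c z))"
        using inner2 by (simp cong: continuous_on_cong)
      then have "L2_inner A g M (Suc ?k) (del_F A N F p q ?\<phi>) v
          = (\<integral>z. indicator (cim c) z *\<^sub>R (weight c z * form_inner (Suc ?k) (g c z) (del_F A N F p q ?\<phi> c z) (v c z)) \<partial>lborel)"
      proof (rule L2_inner_in_chart[OF cA, rotated -1])
        show "del_F A N F p q ?\<phi> d (coord d x) = (\<lambda>vs. 0)" if d: "d \<in> A" "x \<in> cdom d - cdom c" for d x
        proof -
          obtain U where U: "open U" "x \<in> U" "U \<subseteq> cdom d" "\<forall>y\<in>U. ?\<phi> d (coord d y) = (\<lambda>vs. 0)"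
            using test_form_vanishes_near[OF cA e d(1), of x J] d(2) by blast
          have o: "open (coord d ` U)" by (rule open_coord_image[OF d(1) U(1,3)])
          have "wirtinger l (\<lambda>y. ?\<phi> d y ws) (coord d x) = 0" for l ws
          proof -
            have "wirtinger l (\<lambda>y. ?\<phi> d y ws) (coord d x) = wirtinger l (\<lambda>y. 0) (coord d x)"
              by (rule wirtinger_cong_open[OF o]) (use U in auto)
            then show ?thesis by (simp add: wirtinger_const)
          qed
          then have "del A ?\<phi> d (coord d x) = (\<lambda>vs. 0)"
            by (intro ext) (simp add: del_def coord_del_def dz_wedge_def)
          then show ?thesis unfolding del_F_def by (simp add: type_component_zero)
        qed
      qed (rule altF smooth_formsD(2)[OF v' cA] del_components_compat(2)[OF \<phi> _ cA] smooth_formsD(4)[OF v' _ cA]; assumption)+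
      also have "\<dots> = (\<integral>z. indicator (cim c) z *\<^sub>R (weight c z * (\<Sum>l\<in>- R. wirtinger l ?b z * raised v c (l # J) z)) \<partial>lborel)"
        by (intro Bochner_Integration.integral_cong refl) (auto simp: indicator_def inner2)
      finally show ?thesis .
    qed
    have b0: "?b z = 0" if "z \<notin> cball z0 e" for z
    proof -
      have "bump z0 e z = 0" by (rule bump_zero[OF e(1)]) (use that in auto)
      then show ?thesis by simp
    qed
    let ?h = "\<lambda>l z. if z \<in> cim c then ?b z * ?Y l z else 0"
    have sh: "smooth_on UNIV (?h l)" for l
      by (rule smooth_on_extend_zero[OF V closed_cball e(2)])
        (auto intro!: smooth_on_mult V sbV sY simp: b0)
    have h0: "?h l z = 0" if "z \<notin> cball z0 e" for l z using b0[OF that] by simp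
    have wh: "wirtinger l (?h l) z = indicator (cim c) z *\<^sub>R (?b z * wirtinger l (?Y l) z + wirtinger l ?b z * ?Y l z)" for l z
    proof (cases "z \<in> cim c")
      case True
      have "wirtinger l (?h l) z = wirtinger l (\<lambda>z. ?b z * ?Y l z) z"
        by (rule wirtinger_cong_open[OF V True]) simp
      then show ?thesis
        using True wirtinger_mult[OF smooth_on_differentiable[OF sbV True] smooth_on_differentiable[OF sY True]] by simp
    next
      case False
      then have z: "z \<in> - cball z0 e" using e(2) by blast
      have "wirtinger l (?h l) z = wirtinger l (\<lambda>z. 0) z"
        by (rule wirtinger_cong_open[OF _ z]) (use h0 in auto)
      then show ?thesis using False by (simp add: wirtinger_const)
    qed
    have swh: "integrable lborel (\<lambda>z. wirtinger l (?h l) z)" "(\<integral>z. wirtinger l (?h l) z \<partial>lborel) = 0" for l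
    proof -
      show "(\<integral>z. wirtinger l (?h l) z \<partial>lborel) = 0"
        by (rule integral_wirtinger_zero[OF sh compact_cball h0])
      show "integrable lborel (\<lambda>z. wirtinger l (?h l) z)"
        unfolding wirtinger_def using integral_FD_zero(2)[OF sh compact_cball h0] by simp
    qed
    have cpt: "integrable lborel (\<lambda>z. indicator (cim c) z *\<^sub>R (f z))"
      if f: "continuous_on (cim c) f" "\<And>z. z \<notin> cball z0 e \<Longrightarrow> f z = 0" for f :: "complex^'n \<Rightarrow> complex"
    proof -
      have "integrable lborel (\<lambda>z. indicator (cball z0 e) z *\<^sub>R f z)"
        by (rule borel_integrable_compact[OF compact_cball continuous_on_subset[OF f(1) e(2)]])
      moreover have "(\<lambda>z. indicator (cball z0 e) z *\<^sub>R f z) = (\<lambda>z. indicator (cim c) z *\<^sub>R f z)"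
      proof
        fix z show "indicator (cball z0 e) z *\<^sub>R f z = indicator (cim c) z *\<^sub>R f z"
          using f(2)[of z] e(2) by (cases "z \<in> cball z0 e") (auto simp: subset_iff)
      qed
      ultimately show ?thesis by simp
    qed
    have i1: "integrable lborel (\<lambda>z. indicator (cim c) z *\<^sub>R (weight c z * (?b z * raised w c J z)))"
      by (rule cpt) (auto intro!: smooth_on_continuous_on smooth_on_mult V smooth_on_weight[OF cA] sbV smooth_on_raised[OF w' cA] simp: b0)
    have wb0: "wirtinger l ?b z = 0" if "z \<notin> cball z0 e" for l z
    proof -
      have "wirtinger l ?b z = wirtinger l (\<lambda>z. 0) z"
        by (rule wirtinger_cong_open[of "- cball z0 e"]) (use that b0 in auto)
      then show ?thesis by (simp add: wirtinger_const)
    qed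
    have i2: "integrable lborel (\<lambda>z. indicator (cim c) z *\<^sub>R (weight c z * (\<Sum>l\<in>- R. wirtinger l ?b z * raised v c (l # J) z)))"
      by (rule cpt)
        (auto intro!: smooth_on_continuous_on smooth_on_mult smooth_on_sum V smooth_on_weight[OF cA] smooth_on_wirtinger sbV smooth_on_raised[OF v' cA] simp: wb0)
    \<comment> \<open>The Leibniz rule in each direction \<open>l\<close> moves the derivative from the
      coefficients to the bump function; the integral of the derivative of the product \<open>?h
      l\<close> vanishes.\<close>
    have "(\<integral>z. indicator (cim c) z *\<^sub>R (bump z0 e z *\<^sub>R ?G z) \<partial>lborel)
      = (\<integral>z. (indicator (cim c) z *\<^sub>R (weight c z * (?b z * raised w c J z))
          - indicator (cim c) z *\<^sub>R (weight c z * (\<Sum>l\<in>- R. wirtinger l ?b z * raised v c (l # J) z)))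
          + (\<Sum>l\<in>- R. wirtinger l (?h l) z) \<partial>lborel)"
    proof (intro Bochner_Integration.integral_cong refl)
      fix z
      show "indicator (cim c) z *\<^sub>R (bump z0 e z *\<^sub>R ?G z)
        = (indicator (cim c) z *\<^sub>R (weight c z * (?b z * raised w c J z))
          - indicator (cim c) z *\<^sub>R (weight c z * (\<Sum>l\<in>- R. wirtinger l ?b z * raised v c (l # J) z)))
          + (\<Sum>l\<in>- R. wirtinger l (?h l) z)"
        unfolding wh
        by (cases "z \<in> cim c") (simp_all add: scaleR_conv_of_real sum.distrib sum_distrib_left algebra_simps)
    qed
    also have "\<dots> = ((\<integral>z. indicator (cim c) z *\<^sub>R (weight c z * (?b z * raised w c J z)) \<partial>lborel)
          - (\<integral>z. indicator (cim c) z *\<^sub>R (weight c z * (\<Sum>l\<in>- R. wirtinger l ?b z * raised v c (l # J) z)) \<partial>lborel))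
          + (\<Sum>l\<in>- R. \<integral>z. wirtinger l (?h l) z \<partial>lborel)"
      using i1 i2 swh(1) by (simp add: Bochner_Integration.integral_add Bochner_Integration.integral_diff Bochner_Integration.integral_sum)
    also have "\<dots> = L2_inner A g M ?k ?\<phi> w - L2_inner A g M (Suc ?k) (del_F A N F p q ?\<phi>) v"
      unfolding L1 L2 swh(2) by simp
    also have "\<dots> = 0" using adj[OF \<phi>] by simp
    finally show "(\<integral>z. indicator (cim c) z *\<^sub>R (bump z0 e z *\<^sub>R ?G z) \<partial>lborel) = 0" .
  qed
qed

end

section \<open>Wedging in terms of coefficients\<close>

text \<open>The effect of wedging with \<open>dz\<^sub>l\<close> on families of coefficients.\<close>

definition index_wedge :: "'n \<Rightarrow> ('n list \<Rightarrow> complex) \<Rightarrow> 'n list \<Rightarrow> complex" where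
  "index_wedge l X js = (\<Sum>i<length js. (if js ! i = l then (-1) ^ i else 0) * X (drop_at i js))"

lemma dz_wedge_index_wedge: "dz_wedge l \<alpha> (axis_list js) = index_wedge l (\<lambda>ks. \<alpha> (axis_list ks)) js"
  unfolding dz_wedge_axis_list index_wedge_def by (intro sum.cong) auto

lemma index_wedge_Nil: "index_wedge l X [] = 0"
  by (simp add: index_wedge_def)

lemma index_wedge_Cons:
  "index_wedge l X (k # js) = (if k = l then X js else 0) - index_wedge l (\<lambda>ks. X (k # ks)) js"
  unfolding index_wedge_def
  by (simp add: sum.lessThan_Suc_shift sum_negf[symmetric] del: sum.lessThan_Suc)
    (auto intro!: sum.cong)

lemma index_wedge_sum: "index_wedge l (\<lambda>ks. \<Sum>i\<in>I. X i ks) js = (\<Sum>i\<in>I. index_wedge l (X i) js)"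
  unfolding index_wedge_def sum_distrib_left by (rule sum.swap)

lemma index_wedge_scale: "index_wedge l (\<lambda>ks. c * X ks) js = c * index_wedge l X js"
  unfolding index_wedge_def by (simp add: sum_distrib_left mult.left_commute)

lemma index_wedge_minus: "index_wedge l (\<lambda>ks. - X ks) js = - index_wedge l X js"
  using index_wedge_scale[of l "-1" X js] by simp

lemma index_wedge_cnj: "cnj (index_wedge l X js) = index_wedge l (\<lambda>ks. cnj (X ks)) js"
  unfolding index_wedge_def by (simp add: if_distrib[of cnj] cong: if_cong)

lemma index_wedge_cong:
  assumes "\<And>ks. Suc (length ks) = length js \<Longrightarrow> X ks = Y ks"
  shows "index_wedge l X js = index_wedge l Y js"
proof -
  have "X (drop_at i js) = Y (drop_at i js)" if "i < length js" for i
    by (rule assms) (use that in auto)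
  then show ?thesis unfolding index_wedge_def by simp
qed

lemma raise_add: "raise P (\<lambda>ks. X ks + Y ks) js = raise P X js + raise P Y js"
  unfolding raise_eq_sum by (simp add: ring_distribs sum.distrib)

text \<open>The hypothesis says that \<open>P\<close> fixes the covector
  \<open>dz\<^sub>l\<close>.\<close>

lemma raise_index_wedge:
  fixes P :: "complex^'n::finite^'n"
  assumes "\<And>j. P $ l $ j = (if j = l then 1 else 0)"
  shows "raise P (index_wedge l X) js = index_wedge l (raise P X) js"
proof (induction js arbitrary: X)
  case (Cons j js)
  have d: "raise P (\<lambda>ks. Y ks - Z ks) js = raise P Y js - raise P Z js" for Y Z
    unfolding raise_eq_sum by (simp add: right_diff_distrib sum_subtractf)
  have "raise P (index_wedge l X) (j # js)
      = (\<Sum>k\<in>UNIV. P $ k $ j * ((if k = l then raise P X js else 0) - index_wedge l (raise P (\<lambda>ks. X (k # ks))) js))"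
    unfolding raise.simps index_wedge_Cons d Cons.IH by (intro sum.cong refl) (simp add: raise_zero)
  also have "\<dots> = (\<Sum>k\<in>UNIV. if k = l then P $ l $ j * raise P X js else 0)
      - (\<Sum>k\<in>UNIV. P $ k $ j * index_wedge l (raise P (\<lambda>ks. X (k # ks))) js)"
    unfolding right_diff_distrib sum_subtractf by (intro arg_cong2[of _ _ _ _ minus] sum.cong refl) auto
  also have "\<dots> = index_wedge l (raise P X) (j # js)"
    unfolding index_wedge_Cons raise.simps index_wedge_sum index_wedge_scale using assms by simp
  finally show ?case .
qed (simp add: index_wedge_Nil)

lemma differentiable_raise:
  fixes P :: "'a::real_normed_vector \<Rightarrow> complex^'m::finite^'m"
  assumes "\<And>i j. (\<lambda>y. P y $ i $ j) differentiable (at z)" "\<And>ks. (\<lambda>y. Y y ks) differentiable (at z)"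
  shows "(\<lambda>y. raise (P y) (Y y) js) differentiable (at z)"
  using assms(2)
proof (induction js arbitrary: Y)
  case (Cons j js)
  show ?case unfolding raise.simps
    by (intro differentiable_sum ballI differentiable_mult assms(1) Cons.IH Cons.prems) simp
qed simp

text \<open>A derivation that annihilates a matrix commutes with raising indices by it. This is stated for
  a derivation \<open>T\<close> at a point so as to cover both kinds of Wirtinger derivatives.\<close>

lemma derivation_raise:
  fixes P :: "'a::real_normed_vector \<Rightarrow> complex^'m::finite^'m" and T :: "('a \<Rightarrow> complex) \<Rightarrow> complex"
  assumes T: "\<And>(I::'m set) f. (\<And>i. i \<in> I \<Longrightarrow> f i differentiable (at z)) \<Longrightarrow> T (\<lambda>y. \<Sum>i\<in>I. f i y) = (\<Sum>i\<in>I. T (f i))"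
      "\<And>f g. f differentiable (at z) \<Longrightarrow> g differentiable (at z) \<Longrightarrow> T (\<lambda>y. f y * g y) = f z * T g + T f * g z"
    and P: "\<And>i j. (\<lambda>y. P y $ i $ j) differentiable (at z)" "\<And>i j. T (\<lambda>y. P y $ i $ j) = 0"
    and Y: "\<And>ks. (\<lambda>y. Y y ks) differentiable (at z)"
  shows "T (\<lambda>y. raise (P y) (Y y) js) = raise (P z) (\<lambda>ks. T (\<lambda>y. Y y ks)) js"
  using Y
proof (induction js arbitrary: Y)
  case (Cons j js)
  have d: "(\<lambda>y. raise (P y) (\<lambda>ks. Y y (k # ks)) js) differentiable (at z)" for k
    by (rule differentiable_raise[OF P(1) Cons.prems])
  have "T (\<lambda>y. raise (P y) (Y y) (j # js)) = (\<Sum>k\<in>UNIV. T (\<lambda>y. P y $ k $ j * raise (P y) (\<lambda>ks. Y y (k # ks)) js))"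
    unfolding raise.simps by (rule T(1)) (intro differentiable_mult P(1) d)
  also have "\<dots> = (\<Sum>k\<in>UNIV. P z $ k $ j * T (\<lambda>y. raise (P y) (\<lambda>ks. Y y (k # ks)) js))"
    by (simp add: T(2)[OF P(1) d] P(2))
  also have "\<dots> = raise (P z) (\<lambda>ks. T (\<lambda>y. Y y ks)) (j # js)"
    unfolding raise.simps Cons.IH[OF Cons.prems] ..
  finally show ?case .
qed simp

lemma wirtinger_raise:
  fixes P :: "complex^'n::finite \<Rightarrow> complex^'m::finite^'m"
  assumes "\<And>i j. (\<lambda>y. P y $ i $ j) differentiable (at z)" "\<And>i j. wirtinger l (\<lambda>y. P y $ i $ j) z = 0"
    "\<And>ks. (\<lambda>y. Y y ks) differentiable (at z)"
  shows "wirtinger l (\<lambda>y. raise (P y) (Y y) js) z = raise (P z) (\<lambda>ks. wirtinger l (\<lambda>y. Y y ks) z) js"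
  by (rule derivation_raise[where T = "\<lambda>f. wirtinger l f z"]) (rule wirtinger_sum wirtinger_mult assms; assumption)+

lemma wirtinger_bar_raise:
  fixes P :: "complex^'n::finite \<Rightarrow> complex^'m::finite^'m"
  assumes "\<And>i j. (\<lambda>y. P y $ i $ j) differentiable (at z)" "\<And>i j. wirtinger_bar l (\<lambda>y. P y $ i $ j) z = 0"
    "\<And>ks. (\<lambda>y. Y y ks) differentiable (at z)"
  shows "wirtinger_bar l (\<lambda>y. raise (P y) (Y y) js) z = raise (P z) (\<lambda>ks. wirtinger_bar l (\<lambda>y. Y y ks) z) js"
  by (rule derivation_raise[where T = "\<lambda>f. wirtinger_bar l f z"]) (rule wirtinger_bar_sum wirtinger_bar_mult assms; assumption)+

lemma wirtinger_index_wedge: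
  assumes "\<And>ks. (\<lambda>y. X y ks) differentiable (at z)"
  shows "wirtinger l (\<lambda>y. index_wedge j (X y) js) z = index_wedge j (\<lambda>ks. wirtinger l (\<lambda>y. X y ks) z) js"
proof -
  have "wirtinger l (\<lambda>y. index_wedge j (X y) js) z
      = (\<Sum>i<length js. wirtinger l (\<lambda>y. (if js ! i = j then (-1) ^ i else 0) * X y (drop_at i js)) z)"
    unfolding index_wedge_def by (rule wirtinger_sum) (intro differentiable_mult assms differentiable_const)
  then show ?thesis unfolding index_wedge_def by (simp only: wirtinger_scale[OF assms])
qed

section \<open>Functions of some of the variables\<close>

lemma function_of_vars_const:
  assumes "open S" shows "function_of_vars L S (\<lambda>z. c)"
  using assms unfolding function_of_vars_def open_contains_ball by blast

text \<open>On the smallest of the finitely many balls belonging to the entries, all entries are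
  functions of the given variables. As \<open>h\<close> is arbitrary, this covers determinants and
  inverse matrices at once.\<close>

lemma function_of_vars_matrix:
  fixes P :: "complex^'n::finite \<Rightarrow> complex^'m::finite^'m"
  assumes "\<And>i j. function_of_vars L S (\<lambda>z. P z $ i $ j)"
  shows "function_of_vars L S (\<lambda>z. h (P z))"
  unfolding function_of_vars_def
proof
  fix z0 assume "z0 \<in> S"
  then have "\<forall>i j. \<exists>e>0. ball z0 e \<subseteq> S \<and>
      (\<forall>z\<in>ball z0 e. \<forall>w\<in>ball z0 e. (\<forall>l\<in>L. z $ l = w $ l) \<longrightarrow> P z $ i $ j = P w $ i $ j)"
    using assms unfolding function_of_vars_def by blast
  then obtain e where e: "\<And>i j. e i j > 0" "\<And>i j. ball z0 (e i j) \<subseteq> S"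
    "\<And>i j z w. z \<in> ball z0 (e i j) \<Longrightarrow> w \<in> ball z0 (e i j) \<Longrightarrow> (\<forall>l\<in>L. z $ l = w $ l) \<Longrightarrow> P z $ i $ j = P w $ i $ j"
    by metis
  define d where "d = Min (range (\<lambda>(i, j). e i j))"
  have d: "d \<le> e i j" for i j unfolding d_def by (rule Min_le) (auto intro: range_eqI[of _ _ "(i, j)"])
  have d0: "d > 0" unfolding d_def using e(1) by (subst Min_gr_iff) auto
  have sub: "z \<in> ball z0 (e i j)" if "z \<in> ball z0 d" for z i j using that d[of i j] by simp
  have "h (P z) = h (P w)" if "z \<in> ball z0 d" "w \<in> ball z0 d" "\<forall>l\<in>L. z $ l = w $ l" for z w
  proof -
    have "P z = P w" unfolding vec_eq_iff using e(3)[OF sub[OF that(1)] sub[OF that(2)] that(3)] by blast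
    then show ?thesis by simp
  qed
  moreover have "ball z0 d \<subseteq> S" using e(2) sub by blast
  ultimately show "\<exists>e>0. ball z0 e \<subseteq> S \<and>
      (\<forall>z\<in>ball z0 e. \<forall>w\<in>ball z0 e. (\<forall>l\<in>L. z $ l = w $ l) \<longrightarrow> h (P z) = h (P w))"
    using d0 by blast
qed

lemma function_of_vars_FD_zero:
  fixes f :: "complex^'n::finite \<Rightarrow> complex" and v :: "complex^'n"
  assumes f: "function_of_vars L S f" and z: "z \<in> S" and d: "f differentiable (at z)"
    and v: "\<And>l. l \<in> L \<Longrightarrow> v $ l = 0"
  shows "FD f z v = 0"
proof -
  obtain e where e: "e > 0" "\<And>x y. x \<in> ball z e \<Longrightarrow> y \<in> ball z e \<Longrightarrow> (\<forall>l\<in>L. x $ l = y $ l) \<Longrightarrow> f x = f y"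
    using f z unfolding function_of_vars_def by metis
  let ?\<gamma> = "\<lambda>t::real. z + t *\<^sub>R v"
  have g: "(?\<gamma> has_derivative (\<lambda>t. t *\<^sub>R v)) (at 0)" by (auto intro!: derivative_eq_intros)
  have "(f has_derivative FD f z) (at (?\<gamma> 0))" using FD_has_derivative[OF d] by simp
  from diff_chain_at[OF g this]
  have 1: "((\<lambda>t. f (?\<gamma> t)) has_derivative (\<lambda>t. FD f z (t *\<^sub>R v))) (at 0)" by (simp add: o_def)
  have c: "isCont ?\<gamma> 0" by (intro continuous_intros)
  have "\<forall>\<^sub>F t in at 0. ?\<gamma> t \<in> ball z e"
    using topological_tendstoD[OF c[unfolded isCont_def] open_ball[of z e]] e(1) by simp
  then have "\<forall>\<^sub>F t in at 0. f z = f (?\<gamma> t)"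
  proof eventually_elim
    case (elim t)
    then show ?case using e v by (intro e(2)) auto
  qed
  then have 2: "((\<lambda>t. f (?\<gamma> t)) has_derivative (\<lambda>t. 0)) (at 0)"
    using has_derivative_transform_eventually[OF has_derivative_const[of "f z"]] by fastforce
  from fun_cong[OF has_derivative_unique[OF 1 2], of 1] show ?thesis by simp
qed

lemma function_of_vars_wirtinger_zero:
  assumes "function_of_vars L S f" "z \<in> S" "f differentiable (at z)" "l \<notin> L"
  shows "wirtinger l f z = 0" "wirtinger_bar l f z = 0"
proof -
  have 0: "FD f z (axis l a) = 0" for a
    by (rule function_of_vars_FD_zero[OF assms(1-3)]) (use assms(4) in \<open>auto simp: axis_def\<close>)
  show "wirtinger l f z = 0" by (simp add: wirtinger_def 0)
  show "wirtinger_bar l f z = 0" unfolding wirtinger_bar_eq[OF assms(3)] 0 by simp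
qed

text \<open>Completing a block by the identity, instead of restricting the index set, keeps all matrices
  of the same size and makes a block matrix the product of its two diagonal blocks.\<close>

definition block :: "'n set \<Rightarrow> complex^'n^'n \<Rightarrow> complex^'n::finite^'n" where
  "block L H = (\<chi> j k. if j \<in> L \<and> k \<in> L then H $ j $ k else if j = k then 1 else 0)"

lemma block_mult:
  fixes H :: "complex^'n::finite^'n"
  assumes "\<And>j k. (j \<in> R \<longleftrightarrow> k \<notin> R) \<Longrightarrow> H $ j $ k = 0"
  shows "block R H ** block (- R) H = H"
proof -
  have "(\<Sum>k\<in>UNIV. block R H $ i $ k * block (- R) H $ k $ j) = H $ i $ j" for i j
  proof (cases "i \<in> R")
    case True
    have "(\<Sum>k\<in>UNIV. block R H $ i $ k * block (- R) H $ k $ j) = (\<Sum>k\<in>UNIV. if k = j then H $ i $ j else 0)"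
      using True assms[of i j] by (intro sum.cong refl) (auto simp: block_def)
    then show ?thesis by simp
  next
    case False
    have "(\<Sum>k\<in>UNIV. block R H $ i $ k * block (- R) H $ k $ j) = (\<Sum>k\<in>UNIV. if k = i then H $ i $ j else 0)"
      using False assms[of i j] by (intro sum.cong refl) (auto simp: block_def)
    then show ?thesis by simp
  qed
  then show ?thesis by (simp add: matrix_matrix_mult_def vec_eq_iff)
qed

lemma block_inv_row:
  fixes H :: "complex^'n::finite^'n"
  assumes "det (block L H) \<noteq> 0" "l \<notin> L"
  shows "matrix_inv (block L H) $ l $ j = (if j = l then 1 else 0)"
proof -
  have "(block L H ** matrix_inv (block L H)) $ l $ j = (\<Sum>k\<in>UNIV. if k = l then matrix_inv (block L H) $ l $ j else 0)"
    unfolding matrix_matrix_mult_def vec_lambda_beta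
    by (intro sum.cong refl) (use assms(2) in \<open>simp add: block_def\<close>)
  then show ?thesis unfolding matrix_inv_mult(1)[OF assms(1)] by (auto simp: mat_def)
qed

lemma block_inv_column:
  fixes H :: "complex^'n::finite^'n"
  assumes "det (block L H) \<noteq> 0" "l \<notin> L"
  shows "matrix_inv (block L H) $ j $ l = (if j = l then 1 else 0)"
proof -
  have "(matrix_inv (block L H) ** block L H) $ j $ l = (\<Sum>k\<in>UNIV. if k = l then matrix_inv (block L H) $ j $ l else 0)"
    unfolding matrix_matrix_mult_def vec_lambda_beta
    by (intro sum.cong refl) (use assms(2) in \<open>simp add: block_def\<close>)
  then show ?thesis unfolding matrix_inv_mult(2)[OF assms(1)] by (auto simp: mat_def)
qed

lemma smooth_on_block:
  fixes H :: "complex^'n::finite \<Rightarrow> complex^'m::finite^'m"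
  assumes "open S" "\<And>i j. smooth_on S (\<lambda>z. H z $ i $ j)"
  shows "smooth_on S (\<lambda>z. block L (H z) $ i $ j)"
proof -
  have "smooth_on S (\<lambda>z. if i \<in> L \<and> j \<in> L then H z $ i $ j else if i = j then 1 else 0)"
    using assms by (cases "i \<in> L \<and> j \<in> L") (simp_all only: smooth_on_const if_True if_False simp_thms)
  then show ?thesis by (simp add: block_def)
qed

section \<open>The commutator for a bundle-like metric\<close>

locale bundle_like_manifold = hermitian_product_manifold A N F r g M
  for A :: "('a::t2_space, 'n::finite) chart set" and N F :: "('a, 'n) distribution" and r :: nat
    and g :: "('a, 'n) metric" and M :: "'a measure" +
  assumes bundle_like: "bundle_like A N F g"
begin

lemma metric_block_function:
  assumes "product_coords A N F c R"
  shows "function_of_vars R (cim c) (\<lambda>z. h (block R (g c z)))"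
    "function_of_vars (- R) (cim c) (\<lambda>z. h (block (- R) (g c z)))"
proof -
  have o: "open (cim c)" by (rule open_cim[OF product_coords_in[OF assms]])
  have "function_of_vars R (cim c) (\<lambda>z. block R (g c z) $ i $ j)" for i j
  proof (cases "i \<in> R \<and> j \<in> R")
    case True
    then have "function_of_vars R (cim c) (\<lambda>z. g c z $ i $ j)"
      using bundle_like assms unfolding bundle_like_def by blast
    then show ?thesis using True by (simp add: block_def)
  next
    case False
    then have "block R (g c z) $ i $ j = (if i = j then 1 else 0)" for z by (auto simp: block_def)
    then show ?thesis by (simp only: function_of_vars_const[OF o])
  qed
  then show "function_of_vars R (cim c) (\<lambda>z. h (block R (g c z)))" by (rule function_of_vars_matrix)
  have "function_of_vars (- R) (cim c) (\<lambda>z. block (- R) (g c z) $ i $ j)" for i j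
  proof (cases "i \<in> - R \<and> j \<in> - R")
    case True
    then have "function_of_vars (- R) (cim c) (\<lambda>z. g c z $ i $ j)"
      using bundle_like assms unfolding bundle_like_def by blast
    then show ?thesis using True by (simp add: block_def)
  next
    case False
    then have "block (- R) (g c z) $ i $ j = (if i = j then 1 else 0)" for z by (auto simp: block_def)
    then show ?thesis by (simp only: function_of_vars_const[OF o])
  qed
  then show "function_of_vars (- R) (cim c) (\<lambda>z. h (block (- R) (g c z)))" by (rule function_of_vars_matrix)
qed

lemma metric_block_mult:
  "product_coords A N F c R \<Longrightarrow> z \<in> cim c \<Longrightarrow> block R (g c z) ** block (- R) (g c z) = g c z"
  by (rule block_mult) (rule metric_block)

lemma metric_block_det:
  assumes "product_coords A N F c R" "z \<in> cim c"
  shows "det (g c z) = det (block R (g c z)) * det (block (- R) (g c z))"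
    "det (block R (g c z)) \<noteq> 0" "det (block (- R) (g c z)) \<noteq> 0"
proof -
  show e: "det (g c z) = det (block R (g c z)) * det (block (- R) (g c z))"
    using det_mul[of "block R (g c z)" "block (- R) (g c z)"] metric_block_mult[OF assms] by simp
  show "det (block R (g c z)) \<noteq> 0" "det (block (- R) (g c z)) \<noteq> 0"
    using e metric_det[OF product_coords_in[OF assms(1)] assms(2)] by auto
qed

lemma matrix_inv_metric:
  assumes "product_coords A N F c R" "z \<in> cim c"
  shows "matrix_inv (g c z) = matrix_inv (block (- R) (g c z)) ** matrix_inv (block R (g c z))"
proof (rule matrix_inv_unique)
  let ?A = "block R (g c z)" and ?B = "block (- R) (g c z)"
  note d = metric_block_det(2,3)[OF assms]
  have "(matrix_inv ?B ** matrix_inv ?A) ** (?A ** ?B) = matrix_inv ?B ** ((matrix_inv ?A ** ?A) ** ?B)"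
    by (simp only: matrix_mul_assoc)
  then show "(matrix_inv ?B ** matrix_inv ?A) ** g c z = mat 1"
    unfolding metric_block_mult[OF assms] by (simp add: matrix_inv_mult d)
qed

lemma raised_index_type:
  assumes u: "u \<in> forms_pq A N F p q" and c: "product_coords A N F c R" "z \<in> cim c"
  shows "index_type R p q (\<lambda>js. raised u c js z)"
proof -
  have "index_type R p q (\<lambda>ks. cnj (u c z (axis_list ks)))"
    using forms_pq_index_type[OF u c] by (simp add: index_type_def)
  then have "index_type R p q (raise (matrix_inv (block R (g c z)))
      (raise (matrix_inv (block (- R) (g c z))) (\<lambda>ks. cnj (u c z (axis_list ks)))))"
    by (intro raise_index_type)
      (auto simp: block_inv_row block_inv_column metric_block_det[OF c] split: if_splits)
  then show ?thesis unfolding raised_def matrix_inv_metric[OF c] raise_raise[symmetric] .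
qed

text \<open>As \<open>block (- R)\<close> is the identity on \<open>R\<close>, this raises only the
  indices along \<open>F\<close>.\<close>

definition F_raised :: "('a, 'n) form \<Rightarrow> ('a, 'n) chart \<Rightarrow> 'n set \<Rightarrow> 'n list \<Rightarrow> complex^'n \<Rightarrow> complex" where
  "F_raised u c R js z = raise (matrix_inv (block (- R) (g c z))) (\<lambda>ks. cnj (u c z (axis_list ks))) js"

lemma F_raised_eq:
  assumes "product_coords A N F c R" "z \<in> cim c"
  shows "F_raised u c R js z = raise (block R (g c z)) (\<lambda>ks. raised u c ks z) js"
proof -
  let ?A = "block R (g c z)" and ?B = "block (- R) (g c z)"
  note d = metric_block_det(2,3)[OF assms]
  have "matrix_inv (g c z) ** ?A = matrix_inv ?B"
    by (simp add: matrix_inv_metric[OF assms] matrix_mul_assoc[symmetric] matrix_inv_mult d)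
  then show ?thesis unfolding F_raised_def raised_def by (simp add: raise_raise)
qed

lemma smooth_on_F_raised:
  assumes u: "u \<in> smooth_forms A k" and c: "product_coords A N F c R"
  shows "smooth_on (cim c) (F_raised u c R js)"
proof -
  have cA: "c \<in> A" by (rule product_coords_in[OF c])
  show ?thesis unfolding F_raised_def[abs_def]
    by (intro smooth_on_raise smooth_on_matrix_inv smooth_on_block smooth_on_cnj open_cim metric_smooth cA
        smooth_formsD(3)[OF u] metric_block_det(3)[OF c])
qed

text \<open>For \<open>l\<close> outside \<open>R\<close> the derivative in the direction \<open>l\<close> kills the block of the metric along \<open>N\<close>.
  Lowering back the indices along \<open>N\<close> and dividing by the determinant of that block removes it from the formula
  for the adjoint.\<close>

lemma adjoint_formula_F:
  assumes c: "product_coords A N F c R" and z0: "z0 \<in> cim c"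
    and v: "v \<in> forms_pq A N F p (q + 1)" and w: "w \<in> forms_pq A N F p q"
    and adj: "\<And>u. u \<in> forms_pq A N F p q \<Longrightarrow>
      L2_inner A g M (p + q + 1) (del_F A N F p q u) v = L2_inner A g M (p + q) u w"
    and J: "length J = p + q"
  shows "det (block (- R) (g c z0)) * F_raised w c R J z0
    + (\<Sum>l\<in>- R. wirtinger l (\<lambda>z. det (block (- R) (g c z)) * F_raised v c R (l # J) z) z0) = 0"
proof -
  have cA: "c \<in> A" by (rule product_coords_in[OF c])
  note V = open_cim[OF cA]
  let ?a = "\<lambda>z. det (block R (g c z))" and ?b = "\<lambda>z. det (block (- R) (g c z))"
  have sa: "smooth_on (cim c) ?a" and sb: "smooth_on (cim c) ?b"
    by (intro smooth_on_det smooth_on_block V metric_smooth cA)+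
  have v': "v \<in> smooth_forms A (Suc (p + q))" using forms_pq_smooth[OF v] by simp
  have sY: "smooth_on (cim c) (\<lambda>z. ?b z * raised v c js z)" for js
    by (intro smooth_on_mult V sb smooth_on_raised[OF v' cA])
  note dY = smooth_on_differentiable[OF sY]
  note ty = raised_index_type[OF _ c]
  have main: "?b z0 * raised w c js z0 + (\<Sum>l\<in>- R. wirtinger l (\<lambda>z. ?b z * raised v c (l # js) z) z0) = 0"
    if js: "length js = p + q" for js
  proof (cases "length (filter (\<lambda>j. j \<in> R) js) = p")
    case False
    have "raised w c js z0 = 0" using ty[OF w z0] False js by (simp add: index_type_def)
    moreover have "wirtinger l (\<lambda>z. ?b z * raised v c (l # js) z) z0 = 0" if l: "l \<in> - R" for l
    proof -
      have "raised v c (l # js) z = 0" if "z \<in> cim c" for z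
        using ty[OF v that] False js l by (simp add: index_type_def)
      then have "wirtinger l (\<lambda>z. ?b z * raised v c (l # js) z) z0 = wirtinger l (\<lambda>z. 0) z0"
        by (intro wirtinger_cong_open[OF V z0]) simp
      then show ?thesis by (simp add: wirtinger_const)
    qed
    ultimately show ?thesis by simp
  next
    case True
    have "wirtinger l (\<lambda>z. weight c z * raised v c (l # js) z) z0
        = 2 ^ CARD('n) * ?a z0 * wirtinger l (\<lambda>z. ?b z * raised v c (l # js) z) z0" if l: "l \<in> - R" for l
    proof -
      let ?k = "\<lambda>z. 2 ^ CARD('n) * ?a z"
      have sk: "smooth_on (cim c) ?k" by (intro smooth_on_mult smooth_on_const V sa)
      have "wirtinger l ?k z0 = 2 ^ CARD('n) * wirtinger l ?a z0"
        by (rule wirtinger_scale[OF smooth_on_differentiable[OF sa z0]])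
      also have "wirtinger l ?a z0 = 0"
        by (rule function_of_vars_wirtinger_zero(1)[OF metric_block_function(1)[OF c] z0 smooth_on_differentiable[OF sa z0]])
          (use l in simp)
      finally have k0: "wirtinger l ?k z0 = 0" by simp
      have "wirtinger l (\<lambda>z. weight c z * raised v c (l # js) z) z0
        = wirtinger l (\<lambda>z. ?k z * (?b z * raised v c (l # js) z)) z0"
        by (rule wirtinger_cong_open[OF V z0]) (simp add: weight_def metric_block_det(1)[OF c])
      also have "\<dots> = ?k z0 * wirtinger l (\<lambda>z. ?b z * raised v c (l # js) z) z0"
        unfolding wirtinger_mult[OF smooth_on_differentiable[OF sk z0] dY[OF z0]] k0 by simp
      finally show ?thesis .
    qed
    then have "2 ^ CARD('n) * ?a z0 *
      (?b z0 * raised w c js z0 + (\<Sum>l\<in>- R. wirtinger l (\<lambda>z. ?b z * raised v c (l # js) z) z0)) = 0"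
      using adjoint_formula[OF c z0 v w adj js True]
      by (simp add: weight_def metric_block_det(1)[OF c z0] distrib_left sum_distrib_left mult.assoc)
    then show ?thesis using metric_block_det(2)[OF c z0] by simp
  qed
  have F: "wirtinger l (\<lambda>z. ?b z * F_raised v c R (l # J) z) z0
      = raise (block R (g c z0)) (\<lambda>js. wirtinger l (\<lambda>z. ?b z * raised v c (l # js) z) z0) J" if l: "l \<in> - R" for l
  proof -
    have "?b z * F_raised v c R (l # J) z = raise (block R (g c z)) (\<lambda>js. ?b z * raised v c (l # js) z) J"
      if z: "z \<in> cim c" for z
    proof -
      have "F_raised v c R (l # J) z = (\<Sum>k\<in>UNIV. if k = l then raise (block R (g c z)) (\<lambda>js. raised v c (k # js) z) J else 0)"
        unfolding F_raised_eq[OF c z] raise.simps using l by (intro sum.cong refl) (simp add: block_def)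
      then show ?thesis by (simp add: raise_scale)
    qed
    then have "wirtinger l (\<lambda>z. ?b z * F_raised v c R (l # J) z) z0
        = wirtinger l (\<lambda>z. raise (block R (g c z)) (\<lambda>js. ?b z * raised v c (l # js) z) J) z0"
      by (rule wirtinger_cong_open[OF V z0])
    also have "\<dots> = raise (block R (g c z0)) (\<lambda>js. wirtinger l (\<lambda>z. ?b z * raised v c (l # js) z) z0) J"
    proof (rule wirtinger_raise)
      show d: "(\<lambda>z. block R (g c z) $ i $ j) differentiable (at z0)" for i j
        by (rule smooth_on_differentiable[OF smooth_on_block[OF V metric_smooth[OF cA]] z0])
      show "wirtinger l (\<lambda>z. block R (g c z) $ i $ j) z0 = 0" for i j
        by (rule function_of_vars_wirtinger_zero(1)[OF metric_block_function(1)[OF c] z0 d]) (use l in simp)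
    qed (rule dY[OF z0])
    finally show ?thesis .
  qed
  have "?b z0 * F_raised w c R J z0 + (\<Sum>l\<in>- R. wirtinger l (\<lambda>z. ?b z * F_raised v c R (l # J) z) z0)
    = raise (block R (g c z0)) (\<lambda>js. ?b z0 * raised w c js z0
        + (\<Sum>l\<in>- R. wirtinger l (\<lambda>z. ?b z * raised v c (l # js) z) z0)) J"
    using F by (simp add: raise_add raise_scale raise_sum F_raised_eq[OF c z0])
  also have "\<dots> = raise (block R (g c z0)) (\<lambda>js. 0) J"
    by (rule raise_cong) (rule main, simp add: J)
  finally show ?thesis by (simp add: raise_zero)
qed

text \<open>The raising matrix depends on the variables along \<open>F\<close> only and fixes the
  covectors along \<open>N\<close>. Hence raising indices commutes with differentiating and wedging along
  \<open>N\<close>.\<close>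

lemma F_raised_del_N:
  assumes u: "u \<in> forms_pq A N F p q" and c: "product_coords A N F c R" and z: "z \<in> cim c"
  shows "F_raised (del_N A N F p q u) c R K z
    = (\<Sum>j\<in>R. index_wedge j (\<lambda>js. wirtinger_bar j (F_raised u c R js) z) K)"
proof -
  have cA: "c \<in> A" by (rule product_coords_in[OF c])
  note V = open_cim[OF cA]
  let ?Q = "\<lambda>z. matrix_inv (block (- R) (g c z))" and ?X = "\<lambda>js z. cnj (u c z (axis_list js))"
  have sQ: "smooth_on (cim c) (\<lambda>z. ?Q z $ i $ j)" for i j
    by (intro smooth_on_matrix_inv smooth_on_block V metric_smooth cA metric_block_det(3)[OF c])
  have sX: "smooth_on (cim c) (?X js)" for js
    by (intro smooth_on_cnj V smooth_formsD(3)[OF forms_pq_smooth[OF u] cA])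
  have comp: "cnj (del_N A N F p q u c z (axis_list ks)) = (\<Sum>j\<in>R. index_wedge j (\<lambda>js. wirtinger_bar j (?X js) z) ks)" for ks
    unfolding del_components_in_product_coords(1)[OF u c z] coord_del_def dz_wedge_index_wedge
    by (simp add: index_wedge_cnj wirtinger_bar_def)
  have "F_raised (del_N A N F p q u) c R K z
      = (\<Sum>j\<in>R. raise (?Q z) (index_wedge j (\<lambda>js. wirtinger_bar j (?X js) z)) K)"
    unfolding F_raised_def comp by (rule raise_sum)
  also have "\<dots> = (\<Sum>j\<in>R. index_wedge j (\<lambda>js. wirtinger_bar j (F_raised u c R js) z) K)"
  proof (rule sum.cong[OF refl])
    fix j assume j: "j \<in> R"
    have "wirtinger_bar j (F_raised u c R js) z = raise (?Q z) (\<lambda>ks. wirtinger_bar j (?X ks) z) js" for js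
      unfolding F_raised_def[abs_def]
    proof (rule wirtinger_bar_raise)
      show d: "(\<lambda>z. ?Q z $ i $ k) differentiable (at z)" for i k
        by (rule smooth_on_differentiable[OF sQ z])
      show "wirtinger_bar j (\<lambda>z. ?Q z $ i $ k) z = 0" for i k
        by (rule function_of_vars_wirtinger_zero(2)[OF metric_block_function(2)[OF c] z d]) (use j in simp)
    qed (rule smooth_on_differentiable[OF sX z])
    then show "raise (?Q z) (index_wedge j (\<lambda>js. wirtinger_bar j (?X js) z)) K
        = index_wedge j (\<lambda>js. wirtinger_bar j (F_raised u c R js) z) K"
      using raise_index_wedge[of "?Q z" j] block_inv_row[OF metric_block_det(3)[OF c z], of j] j by simp
  qed
  finally show ?thesis .
qed

text \<open>Here \<open>u\<close> is a form of bidegree \<open>(p, q + 1)\<close>, \<open>w\<close> its image under the adjoint, and \<open>w'\<close> the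
  image of \<open>\<partial>\<^sub>N u\<close>. In the coefficients with indices along \<open>F\<close> raised, both composites are sums of the
  same mixed second derivatives; the sign comes from the order in which the index \<open>j\<close> is wedged and \<open>l\<close> is contracted.\<close>

lemma commutator_in_product_coords:
  assumes c: "product_coords A N F c R" and z0: "z0 \<in> cim c"
    and u: "u \<in> forms_pq A N F p (q + 1)" and w: "w \<in> forms_pq A N F p q" and w': "w' \<in> forms_pq A N F (Suc p) q"
    and adj: "\<And>x. x \<in> forms_pq A N F p q \<Longrightarrow>
      L2_inner A g M (p + q + 1) (del_F A N F p q x) u = L2_inner A g M (p + q) x w"
    and adj': "\<And>x. x \<in> forms_pq A N F (Suc p) q \<Longrightarrow>
      L2_inner A g M (Suc p + q + 1) (del_F A N F (Suc p) q x) (del_N A N F p (q + 1) u) = L2_inner A g M (Suc p + q) x w'"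
  shows "del_N A N F p q w c z0 vs + w' c z0 vs = 0"
proof -
  have cA: "c \<in> A" by (rule product_coords_in[OF c])
  note V = open_cim[OF cA]
  let ?b = "\<lambda>z. det (block (- R) (g c z))"
  have sb: "smooth_on (cim c) ?b" by (intro smooth_on_det smooth_on_block V metric_smooth cA)
  have wb: "wirtinger_bar j ?b z = 0" if "j \<in> R" "z \<in> cim c" for j z
    by (rule function_of_vars_wirtinger_zero(2)[OF metric_block_function(2)[OF c] that(2) smooth_on_differentiable[OF sb that(2)]])
      (use that in simp)
  have u': "u \<in> smooth_forms A (Suc (p + q))" using forms_pq_smooth[OF u] by simp
  have sZ: "smooth_on (cim c) (F_raised u c R js)" for js by (rule smooth_on_F_raised[OF u' c])
  have sW: "smooth_on (cim c) (F_raised w c R js)" for js by (rule smooth_on_F_raised[OF forms_pq_smooth[OF w] c])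
  let ?Y = "\<lambda>js z. ?b z * F_raised u c R js z"
  have sY: "smooth_on (cim c) (?Y js)" for js by (intro smooth_on_mult V sb sZ)
  have bar: "wirtinger_bar j (\<lambda>z. ?b z * f z) z = ?b z * wirtinger_bar j f z"
    if "j \<in> R" "z \<in> cim c" "smooth_on (cim c) f" for j z f
    unfolding wirtinger_bar_mult[OF smooth_on_differentiable[OF sb that(2)] smooth_on_differentiable[OF that(3,2)]]
    using wb[OF that(1,2)] by simp
  have vN: "del_N A N F p (q + 1) u \<in> forms_pq A N F (Suc p) (q + 1)" by (rule del_N_in_forms_pq[OF u])
  have sum0: "F_raised (del_N A N F p q w) c R K z0 + F_raised w' c R K z0 = 0" if K: "length K = Suc p + q" for K
  proof -
    have 1: "?b z0 * F_raised (del_N A N F p q w) c R K z0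
      = - (\<Sum>l\<in>- R. \<Sum>j\<in>R. index_wedge j (\<lambda>js. wirtinger_bar j (wirtinger l (?Y (l # js))) z0) K)"
    proof -
      have "?b z0 * index_wedge j (\<lambda>js. wirtinger_bar j (F_raised w c R js) z0) K
        = - (\<Sum>l\<in>- R. index_wedge j (\<lambda>js. wirtinger_bar j (wirtinger l (?Y (l # js))) z0) K)" if j: "j \<in> R" for j
      proof -
        have "?b z0 * wirtinger_bar j (F_raised w c R js) z0 = - (\<Sum>l\<in>- R. wirtinger_bar j (wirtinger l (?Y (l # js))) z0)"
          if js: "Suc (length js) = length K" for js
        proof -
          have "?b z0 * wirtinger_bar j (F_raised w c R js) z0 = wirtinger_bar j (\<lambda>z. ?b z * F_raised w c R js z) z0"
            by (rule bar[OF j z0 sW, symmetric])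
          also have "\<dots> = wirtinger_bar j (\<lambda>z. (- 1) * (\<Sum>l\<in>- R. wirtinger l (?Y (l # js)) z)) z0"
          proof (rule wirtinger_bar_cong_open[OF V z0])
            fix z assume "z \<in> cim c"
            from adjoint_formula_F[OF c this u w adj, of js] js K
            show "?b z * F_raised w c R js z = (- 1) * (\<Sum>l\<in>- R. wirtinger l (?Y (l # js)) z)"
              by (simp add: eq_neg_iff_add_eq_0)
          qed
          also have "\<dots> = (- 1) * (\<Sum>l\<in>- R. wirtinger_bar j (wirtinger l (?Y (l # js))) z0)"
          proof -
            have d: "wirtinger l (?Y (l # js)) differentiable (at z0)" for l
              by (rule smooth_on_differentiable[OF smooth_on_wirtinger[OF V sY] z0])
            have ds: "(\<lambda>z. \<Sum>l\<in>- R. wirtinger l (?Y (l # js)) z) differentiable (at z0)"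
              by (intro differentiable_sum d ballI) simp
            have c0: "wirtinger_bar j (\<lambda>z. - 1) z0 = 0" by (simp add: wirtinger_bar_def wirtinger_const)
            show ?thesis
              unfolding wirtinger_bar_mult[OF differentiable_const ds] wirtinger_bar_sum[OF d] c0 by simp
          qed
          finally show ?thesis by simp
        qed
        then have "?b z0 * index_wedge j (\<lambda>js. wirtinger_bar j (F_raised w c R js) z0) K
            = index_wedge j (\<lambda>js. - (\<Sum>l\<in>- R. wirtinger_bar j (wirtinger l (?Y (l # js))) z0)) K"
          unfolding index_wedge_scale[symmetric] by (rule index_wedge_cong)
        then show ?thesis by (simp add: index_wedge_minus index_wedge_sum)
      qed
      then have "?b z0 * F_raised (del_N A N F p q w) c R K z0
          = - (\<Sum>j\<in>R. \<Sum>l\<in>- R. index_wedge j (\<lambda>js. wirtinger_bar j (wirtinger l (?Y (l # js))) z0) K)"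
        unfolding F_raised_del_N[OF w c z0] sum_distrib_left by (simp add: sum_negf)
      also note sum.swap
      finally show ?thesis .
    qed
    have 2: "?b z0 * F_raised w' c R K z0
      = (\<Sum>l\<in>- R. \<Sum>j\<in>R. index_wedge j (\<lambda>js. wirtinger_bar j (wirtinger l (?Y (l # js))) z0) K)"
    proof -
      have "wirtinger l (\<lambda>z. ?b z * F_raised (del_N A N F p (q + 1) u) c R (l # K) z) z0
        = - (\<Sum>j\<in>R. index_wedge j (\<lambda>js. wirtinger_bar j (wirtinger l (?Y (l # js))) z0) K)" if l: "l \<in> - R" for l
      proof -
        have "?b z * F_raised (del_N A N F p (q + 1) u) c R (l # K) z
            = (\<Sum>j\<in>R. (- 1) * index_wedge j (\<lambda>js. wirtinger_bar j (?Y (l # js)) z) K)" if z: "z \<in> cim c" for z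
        proof -
          have "?b z * index_wedge j (\<lambda>js. wirtinger_bar j (F_raised u c R js) z) (l # K)
              = (- 1) * index_wedge j (\<lambda>js. wirtinger_bar j (?Y (l # js)) z) K" if j: "j \<in> R" for j
          proof -
            have "l \<noteq> j" using l j by blast
            then show ?thesis unfolding bar[OF j z sZ] index_wedge_scale index_wedge_Cons by simp
          qed
          then show ?thesis unfolding F_raised_del_N[OF u c z] sum_distrib_left by (intro sum.cong refl)
        qed
        then have "wirtinger l (\<lambda>z. ?b z * F_raised (del_N A N F p (q + 1) u) c R (l # K) z) z0
            = wirtinger l (\<lambda>z. \<Sum>j\<in>R. (- 1) * index_wedge j (\<lambda>js. wirtinger_bar j (?Y (l # js)) z) K) z0"
          by (rule wirtinger_cong_open[OF V z0])
        also have "\<dots> = (\<Sum>j\<in>R. (- 1) * index_wedge j (\<lambda>js. wirtinger l (wirtinger_bar j (?Y (l # js))) z0) K)"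
        proof -
          have d: "wirtinger_bar j (?Y js) differentiable (at z0)" for j js
            by (rule smooth_on_differentiable[OF smooth_on_wirtinger_bar[OF V sY] z0])
          have di: "(\<lambda>z. index_wedge j (\<lambda>js. wirtinger_bar j (?Y (l # js)) z) K) differentiable (at z0)" for j
            unfolding index_wedge_def by (intro differentiable_sum differentiable_mult d differentiable_const ballI) simp
          have "wirtinger l (\<lambda>z. \<Sum>j\<in>R. (- 1) * index_wedge j (\<lambda>js. wirtinger_bar j (?Y (l # js)) z) K) z0
            = (\<Sum>j\<in>R. wirtinger l (\<lambda>z. (- 1) * index_wedge j (\<lambda>js. wirtinger_bar j (?Y (l # js)) z) K) z0)"
            by (rule wirtinger_sum) (intro differentiable_mult differentiable_const di)
          then show ?thesis unfolding wirtinger_scale[OF di] wirtinger_index_wedge[OF d] .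
        qed
        also have "\<dots> = - (\<Sum>j\<in>R. index_wedge j (\<lambda>js. wirtinger_bar j (wirtinger l (?Y (l # js))) z0) K)"
          unfolding wirtinger_commute[OF V z0 sY] by (simp add: sum_negf)
        finally show ?thesis .
      qed
      then show ?thesis
        using adjoint_formula_F[OF c z0 vN w' adj' K] by (simp add: sum_negf)
    qed
    have "?b z0 * (F_raised (del_N A N F p q w) c R K z0 + F_raised w' c R K z0) = 0"
      unfolding distrib_left 1 2 by simp
    then show ?thesis using metric_block_det(3)[OF c z0] by simp
  qed
  let ?B = "block (- R) (g c z0)"
  have unraise: "cnj (x c z0 (axis_list K)) = raise ?B (\<lambda>ks. F_raised x c R ks z0) K" for x K
    unfolding F_raised_def raise_raise matrix_inv_mult(2)[OF metric_block_det(3)[OF c z0]] raise_id ..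
  have coeff: "del_N A N F p q w c z0 (axis_list K) + w' c z0 (axis_list K) = 0" if K: "length K = Suc p + q" for K
  proof -
    have "cnj (del_N A N F p q w c z0 (axis_list K)) + cnj (w' c z0 (axis_list K))
      = raise ?B (\<lambda>ks. F_raised (del_N A N F p q w) c R ks z0 + F_raised w' c R ks z0) K"
      unfolding unraise raise_add ..
    also have "\<dots> = raise ?B (\<lambda>ks. 0) K" by (rule raise_cong) (rule sum0, simp add: K)
    finally have "cnj (del_N A N F p q w c z0 (axis_list K) + w' c z0 (axis_list K)) = 0" by (simp add: raise_zero)
    then show ?thesis by (simp only: complex_cnj_zero_iff)
  qed
  have "del_N A N F p q w c z0 = (\<lambda>vs. (- 1) * w' c z0 vs)"
  proof (rule alternating_form_ext)
    show "alternating_form (Suc p + q) (del_N A N F p q w c z0)"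
      by (rule smooth_formsD(2)[OF forms_pq_smooth[OF del_N_in_forms_pq[OF w]] cA z0])
    show "alternating_form (Suc p + q) (\<lambda>vs. (- 1) * w' c z0 vs)"
      by (rule alternating_form_scale[OF smooth_formsD(2)[OF forms_pq_smooth[OF w'] cA z0]])
    show "del_N A N F p q w c z0 (axis_list K) = (- 1) * w' c z0 (axis_list K)" if "length K = Suc p + q" for K
      using coeff[OF that] by (simp add: eq_neg_iff_add_eq_0)
  qed
  then show ?thesis by simp
qed

end

lemma (in complex_manifold) smooth_forms_add:
  assumes "u \<in> smooth_forms A k" "v \<in> smooth_forms A k"
  shows "(\<lambda>c z vs. u c z vs + v c z vs) \<in> smooth_forms A k"
proof -
  note uv = smooth_formsD[OF assms(1)] smooth_formsD[OF assms(2)]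
  have "alternating_form k (\<lambda>vs. u c z vs + v c z vs)" if "c \<in> A" "z \<in> cim c" for c z
    using alternating_form_add[OF uv(2)[OF that] uv(6)[OF that]] .
  moreover have "smooth_on (cim c) (\<lambda>z. u c z vs + v c z vs)" if "c \<in> A" for c vs
    by (rule smooth_on_add[OF open_cim[OF that] uv(3)[OF that] uv(7)[OF that]])
  moreover have "u c z vs + v c z vs = 0" if "c \<notin> A \<or> z \<notin> cim c" for c z vs
    using uv(1)[OF that] uv(5)[OF that] by simp
  moreover have "u c (coord c x) vs + v c (coord c x) vs
      = u d (coord d x) (map (jac c d x) vs) + v d (coord d x) (map (jac c d x) vs)"
    if "c \<in> A" "d \<in> A" "x \<in> cdom c \<inter> cdom d" for c d x vs
    using uv(4)[OF that, of vs] uv(8)[OF that, of vs] by simp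
  ultimately show ?thesis unfolding smooth_forms_def mem_Collect_eq by blast
qed

lemma (in product_manifold) smooth_forms_zeroI:
  assumes u: "u \<in> smooth_forms A k"
    and zero: "\<And>d R x vs. product_coords A N F d R \<Longrightarrow> x \<in> cdom d \<Longrightarrow> u d (coord d x) vs = 0"
  shows "u c z vs = 0"
proof (cases "c \<in> A \<and> z \<in> cim c")
  case True
  then obtain x where x: "x \<in> cdom c" "z = coord c x" by (auto simp: cim_def)
  obtain d R where d: "product_coords A N F d R" "x \<in> cdom d" by (rule product_chart_cover)
  have "u c (coord c x) vs = u d (coord d x) (map (jac c d x) vs)"
    by (rule smooth_formsD(4)[OF u]) (use True x d product_coords_in[OF d(1)] in auto)
  then show ?thesis using zero[OF d] x(2) by simp
qed (use smooth_formsD(1)[OF u] in blast)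

theorem theorem8p1:
  fixes A :: "('a::t2_space, 'n::finite) chart set"
    and N F :: "('a, 'n) distribution"
    and g :: "('a, 'n) metric"
    and M :: "'a measure"
    and D :: "nat \<Rightarrow> nat \<Rightarrow> ('a, 'n) form \<Rightarrow> ('a, 'n) form"
    and r :: nat
  assumes "compact (UNIV :: 'a set)"
    and "complex_structure A"
    and "integrable_product_structure A r N F"
    and "product_metric A N F g"
    and "volume_measure A g M"
    and "formal_adjoint_del_F A N F g M D"
    and "bundle_like A N F g"
    and "del_N_omega_N_zero A N F g"
  shows "\<forall>p q. \<forall>u\<in>forms_pq A N F p q. commutator_del_N A N F D p q u = (\<lambda>c z vs. 0)"
proof (intro allI ballI ext)
  fix p q and u :: "('a, 'n) form" and c :: "('a, 'n) chart" and z :: "complex^'n" and vs :: "(complex^'n) list"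
  assume u: "u \<in> forms_pq A N F p q"
  interpret bundle_like_manifold A N F r g M
    by unfold_locales (use assms in auto)
  have D0: "D p' 0 v = (\<lambda>c z vs. 0)" if "v \<in> forms_pq A N F p' 0" for p' v
    using assms(6) that unfolding formal_adjoint_del_F_def by blast
  have D: "D p' (q' + 1) v \<in> forms_pq A N F p' q'"
    "\<And>x. x \<in> forms_pq A N F p' q' \<Longrightarrow>
      L2_inner A g M (p' + q' + 1) (del_F A N F p' q' x) v = L2_inner A g M (p' + q') x (D p' (q' + 1) v)"
    if "v \<in> forms_pq A N F p' (q' + 1)" for p' q' v
    using assms(6) that unfolding formal_adjoint_del_F_def by blast+
  show "commutator_del_N A N F D p q u c z vs = 0"
  proof (cases q)
    case 0
    have "del A (\<lambda>c z vs. 0 :: complex) c z = (\<lambda>vs. 0)"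
      by (intro ext) (simp add: del_def coord_del_def wirtinger_const dz_wedge_def)
    then have "del_N A N F p (q - 1) (\<lambda>c z vs. 0) c z = (\<lambda>vs. 0)"
      by (simp add: del_N_def type_component_zero)
    moreover have "D p q u = (\<lambda>c z vs. 0)" "D (p + 1) q (del_N A N F p q u) = (\<lambda>c z vs. 0)"
      using D0 u del_N_in_forms_pq[OF u] 0 by auto
    ultimately show ?thesis by (simp add: commutator_del_N_def)
  next
    case (Suc q')
    have u': "u \<in> forms_pq A N F p (q' + 1)" using u Suc by simp
    have v: "del_N A N F p (q' + 1) u \<in> forms_pq A N F (Suc p) (q' + 1)" by (rule del_N_in_forms_pq[OF u'])
    let ?w = "D p (q' + 1) u" and ?w' = "D (Suc p) (q' + 1) (del_N A N F p (q' + 1) u)"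
    have w: "?w \<in> forms_pq A N F p q'" and w': "?w' \<in> forms_pq A N F (Suc p) q'"
      by (rule D(1)[OF u'], rule D(1)[OF v])
    have local: "del_N A N F p q' ?w d (coord d x) vs + ?w' d (coord d x) vs = 0"
      if d: "product_coords A N F d R" "x \<in> cdom d" for d R x vs
      by (rule commutator_in_product_coords[OF d(1) coord_in[OF d(2)] u' w w' D(2)[OF u'] D(2)[OF v]])
    have "(\<lambda>c z vs. del_N A N F p q' ?w c z vs + ?w' c z vs) \<in> smooth_forms A (Suc p + q')"
      by (rule smooth_forms_add[OF forms_pq_smooth[OF del_N_in_forms_pq[OF w]] forms_pq_smooth[OF w']])
    from smooth_forms_zeroI[OF this local]
    show ?thesis using Suc by (simp add: commutator_del_N_def)
  qed
qed

end
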